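(* Let $(Y,X)$ be as in the basic setting, let $g:\mathbb{R}^d\to S_d$ be continuous with at most polynomial growth, and suppose that $(Y,g)$ has the jump-approximation property of order $0$. Let $\gamma>1$ and suppose that $n,N\to\infty$ with $\lim\frac{n}{N^\gamma}=K$ for some constant $K>0$. Then for every $t\in[0,T]$ $$\widehat{\rho_g(X)}^{n,N}_t\ \xrightarrow{\ \mathbb{P}\ }\ \frac{\rho_g(X_{t-})+\rho_g(X_t)}{2}$$ as $n,N\to\infty$. If $X$ has no fixed time of discontinuity, then $$\widehat{\rho_g(X)}^{n,N}_t\ \xrightarrow{\ \mathbb{P}\ }\ \rho_g(X_t).$$
   Context: Fix $T>0$, $d\ge 1$ and a filtered probability space $(\Omega,\mathcal{F},(\mathcal{F}_t)_{0\le t\le T},\mathbb{P})$. $S_d$, $S_d^+$ denote the real symmetric and the positive semidefinite $d\times d$ matrices; $\sqrt{\cdot}$ is the matrix square root on $S_d^+$; $\chi$ is a fixed truncation function on $\mathbb{R}^d$ (bounded, $\chi(\xi)=\xi$ near $0$); $\mathsf{i}$ is the imaginary unit. Basic setting: $Y$ is a $d$-dimensional semimartingale with $$Y_t=y+\int_0^t b^Y_s\,ds+\int_0^t\sqrt{X_{s-}}\,dZ_s+\int_0^t\!\int_{\mathbb{R}^d}\chi(\xi)\,(\mu^Y(d\xi,ds)-K_s(d\xi)\,ds)+\int_0^t\!\int_{\mathbb{R}^d}(\xi-\chi(\xi))\,\mu^Y(d\xi,ds),$$ where $y\in\mathbb{R}^d$, $Z$ is a $d$-dimensional Brownian motion,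 $b^Y$ is an $\mathbb{R}^d$-valued locally bounded process, $X$ is a càdlàg $S_d^+$-valued process, and $\mu^Y$ is the random measure associated with the jumps of $Y$, with compensator $K_t(d\xi)\,dt$, $K_t=K_t(\omega,\cdot)$ being for each $(\omega,t)$ a measure on $\mathbb{R}^d$. Observation grid: $t^n_m=m/n$, $m=0,\dots,\lfloor nT\rfloor$, and $\Delta^n_mU=U_{t^n_m}-U_{t^n_{m-1}}$ for a process $U$. Jump-approximation property of order $\eta\ge 0$ for $(Y,g)$: there is a truncation function $\chi'$ (the choices $\chi'=0$ and $\chi'=\mathrm{id}$ are allowed when the integral below is well defined) such that $b^Y(\chi')=b^Y+\int(\chi'(\xi)-\chi(\xi))K(d\xi)$ is càglàd, and there exist an increasing sequence of stopping times $(\tau_p)$ with $\lim_p\tau_p=\infty$ a.s. and processes $Y(p)$ such that, for $t<\tau_p$, $Y(p)_t=Y_t$ and $D^Y_t(\chi')=D^{Y(p)}_t(\chi')$ a.s., and for all $p$ $$\lim_{n\to\infty}\sup_{1\le m\le\lfloor nT\rfloor}n^{\eta}\,\mathbb{E}\left[\left\|g(\sqrt n\Delta^n_mY(p))-g(\sqrt n\Delta^n_mD^{Y(p)}(\chi'))\right\|\right]=0.$$ Here $D^Y(\chi')$ is the diffusion part $D^Y_t(\chi')=y+\int_0^t\big(b^Y_s+\int(\chi'(\xi)-\chi(\xi))K_s(d\xi)\big)ds+\int_0^t\sqrt{X_{s-}}\,dZ_s$ of $Y$ (and similarly for $Y(p)$). Notation: for $x\in S_d^+$, $\rho_g(x)=\mathbb{E}[g(U)]$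 with $U\sim\mathcal{N}(0,x)$. $V(Y,g,k)^n_T=\frac1n\sum_{m=1}^{\lfloor nT\rfloor}e^{-\mathsf{i}\frac{2\pi}{T}kt^n_{m-1}}g(\sqrt n\Delta^n_mY)$ and the estimator is $$\widehat{\rho_g(X)}^{n,N}_t=\frac1T\sum_{k=-N}^{N}\left(1-\frac{|k|}{N}\right)e^{\mathsf{i}\frac{2\pi}{T}kt}\,V(Y,g,k)^n_T.$$
   Formalization: At t=0 and t=T the claim fails as written (the estimator is T-periodic in t): there the first limit is (ρ_g(X_{T-})+ρ_g(X_0))/2, i.e. X is extended T-periodically from [0,T), and the second claim additionally assumes X_0=X_T a.s. at these two times. *)

theory Defs
  imports "HOL-Probability.Probability"
begin

section \<open>Matrices and Gaussian laws\<close>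

definition sym_mat :: "real^'n^'n \<Rightarrow> bool" where
  "sym_mat A \<longleftrightarrow> transpose A = A"

definition psd_mat :: "real^'n^'n \<Rightarrow> bool" where
  "psd_mat A \<longleftrightarrow> sym_mat A \<and> (\<forall>v. 0 \<le> v \<bullet> (A *v v))"

text \<open>Meaningful for positive semidefinite arguments only.\<close>

definition msqrt :: "real^'n^'n \<Rightarrow> real^'n^'n" where
  "msqrt A = (THE S. psd_mat S \<and> S ** S = A)"

definition std_gaussian :: "(real^'n) measure" where
  "std_gaussian = density lborel (\<lambda>z. ennreal (\<Prod>i\<in>UNIV. std_normal_density (z $ i)))"

text \<open>The centred normal law with (possibly degenerate) covariance matrix \<open>A\<close>, as the law of
  \<open>msqrt A *v U\<close> for a standard normal vector \<open>U\<close>.\<close>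

definition gaussian :: "real^'n^'n \<Rightarrow> (real^'n) measure" where
  "gaussian A = distr std_gaussian borel (\<lambda>z. msqrt A *v z)"

definition rho :: "(real^'n \<Rightarrow> real^'n^'n) \<Rightarrow> real^'n^'n \<Rightarrow> real^'n^'n" where
  "rho g A = (LINT u|gaussian A. g u)"

definition cmat :: "real^'n^'n \<Rightarrow> complex^'n^'n" where
  "cmat A = (\<chi> i j. complex_of_real (A $ i $ j))"

definition cscale :: "complex \<Rightarrow> complex^'n^'n \<Rightarrow> complex^'n^'n" where
  "cscale c A = (\<chi> i j. c * A $ i $ j)"


section \<open>Paths\<close>

text \<open>All paths and processes are functions on the reals of which only the restriction to \<open>{0..T}\<close>
  is used. The convention \<open>leftlim f 0 = f 0\<close> applies at the origin.\<close>

definition leftlim :: "(real \<Rightarrow> 'b::t2_space) \<Rightarrow> real \<Rightarrow> 'b" where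
  "leftlim f t = (if t \<le> 0 then f t else Lim (at_left t) f)"

definition jump :: "(real \<Rightarrow> 'b::real_normed_vector) \<Rightarrow> real \<Rightarrow> 'b" where
  "jump f t = f t - leftlim f t"

definition cadlag :: "real \<Rightarrow> (real \<Rightarrow> 'b::t2_space) \<Rightarrow> bool" where
  "cadlag T f \<longleftrightarrow> (\<forall>t\<in>{0..<T}. (f \<longlongrightarrow> f t) (at_right t))
     \<and> (\<forall>t\<in>{0<..T}. \<exists>l. (f \<longlongrightarrow> l) (at_left t))"

definition caglad :: "real \<Rightarrow> (real \<Rightarrow> 'b::t2_space) \<Rightarrow> bool" where
  "caglad T f \<longleftrightarrow> (\<forall>t\<in>{0<..T}. (f \<longlongrightarrow> f t) (at_left t))
     \<and> (\<forall>t\<in>{0..<T}. \<exists>l. (f \<longlongrightarrow> l) (at_right t))"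

definition finite_variation :: "real \<Rightarrow> (real \<Rightarrow> real) \<Rightarrow> bool" where
  "finite_variation T f \<longleftrightarrow> (\<exists>B. \<forall>n. \<forall>u::nat \<Rightarrow> real. mono u \<longrightarrow> range u \<subseteq> {0..T} \<longrightarrow>
     (\<Sum>i<n. \<bar>f (u (Suc i)) - f (u i)\<bar>) \<le> B)"

text \<open>The \<open>T\<close>-periodic extension of the restriction of \<open>f\<close> to \<open>{0..<T}\<close>.\<close>

definition periodic_ext :: "real \<Rightarrow> (real \<Rightarrow> 'b) \<Rightarrow> real \<Rightarrow> 'b" where
  "periodic_ext T f t = f (t - T * of_int \<lfloor>t / T\<rfloor>)"

text \<open>Fourier series on \<open>{0..T}\<close> only see this extension: it agrees with \<open>f\<close> on \<open>{0..<T}\<close>, whereas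
  at both endpoints its one-sided limits are \<open>f (T-)\<close> and \<open>f 0\<close>.\<close>

lemma periodic_ext_eq: "0 < T \<Longrightarrow> t \<in> {0..<T} \<Longrightarrow> periodic_ext T f t = f t"
proof -
  assume "0 < T" "t \<in> {0..<T}"
  then have "\<lfloor>t / T\<rfloor> = 0" by (simp add: floor_eq_iff)
  then show ?thesis by (simp add: periodic_ext_def)
qed

lemma periodic_ext_shift: "0 < T \<Longrightarrow> periodic_ext T f (t + T) = periodic_ext T f t"
  by (simp add: periodic_ext_def add_divide_distrib algebra_simps)

lemma periodic_ext_T: "0 < T \<Longrightarrow> periodic_ext T f T = f 0"
  by (simp add: periodic_ext_def)

lemma Lim_periodic_ext:
  assumes "0 < T" "t \<in> {0<..T}"
  shows "Lim (at_left t) (periodic_ext T f) = leftlim f t"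
proof -
  have "\<forall>\<^sub>F s in at_left t. s \<in> {0<..<t}"
    using assms eventually_at_left_real[of 0 t] by auto
  then have ev: "\<forall>\<^sub>F s in at_left t. periodic_ext T f s = f s"
    by eventually_elim (use assms in \<open>auto intro!: periodic_ext_eq\<close>)
  have "(periodic_ext T f \<longlongrightarrow> l) (at_left t) \<longleftrightarrow> (f \<longlongrightarrow> l) (at_left t)" for l
    by (rule tendsto_cong[OF ev])
  then show ?thesis
    using assms by (simp add: leftlim_def Topological_Spaces.t2_space_class.Lim_def)
qed

lemma Lim_periodic_ext_0:
  assumes "0 < T"
  shows "Lim (at_left 0) (periodic_ext T f) = leftlim f T"
proof -
  have "(periodic_ext T f \<longlongrightarrow> l) (at_left 0) \<longleftrightarrow> (periodic_ext T f \<longlongrightarrow> l) (at_left T)" for l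
  proof -
    have "at_left T = filtermap (\<lambda>s. s + T) (at_left 0)"
      using filtermap_at_left_shift[of "- T" 0] by simp
    then show ?thesis
      using periodic_ext_shift[OF assms, of f] by (simp add: filterlim_filtermap)
  qed
  then have "Lim (at_left 0) (periodic_ext T f) = Lim (at_left T) (periodic_ext T f)"
    by (simp add: Topological_Spaces.t2_space_class.Lim_def)
  then show ?thesis
    using Lim_periodic_ext[of T T f] assms by simp
qed


section \<open>Stochastic basis, stopping times and martingales\<close>

definition filtered_prob_space :: "'a measure \<Rightarrow> (real \<Rightarrow> 'a measure) \<Rightarrow> real \<Rightarrow> bool" where
  "filtered_prob_space M F T \<longleftrightarrow> prob_space M \<and> (\<forall>t\<in>{0..T}. subalgebra M (F t))
     \<and> (\<forall>s\<in>{0..T}. \<forall>t\<in>{0..T}. s \<le> t \<longrightarrow> sets (F s) \<subseteq> sets (F t))"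

text \<open>Measurability of the terms and of the limit is part of the notion, since \<open>measure\<close> is zero
  on non-measurable sets.\<close>

definition conv_in_prob ::
  "'a measure \<Rightarrow> (nat \<Rightarrow> 'a \<Rightarrow> 'b::{metric_space, second_countable_topology}) \<Rightarrow> ('a \<Rightarrow> 'b) \<Rightarrow> bool" where
  "conv_in_prob M U V \<longleftrightarrow> (\<forall>j. U j \<in> borel_measurable M) \<and> V \<in> borel_measurable M
     \<and> (\<forall>\<epsilon>>0. (\<lambda>j. measure M {\<omega>\<in>space M. dist (U j \<omega>) (V \<omega>) > \<epsilon>}) \<longlonglongrightarrow> 0)"

definition adapted ::
  "(real \<Rightarrow> 'a measure) \<Rightarrow> real \<Rightarrow> (real \<Rightarrow> 'a \<Rightarrow> 'b::topological_space) \<Rightarrow> bool" where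
  "adapted F T U \<longleftrightarrow> (\<forall>t\<in>{0..T}. U t \<in> borel_measurable (F t))"

definition progressive ::
  "(real \<Rightarrow> 'a measure) \<Rightarrow> real \<Rightarrow> (real \<Rightarrow> 'a \<Rightarrow> 'b::topological_space) \<Rightarrow> bool" where
  "progressive F T U \<longleftrightarrow> (\<forall>t\<in>{0..T}.
     (\<lambda>(s, \<omega>). U s \<omega>) \<in> borel_measurable (restrict_space borel {0..t} \<Otimes>\<^sub>M F t))"

definition predictable_sigma :: "'a measure \<Rightarrow> (real \<Rightarrow> 'a measure) \<Rightarrow> real \<Rightarrow> (real \<times> 'a) measure" where
  "predictable_sigma M F T = sigma ({0..T} \<times> space M)
     ({{0} \<times> A | A. A \<in> sets (F 0)}
      \<union> {{s<..t} \<times> A | s t A. 0 \<le> s \<and> s < t \<and> t \<le> T \<and> A \<in> sets (F s)})"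

text \<open>Stopping times may be infinite, whereas the filtration is indexed by \<open>{0..T}\<close>; hence the
  library's \<open>stopping_time\<close>, in which both share one index type, does not apply.\<close>

definition ext_stopping_time ::
  "'a measure \<Rightarrow> (real \<Rightarrow> 'a measure) \<Rightarrow> real \<Rightarrow> ('a \<Rightarrow> ereal) \<Rightarrow> bool" where
  "ext_stopping_time M F T \<tau> \<longleftrightarrow> (\<forall>\<omega>\<in>space M. 0 \<le> \<tau> \<omega>)
     \<and> (\<forall>t\<in>{0..T}. {\<omega>\<in>space M. \<tau> \<omega> \<le> ereal t} \<in> sets (F t))"

definition localizing_seq ::
  "'a measure \<Rightarrow> (real \<Rightarrow> 'a measure) \<Rightarrow> real \<Rightarrow> (nat \<Rightarrow> 'a \<Rightarrow> ereal) \<Rightarrow> bool" where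
  "localizing_seq M F T \<tau> \<longleftrightarrow> (\<forall>p. ext_stopping_time M F T (\<tau> p))
     \<and> (\<forall>p. \<forall>\<omega>\<in>space M. \<tau> p \<omega> \<le> \<tau> (Suc p) \<omega>)
     \<and> (AE \<omega> in M. (\<lambda>p. \<tau> p \<omega>) \<longlonglongrightarrow> \<infinity>)"

definition stopped :: "(real \<Rightarrow> 'a \<Rightarrow> 'b) \<Rightarrow> ('a \<Rightarrow> ereal) \<Rightarrow> real \<Rightarrow> 'a \<Rightarrow> 'b" where
  "stopped U \<tau> t \<omega> = U (real_of_ereal (min (ereal t) (\<tau> \<omega>))) \<omega>"

text \<open>Boundedness is required on the stochastic interval \<open>]0, \<tau> p]\<close>; the value at time \<open>0\<close> is
  irrelevant for the integrals in which locally bounded processes occur.\<close>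

definition locally_bounded ::
  "'a measure \<Rightarrow> (real \<Rightarrow> 'a measure) \<Rightarrow> real \<Rightarrow> (real \<Rightarrow> 'a \<Rightarrow> 'b::real_normed_vector) \<Rightarrow> bool" where
  "locally_bounded M F T U \<longleftrightarrow> (\<exists>\<tau>. localizing_seq M F T \<tau> \<and>
     (\<forall>p. \<exists>C. \<forall>\<omega>\<in>space M. \<forall>s\<in>{0<..T}. ereal s \<le> \<tau> p \<omega> \<longrightarrow> norm (U s \<omega>) \<le> C))"

definition martingale ::
  "'a measure \<Rightarrow> (real \<Rightarrow> 'a measure) \<Rightarrow> real \<Rightarrow> (real \<Rightarrow> 'a \<Rightarrow> real) \<Rightarrow> bool" where
  "martingale M F T U \<longleftrightarrow> adapted F T U \<and> (\<forall>\<omega>\<in>space M. cadlag T (\<lambda>t. U t \<omega>))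
     \<and> (\<forall>t\<in>{0..T}. integrable M (U t))
     \<and> (\<forall>s\<in>{0..T}. \<forall>t\<in>{0..T}. s \<le> t \<longrightarrow> (AE \<omega> in M. real_cond_exp M (F s) (U t) \<omega> = U s \<omega>))"

definition local_martingale ::
  "'a measure \<Rightarrow> (real \<Rightarrow> 'a measure) \<Rightarrow> real \<Rightarrow> (real \<Rightarrow> 'a \<Rightarrow> real) \<Rightarrow> bool" where
  "local_martingale M F T U \<longleftrightarrow> adapted F T U \<and> (\<forall>\<omega>\<in>space M. cadlag T (\<lambda>t. U t \<omega>))
     \<and> (\<exists>\<tau>. localizing_seq M F T \<tau> \<and> (\<forall>p. martingale M F T (stopped U (\<tau> p))))"

definition purely_discontinuous ::
  "'a measure \<Rightarrow> (real \<Rightarrow> 'a measure) \<Rightarrow> real \<Rightarrow> (real \<Rightarrow> 'a \<Rightarrow> real) \<Rightarrow> bool" where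
  "purely_discontinuous M F T U \<longleftrightarrow> local_martingale M F T U \<and> (AE \<omega> in M. U 0 \<omega> = 0)
     \<and> (\<forall>N. local_martingale M F T N \<and> (\<forall>\<omega>\<in>space M. continuous_on {0..T} (\<lambda>t. N t \<omega>))
          \<longrightarrow> local_martingale M F T (\<lambda>t \<omega>. U t \<omega> * N t \<omega>))"

definition semimartingale ::
  "'a measure \<Rightarrow> (real \<Rightarrow> 'a measure) \<Rightarrow> real \<Rightarrow> (real \<Rightarrow> 'a \<Rightarrow> real^'n) \<Rightarrow> bool" where
  "semimartingale M F T Y \<longleftrightarrow> adapted F T Y \<and> (\<forall>\<omega>\<in>space M. cadlag T (\<lambda>t. Y t \<omega>))
     \<and> (\<forall>i. \<exists>L A. local_martingale M F T L
          \<and> adapted F T A \<and> (\<forall>\<omega>\<in>space M. cadlag T (\<lambda>t. A t \<omega>) \<and> finite_variation T (\<lambda>t. A t \<omega>))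
          \<and> (AE \<omega> in M. L 0 \<omega> = 0 \<and> A 0 \<omega> = 0 \<and>
               (\<forall>t\<in>{0..T}. Y t \<omega> $ i = Y 0 \<omega> $ i + L t \<omega> + A t \<omega>)))"


section \<open>Brownian motion and the Ito integral\<close>

definition brownian_motion ::
  "'a measure \<Rightarrow> (real \<Rightarrow> 'a measure) \<Rightarrow> real \<Rightarrow> (real \<Rightarrow> 'a \<Rightarrow> real^'n) \<Rightarrow> bool" where
  "brownian_motion M F T Z \<longleftrightarrow> adapted F T Z \<and> (\<forall>\<omega>\<in>space M. continuous_on {0..T} (\<lambda>t. Z t \<omega>))
     \<and> (AE \<omega> in M. Z 0 \<omega> = 0)
     \<and> (\<forall>s t. 0 \<le> s \<and> s \<le> t \<and> t \<le> T \<longrightarrow>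
          distr M borel (\<lambda>\<omega>. Z t \<omega> - Z s \<omega>) = gaussian ((t - s) *\<^sub>R mat 1)
          \<and> prob_space.indep_set M (sets (F s))
               (sets (vimage_algebra (space M) (\<lambda>\<omega>. Z t \<omega> - Z s \<omega>) borel)))"

text \<open>Simple integrands \<open>\<Sum>i<k. A i * 1_(ts i, ts (i+1)]\<close> with \<open>A i\<close> bounded and
  \<open>F (ts i)\<close>-measurable.\<close>

definition simple_integrand ::
  "'a measure \<Rightarrow> (real \<Rightarrow> 'a measure) \<Rightarrow> real \<Rightarrow> nat \<Rightarrow> (nat \<Rightarrow> real)
     \<Rightarrow> (nat \<Rightarrow> 'a \<Rightarrow> real^'n^'n) \<Rightarrow> bool" where
  "simple_integrand M F T k ts A \<longleftrightarrow> (\<forall>i\<le>k. ts i \<in> {0..T}) \<and> (\<forall>i<k. ts i \<le> ts (Suc i))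
     \<and> (\<forall>i<k. A i \<in> borel_measurable (F (ts i)) \<and> (\<exists>C. \<forall>\<omega>\<in>space M. norm (A i \<omega>) \<le> C))"

definition simple_value ::
  "nat \<Rightarrow> (nat \<Rightarrow> real) \<Rightarrow> (nat \<Rightarrow> 'a \<Rightarrow> real^'n^'n) \<Rightarrow> real \<Rightarrow> 'a \<Rightarrow> real^'n^'n" where
  "simple_value k ts A s \<omega> = (\<Sum>i<k. indicat_real {ts i<..ts (Suc i)} s *\<^sub>R A i \<omega>)"

definition simple_integral ::
  "(real \<Rightarrow> 'a \<Rightarrow> real^'n) \<Rightarrow> nat \<Rightarrow> (nat \<Rightarrow> real) \<Rightarrow> (nat \<Rightarrow> 'a \<Rightarrow> real^'n^'n)
     \<Rightarrow> real \<Rightarrow> 'a \<Rightarrow> real^'n" where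
  "simple_integral Z k ts A t \<omega> =
     (\<Sum>i<k. A i \<omega> *v (Z (min t (ts (Suc i))) \<omega> - Z (min t (ts i)) \<omega>))"

text \<open>\<open>I\<close> is a continuous version of the Ito integral of \<open>H\<close> with respect to \<open>Z\<close>: the limit,
  uniformly in time in probability, of integrals of simple integrands that approximate \<open>H\<close> in
  \<open>L\<^sup>2(dt)\<close> in probability. This determines \<open>I\<close> up to indistinguishability.\<close>

definition is_ito_integral ::
  "'a measure \<Rightarrow> (real \<Rightarrow> 'a measure) \<Rightarrow> real \<Rightarrow> (real \<Rightarrow> 'a \<Rightarrow> real^'n)
     \<Rightarrow> (real \<Rightarrow> 'a \<Rightarrow> real^'n^'n) \<Rightarrow> (real \<Rightarrow> 'a \<Rightarrow> real^'n) \<Rightarrow> bool" where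
  "is_ito_integral M F T Z H I \<longleftrightarrow>
     progressive F T H
     \<and> (AE \<omega> in M. set_integrable lborel {0..T} (\<lambda>s. (norm (H s \<omega>))\<^sup>2))
     \<and> (\<forall>t\<in>{0..T}. I t \<in> borel_measurable M)
     \<and> (\<forall>\<omega>\<in>space M. continuous_on {0..T} (\<lambda>t. I t \<omega>))
     \<and> (\<exists>k ts A. (\<forall>j. simple_integrand M F T (k j) (ts j) (A j))
          \<and> conv_in_prob M
               (\<lambda>j \<omega>. LINT s:{0..T}|lborel. (norm (simple_value (k j) (ts j) (A j) s \<omega> - H s \<omega>))\<^sup>2)
               (\<lambda>_. 0)
          \<and> conv_in_prob M
               (\<lambda>j \<omega>. SUP t\<in>{0..T}. norm (simple_integral Z (k j) (ts j) (A j) t \<omega> - I t \<omega>))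
               (\<lambda>_. 0))"


section \<open>Jump measure, compensator and compensated jump integrals\<close>

text \<open>The measure \<open>\<Sum>s\<in>{0<..T}. \<delta> (jump y s, s)\<close>, the sum ranging over the jump times of the
  path \<open>y\<close>.\<close>

definition jump_measure :: "real \<Rightarrow> (real \<Rightarrow> real^'n) \<Rightarrow> ((real^'n) \<times> real) measure" where
  "jump_measure T y = distr (count_space {s\<in>{0<..T}. jump y s \<noteq> 0}) borel (\<lambda>s. (jump y s, s))"

definition predictable_kernel ::
  "'a measure \<Rightarrow> (real \<Rightarrow> 'a measure) \<Rightarrow> real \<Rightarrow> (real \<Rightarrow> 'a \<Rightarrow> (real^'n) measure) \<Rightarrow> bool" where
  "predictable_kernel M F T K \<longleftrightarrow> (\<forall>s\<in>{0..T}. \<forall>\<omega>\<in>space M. sets (K s \<omega>) = sets borel)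
     \<and> (\<forall>W :: (real \<times> 'a) \<times> (real^'n) \<Rightarrow> ennreal.
          W \<in> borel_measurable (predictable_sigma M F T \<Otimes>\<^sub>M borel) \<longrightarrow>
          (\<lambda>(s, \<omega>). \<integral>\<^sup>+\<xi>. W ((s, \<omega>), \<xi>) \<partial>K s \<omega>) \<in> borel_measurable (predictable_sigma M F T))"

text \<open>\<open>K s(d\<xi>) ds\<close> is the compensator of the jump measure of \<open>Y\<close>.\<close>

definition compensator_kernel ::
  "'a measure \<Rightarrow> (real \<Rightarrow> 'a measure) \<Rightarrow> real \<Rightarrow> (real \<Rightarrow> 'a \<Rightarrow> real^'n)
     \<Rightarrow> (real \<Rightarrow> 'a \<Rightarrow> (real^'n) measure) \<Rightarrow> bool" where
  "compensator_kernel M F T Y K \<longleftrightarrow> predictable_kernel M F T K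
     \<and> (\<forall>W :: (real \<times> 'a) \<times> (real^'n) \<Rightarrow> ennreal.
          W \<in> borel_measurable (predictable_sigma M F T \<Otimes>\<^sub>M borel) \<longrightarrow>
          (\<integral>\<^sup>+\<omega>. (\<integral>\<^sup>+z\<in>(UNIV \<times> {0<..T}). W ((snd z, \<omega>), fst z) \<partial>jump_measure T (\<lambda>t. Y t \<omega>)) \<partial>M)
          = (\<integral>\<^sup>+\<omega>. (\<integral>\<^sup>+s\<in>{0..T}. (\<integral>\<^sup>+\<xi>. W ((s, \<omega>), \<xi>) \<partial>K s \<omega>) \<partial>lborel) \<partial>M))"

text \<open>\<open>J\<close> is the stochastic integral of \<open>h\<close> with respect to the compensated jump measure of \<open>Y\<close>,
  i.e. the purely discontinuous local martingale with jumps
  \<open>h (jump Y t) - \<integral> h(\<xi>) \<nu>({t} \<times> d\<xi>)\<close>, \<open>\<nu>\<close> being the compensator. As \<open>\<nu>\<close> has the form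
  \<open>K s(d\<xi>) ds\<close>, it does not charge \<open>{t} \<times> UNIV\<close> and the second term vanishes.\<close>

definition is_compensated_integral ::
  "'a measure \<Rightarrow> (real \<Rightarrow> 'a measure) \<Rightarrow> real \<Rightarrow> (real^'n \<Rightarrow> real^'n) \<Rightarrow> (real \<Rightarrow> 'a \<Rightarrow> real^'n)
     \<Rightarrow> (real \<Rightarrow> 'a \<Rightarrow> real^'n) \<Rightarrow> bool" where
  "is_compensated_integral M F T h Y J \<longleftrightarrow>
     (\<forall>i. purely_discontinuous M F T (\<lambda>t \<omega>. J t \<omega> $ i))
     \<and> (AE \<omega> in M. \<forall>t\<in>{0<..T}. jump (\<lambda>u. J u \<omega>) t = h (jump (\<lambda>u. Y u \<omega>) t))"


section \<open>The basic setting\<close>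

text \<open>Truncation functions are called \<open>h\<close>, because \<open>\<chi>\<close> is the binder of vectors.\<close>

definition truncation :: "(real^'n \<Rightarrow> real^'n) \<Rightarrow> bool" where
  "truncation h \<longleftrightarrow> h \<in> borel_measurable borel \<and> bounded (range h) \<and> (\<forall>\<^sub>F \<xi> in nhds 0. h \<xi> = \<xi>)"

text \<open>The volatility \<open>sqrt (X (s-))\<close>.\<close>

definition vol :: "(real \<Rightarrow> 'a \<Rightarrow> real^'n^'n) \<Rightarrow> real \<Rightarrow> 'a \<Rightarrow> real^'n^'n" where
  "vol X s \<omega> = msqrt (leftlim (\<lambda>u. X u \<omega>) s)"

definition basic_setting ::
  "'a measure \<Rightarrow> (real \<Rightarrow> 'a measure) \<Rightarrow> real \<Rightarrow> (real^'n \<Rightarrow> real^'n)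
     \<Rightarrow> (real \<Rightarrow> 'a \<Rightarrow> real^'n) \<Rightarrow> real^'n \<Rightarrow> (real \<Rightarrow> 'a \<Rightarrow> real^'n) \<Rightarrow> (real \<Rightarrow> 'a \<Rightarrow> real^'n^'n)
     \<Rightarrow> (real \<Rightarrow> 'a \<Rightarrow> real^'n) \<Rightarrow> (real \<Rightarrow> 'a \<Rightarrow> (real^'n) measure) \<Rightarrow> bool" where
  "basic_setting M F T h Y y b X Z K \<longleftrightarrow>
     semimartingale M F T Y
     \<and> progressive F T b \<and> locally_bounded M F T b
     \<and> adapted F T X \<and> (\<forall>\<omega>\<in>space M. cadlag T (\<lambda>t. X t \<omega>) \<and> (\<forall>t\<in>{0..T}. psd_mat (X t \<omega>)))
     \<and> brownian_motion M F T Z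
     \<and> compensator_kernel M F T Y K
     \<and> (\<exists>I J. is_ito_integral M F T Z (vol X) I \<and> is_compensated_integral M F T h Y J
          \<and> (AE \<omega> in M. \<forall>t\<in>{0..T}.
               Y t \<omega> = y + (LINT s:{0..t}|lborel. b s \<omega>) + I t \<omega> + J t \<omega>
                 + (LINT z:(UNIV \<times> {0<..t})|jump_measure T (\<lambda>u. Y u \<omega>). fst z - h (fst z))))"

text \<open>The drift \<open>b + \<integral>(h'(\<xi>) - h(\<xi>)) K(d\<xi>)\<close> relative to \<open>h'\<close>.\<close>

definition drift_for ::
  "(real^'n \<Rightarrow> real^'n) \<Rightarrow> (real \<Rightarrow> 'a \<Rightarrow> real^'n) \<Rightarrow> (real \<Rightarrow> 'a \<Rightarrow> (real^'n) measure)
     \<Rightarrow> (real^'n \<Rightarrow> real^'n) \<Rightarrow> real \<Rightarrow> 'a \<Rightarrow> real^'n" where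
  "drift_for h b K h' s \<omega> = b s \<omega> + (LINT \<xi>|K s \<omega>. h' \<xi> - h \<xi>)"

text \<open>\<open>D\<close> is (a version of) the diffusion part, relative to \<open>h'\<close>, of the semimartingale with the given
  data.\<close>

definition is_diffusion_part ::
  "'a measure \<Rightarrow> (real \<Rightarrow> 'a measure) \<Rightarrow> real \<Rightarrow> (real^'n \<Rightarrow> real^'n)
     \<Rightarrow> real^'n \<Rightarrow> (real \<Rightarrow> 'a \<Rightarrow> real^'n) \<Rightarrow> (real \<Rightarrow> 'a \<Rightarrow> real^'n^'n)
     \<Rightarrow> (real \<Rightarrow> 'a \<Rightarrow> real^'n) \<Rightarrow> (real \<Rightarrow> 'a \<Rightarrow> (real^'n) measure)
     \<Rightarrow> (real^'n \<Rightarrow> real^'n) \<Rightarrow> (real \<Rightarrow> 'a \<Rightarrow> real^'n) \<Rightarrow> bool" where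
  "is_diffusion_part M F T h y b X Z K h' D \<longleftrightarrow>
     (\<forall>t\<in>{0..T}. D t \<in> borel_measurable M)
     \<and> (AE \<omega> in M. (AE s in lborel. s \<in> {0<..T} \<longrightarrow> integrable (K s \<omega>) (\<lambda>\<xi>. h' \<xi> - h \<xi>))
          \<and> set_integrable lborel {0..T} (\<lambda>s. drift_for h b K h' s \<omega>))
     \<and> (\<exists>I. is_ito_integral M F T Z (vol X) I
          \<and> (AE \<omega> in M. \<forall>t\<in>{0..T}.
               D t \<omega> = y + (LINT s:{0..t}|lborel. drift_for h b K h' s \<omega>) + I t \<omega>))"

text \<open>\<open>grid_incr n m u\<close> is the increment of the path \<open>u\<close> over \<open>[(m-1)/n, m/n]\<close>; only \<open>m \<ge> 1\<close>
  is used.\<close>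

definition grid_incr :: "nat \<Rightarrow> nat \<Rightarrow> (real \<Rightarrow> 'b::real_vector) \<Rightarrow> 'b" where
  "grid_incr n m u = u (real m / real n) - u ((real m - 1) / real n)"

text \<open>The approximating processes \<open>Y' p\<close> are semimartingales of the form of the basic setting, with
  their own data. Expectations are taken in \<open>[0, \<infinity>]\<close>, so that the limit relation entails that they
  are finite for large \<open>n\<close>.\<close>

definition jump_approximation ::
  "'a measure \<Rightarrow> (real \<Rightarrow> 'a measure) \<Rightarrow> real \<Rightarrow> (real^'n \<Rightarrow> real^'n)
     \<Rightarrow> (real \<Rightarrow> 'a \<Rightarrow> real^'n) \<Rightarrow> real^'n \<Rightarrow> (real \<Rightarrow> 'a \<Rightarrow> real^'n) \<Rightarrow> (real \<Rightarrow> 'a \<Rightarrow> real^'n^'n)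
     \<Rightarrow> (real \<Rightarrow> 'a \<Rightarrow> real^'n) \<Rightarrow> (real \<Rightarrow> 'a \<Rightarrow> (real^'n) measure)
     \<Rightarrow> (real^'n \<Rightarrow> real^'n^'n) \<Rightarrow> real \<Rightarrow> bool" where
  "jump_approximation M F T h Y y b X Z K g \<eta> \<longleftrightarrow>
     (\<exists>h'. (truncation h' \<or> h' = (\<lambda>_. 0) \<or> h' = id)
       \<and> (AE \<omega> in M. (\<forall>s\<in>{0<..T}. integrable (K s \<omega>) (\<lambda>\<xi>. h' \<xi> - h \<xi>))
            \<and> caglad T (\<lambda>s. drift_for h b K h' s \<omega>))
       \<and> (\<exists>D \<tau> Y' y' b' X' Z' K' D'.
            is_diffusion_part M F T h y b X Z K h' D
            \<and> localizing_seq M F T \<tau>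
            \<and> (\<forall>p::nat.
                 basic_setting M F T h (Y' p) (y' p) (b' p) (X' p) (Z' p) (K' p)
                 \<and> is_diffusion_part M F T h (y' p) (b' p) (X' p) (Z' p) (K' p) h' (D' p)
                 \<and> (AE \<omega> in M. \<forall>t\<in>{0..T}. ereal t < \<tau> p \<omega> \<longrightarrow>
                       Y' p t \<omega> = Y t \<omega> \<and> D t \<omega> = D' p t \<omega>)
                 \<and> (\<lambda>n. SUP m\<in>{1..nat \<lfloor>real n * T\<rfloor>}.
                       ennreal (real n powr \<eta>) *
                       (\<integral>\<^sup>+\<omega>. ennreal (norm
                           (g (sqrt (real n) *\<^sub>R grid_incr n m (\<lambda>t. Y' p t \<omega>))
                            - g (sqrt (real n) *\<^sub>R grid_incr n m (\<lambda>t. D' p t \<omega>)))) \<partial>M))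
                    \<longlonglongrightarrow> 0)))"

definition poly_growth :: "(real^'n \<Rightarrow> real^'n^'n) \<Rightarrow> bool" where
  "poly_growth g \<longleftrightarrow> (\<exists>C. \<exists>q::nat. \<forall>x. norm (g x) \<le> C * (1 + norm x ^ q))"

definition no_fixed_discontinuity ::
  "'a measure \<Rightarrow> real \<Rightarrow> (real \<Rightarrow> 'a \<Rightarrow> real^'n^'n) \<Rightarrow> bool" where
  "no_fixed_discontinuity M T X \<longleftrightarrow>
     (\<forall>t\<in>{0<..T}. AE \<omega> in M. leftlim (\<lambda>u. X u \<omega>) t = X t \<omega>)"


section \<open>The estimator\<close>

definition fourier_V ::
  "real \<Rightarrow> (real^'n \<Rightarrow> real^'n^'n) \<Rightarrow> int \<Rightarrow> nat \<Rightarrow> (real \<Rightarrow> real^'n) \<Rightarrow> complex^'n^'n" where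
  "fourier_V T g k n u = (1 / real n) *\<^sub>R
     (\<Sum>m = 1..nat \<lfloor>real n * T\<rfloor>.
        cscale (exp (- (\<i> * of_real (2 * pi / T * of_int k * ((real m - 1) / real n)))))
          (cmat (g (sqrt (real n) *\<^sub>R grid_incr n m u))))"

definition rho_hat ::
  "real \<Rightarrow> (real^'n \<Rightarrow> real^'n^'n) \<Rightarrow> nat \<Rightarrow> nat \<Rightarrow> real \<Rightarrow> (real \<Rightarrow> real^'n) \<Rightarrow> complex^'n^'n" where
  "rho_hat T g n N t u = (1 / T) *\<^sub>R
     (\<Sum>k\<in>{- int N..int N}. (1 - real_of_int \<bar>k\<bar> / real N) *\<^sub>R
        cscale (exp (\<i> * of_real (2 * pi / T * of_int k * t))) (fourier_V T g k n u))"

end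

theory Submission
  imports Defs
begin

text \<open>
  The entries of the estimator are weighted averages of \<open>g (sqrt n *\<^sub>R incr)\<close> over the increments of
  \<open>Y\<close>, the weights being samples of the Fejer kernel. This kernel has total variation of order
  \<open>N\<close>, so its Riemann sums over a grid of mesh \<open>1/n\<close> are within \<open>O(N/n)\<close> of the integrals, and in
  the limit each side of \<open>t\<close> carries weight \<open>1/2\<close>. The jumps are removed by the approximation
  property. On an event of large probability the volatility is bounded, and there the diffusion
  increments are compared with \<open>sqrt (X (i/n)) (Z ((i+1)/n) - Z (i/n))\<close>: both have bounded exponential
  moments, which absorb the growth of \<open>g\<close>, and the weighted sum of their squared distances tends to
  zero because the weights concentrate where \<open>X\<close> is close to one of its one-sided limits. For the
  frozen increments a weak law of large numbers replaces \<open>g\<close> by \<open>rho g (X (i/n))\<close>. No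
  stochastic calculus beyond simple integrands enters, as the Ito integral is replaced by simple
  integrals whose error is negligible even at the scale of single grid cells.
\<close>

section \<open>The Fejer kernel\<close>

text \<open>Since \<open>X\<close> may jump, no global modulus of continuity is available, so
  smallness is only asked of cells close to \<open>t\<close>, and the straddling cell is discarded
  because its weight is O(N/n). Exponential moments need integrands with a deterministic bound. This
  is achieved not by stopping but by projecting volatility matrices onto a ball of radius
  \<open>R\<close>: the projection is 1-Lipschitz, so approximations survive it, and boundedness
  turns approximation in probability into approximation in expectation. Undoing the truncation costs
  one further simple integral, that of \<open>S - proj S\<close>, which is small on the event that
  the volatility stays in the ball. The accuracies 1/(n+1)^4 and 1/(n+1) of the simple integrands
  come from the grid: Chebyshev at level 1/n with a union over about n T grid points loses a factor
  n^3, and increments are multiplied by sqrt n. The relation between \<open>n\<close> and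
  \<open>N\<close> is used in the form N/n -> 0, which controls the Riemann sum error, the
  straddling cell, and the sum of squared weights in the weak law.\<close>

definition fejer :: "nat \<Rightarrow> real \<Rightarrow> real" where
  "fejer N x = (\<Sum>k<N. \<Sum>l<N. cos ((real k - real l) * x)) / real N"

text \<open>Normalised to vanish at 0, hence odd in \<open>x\<close>. At \<open>pi\<close> and
  \<open>2 * pi\<close> it vanishes for nonzero integer \<open>d\<close>, which is the orthogonality
  used below.\<close>

definition cos_primitive :: "real \<Rightarrow> real \<Rightarrow> real" where
  "cos_primitive d x = (if d = 0 then x else sin (d * x) / d)"

definition fejer_primitive :: "nat \<Rightarrow> real \<Rightarrow> real" where
  "fejer_primitive N x = (\<Sum>k<N. \<Sum>l<N. cos_primitive (real k - real l) x) / real N"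

text \<open>A primitive of a trigonometric polynomial dominating the derivative of the kernel. With \<open>D\<close> the
  Dirichlet sum, \<open>fejer = |D|\<^sup>2 / N\<close> has derivative at most \<open>|D|\<^sup>2 + |D'|\<^sup>2 / N\<^sup>2\<close>, whose integral over
  a period is of order \<open>N\<close> by orthogonality.\<close>

definition fejer_variation :: "nat \<Rightarrow> real \<Rightarrow> real" where
  "fejer_variation N x = real N * fejer_primitive N x
     + (\<Sum>k<N. \<Sum>l<N. real k * real l * cos_primitive (real k - real l) x) / (real N)\<^sup>2"

lemma cos_primitive_deriv [derivative_intros]:
  assumes "(f has_real_derivative f') (at x)"
  shows "((\<lambda>x. cos_primitive d (f x)) has_real_derivative cos (d * f x) * f') (at x)"
  unfolding cos_primitive_def using assms
  by (cases "d = 0") (auto intro!: derivative_eq_intros)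

lemma fejer_primitive_deriv:
  "(fejer_primitive N has_real_derivative fejer N x) (at x)"
proof (cases "N = 0")
  case False
  then show ?thesis unfolding fejer_primitive_def[abs_def] fejer_def by (auto intro!: derivative_eq_intros)
qed (simp add: fejer_primitive_def[abs_def] fejer_def)

text \<open>The squared modulus of the trigonometric polynomial with coefficients
  \<open>c k\<close>. It is needed for \<open>c k = 1\<close>, the Dirichlet sum, and for
  \<open>c k = k\<close>, its derivative.\<close>

lemma trig_square_sum:
  fixes c :: "nat \<Rightarrow> real"
  shows "(\<Sum>k<N. \<Sum>l<N. c k * c l * cos ((real k - real l) * x))
    = (\<Sum>k<N. c k * cos (real k * x))\<^sup>2 + (\<Sum>k<N. c k * sin (real k * x))\<^sup>2"
  by (simp add: power2_eq_square sum_product sum.distrib[symmetric] left_diff_distrib cos_diff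
      algebra_simps)

lemma fejer_alt:
  "fejer N x = ((\<Sum>k<N. cos (real k * x))\<^sup>2 + (\<Sum>k<N. sin (real k * x))\<^sup>2) / real N"
  using trig_square_sum[where c = "\<lambda>_. 1" and N = N and x = x] by (simp add: fejer_def)

lemma fejer_nonneg: "0 \<le> fejer N x"
  by (simp add: fejer_alt)

lemma fejer_le: "fejer N x \<le> real N"
proof (cases "N = 0")
  case False
  have "(\<Sum>k<N. \<Sum>l<N. cos ((real k - real l) * x)) \<le> (\<Sum>k<N. \<Sum>l<N. 1)"
    by (intro sum_mono) simp
  then show ?thesis using False by (simp add: fejer_def divide_le_eq)
qed (simp add: fejer_def)

lemma fejer_minus: "fejer N (- x) = fejer N x"
  unfolding fejer_def minus_mult_right[symmetric] cos_minus by simp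

lemma fejer_periodic: "fejer N (x + 2 * pi) = fejer N x"
proof -
  have "cos ((real k - real l) * (x + 2 * pi)) = cos ((real k - real l) * x)" for k l
  proof -
    have "(real k - real l) * (x + 2 * pi) = (real k - real l) * x + 2 * pi * of_int (int k - int l)"
      by (simp add: algebra_simps)
    then show ?thesis by (simp only: cos_add cos_int_2pin sin_int_2pin mult_1_right mult_zero_right diff_zero)
  qed
  then show ?thesis by (simp add: fejer_def)
qed

lemma fejer_primitive_minus: "fejer_primitive N (- x) = - fejer_primitive N x"
proof -
  have "cos_primitive d (- x) = - cos_primitive d x" for d
    by (simp add: cos_primitive_def)
  then show ?thesis by (simp add: fejer_primitive_def sum_negf)
qed

lemma sin_nat_diff_pi: "sin ((real k - real l) * pi) = 0"
  by (simp add: left_diff_distrib sin_diff)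

lemma sin_nat_diff_2pi: "sin ((real k - real l) * (2 * pi)) = 0"
proof -
  have "(real k - real l) * (2 * pi) = (real (2*k) - real (2*l)) * pi" by (simp add: algebra_simps)
  then show ?thesis by (simp only: sin_nat_diff_pi)
qed

text \<open>Orthogonality of cosines: only diagonal terms of the double sum survive.\<close>

lemma cos_primitive_pi: "cos_primitive (real k - real l) pi = (if k = l then pi else 0)"
  by (simp add: cos_primitive_def sin_nat_diff_pi)

lemma cos_primitive_2pi: "cos_primitive (real k - real l) (2 * pi) = (if k = l then 2 * pi else 0)"
  using sin_nat_diff_2pi[of k l] by (auto simp: cos_primitive_def)

text \<open>The \<open>N\<close> diagonal terms contribute \<open>pi\<close> each, so half a period
  carries mass \<open>pi\<close> whatever \<open>N\<close> is. This is the origin of the weight 1/2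
  on each side.\<close>

lemma fejer_primitive_pi: "N > 0 \<Longrightarrow> fejer_primitive N pi = pi"
  by (simp add: fejer_primitive_def cos_primitive_pi sum.delta)

lemma fejer_primitive_2pi: "N > 0 \<Longrightarrow> fejer_primitive N (2 * pi) = 2 * pi"
  by (simp add: fejer_primitive_def cos_primitive_2pi sum.delta)

lemma fejer_primitive_0: "fejer_primitive N 0 = 0"
  by (simp add: fejer_primitive_def cos_primitive_def cong: if_cong)

text \<open>At \<open>2 * pi\<close> the first summand is 2 pi N, and the second is at most 2 pi N
  because only the diagonal terms k^2 \<le> N^2 remain; oddness doubles the sum. Two periods are
  covered because the angles occurring later range over \<open>{- (2 * pi)..2 * pi}\<close>.\<close>

lemma fejer_variation_bound:
  assumes "N > 0"
  shows "fejer_variation N (2 * pi) - fejer_variation N (- (2 * pi)) \<le> 8 * pi * real N"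
proof -
  have m: "cos_primitive d (- x) = - cos_primitive d x" for d x
    by (simp add: cos_primitive_def)
  have "(\<Sum>k<N. \<Sum>l<N. real k * real l * cos_primitive (real k - real l) (2 * pi))
      = (\<Sum>k<N. real k * real k * (2 * pi))"
    by (simp add: cos_primitive_2pi if_distrib[of "\<lambda>x. _ * x"] sum.delta cong: if_cong)
  also have "\<dots> \<le> (\<Sum>k<N. real N * real N * (2 * pi))"
    by (intro sum_mono mult_right_mono mult_mono) auto
  finally have S: "(\<Sum>k<N. \<Sum>l<N. real k * real l * cos_primitive (real k - real l) (2 * pi))
      / (real N)\<^sup>2 \<le> 2 * pi * real N"
    using assms by (simp add: divide_le_eq power2_eq_square algebra_simps)
  have "fejer_variation N (- (2 * pi)) = - fejer_variation N (2 * pi)"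
    unfolding fejer_variation_def fejer_primitive_minus m by (simp add: sum_negf)
  moreover have "fejer_variation N (2 * pi) \<le> 4 * pi * real N"
    using S assms unfolding fejer_variation_def by (simp add: fejer_primitive_2pi)
  ultimately show ?thesis by simp
qed

lemma fejer_deriv:
  "\<exists>D D'. (fejer N has_real_derivative D) (at x) \<and> (fejer_variation N has_real_derivative D') (at x)
     \<and> \<bar>D\<bar> \<le> D'"
proof (cases "N = 0")
  case True
  then have "fejer N = (\<lambda>_. 0)" "fejer_variation N = (\<lambda>_. 0)"
    by (auto simp: fejer_def fejer_variation_def fun_eq_iff)
  then show ?thesis by (intro exI[of _ 0]) auto
next
  case False
  define C S C' S' where "C = (\<Sum>k<N. cos (real k * x))" and "S = (\<Sum>k<N. sin (real k * x))"
    and "C' = (\<Sum>k<N. real k * cos (real k * x))" and "S' = (\<Sum>k<N. real k * sin (real k * x))"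
  define D where "D = 2 * (S * C' - C * S') / real N"
  define D' where "D' = C\<^sup>2 + S\<^sup>2 + (C'\<^sup>2 + S'\<^sup>2) / (real N)\<^sup>2"
  have "(fejer N has_real_derivative D) (at x)"
  proof -
    have dC: "((\<lambda>x. \<Sum>k<N. cos (real k * x)) has_real_derivative - S') (at x)"
      unfolding S'_def by (auto intro!: derivative_eq_intros simp: sum_negf mult.commute)
    have dS: "((\<lambda>x. \<Sum>k<N. sin (real k * x)) has_real_derivative C') (at x)"
      unfolding C'_def by (auto intro!: derivative_eq_intros simp: mult.commute)
    have "((\<lambda>x. ((\<Sum>k<N. cos (real k * x))\<^sup>2 + (\<Sum>k<N. sin (real k * x))\<^sup>2) / real N)
        has_real_derivative (of_nat 2 * (- S' * C ^ (2 - Suc 0)) + of_nat 2 * (C' * S ^ (2 - Suc 0))) / real N) (at x)"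
      unfolding C_def S_def
      by (rule DERIV_cdivide[OF DERIV_add[OF DERIV_power[OF dC] DERIV_power[OF dS]]])
    moreover have "(of_nat 2 * (- S' * C ^ (2 - Suc 0)) + of_nat 2 * (C' * S ^ (2 - Suc 0))) / real N = D"
      by (simp add: D_def mult_ac add_divide_distrib[symmetric])
    moreover have "fejer N = (\<lambda>x. ((\<Sum>k<N. cos (real k * x))\<^sup>2 + (\<Sum>k<N. sin (real k * x))\<^sup>2) / real N)"
      by (rule ext) (rule fejer_alt)
    ultimately show ?thesis by simp
  qed
  moreover have "(fejer_variation N has_real_derivative D') (at x)"
  proof -
    have "(fejer_variation N has_real_derivative real N * fejer N x +
       (\<Sum>k<N. \<Sum>l<N. real k * real l * cos ((real k - real l) * x)) / (real N)\<^sup>2) (at x)"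
      unfolding fejer_variation_def[abs_def] using False
      by (auto intro!: derivative_eq_intros fejer_primitive_deriv simp: power2_eq_square mult.commute)
    also have "real N * fejer N x + (\<Sum>k<N. \<Sum>l<N. real k * real l * cos ((real k - real l) * x)) / (real N)\<^sup>2 = D'"
      using False by (simp add: D'_def fejer_alt trig_square_sum C_def S_def C'_def S'_def)
    finally show ?thesis .
  qed
  moreover have "\<bar>D\<bar> \<le> D'"
  proof -
    define a b where "a = C' / real N" and "b = S' / real N"
    have D: "D = 2 * (S * a - C * b)" "D' = C\<^sup>2 + S\<^sup>2 + a\<^sup>2 + b\<^sup>2"
      unfolding D_def D'_def a_def b_def by (simp_all add: diff_divide_distrib power_divide
          add_divide_distrib right_diff_distrib)
    \<comment> \<open>The inequality 2uv \<le> u^2 + v^2 for both signs of \<open>D\<close>.\<close>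
    have "0 \<le> (S - a)\<^sup>2 + (C + b)\<^sup>2" "0 \<le> (S + a)\<^sup>2 + (C - b)\<^sup>2" by simp_all
    then show ?thesis unfolding D by (simp add: power2_eq_square algebra_simps)
  qed
  ultimately show ?thesis by blast
qed

text \<open>Sum and difference of \<open>fejer_variation N\<close> and \<open>fejer N\<close> have
  nonnegative derivatives, hence are nondecreasing. In particular \<open>fejer_variation N\<close>
  is itself nondecreasing.\<close>

lemma fejer_increment_le_variation:
  assumes "x \<le> y"
  shows "\<bar>fejer N y - fejer N x\<bar> \<le> fejer_variation N y - fejer_variation N x"
proof -
  have "fejer_variation N x - fejer N x \<le> fejer_variation N y - fejer N y"
  proof (rule DERIV_nonneg_imp_nondecreasing[OF assms])
    fix z
    obtain D D' where D: "(fejer N has_real_derivative D) (at z)"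
      "(fejer_variation N has_real_derivative D') (at z)" "\<bar>D\<bar> \<le> D'"
      using fejer_deriv[of N z] by blast
    show "\<exists>d. ((\<lambda>x. fejer_variation N x - fejer N x) has_real_derivative d) (at z) \<and> 0 \<le> d"
      by (intro exI[of _ "D' - D"]) (use D in \<open>auto intro!: derivative_intros\<close>)
  qed
  moreover have "fejer_variation N x + fejer N x \<le> fejer_variation N y + fejer N y"
  proof (rule DERIV_nonneg_imp_nondecreasing[OF assms])
    fix z
    obtain D D' where D: "(fejer N has_real_derivative D) (at z)"
      "(fejer_variation N has_real_derivative D') (at z)" "\<bar>D\<bar> \<le> D'"
      using fejer_deriv[of N z] by blast
    show "\<exists>d. ((\<lambda>x. fejer_variation N x + fejer N x) has_real_derivative d) (at z) \<and> 0 \<le> d"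
      by (intro exI[of _ "D' + D"]) (use D in \<open>auto intro!: derivative_intros\<close>)
  qed
  ultimately show ?thesis by linarith
qed

text \<open>On each cell the mean value theorem writes the integral as \<open>\<delta>\<close> times
  a value of the kernel, and this value differs from the one at the left end by at most the
  variation over the cell. The cell variations telescope.\<close>

lemma fejer_riemann_sum:
  fixes x0 \<delta> :: real
  assumes "p \<le> q" "\<delta> \<ge> 0"
  shows "\<bar>(\<Sum>i=p..<q. \<delta> * fejer N (x0 + \<delta> * real i))
      - (fejer_primitive N (x0 + \<delta> * real q) - fejer_primitive N (x0 + \<delta> * real p))\<bar>
    \<le> \<delta> * (fejer_variation N (x0 + \<delta> * real q) - fejer_variation N (x0 + \<delta> * real p))"
  using assms(1)
proof (induction rule: dec_induct)
  case (step i)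
  define u where "u = x0 + \<delta> * real i"
  have eq: "x0 + \<delta> * real (Suc i) = u + \<delta>" by (simp add: u_def algebra_simps)
  have cell: "\<bar>\<delta> * fejer N u - (fejer_primitive N (u + \<delta>) - fejer_primitive N u)\<bar>
      \<le> \<delta> * (fejer_variation N (u + \<delta>) - fejer_variation N u)"
  proof (cases "\<delta> = 0")
    case False
    then have d: "\<delta> > 0" using assms by simp
    obtain z where z: "u < z" "z < u + \<delta>"
      "fejer_primitive N (u + \<delta>) - fejer_primitive N u = \<delta> * fejer N z"
      using MVT2[of u "u + \<delta>" "fejer_primitive N" "fejer N"] fejer_primitive_deriv d by auto
    have "\<bar>fejer N z - fejer N u\<bar> \<le> fejer_variation N z - fejer_variation N u"
      using z by (intro fejer_increment_le_variation) simp
    \<comment> \<open>Serves to extend the variation bound from \<open>z\<close> to the right end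
      \<open>u + \<delta>\<close> of the cell.\<close>
    moreover have "\<bar>fejer N (u + \<delta>) - fejer N z\<bar> \<le> fejer_variation N (u + \<delta>) - fejer_variation N z"
      using z by (intro fejer_increment_le_variation) simp
    ultimately have *: "\<bar>fejer N u - fejer N z\<bar> \<le> fejer_variation N (u + \<delta>) - fejer_variation N u"
      by linarith
    have "\<delta> * fejer N u - (fejer_primitive N (u + \<delta>) - fejer_primitive N u) = \<delta> * (fejer N u - fejer N z)"
      unfolding z(3) by (simp add: algebra_simps)
    then show ?thesis using * d by (simp add: abs_mult)
  qed auto
  have "(\<Sum>i = p..<Suc i. \<delta> * fejer N (x0 + \<delta> * real i))
     = (\<Sum>i = p..<i. \<delta> * fejer N (x0 + \<delta> * real i)) + \<delta> * fejer N u"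
    using step by (simp add: u_def)
  moreover have "\<delta> * (fejer_variation N (u + \<delta>) - fejer_variation N (x0 + \<delta> * real p))
     = \<delta> * (fejer_variation N (u + \<delta>) - fejer_variation N u)
       + \<delta> * (fejer_variation N u - fejer_variation N (x0 + \<delta> * real p))"
    by (simp add: algebra_simps)
  ultimately show ?case
    using step.IH cell unfolding eq u_def[symmetric] by linarith
qed simp

text \<open>Multiplication by 2 sin(x/2) makes both the cosine and the sine sum telescope. The
  squares then add up to 2 - 2 cos(N x), which is at most 4.\<close>

lemma fejer_le_sin:
  assumes "sin (x / 2) \<noteq> 0"
  shows "fejer N x \<le> 1 / (real N * (sin (x / 2))\<^sup>2)"
proof (cases "N = 0")
  case False
  define C S where "C = (\<Sum>k<N. cos (real k * x))" and "S = (\<Sum>k<N. sin (real k * x))"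
  have C: "2 * sin (x/2) * C = sin ((real N - 1/2) * x) + sin (x/2)"
    unfolding C_def
  proof (induction N)
    case (Suc N)
    have "2 * sin (x/2) * cos (real N * x) = sin (real N * x + x/2) - sin (real N * x - x/2)"
      unfolding sin_add sin_diff by simp
    moreover have "(real (Suc N) - 1/2) * x = real N * x + x/2" "(real N - 1/2) * x = real N * x - x/2"
      by (simp_all add: field_simps)
    ultimately show ?case using Suc by (simp add: distrib_left)
  qed simp
  have S: "2 * sin (x/2) * S = cos (x/2) - cos ((real N - 1/2) * x)"
    unfolding S_def
  proof (induction N)
    case (Suc N)
    have "2 * sin (x/2) * sin (real N * x) = cos (real N * x - x/2) - cos (real N * x + x/2)"
      unfolding cos_add cos_diff by simp
    moreover have "(real (Suc N) - 1/2) * x = real N * x + x/2" "(real N - 1/2) * x = real N * x - x/2"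
      by (simp_all add: field_simps)
    ultimately show ?case using Suc by (simp add: distrib_left)
  qed simp
  have "4 * (sin (x/2))\<^sup>2 * (C\<^sup>2 + S\<^sup>2) = (2 * sin (x/2) * C)\<^sup>2 + (2 * sin (x/2) * S)\<^sup>2"
    by (simp only: power_mult_distrib distrib_left) simp
  also have "\<dots> = 2 + 2 * (sin ((real N - 1/2) * x) * sin (x/2) - cos (x/2) * cos ((real N - 1/2) * x))"
  proof -
    have *: "(s + a)\<^sup>2 + (b - c)\<^sup>2 = 2 + 2 * (s * a - b * c)"
      if "a\<^sup>2 + b\<^sup>2 = 1" "s\<^sup>2 + c\<^sup>2 = 1" for s a b c :: real
      using that by (simp add: power2_eq_square algebra_simps)
    show ?thesis unfolding C S by (rule *) simp_all
  qed
  also have "\<dots> = 2 - 2 * cos (x/2 + (real N - 1/2) * x)"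
    unfolding cos_add by (simp add: algebra_simps)
  also have "\<dots> \<le> 4" using cos_ge_minus_one[of "x/2 + (real N - 1/2) * x"] by linarith
  finally have "(sin (x/2))\<^sup>2 * (C\<^sup>2 + S\<^sup>2) \<le> 1" by simp
  then show ?thesis
  proof -
    have "C\<^sup>2 + S\<^sup>2 \<le> 1 / (sin (x / 2))\<^sup>2"
      using \<open>(sin (x/2))\<^sup>2 * (C\<^sup>2 + S\<^sup>2) \<le> 1\<close> assms
      by (subst pos_le_divide_eq) (auto simp: mult.commute)
    from divide_right_mono[OF this, of "real N"] show ?thesis
      unfolding fejer_alt C_def[symmetric] S_def[symmetric]
      by (simp add: mult.commute)
  qed
qed (simp add: fejer_def)

text \<open>The number of pairs in an N by N array with difference \<open>k\<close> is N - |k|. The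
  induction enlarges the array by one row and one column.\<close>

lemma fejer_complex:
  assumes "N > 0"
  shows "(\<Sum>k\<in>{- int N..int N}. (1 - real_of_int \<bar>k\<bar> / real N) *\<^sub>R exp (\<i> * of_real (of_int k * x)))
     = of_real (fejer N x)"
proof -
  define e where "e k = exp (\<i> * of_real (of_int k * x))" for k
  have cos_e: "complex_of_real (2 * cos (of_int k * x)) = e k + e (- k)" for k
    by (simp add: e_def exp_Euler exp_minus_Euler flip: cos_of_real)
  \<comment> \<open>The exponentials are grouped in the pairs \<open>k - n\<close>,
    \<open>n - k\<close>, as they occur in the new row and column; the summand 1 is the new diagonal
    entry.\<close>
  have full: "(\<Sum>k\<in>{- int n..int n}. e k) = (\<Sum>k<n. e (int k - int n) + e (int n - int k)) + 1" for n
  proof (induction n)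
    case (Suc n)
    have "{- int (Suc n)..int (Suc n)} = insert (- int (Suc n)) (insert (int (Suc n)) {- int n..int n})"
      by auto
    then have "(\<Sum>k\<in>{- int (Suc n)..int (Suc n)}. e k) = e (- int (Suc n)) + e (int (Suc n)) + (\<Sum>k\<in>{- int n..int n}. e k)"
      by simp
    moreover have "(\<Sum>k<Suc n. e (int k - int (Suc n)) + e (int (Suc n) - int k))
      = e (- int (Suc n)) + e (int (Suc n)) + (\<Sum>k<n. e (int k - int n) + e (int n - int k))"
      by (subst sum.lessThan_Suc_shift) simp
    ultimately show ?case using Suc by simp
  qed (simp add: e_def)
  have "(\<Sum>k\<in>{- int n..int n}. (real n - real_of_int \<bar>k\<bar>) *\<^sub>R e k)
      = of_real (\<Sum>k<n. \<Sum>l<n. cos ((real k - real l) * x))" for n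
  proof (induction n)
    case (Suc n)
    have "{- int (Suc n)..int (Suc n)} = insert (- int (Suc n)) (insert (int (Suc n)) {- int n..int n})"
      by auto
    \<comment> \<open>The two new extreme frequencies have coefficient 0 and drop out.\<close>
    then have "(\<Sum>k\<in>{- int (Suc n)..int (Suc n)}. (real (Suc n) - real_of_int \<bar>k\<bar>) *\<^sub>R e k)
       = (\<Sum>k\<in>{- int n..int n}. (real (Suc n) - real_of_int \<bar>k\<bar>) *\<^sub>R e k)"
      by simp
    also have "\<dots> = (\<Sum>k\<in>{- int n..int n}. (real n - real_of_int \<bar>k\<bar>) *\<^sub>R e k) + (\<Sum>k\<in>{- int n..int n}. e k)"
      unfolding sum.distrib[symmetric] by (intro sum.cong refl) (simp add: algebra_simps)
    also have "(\<Sum>k\<in>{- int n..int n}. e k) = of_real ((\<Sum>k<n. 2 * cos ((real k - real n) * x)) + 1)"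
    proof -
      have "complex_of_real (2 * cos ((real k - real n) * x)) = e (int k - int n) + e (int n - int k)" for k
        using cos_e[of "int k - int n"] by simp
      then show ?thesis unfolding full of_real_add of_real_sum by simp
    qed
    also have "(\<Sum>k\<in>{- int n..int n}. (real n - real_of_int \<bar>k\<bar>) *\<^sub>R e k)
      = of_real (\<Sum>k<n. \<Sum>l<n. cos ((real k - real l) * x))" by (rule Suc)
    also have "of_real (\<Sum>k<n. \<Sum>l<n. cos ((real k - real l) * x)) + of_real ((\<Sum>k<n. 2 * cos ((real k - real n) * x)) + 1)
       = complex_of_real (\<Sum>k<Suc n. \<Sum>l<Suc n. cos ((real k - real l) * x))"
    proof -
      have "cos ((real n - real l) * x) = cos ((real l - real n) * x)" for l
        using cos_minus[of "(real l - real n) * x"] by (simp add: algebra_simps)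
      then have "(\<Sum>k<Suc n. \<Sum>l<Suc n. cos ((real k - real l) * x))
        = (\<Sum>k<n. \<Sum>l<n. cos ((real k - real l) * x)) + ((\<Sum>k<n. 2 * cos ((real k - real n) * x)) + 1)"
        by (simp add: sum.distrib flip: sum_distrib_left)
      then show ?thesis by (simp only: of_real_add[symmetric])
    qed
    finally show ?case .
  qed simp
  note * = this[of N]
  have "(\<Sum>k\<in>{- int N..int N}. (1 - real_of_int \<bar>k\<bar> / real N) *\<^sub>R e k)
      = (1 / real N) *\<^sub>R of_real (\<Sum>k<N. \<Sum>l<N. cos ((real k - real l) * x))"
    unfolding *[symmetric] scaleR_sum_right
    using assms by (intro sum.cong refl) (simp add: diff_divide_distrib)
  then show ?thesis by (simp add: e_def fejer_def scaleR_conv_of_real)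
qed

section \<open>Sampled Fejer weights\<close>

text \<open>The angles of consecutive grid points differ by 2 pi / (n T), so the normalisation makes
  sums of weights Riemann sums of \<open>fejer N\<close> divided by \<open>2 * pi\<close>.\<close>

definition fejer_weight :: "real \<Rightarrow> nat \<Rightarrow> nat \<Rightarrow> real \<Rightarrow> nat \<Rightarrow> real" where
  "fejer_weight T n N t i = fejer N (2 * pi / T * (real i / real n - t)) / (real n * T)"

lemma fejer_primitive_diff_le:
  assumes "x \<le> y" "\<And>z. x < z \<Longrightarrow> z < y \<Longrightarrow> fejer N z \<le> c"
  shows "\<bar>fejer_primitive N y - fejer_primitive N x\<bar> \<le> c * (y - x)"
proof (cases "x = y")
  case False
  then obtain z where z: "x < z" "z < y" "fejer_primitive N y - fejer_primitive N x = (y - x) * fejer N z"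
    using MVT2[of x y "fejer_primitive N" "fejer N"] fejer_primitive_deriv assms by auto
  then show ?thesis using assms fejer_nonneg[of N z]
    by (auto simp: abs_mult mult.commute intro!: mult_left_mono)
qed simp

text \<open>Used at arguments of order 1/n, where the bound becomes O(N/n): rounding
  \<open>t\<close> to the grid does not matter.\<close>

lemma fejer_primitive_abs_le: "\<bar>fejer_primitive N y\<bar> \<le> real N * \<bar>y\<bar>"
proof (cases "0 \<le> y")
  case True
  then show ?thesis using fejer_primitive_diff_le[of 0 y N "real N"] fejer_le by (simp add: fejer_primitive_0)
next
  case False
  then show ?thesis using fejer_primitive_diff_le[of y 0 N "real N"] fejer_le by (simp add: fejer_primitive_0)
qed

text \<open>On a compact interval inside the open period, sin(x/2) is bounded below by some s > 0,
  so the kernel is at most 1/(N s^2) there and its primitive stays within O(1/N) of its value at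
  \<open>pi\<close>.\<close>

lemma fejer_primitive_near_pi:
  fixes a b :: real
  assumes "0 < a" "a \<le> pi" "pi \<le> b" "b < 2 * pi"
  obtains C where "C \<ge> 0" "\<And>N y. N > 0 \<Longrightarrow> y \<in> {a..b} \<Longrightarrow> \<bar>fejer_primitive N y - pi\<bar> \<le> C / real N"
proof -
  have "continuous_on {a..b} (\<lambda>x::real. sin (x / 2))" by (auto intro!: continuous_intros)
  then obtain x0 where x0: "x0 \<in> {a..b}" "\<And>x. x \<in> {a..b} \<Longrightarrow> sin (x0 / 2) \<le> sin (x / 2)"
    using continuous_attains_inf[of "{a..b}" "\<lambda>x. sin (x / 2)"] assms by auto
  define s where "s = sin (x0 / 2)"
  have s: "s > 0" unfolding s_def using x0(1) assms by (intro sin_gt_zero) auto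
  have F: "fejer N z \<le> 1 / (real N * s\<^sup>2)" if "z \<in> {a..b}" "N > 0" for z N
  proof -
    have "s \<le> sin (z / 2)" using x0 that by (simp add: s_def)
    moreover have "fejer N z \<le> 1 / (real N * (sin (z / 2))\<^sup>2)"
      using calculation s by (intro fejer_le_sin) simp
    moreover have "1 / (real N * (sin (z / 2))\<^sup>2) \<le> 1 / (real N * s\<^sup>2)"
      using calculation(1) s that by (intro divide_left_mono mult_left_mono power_mono) auto
    ultimately show ?thesis by linarith
  qed
  show ?thesis
  proof (rule that[of "2 * pi / s\<^sup>2"])
    show "2 * pi / s\<^sup>2 \<ge> 0" by simp
    fix N :: nat and y assume N: "N > 0" and y: "y \<in> {a..b}"
    have "\<bar>fejer_primitive N y - fejer_primitive N pi\<bar> \<le> 1 / (real N * s\<^sup>2) * \<bar>y - pi\<bar>"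
    proof (cases "y \<le> pi")
      case True
      then have "\<bar>fejer_primitive N pi - fejer_primitive N y\<bar> \<le> 1 / (real N * s\<^sup>2) * (pi - y)"
        using F N y assms by (intro fejer_primitive_diff_le) auto
      then show ?thesis using True by (simp add: abs_minus_commute)
    next
      case False
      then have "\<bar>fejer_primitive N y - fejer_primitive N pi\<bar> \<le> 1 / (real N * s\<^sup>2) * (y - pi)"
        using F N y assms by (intro fejer_primitive_diff_le) auto
      then show ?thesis using False by simp
    qed
    also have "\<dots> \<le> 1 / (real N * s\<^sup>2) * (2 * pi)"
      using y assms by (intro mult_left_mono) auto
    finally show "\<bar>fejer_primitive N y - pi\<bar> \<le> 2 * pi / s\<^sup>2 / real N"
      using N by (simp add: fejer_primitive_pi mult.commute)
  qed
qed

lemma fejer_weight_nonneg: "T > 0 \<Longrightarrow> 0 \<le> fejer_weight T n N t i"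
  by (simp add: fejer_weight_def fejer_nonneg)

lemma fejer_weight_le: "T > 0 \<Longrightarrow> fejer_weight T n N t i \<le> real N / (real n * T)"
  by (simp add: fejer_weight_def fejer_le divide_right_mono)

text \<open>A shift of \<open>t\<close> by \<open>T\<close> is a full period of the angle. This
  identifies the two endpoints of \<open>{0..T}\<close>.\<close>

lemma fejer_weight_shift:
  assumes "T > 0"
  shows "fejer_weight T n N (t - T) i = fejer_weight T n N t i"
proof -
  have "2 * pi / T * (real i / real n - (t - T)) = 2 * pi / T * (real i / real n - t) + 2 * pi"
    using assms by (simp add: field_simps)
  then show ?thesis unfolding fejer_weight_def by (simp only: fejer_periodic)
qed

text \<open>The constant is the angular mesh 2 pi / (n T) times the variation bound 8 pi N.\<close>

lemma fejer_weight_sum: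
  assumes T: "T > 0" and n: "n > 0" and N: "N > 0" and pq: "p \<le> q"
    and u: "\<bar>real p / real n - t\<bar> \<le> T" "\<bar>real q / real n - t\<bar> \<le> T"
  shows "\<bar>2 * pi * (\<Sum>i=p..<q. fejer_weight T n N t i)
     - (fejer_primitive N (2 * pi / T * (real q / real n - t)) - fejer_primitive N (2 * pi / T * (real p / real n - t)))\<bar>
     \<le> (16 * pi\<^sup>2 / T) * (real N / real n)"
proof -
  define x0 \<delta> where "x0 = - (2 * pi / T * t)" and "\<delta> = 2 * pi / (real n * T)"
  have \<delta>: "\<delta> \<ge> 0" using T by (simp add: \<delta>_def)
  have y: "2 * pi / T * (real i / real n - t) = x0 + \<delta> * real i" for i
    using T n by (simp add: x0_def \<delta>_def field_simps)
  have "2 * pi * (\<Sum>i=p..<q. fejer_weight T n N t i) = (\<Sum>i=p..<q. \<delta> * fejer N (x0 + \<delta> * real i))"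
    unfolding fejer_weight_def y sum_distrib_left by (simp add: \<delta>_def)
  then have *: "\<bar>2 * pi * (\<Sum>i=p..<q. fejer_weight T n N t i)
     - (fejer_primitive N (x0 + \<delta> * real q) - fejer_primitive N (x0 + \<delta> * real p))\<bar>
     \<le> \<delta> * (fejer_variation N (x0 + \<delta> * real q) - fejer_variation N (x0 + \<delta> * real p))"
    using fejer_riemann_sum[OF pq \<delta>, of N x0] by simp
  have mono: "fejer_variation N x \<le> fejer_variation N y" if "x \<le> y" for x y
    using fejer_increment_le_variation[OF that, of N] by linarith
  have bnd: "\<bar>2 * pi / T * z\<bar> \<le> 2 * pi" if "\<bar>z\<bar> \<le> T" for z
    using T that by (simp add: abs_mult divide_le_eq)
  have "fejer_variation N (x0 + \<delta> * real q) - fejer_variation N (x0 + \<delta> * real p)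
     \<le> fejer_variation N (2 * pi) - fejer_variation N (- (2 * pi))"
    using bnd[OF u(1)] bnd[OF u(2)] unfolding y by (intro diff_mono mono) linarith+
  also have "\<dots> \<le> 8 * pi * real N" by (rule fejer_variation_bound[OF N])
  finally have "\<delta> * (fejer_variation N (x0 + \<delta> * real q) - fejer_variation N (x0 + \<delta> * real p))
     \<le> \<delta> * (8 * pi * real N)" using \<delta> by (rule mult_left_mono)
  also have "\<dots> = (16 * pi\<^sup>2 / T) * (real N / real n)"
    by (simp add: \<delta>_def power2_eq_square mult.commute)
  finally show ?thesis using * unfolding y by linarith
qed

section \<open>Asymptotics of the sampled weights\<close>

locale fejer_asymptotics =
  fixes T :: real and n N :: "nat \<Rightarrow> nat"
  assumes T_pos: "T > 0"
    and n_lim: "filterlim n at_top sequentially"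
    and N_lim: "filterlim N at_top sequentially"
    and ratio: "(\<lambda>j. real (N j) / real (n j)) \<longlonglongrightarrow> 0"
begin

text \<open>The index i < \<open>K j\<close> stands for the cell from i/n to (i+1)/n, which is the
  increment with number i + 1 in the estimator.\<close>

abbreviation "w t j \<equiv> fejer_weight T (n j) (N j) t"
abbreviation "K j \<equiv> nat \<lfloor>real (n j) * T\<rfloor>"

lemma n_pos: "\<forall>\<^sub>F j in sequentially. n j > 0"
  using n_lim unfolding filterlim_at_top by (auto dest!: spec[of _ 1] elim: eventually_mono)

lemma N_pos: "\<forall>\<^sub>F j in sequentially. N j > 0"
  using N_lim unfolding filterlim_at_top by (auto dest!: spec[of _ 1] elim: eventually_mono)

lemma inverse_n: "(\<lambda>j. 1 / real (n j)) \<longlonglongrightarrow> 0"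
  by (intro real_tendsto_divide_at_top[OF tendsto_const]
      filterlim_compose[OF filterlim_real_sequentially n_lim])

lemma inverse_N: "(\<lambda>j. C / real (N j)) \<longlonglongrightarrow> 0"
  by (intro real_tendsto_divide_at_top[OF tendsto_const]
      filterlim_compose[OF filterlim_real_sequentially N_lim])

text \<open>The hypothesis is chosen so that it covers rounding down as well as rounding up.\<close>

lemma div_n_limit:
  assumes "\<forall>\<^sub>F j in sequentially. \<bar>real (p j) - real (n j) * u\<bar> \<le> 1"
  shows "(\<lambda>j. real (p j) / real (n j)) \<longlonglongrightarrow> u"
proof (rule Lim_null[THEN iffD2], rule Lim_null_comparison[OF _ inverse_n])
  show "\<forall>\<^sub>F j in sequentially. norm (real (p j) / real (n j) - u) \<le> 1 / real (n j)"
    using assms n_pos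
  proof eventually_elim
    case (elim j)
    have "real (p j) / real (n j) - u = (real (p j) - real (n j) * u) / real (n j)"
      using elim by (simp add: field_simps)
    then show ?case using elim by (simp add: divide_right_mono)
  qed
qed

text \<open>The angle is O(1/n) while the kernel is at most \<open>N\<close>, so the primitive is
  O(N/n).\<close>

lemma primitive_at_0:
  assumes "\<forall>\<^sub>F j in sequentially. \<bar>real (p j) - real (n j) * u\<bar> \<le> 1"
  shows "(\<lambda>j. fejer_primitive (N j) (2 * pi / T * (real (p j) / real (n j) - u))) \<longlonglongrightarrow> 0"
proof (rule Lim_null_comparison)
  show "(\<lambda>j. 2 * pi / T * (real (N j) / real (n j))) \<longlonglongrightarrow> 0"
    using tendsto_mult_left[OF ratio, of "2 * pi / T"] by simp
  show "\<forall>\<^sub>F j in sequentially. norm (fejer_primitive (N j) (2 * pi / T * (real (p j) / real (n j) - u)))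
     \<le> 2 * pi / T * (real (N j) / real (n j))"
    using assms n_pos
  proof eventually_elim
    case (elim j)
    have "real (p j) / real (n j) - u = (real (p j) - real (n j) * u) / real (n j)"
      using elim by (simp add: field_simps)
    then have "\<bar>2 * pi / T * (real (p j) / real (n j) - u)\<bar> \<le> 2 * pi / T * (1 / real (n j))"
      using elim T_pos by (simp only: abs_mult abs_divide) (simp add: divide_right_mono mult_left_mono)
    then have "real (N j) * \<bar>2 * pi / T * (real (p j) / real (n j) - u)\<bar> \<le> real (N j) * (2 * pi / T * (1 / real (n j)))"
      by (intro mult_left_mono) auto
    with fejer_primitive_abs_le[of "N j" "2 * pi / T * (real (p j) / real (n j) - u)"]
    show ?case by (simp add: mult_ac)
  qed
qed

lemma primitive_at_pi:
  assumes y: "y \<longlonglongrightarrow> y0" and "0 < y0" "y0 < 2 * pi"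
  shows "(\<lambda>j. fejer_primitive (N j) (y j)) \<longlonglongrightarrow> pi"
proof -
  \<comment> \<open>A compact subinterval of the open period that contains \<open>pi\<close> and has
    \<open>y0\<close> in its interior, so that \<open>y j\<close> eventually lies in it.\<close>
  define a b where "a = min (y0 / 2) pi" and "b = max ((y0 + 2 * pi) / 2) pi"
  have ab: "0 < a" "a \<le> pi" "pi \<le> b" "b < 2 * pi" "a < y0" "y0 < b"
    using assms by (auto simp: a_def b_def)
  obtain C where C: "C \<ge> 0" "\<And>N y. N > 0 \<Longrightarrow> y \<in> {a..b} \<Longrightarrow> \<bar>fejer_primitive N y - pi\<bar> \<le> C / real N"
    using fejer_primitive_near_pi[of a b] ab by auto
  have "\<forall>\<^sub>F j in sequentially. a < y j" "\<forall>\<^sub>F j in sequentially. y j < b"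
    using order_tendstoD[OF y] ab by auto
  then have "\<forall>\<^sub>F j in sequentially. norm (fejer_primitive (N j) (y j) - pi) \<le> C / real (N j)"
    using N_pos by eventually_elim (simp add: C)
  then show ?thesis
    by (rule Lim_null[THEN iffD2, OF Lim_null_comparison]) (rule inverse_N)
qed

text \<open>By \<open>fejer_weight_sum\<close>, 2 pi times the sum differs from the increment of the
  primitive by O(N/n); the limit is pi / (2 pi).\<close>

lemma weight_sum_limit:
  assumes pq: "\<forall>\<^sub>F j in sequentially. p j \<le> q j"
    and u: "\<forall>\<^sub>F j in sequentially. \<bar>real (p j) / real (n j) - t\<bar> \<le> T \<and> \<bar>real (q j) / real (n j) - t\<bar> \<le> T"
    and F: "(\<lambda>j. fejer_primitive (N j) (2 * pi / T * (real (q j) / real (n j) - t))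
       - fejer_primitive (N j) (2 * pi / T * (real (p j) / real (n j) - t))) \<longlonglongrightarrow> pi"
  shows "(\<lambda>j. \<Sum>i=p j..<q j. w t j i) \<longlonglongrightarrow> 1 / 2"
proof -
  let ?F = "\<lambda>j. fejer_primitive (N j) (2 * pi / T * (real (q j) / real (n j) - t))
       - fejer_primitive (N j) (2 * pi / T * (real (p j) / real (n j) - t))"
  have "(\<lambda>j. (2 * pi * (\<Sum>i=p j..<q j. w t j i)) - ?F j) \<longlonglongrightarrow> 0"
  proof (rule Lim_null_comparison)
    show "(\<lambda>j. 16 * pi\<^sup>2 / T * (real (N j) / real (n j))) \<longlonglongrightarrow> 0"
      using tendsto_mult_left[OF ratio, of "16 * pi\<^sup>2 / T"] by simp
    show "\<forall>\<^sub>F j in sequentially. norm (2 * pi * (\<Sum>i=p j..<q j. w t j i) - ?F j)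
       \<le> 16 * pi\<^sup>2 / T * (real (N j) / real (n j))"
      using n_pos N_pos pq u
      by eventually_elim (simp only: real_norm_def, rule fejer_weight_sum[OF T_pos]; simp)
  qed
  from tendsto_add[OF this F] have "(\<lambda>j. 2 * pi * (\<Sum>i=p j..<q j. w t j i)) \<longlonglongrightarrow> pi" by simp
  from tendsto_divide[OF this tendsto_const, of "2 * pi"] show ?thesis by simp
qed

lemma angle_limit: 
  assumes "(\<lambda>j. real (q j) / real (n j)) \<longlonglongrightarrow> u"
  shows "(\<lambda>j. 2 * pi / T * (real (q j) / real (n j) - t)) \<longlonglongrightarrow> 2 * pi / T * (u - t)"
  by (intro tendsto_intros assms)

text \<open>The primitive tends to 0 at the lower end, which is within one cell of \<open>t\<close>,
  and to \<open>pi\<close> at the upper end, whose angle tends to 2 pi d / T, strictly inside the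
  period because d < T.\<close>

lemma weight_sum_right:
  assumes p: "\<forall>\<^sub>F j in sequentially. \<bar>real (p j) - real (n j) * t\<bar> \<le> 1"
    and q: "(\<lambda>j. real (q j) / real (n j)) \<longlonglongrightarrow> t + d" and d: "0 < d" "d < T"
  shows "(\<lambda>j. \<Sum>i=p j..<q j. w t j i) \<longlonglongrightarrow> 1 / 2"
proof (rule weight_sum_limit)
  have pl: "(\<lambda>j. real (p j) / real (n j)) \<longlonglongrightarrow> t" by (rule div_n_limit[OF p])
  have e1: "\<forall>\<^sub>F j in sequentially. real (p j) / real (n j) < t + d/2"
       "\<forall>\<^sub>F j in sequentially. t - T < real (p j) / real (n j)"
       "\<forall>\<^sub>F j in sequentially. t + d/2 < real (q j) / real (n j)"
       "\<forall>\<^sub>F j in sequentially. real (q j) / real (n j) < t + T"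
    using order_tendstoD[OF pl] order_tendstoD[OF q] d T_pos by auto
  show "\<forall>\<^sub>F j in sequentially. p j \<le> q j" using e1(1,3) n_pos
  proof eventually_elim
    case (elim j)
    then have "real (p j) / real (n j) < real (q j) / real (n j)" by linarith
    then show ?case using elim by (simp add: divide_less_cancel)
  qed
  show "\<forall>\<^sub>F j in sequentially. \<bar>real (p j) / real (n j) - t\<bar> \<le> T \<and> \<bar>real (q j) / real (n j) - t\<bar> \<le> T"
    using e1 by eventually_elim (use d in auto)
  have "(\<lambda>j. fejer_primitive (N j) (2 * pi / T * (real (q j) / real (n j) - t))) \<longlonglongrightarrow> pi"
    using d T_pos by (intro primitive_at_pi[OF angle_limit[OF q]]) (auto simp: field_simps)
  from tendsto_diff[OF this primitive_at_0[OF p]]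
  show "(\<lambda>j. fejer_primitive (N j) (2 * pi / T * (real (q j) / real (n j) - t))
       - fejer_primitive (N j) (2 * pi / T * (real (p j) / real (n j) - t))) \<longlonglongrightarrow> pi" by simp
qed

text \<open>The mirror image of the previous lemma, by oddness of the primitive.\<close>

lemma weight_sum_left:
  assumes q: "\<forall>\<^sub>F j in sequentially. \<bar>real (q j) - real (n j) * t\<bar> \<le> 1"
    and p: "(\<lambda>j. real (p j) / real (n j)) \<longlonglongrightarrow> t - d" and d: "0 < d" "d < T"
  shows "(\<lambda>j. \<Sum>i=p j..<q j. w t j i) \<longlonglongrightarrow> 1 / 2"
proof (rule weight_sum_limit)
  have ql: "(\<lambda>j. real (q j) / real (n j)) \<longlonglongrightarrow> t" by (rule div_n_limit[OF q])
  have e1: "\<forall>\<^sub>F j in sequentially. t - d/2 < real (q j) / real (n j)"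
       "\<forall>\<^sub>F j in sequentially. real (q j) / real (n j) < t + T"
       "\<forall>\<^sub>F j in sequentially. real (p j) / real (n j) < t - d/2"
       "\<forall>\<^sub>F j in sequentially. t - T < real (p j) / real (n j)"
    using order_tendstoD[OF ql] order_tendstoD[OF p] d T_pos by auto
  show "\<forall>\<^sub>F j in sequentially. p j \<le> q j" using e1(1,3) n_pos
  proof eventually_elim
    case (elim j)
    then have "real (p j) / real (n j) < real (q j) / real (n j)" by linarith
    then show ?case using elim by (simp add: divide_less_cancel)
  qed
  show "\<forall>\<^sub>F j in sequentially. \<bar>real (p j) / real (n j) - t\<bar> \<le> T \<and> \<bar>real (q j) / real (n j) - t\<bar> \<le> T"
    using e1 by eventually_elim (use d in auto)
  have "(\<lambda>j. fejer_primitive (N j) (- (2 * pi / T * (real (p j) / real (n j) - t)))) \<longlonglongrightarrow> pi"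
    using d T_pos
    by (intro primitive_at_pi[OF tendsto_minus[OF angle_limit[OF p]]]) (auto simp: field_simps)
  from tendsto_add[OF this primitive_at_0[OF q]]
  show "(\<lambda>j. fejer_primitive (N j) (2 * pi / T * (real (q j) / real (n j) - t))
       - fejer_primitive (N j) (2 * pi / T * (real (p j) / real (n j) - t))) \<longlonglongrightarrow> pi"
    by (simp add: fejer_primitive_minus)
qed

lemma nat_ceiling_near: "0 \<le> x \<Longrightarrow> \<bar>real (nat \<lceil>x\<rceil>) - x\<bar> \<le> 1"
  by (simp add: of_nat_nat) linarith

lemma nat_floor_near: "0 \<le> x \<Longrightarrow> \<bar>real (nat \<lfloor>x\<rfloor>) - x\<bar> \<le> 1"
  by (simp add: of_nat_nat) linarith

lemma K_limit: "(\<lambda>j. real (K j) / real (n j)) \<longlonglongrightarrow> T"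
  using T_pos by (intro div_n_limit always_eventually allI nat_floor_near) simp

end

text \<open>The point \<open>t\<close> of the circle is described by its representatives \<open>t0\<close> and \<open>t1\<close>, which are
  approached from the left and from the right within \<open>{0..T}\<close>; they differ only at the endpoints.\<close>

locale fejer_point = fejer_asymptotics +
  fixes t0 t1 t :: real
  assumes t_eq: "t \<in> {t0, t1}" and t01: "(t0 = t1 \<and> 0 < t0 \<and> t0 < T) \<or> (t0 = T \<and> t1 = 0)"
begin

lemma w_t0: "w t0 j i = w t j i" and w_t1: "w t1 j i = w t j i"
  using t_eq t01 fejer_weight_shift[OF T_pos, of _ _ T] by (auto simp: fun_eq_iff)

text \<open>In the interior the sum is cut at \<open>t\<close>, leaving out at most one straddling
  cell. For the endpoints the window closes up around the circle, and the cut is made at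
  \<open>T / 2\<close>, far from the peak.\<close>

lemma weight_total: "(\<lambda>j. \<Sum>i<K j. w t j i) \<longlonglongrightarrow> 1"
  using t01
proof
  assume t: "t0 = t1 \<and> 0 < t0 \<and> t0 < T"
  define p q where "p j = nat \<lceil>real (n j) * t1\<rceil>" and "q j = nat \<lfloor>real (n j) * t0\<rfloor>" for j
  have R: "(\<lambda>j. \<Sum>i=p j..<K j. w t1 j i) \<longlonglongrightarrow> 1 / 2"
  proof (rule weight_sum_right[where d = "T - t1"])
    show "\<forall>\<^sub>F j in sequentially. \<bar>real (p j) - real (n j) * t1\<bar> \<le> 1"
      using t unfolding p_def by (intro always_eventually allI nat_ceiling_near) simp
  qed (use t K_limit in auto)
  have L: "(\<lambda>j. \<Sum>i=0..<q j. w t0 j i) \<longlonglongrightarrow> 1 / 2"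
  proof (rule weight_sum_left[where d = t0])
    show "\<forall>\<^sub>F j in sequentially. \<bar>real (q j) - real (n j) * t0\<bar> \<le> 1"
      using t unfolding q_def by (intro always_eventually allI nat_floor_near) simp
  qed (use t in auto)
  have qp: "q j \<le> p j" "p j \<le> Suc (q j)" for j
    using t unfolding p_def q_def by (auto intro!: nat_mono) linarith+
  have pK: "q j \<le> K j" for j
    using t unfolding q_def by (intro nat_mono floor_mono mult_left_mono) auto
  \<comment> \<open>At most the cell with index \<open>q j\<close> lies between the roundings of
    \<open>t\<close>, and a single weight is at most N/(n T).\<close>
  have M: "(\<lambda>j. (\<Sum>i\<in>{q j..<p j} \<inter> {..<K j}. w t j i)) \<longlonglongrightarrow> 0"
  proof (rule Lim_null_comparison[OF always_eventually], rule allI)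
    show "(\<lambda>j. 1 / T * (real (N j) / real (n j))) \<longlonglongrightarrow> 0"
      using tendsto_mult_left[OF ratio, of "1 / T"] by simp
    fix j
    have "(\<Sum>i\<in>{q j..<p j} \<inter> {..<K j}. w t j i) \<le> (\<Sum>i\<in>{q j}. w t j i)"
      using qp[of j] T_pos by (intro sum_mono2) (auto simp: fejer_weight_nonneg)
    also have "\<dots> \<le> 1 / T * (real (N j) / real (n j))"
      using fejer_weight_le[OF T_pos, of "n j" "N j" t "q j"] by (simp add: mult.commute)
    finally show "norm (\<Sum>i\<in>{q j..<p j} \<inter> {..<K j}. w t j i) \<le> 1 / T * (real (N j) / real (n j))"
      using T_pos by (simp add: sum_nonneg fejer_weight_nonneg)
  qed
  have "(\<Sum>i<K j. w t j i) = (\<Sum>i=0..<q j. w t0 j i) + (\<Sum>i\<in>{q j..<p j} \<inter> {..<K j}. w t j i) + (\<Sum>i=p j..<K j. w t1 j i)" for j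
  proof -
    have "{..<K j} = {0..<q j} \<union> (({q j..<p j} \<inter> {..<K j}) \<union> {p j..<K j})"
      using qp[of j] pK[of j] by auto
    then have "(\<Sum>i<K j. w t j i) = (\<Sum>i\<in>{0..<q j} \<union> (({q j..<p j} \<inter> {..<K j}) \<union> {p j..<K j}). w t j i)"
      by simp
    also have "\<dots> = (\<Sum>i=0..<q j. w t j i) + (\<Sum>i\<in>{q j..<p j} \<inter> {..<K j}. w t j i) + (\<Sum>i=p j..<K j. w t j i)"
      using qp[of j] by (subst sum.union_disjoint, simp, simp, force)+ simp
    finally show ?thesis by (simp only: w_t0 w_t1)
  qed
  with tendsto_add[OF tendsto_add[OF L M] R] show ?thesis by simp
next
  assume t: "t0 = T \<and> t1 = 0"
  define r where "r j = nat \<lfloor>real (n j) * (T / 2)\<rfloor>" for j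
  have r: "(\<lambda>j. real (r j) / real (n j)) \<longlonglongrightarrow> T / 2"
    unfolding r_def using T_pos by (intro div_n_limit always_eventually allI nat_floor_near) simp
  have R: "(\<lambda>j. \<Sum>i=0..<r j. w t1 j i) \<longlonglongrightarrow> 1 / 2"
    using t r T_pos by (intro weight_sum_right[where d = "T / 2"] always_eventually allI) auto
  have L: "(\<lambda>j. \<Sum>i=r j..<K j. w t0 j i) \<longlonglongrightarrow> 1 / 2"
  proof (rule weight_sum_left[where d = "T / 2"])
    show "\<forall>\<^sub>F j in sequentially. \<bar>real (K j) - real (n j) * t0\<bar> \<le> 1"
      using t T_pos by (simp only:) (intro always_eventually allI nat_floor_near, simp)
  qed (use t r T_pos in auto)
  have "r j \<le> K j" for j
    unfolding r_def using T_pos by (intro nat_mono floor_mono mult_left_mono) auto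
  then have "(\<Sum>i<K j. w t j i) = (\<Sum>i=0..<r j. w t1 j i) + (\<Sum>i=r j..<K j. w t0 j i)" for j
    by (simp add: w_t0 w_t1 atLeast0LessThan[symmetric] sum.atLeastLessThan_concat)
  with tendsto_add[OF R L] show ?thesis by simp
qed

lemma weight_total_le: "\<forall>\<^sub>F j in sequentially. (\<Sum>i<K j. w t j i) \<le> 2"
  using order_tendstoD(2)[OF weight_total, of 2] by (auto elim: eventually_mono)

text \<open>The cells just to the right and just to the left of the point carry weight 1/2 each in
  the limit, so what remains has weight tending to 1 - 1/2 - 1/2 = 0 and is controlled by the bound
  \<open>B\<close>. Closeness on the left is only asked of cells that end by \<open>t0\<close>, so
  that a cell containing a jump at \<open>t\<close> falls into the remainder.\<close>

lemma weighted_sum_limit: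
  fixes e :: "nat \<Rightarrow> nat \<Rightarrow> real"
  assumes B: "\<And>j i. i < K j \<Longrightarrow> \<bar>e j i\<bar> \<le> B"
    and right: "\<And>\<epsilon>. \<epsilon> > 0 \<Longrightarrow> \<exists>d>0. \<forall>\<^sub>F j in sequentially. \<forall>i<K j.
       t1 \<le> real i / real (n j) \<longrightarrow> real i / real (n j) < t1 + d \<longrightarrow> \<bar>e j i - b\<bar> \<le> \<epsilon>"
    and left: "\<And>\<epsilon>. \<epsilon> > 0 \<Longrightarrow> \<exists>d>0. \<forall>\<^sub>F j in sequentially. \<forall>i<K j.
       t0 - d \<le> real i / real (n j) \<longrightarrow> (real i + 1) / real (n j) \<le> t0 \<longrightarrow> \<bar>e j i - a\<bar> \<le> \<epsilon>"
  shows "(\<lambda>j. \<Sum>i<K j. w t j i * e j i) \<longlonglongrightarrow> (a + b) / 2"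
proof (rule tendstoI)
  fix \<epsilon> :: real assume "\<epsilon> > 0"
  define \<eta> where "\<eta> = \<epsilon> / 2"
  have \<eta>: "\<eta> > 0" using \<open>\<epsilon> > 0\<close> by (simp add: \<eta>_def)
  obtain d1 d2 where d1: "d1 > 0" "\<forall>\<^sub>F j in sequentially. \<forall>i<K j.
       t1 \<le> real i / real (n j) \<longrightarrow> real i / real (n j) < t1 + d1 \<longrightarrow> \<bar>e j i - b\<bar> \<le> \<eta>"
     and d2: "d2 > 0" "\<forall>\<^sub>F j in sequentially. \<forall>i<K j.
       t0 - d2 \<le> real i / real (n j) \<longrightarrow> (real i + 1) / real (n j) \<le> t0 \<longrightarrow> \<bar>e j i - a\<bar> \<le> \<eta>"
    using right[OF \<eta>] left[OF \<eta>] by blast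
  \<comment> \<open>The bounds \<open>T - t1\<close> and \<open>t0\<close> keep both windows inside
    \<open>{0..T}\<close>. The bound \<open>T / 2\<close> makes them disjoint when the point is an
    endpoint, and gives d < T.\<close>
  define d where "d = Min {d1, d2, T - t1, t0, T / 2}"
  have d: "0 < d" "d \<le> d1" "d \<le> d2" "d \<le> T - t1" "d \<le> t0" "d \<le> T / 2"
  proof -
    show "0 < d" using d1 d2 t01 T_pos by (auto simp: d_def)
    show "d \<le> d1" "d \<le> d2" "d \<le> T - t1" "d \<le> t0" "d \<le> T / 2"
      unfolding d_def by (rule Min_le; simp)+
  qed
  then have "d < T" using T_pos by linarith
  note d = d this
  have t: "0 \<le> t1" "t1 < T" "0 < t0" "t0 \<le> T" using t01 T_pos by auto
  define p q where "p j = nat \<lceil>real (n j) * t1\<rceil>" and "q j = min (nat \<lceil>real (n j) * (t1 + d)\<rceil>) (K j)" for j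
  define p' q' where "p' j = nat \<lceil>real (n j) * (t0 - d)\<rceil>" and "q' j = nat \<lfloor>real (n j) * t0\<rfloor>" for j
  have R: "(\<lambda>j. \<Sum>i=p j..<q j. w t j i) \<longlonglongrightarrow> 1 / 2"
    unfolding w_t1[symmetric]
  proof (rule weight_sum_right[OF _ _ d(1,7)])
    show "\<forall>\<^sub>F j in sequentially. \<bar>real (p j) - real (n j) * t1\<bar> \<le> 1"
      using t unfolding p_def by (intro always_eventually allI nat_ceiling_near) simp
    have "(\<lambda>j. min (real (nat \<lceil>real (n j) * (t1 + d)\<rceil>) / real (n j)) (real (K j) / real (n j))) \<longlonglongrightarrow> min (t1 + d) T"
      using t d by (intro tendsto_min K_limit div_n_limit always_eventually allI nat_ceiling_near) auto
    moreover have "min (real (nat \<lceil>real (n j) * (t1 + d)\<rceil>) / real (n j)) (real (K j) / real (n j)) = real (q j) / real (n j)" for j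
      unfolding q_def of_nat_min by (intro min_of_mono[where f = "\<lambda>x. x / real (n j)"]) (auto intro!: monoI divide_right_mono)
    ultimately show "(\<lambda>j. real (q j) / real (n j)) \<longlonglongrightarrow> t1 + d" using d by (simp add: min_absorb1)
  qed
  have L: "(\<lambda>j. \<Sum>i=p' j..<q' j. w t j i) \<longlonglongrightarrow> 1 / 2"
    unfolding w_t0[symmetric]
  proof (rule weight_sum_left[OF _ _ d(1,7)])
    show "\<forall>\<^sub>F j in sequentially. \<bar>real (q' j) - real (n j) * t0\<bar> \<le> 1"
      using t unfolding q'_def by (intro always_eventually allI nat_floor_near) simp
    show "(\<lambda>j. real (p' j) / real (n j)) \<longlonglongrightarrow> t0 - d"
      unfolding p'_def using d by (intro div_n_limit always_eventually allI nat_ceiling_near) auto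
  qed
  define SR SL ST where "SR j = (\<Sum>i=p j..<q j. w t j i)" and "SL j = (\<Sum>i=p' j..<q' j. w t j i)"
    and "ST j = (\<Sum>i<K j. w t j i)" for j
  \<comment> \<open>This expression dominates the total error: deviation of \<open>e\<close> inside
    the windows, deviation of the window weights from 1/2, and the remainder.\<close>
  have "(\<lambda>j. \<eta> * (SR j + SL j) + \<bar>b\<bar> * \<bar>SR j - 1/2\<bar> + \<bar>a\<bar> * \<bar>SL j - 1/2\<bar> + B * (ST j - SR j - SL j))
      \<longlonglongrightarrow> \<eta> * (1/2 + 1/2) + \<bar>b\<bar> * \<bar>1/2 - 1/2\<bar> + \<bar>a\<bar> * \<bar>1/2 - 1/2\<bar> + B * (1 - 1/2 - 1/2)"
    unfolding SR_def SL_def ST_def by (intro tendsto_intros R L weight_total)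
  then have lim: "(\<lambda>j. \<eta> * (SR j + SL j) + \<bar>b\<bar> * \<bar>SR j - 1/2\<bar> + \<bar>a\<bar> * \<bar>SL j - 1/2\<bar> + B * (ST j - SR j - SL j)) \<longlonglongrightarrow> \<eta>"
    by simp
  have ev: "\<forall>\<^sub>F j in sequentially. \<eta> * (SR j + SL j) + \<bar>b\<bar> * \<bar>SR j - 1/2\<bar> + \<bar>a\<bar> * \<bar>SL j - 1/2\<bar> + B * (ST j - SR j - SL j) < \<epsilon>"
    using order_tendstoD(2)[OF lim, of \<epsilon>] \<open>\<epsilon> > 0\<close> by (simp add: \<eta>_def)
  show "\<forall>\<^sub>F j in sequentially. dist (\<Sum>i<K j. w t j i * e j i) ((a + b) / 2) < \<epsilon>"
    using ev d1(2) d2(2) n_pos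
  proof eventually_elim
    case (elim j)
    define RR LL where "RR = {p j..<q j}" and "LL = {p' j..<q' j}"
    define QQ where "QQ = {..<K j} - RR - LL"
    have nj: "real (n j) > 0" using elim by simp
    have RRi: "i < K j" "t1 \<le> real i / real (n j)" "real i / real (n j) < t1 + d" if "i \<in> RR" for i
    proof -
      have i: "nat \<lceil>real (n j) * t1\<rceil> \<le> i" "i < nat \<lceil>real (n j) * (t1 + d)\<rceil>" "i < K j"
        using that by (auto simp: RR_def p_def q_def)
      show "i < K j" by fact
      have "real (n j) * t1 \<le> real i" using i(1) by (simp add: nat_le_iff ceiling_le_iff)
      then show "t1 \<le> real i / real (n j)" using nj by (simp add: field_simps)
      have "real i < real (n j) * (t1 + d)" using i(2) by (simp add: zless_nat_eq_int_zless less_ceiling_iff)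
      then show "real i / real (n j) < t1 + d" using nj by (simp add: field_simps)
    qed
    have LLi: "i < K j" "t0 - d \<le> real i / real (n j)" "(real i + 1) / real (n j) \<le> t0" if "i \<in> LL" for i
    proof -
      have i: "nat \<lceil>real (n j) * (t0 - d)\<rceil> \<le> i" "i < nat \<lfloor>real (n j) * t0\<rfloor>"
        using that by (auto simp: LL_def p'_def q'_def)
      have "nat \<lfloor>real (n j) * t0\<rfloor> \<le> K j" using t by (intro nat_mono floor_mono mult_left_mono) auto
      then show "i < K j" using i by simp
      have "real (n j) * (t0 - d) \<le> real i" using i(1) by (simp add: nat_le_iff ceiling_le_iff)
      then show "t0 - d \<le> real i / real (n j)" using nj by (simp add: field_simps)
      have "int i + 1 \<le> \<lfloor>real (n j) * t0\<rfloor>" using i(2) by linarith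
      then have "real i + 1 \<le> real (n j) * t0" by (simp add: le_floor_iff)
      then show "(real i + 1) / real (n j) \<le> t0" using nj by (simp add: field_simps)
    qed
    \<comment> \<open>In the interior a common cell would start at or after \<open>t1\<close> and
      end at or before \<open>t0 = t1\<close>; at the endpoints the windows lie in different halves
      of \<open>{0..T}\<close>.\<close>
    have disj: "RR \<inter> LL = {}"
    proof -
      have False if "i \<in> RR" "i \<in> LL" for i
      proof -
        have "real i / real (n j) < (real i + 1) / real (n j)" using nj by (simp add: divide_strict_right_mono)
        then show False using RRi[OF that(1)] LLi[OF that(2)] t01 d by auto
      qed
      then show ?thesis by blast
    qed
    have un: "{..<K j} = RR \<union> LL \<union> QQ" using RRi LLi by (auto simp: QQ_def)
    have fin: "finite RR" "finite LL" "finite QQ" by (auto simp: RR_def LL_def QQ_def)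
    have split: "(\<Sum>i<K j. f i) = sum f RR + sum f LL + sum f QQ" for f :: "nat \<Rightarrow> real"
    proof -
      have "sum f (RR \<union> LL \<union> QQ) = sum f (RR \<union> LL) + sum f QQ"
        by (rule sum.union_disjoint) (use fin in \<open>auto simp: QQ_def\<close>)
      also have "sum f (RR \<union> LL) = sum f RR + sum f LL"
        by (rule sum.union_disjoint) (use fin disj in auto)
      finally show ?thesis using un by simp
    qed
    have part: "\<bar>(\<Sum>i\<in>A. w t j i * e j i) - c / 2\<bar> \<le> \<eta> * sum (w t j) A + \<bar>c\<bar> * \<bar>sum (w t j) A - 1/2\<bar>"
      if "\<And>i. i \<in> A \<Longrightarrow> \<bar>e j i - c\<bar> \<le> \<eta>" for A c
    proof -
      have "(\<Sum>i\<in>A. w t j i * e j i) - c / 2 = (\<Sum>i\<in>A. w t j i * (e j i - c)) + c * (sum (w t j) A - 1/2)"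
        by (simp add: sum_subtractf sum_distrib_left algebra_simps)
      moreover have "\<bar>\<Sum>i\<in>A. w t j i * (e j i - c)\<bar> \<le> (\<Sum>i\<in>A. w t j i * \<eta>)"
        using T_pos that by (intro order_trans[OF sum_abs] sum_mono)
          (auto simp: abs_mult fejer_weight_nonneg intro!: mult_left_mono)
      ultimately show ?thesis
        using abs_triangle_ineq[of "\<Sum>i\<in>A. w t j i * (e j i - c)" "c * (sum (w t j) A - 1/2)"]
        by (simp add: abs_mult sum_distrib_left mult.commute)
    qed
    have 1: "\<bar>(\<Sum>i\<in>RR. w t j i * e j i) - b / 2\<bar> \<le> \<eta> * SR j + \<bar>b\<bar> * \<bar>SR j - 1/2\<bar>"
      using part[of RR b] RRi elim(2) d by (fastforce simp: SR_def RR_def[symmetric])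
    have 2: "\<bar>(\<Sum>i\<in>LL. w t j i * e j i) - a / 2\<bar> \<le> \<eta> * SL j + \<bar>a\<bar> * \<bar>SL j - 1/2\<bar>"
      using part[of LL a] LLi elim(3) d by (fastforce simp: SL_def LL_def[symmetric])
    have "\<bar>\<Sum>i\<in>QQ. w t j i * e j i\<bar> \<le> (\<Sum>i\<in>QQ. w t j i * B)"
      using T_pos B[of _ j] by (intro order_trans[OF sum_abs] sum_mono)
        (auto simp: QQ_def abs_mult fejer_weight_nonneg intro!: mult_left_mono)
    also have "\<dots> = B * (ST j - SR j - SL j)"
      using split[of "w t j"] by (simp add: ST_def SR_def SL_def RR_def LL_def sum_distrib_left mult.commute)
    finally have 3: "\<bar>\<Sum>i\<in>QQ. w t j i * e j i\<bar> \<le> B * (ST j - SR j - SL j)" .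
    have "\<bar>(x + y + z) - (a + b) / 2\<bar> \<le> \<bar>x - b / 2\<bar> + \<bar>y - a / 2\<bar> + \<bar>z\<bar>" for x y z :: real
      by (simp add: field_simps)
    from order_trans[OF this add_mono[OF add_mono[OF 1 2] 3]] elim(1) show ?case
      unfolding split dist_real_def by (auto simp: distrib_left intro: le_less_trans)
  qed
qed

end

section \<open>Square roots of positive semidefinite matrices\<close>

text \<open>Polarisation. It reduces equality and convergence of symmetric matrices to quadratic
  forms, for which the square root is easily compared.\<close>

lemma matrix_eq_of_quadratic_forms:
  fixes A :: "real^'n^'n"
  assumes "sym_mat A"
  shows "A $ i $ j = (((axis i 1 + axis j 1) \<bullet> (A *v (axis i 1 + axis j 1)))
     - axis i 1 \<bullet> (A *v axis i 1) - axis j 1 \<bullet> (A *v axis j 1)) / 2"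
proof -
  have *: "axis k 1 \<bullet> (A *v axis l 1) = A $ k $ l" for k l
    by (simp add: inner_axis' matrix_vector_mul_component inner_axis)
  have "A $ j $ i = A $ i $ j"
    using assms unfolding sym_mat_def transpose_def by (metis vec_lambda_beta)
  then show ?thesis
    by (simp add: matrix_vector_right_distrib inner_add_left inner_add_right *)
qed

lemma sym_mat_inner: "sym_mat A \<Longrightarrow> u \<bullet> (A *v v) = (A *v u) \<bullet> v"
  by (metis dot_lmul_matrix sym_mat_def vector_transpose_matrix)

text \<open>With w = A v, the form at t w + v is t^2 q + 2 t |w|^2 and must be nonnegative for every
  real t. For w \<noteq> 0 a suitable negative t violates this.\<close>

lemma psd_mat_kernel:
  assumes "psd_mat A" "v \<bullet> (A *v v) = 0"
  shows "A *v v = 0"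
proof (rule ccontr)
  assume *: "A *v v \<noteq> 0"
  define w where "w = A *v v"
  define q where "q = w \<bullet> (A *v w)"
  have w: "w \<bullet> w > 0" using * by (simp add: w_def)
  have q: "q \<ge> 0" using assms by (simp add: q_def psd_mat_def)
  have sym: "sym_mat A" using assms by (simp add: psd_mat_def)
  have "0 \<le> (t *\<^sub>R w + v) \<bullet> (A *v (t *\<^sub>R w + v))" for t
    using assms by (auto simp: psd_mat_def)
  moreover have "(t *\<^sub>R w + v) \<bullet> (A *v (t *\<^sub>R w + v)) = t\<^sup>2 * q + 2 * t * (w \<bullet> w)" for t
    using assms(2) sym_mat_inner[OF sym, of v w]
    by (simp add: matrix_vector_right_distrib matrix_vector_mult_scaleR inner_add_left inner_add_right
      q_def w_def[symmetric] power2_eq_square algebra_simps)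
  ultimately have t: "0 \<le> t\<^sup>2 * q + 2 * t * (w \<bullet> w)" for t by metis
  show False
  proof (cases "q = 0")
    case True then show False using t[of "-1"] w by simp
  next
    case False
    then have "q > 0" using q by simp
    moreover have "(- (w \<bullet> w) / q)\<^sup>2 * q + 2 * (- (w \<bullet> w) / q) * (w \<bullet> w) = - ((w \<bullet> w)\<^sup>2 / q)"
      using False by (simp add: power2_eq_square field_simps)
    ultimately show False using t[of "- (w \<bullet> w) / q"] w by (smt (verit) divide_pos_pos zero_less_power2)
  qed
qed

text \<open>The form attains a maximum \<open>l\<close> on the compact unit sphere, at
  \<open>v\<close> say. Then l 1 - A is positive semidefinite and its form vanishes at
  \<open>v\<close>, so it annihilates \<open>v\<close>.\<close>

lemma quadratic_form_max:
  fixes A :: "real^'n^'n"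
  assumes "sym_mat A"
  obtains v l where "norm v = 1" "A *v v = l *\<^sub>R v" "\<And>u. u \<bullet> (A *v u) \<le> l * (u \<bullet> u)"
proof -
  have "continuous_on (sphere 0 1) (\<lambda>v. v \<bullet> (A *v v))"
    by (intro continuous_on_inner continuous_on_id matrix_vector_mult_linear_continuous_on)
  moreover have "compact (sphere (0::real^'n) 1)" "sphere (0::real^'n) 1 \<noteq> {}" by auto
  ultimately obtain v where v: "v \<in> sphere 0 1" "\<And>u. u \<in> sphere 0 1 \<Longrightarrow> u \<bullet> (A *v u) \<le> v \<bullet> (A *v v)"
    using continuous_attains_sup[of "sphere 0 1" "\<lambda>v. v \<bullet> (A *v v)"] by blast
  define l where "l = v \<bullet> (A *v v)"
  have le: "u \<bullet> (A *v u) \<le> l * (u \<bullet> u)" for u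
  proof (cases "u = 0")
    case False
    have "(u /\<^sub>R norm u) \<bullet> (A *v (u /\<^sub>R norm u)) \<le> l"
      unfolding l_def using False by (intro v) simp
    moreover have "(u /\<^sub>R norm u) \<bullet> (A *v (u /\<^sub>R norm u)) = (u \<bullet> (A *v u)) / (u \<bullet> u)"
      by (simp add: matrix_vector_mult_scaleR dot_square_norm power2_eq_square divide_inverse)
    ultimately show ?thesis using False by (simp add: divide_le_eq)
  qed simp
  define C where "C = l *\<^sub>R mat 1 - A"
  have Cv: "C *v u = l *\<^sub>R u - A *v u" for u
    by (simp add: C_def matrix_vector_mult_diff_rdistrib scaleR_matrix_vector_assoc[symmetric])
  have "psd_mat C"
    unfolding psd_mat_def
  proof
    have "transpose (l *\<^sub>R mat 1 - A) = l *\<^sub>R mat 1 - transpose A"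
      by (simp add: transpose_def mat_def vec_eq_iff)
    then show "sym_mat C" using assms unfolding sym_mat_def C_def by simp
    show "\<forall>u. 0 \<le> u \<bullet> (C *v u)" using le by (simp add: Cv inner_diff_right)
  qed
  moreover have "v \<bullet> (C *v v) = 0"
    using v(1) by (simp add: Cv inner_diff_right l_def[symmetric] dot_square_norm)
  ultimately have "A *v v = l *\<^sub>R v" using psd_mat_kernel[of C v] by (simp add: Cv)
  then show ?thesis using that v(1) le by auto
qed

text \<open>If \<open>v\<close> is an eigenvector of \<open>S - S'\<close> for the largest eigenvalue \<open>l > 0\<close>, then
  \<open>v \<bullet> (S\<^sup>2 - S'\<^sup>2) v = l (v \<bullet> S v + v \<bullet> S' v) \<ge> l\<^sup>2\<close>. This yields uniqueness as well as continuity of the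
  square root.\<close>

lemma quadratic_form_root_diff:
  fixes S S' :: "real^'n^'n"
  assumes S: "psd_mat S" and S': "psd_mat S'" and d: "\<And>u. u \<bullet> ((S ** S - S' ** S') *v u) \<le> d * (u \<bullet> u)" "d \<ge> 0"
  shows "u \<bullet> ((S - S') *v u) \<le> sqrt d * (u \<bullet> u)"
proof -
  have "sym_mat (S - S')" using S S' by (auto simp: psd_mat_def sym_mat_def transpose_def vec_eq_iff)
  then obtain v l where v: "norm v = 1" "(S - S') *v v = l *\<^sub>R v" "\<And>u. u \<bullet> ((S - S') *v u) \<le> l * (u \<bullet> u)"
    using quadratic_form_max by blast
  have "l \<le> sqrt d"
  proof (cases "l \<le> 0")
    case False
    have vv: "v \<bullet> v = 1" using v by (simp add: dot_square_norm)
    have "(S ** S - S' ** S') *v v = S *v ((S - S') *v v) + (S - S') *v (S' *v v)"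
      by (simp add: matrix_vector_mult_diff_rdistrib matrix_vector_mul_assoc[symmetric]
        matrix_vector_mult_diff_distrib)
    also have "v \<bullet> \<dots> = l * (v \<bullet> (S *v v) + v \<bullet> (S' *v v))"
      using sym_mat_inner[OF \<open>sym_mat (S - S')\<close>, of v "S' *v v"]
      by (simp add: v inner_add_right matrix_vector_mult_scaleR distrib_left)
    finally have "l * (v \<bullet> (S *v v) + v \<bullet> (S' *v v)) \<le> d" using d(1)[of v] vv by simp
    moreover have "l \<le> v \<bullet> (S *v v) + v \<bullet> (S' *v v)"
    proof -
      have "l = v \<bullet> ((S - S') *v v)" by (simp add: v vv)
      also have "\<dots> = v \<bullet> (S *v v) - v \<bullet> (S' *v v)" by (simp add: matrix_vector_mult_diff_rdistrib inner_diff_right)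
      finally show ?thesis using S' by (smt (verit) psd_mat_def)
    qed
    ultimately have "l * l \<le> d" using False by (smt (verit) mult_left_mono)
    then show ?thesis by (simp add: real_le_rsqrt power2_eq_square)
  qed (use d in \<open>smt (verit) real_sqrt_ge_zero\<close>)
  then show ?thesis using v(3)[of u] by (smt (verit) inner_ge_zero mult_right_mono)
qed

lemma psd_root_unique:
  assumes "psd_mat S" "psd_mat S'" "S ** S = S' ** S'"
  shows "S = S'"
proof -
  have "u \<bullet> (S *v u) = u \<bullet> (S' *v u)" for u
    using quadratic_form_root_diff[of S S' 0 u] quadratic_form_root_diff[of S' S 0 u] assms
    by (simp add: matrix_vector_mult_diff_rdistrib inner_diff_right)
  then show ?thesis using assms(1,2)
    by (simp add: vec_eq_iff psd_mat_def matrix_eq_of_quadratic_forms)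
qed

lemma subspace_kernel_mat: "subspace {x. A *v x = (0::real^'m)}"
  by (auto simp: subspace_def matrix_vector_right_distrib matrix_vector_mult_scaleR)

text \<open>By induction on the rank: splitting off the projection onto an eigenvector of the largest
  eigenvalue leaves a positive semidefinite matrix of smaller rank.\<close>

lemma psd_root_exists:
  fixes A :: "real^'n^'n"
  assumes "psd_mat A"
  shows "\<exists>S. psd_mat S \<and> S ** S = A"
  using assms
proof (induction "CARD('n) - dim {x. A *v x = 0}" arbitrary: A rule: less_induct)
  case (less A)
  have sym: "sym_mat A" using less by (simp add: psd_mat_def)
  obtain v l where v: "norm v = 1" "A *v v = l *\<^sub>R v" "\<And>u. u \<bullet> (A *v u) \<le> l * (u \<bullet> u)"
    using quadratic_form_max[OF sym] by blast
  have vv: "v \<bullet> v = 1" using v by (simp add: dot_square_norm)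
  have l0: "l \<ge> 0" using less.prems v vv by (auto simp: psd_mat_def dest!: spec[of _ v])
  show ?case
  proof (cases "l = 0")
    case True
    then have "u \<bullet> (A *v u) = 0" for u
      using v(3)[of u] less.prems by (auto simp: psd_mat_def intro!: antisym)
    then have "A = 0" by (simp add: vec_eq_iff matrix_eq_of_quadratic_forms[OF sym])
    then show ?thesis by (intro exI[of _ 0]) (auto simp: psd_mat_def sym_mat_def transpose_def vec_eq_iff)
  next
    case False
    define P :: "real^'n^'n" where "P = (\<chi> i j. v $ i * v $ j)"
    have P: "P *v u = (v \<bullet> u) *\<^sub>R v" for u
      by (simp add: P_def matrix_vector_mult_def vec_eq_iff inner_vec_def sum_distrib_left sum_distrib_right mult_ac)
    have Psym: "transpose P = P" by (simp add: P_def transpose_def vec_eq_iff)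
    define A' where "A' = A - l *\<^sub>R P"
    have A': "A' *v u = A *v u - (l * (v \<bullet> u)) *\<^sub>R v" for u
      by (simp add: A'_def matrix_vector_mult_diff_rdistrib scaleR_matrix_vector_assoc[symmetric] P)
    have sA': "sym_mat A'" using sym Psym by (auto simp: A'_def sym_mat_def transpose_def vec_eq_iff)
    have A'v: "A' *v v = 0" by (simp add: A' v vv)
    have "0 \<le> u \<bullet> (A' *v u)" for u
    proof -
      \<comment> \<open>The form of \<open>A'\<close> at \<open>u\<close> is the form of
        \<open>A\<close> at the component of \<open>u\<close> orthogonal to
        \<open>v\<close>.\<close>
      define w where "w = u - (v \<bullet> u) *\<^sub>R v"
      have u: "u = w + (v \<bullet> u) *\<^sub>R v" by (simp add: w_def)
      have vw: "v \<bullet> w = 0" by (simp add: w_def inner_diff_right vv)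
      have "A' *v u = A' *v w" by (subst u) (simp add: matrix_vector_right_distrib matrix_vector_mult_scaleR A'v)
      moreover have "A' *v w = A *v w" by (simp add: A' vw)
      moreover have "v \<bullet> (A *v w) = 0" using sym_mat_inner[OF sym, of v w] vw by (simp add: v)
      ultimately have "u \<bullet> (A' *v u) = w \<bullet> (A *v w)" by (subst u) (simp add: inner_add_left)
      then show ?thesis using less.prems by (simp add: psd_mat_def)
    qed
    then have psd': "psd_mat A'" using sA' by (simp add: psd_mat_def)
    \<comment> \<open>The rank drops: everything annihilated by \<open>A\<close> is orthogonal to
      \<open>v\<close>, and \<open>v\<close> itself is new in the kernel.\<close>
    have "{x. A *v x = 0} \<subset> {x. A' *v x = 0}"
    proof
      show "{x. A *v x = 0} \<subseteq> {x. A' *v x = 0}"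
      proof safe
        fix x assume "A *v x = 0"
        moreover from this have "v \<bullet> x = 0" using sym_mat_inner[OF sym, of v x] False by (simp add: v)
        ultimately show "A' *v x = 0" by (simp add: A')
      qed
      show "{x. A *v x = 0} \<noteq> {x. A' *v x = 0}"
      proof
        assume "{x. A *v x = 0} = {x. A' *v x = 0}"
        then have "A *v v = 0" using A'v by blast
        then show False using v(1,2) False by auto
      qed
    qed
    then have "dim {x. A *v x = 0} < dim {x. A' *v x = 0}"
      by (intro dim_psubset) (simp add: span_eq_iff[THEN iffD2, OF subspace_kernel_mat])
    moreover have "dim {x. A' *v x = 0} \<le> CARD('n)" using dim_subset_UNIV_cart by auto
    ultimately obtain S where S: "psd_mat S" "S ** S = A'"
      using less.hyps[OF _ psd'] by (metis (no_types, lifting) diff_less_mono2 order_less_le_trans)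
    have sS: "sym_mat S" using S by (simp add: psd_mat_def)
    \<comment> \<open>Since \<open>S\<close> annihilates \<open>v\<close>, the cross terms in the
      square of \<open>R\<close> vanish and the two orthogonal pieces can be squared
      separately.\<close>
    have "(S *v v) \<bullet> (S *v v) = v \<bullet> (A' *v v)"
      using sym_mat_inner[OF sS, of v "S *v v"] by (simp add: S(2)[symmetric] matrix_vector_mul_assoc)
    then have Sv: "S *v v = 0" using A'v by simp
    define R where "R = S + sqrt l *\<^sub>R P"
    have R: "R *v u = S *v u + (sqrt l * (v \<bullet> u)) *\<^sub>R v" for u
      by (simp add: R_def matrix_vector_mult_add_rdistrib scaleR_matrix_vector_assoc[symmetric] P)
    have "psd_mat R"
      unfolding psd_mat_def
    proof
      show "sym_mat R" using sS Psym by (auto simp: R_def sym_mat_def transpose_def vec_eq_iff)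
      show "\<forall>u. 0 \<le> u \<bullet> (R *v u)"
      proof
        fix u
        have "u \<bullet> (R *v u) = u \<bullet> (S *v u) + sqrt l * (v \<bullet> u)\<^sup>2"
          by (simp add: R inner_add_right power2_eq_square inner_commute)
        then show "0 \<le> u \<bullet> (R *v u)" using S(1) l0 by (simp add: psd_mat_def)
      qed
    qed
    moreover have "R ** R = A"
    proof (subst matrix_eq, rule allI)
      fix u
      have "v \<bullet> (S *v u) = 0" using sym_mat_inner[OF sS, of v u] Sv by simp
      then have "R *v (R *v u) = S *v (S *v u) + (l * (v \<bullet> u)) *\<^sub>R v"
        using l0 by (simp add: R matrix_vector_right_distrib matrix_vector_mult_scaleR Sv vv inner_add_right
          mult.assoc[symmetric])
      also have "\<dots> = A *v u" by (simp add: matrix_vector_mul_assoc S A')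
      finally show "(R ** R) *v u = A *v u" by (simp add: matrix_vector_mul_assoc)
    qed
    ultimately show ?thesis by blast
  qed
qed

lemma msqrt_properties:
  assumes "psd_mat A"
  shows "psd_mat (msqrt A)" "msqrt A ** msqrt A = A"
proof -
  have "\<exists>!S. psd_mat S \<and> S ** S = A"
    using psd_root_exists[OF assms] psd_root_unique by metis
  from theI'[OF this] show "psd_mat (msqrt A)" "msqrt A ** msqrt A = A"
    unfolding msqrt_def by auto
qed

lemma msqrt_eqI: "psd_mat S \<Longrightarrow> S ** S = A \<Longrightarrow> msqrt A = S"
  unfolding msqrt_def by (rule the_equality) (auto intro: psd_root_unique)

lemma msqrt_scaled_mat_1: "0 \<le> c \<Longrightarrow> msqrt (c *\<^sub>R mat 1 :: real^'n^'n) = sqrt c *\<^sub>R mat 1"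
proof (rule msqrt_eqI)
  assume "0 \<le> c"
  then show "psd_mat (sqrt c *\<^sub>R mat 1 :: real^'n^'n)"
    by (auto simp: psd_mat_def sym_mat_def transpose_def mat_def vec_eq_iff scaleR_matrix_vector_assoc[symmetric])
       (simp add: matrix_vector_mul_lid flip: mat_def)
  show "(sqrt c *\<^sub>R mat 1 :: real^'n^'n) ** sqrt c *\<^sub>R mat 1 = c *\<^sub>R mat 1"
    using \<open>0 \<le> c\<close> by (subst matrix_eq) (simp add: scaleR_matrix_vector_assoc[symmetric]
        matrix_vector_mul_assoc[symmetric])
qed

lemma norm_matrix_vector_le: "norm (A *v u) \<le> norm A * norm u" for A :: "real^'n^'m"
proof -
  have "norm (A *v u) \<le> L2_set (\<lambda>i. norm (A $ i) * norm u) UNIV"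
    unfolding norm_vec_def[of "A *v u"]
    by (intro L2_set_mono) (auto simp: matrix_vector_mul_component Cauchy_Schwarz_ineq2)
  also have "\<dots> = norm A * norm u"
    by (simp add: norm_vec_def[of A] L2_set_left_distrib)
  finally show ?thesis .
qed

lemma inner_matrix_vector_le: "u \<bullet> (A *v u) \<le> norm A * (u \<bullet> u)" for A :: "real^'n^'n"
proof -
  have "\<bar>u \<bullet> (A *v u)\<bar> \<le> norm u * (norm A * norm u)"
    by (meson Cauchy_Schwarz_ineq2 mult_left_mono norm_ge_zero norm_matrix_vector_le order_trans)
  then show ?thesis by (simp add: dot_square_norm power2_eq_square mult_ac)
qed

text \<open>Applying \<open>quadratic_form_root_diff\<close> in both orders with d = |B - A| bounds
  the difference of the forms of the roots by sqrt |B - A| |u|^2; polarisation then gives the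
  entries.\<close>

lemma continuous_on_msqrt: "continuous_on (Collect psd_mat) (msqrt :: real^'n^'n \<Rightarrow> _)"
proof -
  have "(msqrt \<longlongrightarrow> msqrt A) (at A within Collect psd_mat)" if A: "psd_mat A" for A :: "real^'n^'n"
  proof -
    have ev: "\<forall>\<^sub>F B in at A within Collect psd_mat. psd_mat B"
      by (simp add: eventually_at_filter)
    have sq: "((\<lambda>B. sqrt (norm (B - A))) \<longlongrightarrow> 0) (at A within Collect psd_mat)"
      by (rule tendsto_eq_intros refl | simp)+
    have q: "((\<lambda>B. u \<bullet> (msqrt B *v u)) \<longlongrightarrow> u \<bullet> (msqrt A *v u)) (at A within Collect psd_mat)" for u
    proof (rule Lim_null[THEN iffD2], rule Lim_null_comparison)
      show "((\<lambda>B. sqrt (norm (B - A)) * (u \<bullet> u)) \<longlongrightarrow> 0) (at A within Collect psd_mat)"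
        using tendsto_mult_left_zero[OF sq] by simp
      show "\<forall>\<^sub>F B in at A within Collect psd_mat.
          norm (u \<bullet> (msqrt B *v u) - u \<bullet> (msqrt A *v u)) \<le> sqrt (norm (B - A)) * (u \<bullet> u)"
        using ev
      proof eventually_elim
        case (elim B)
        have "u \<bullet> ((msqrt B - msqrt A) *v u) \<le> sqrt (norm (B - A)) * (u \<bullet> u)"
          using msqrt_properties[OF A] msqrt_properties[OF elim] inner_matrix_vector_le[of _ "B - A"]
          by (intro quadratic_form_root_diff) auto
        moreover have "u \<bullet> ((msqrt A - msqrt B) *v u) \<le> sqrt (norm (B - A)) * (u \<bullet> u)"
          using msqrt_properties[OF A] msqrt_properties[OF elim] inner_matrix_vector_le[of _ "A - B"]
          by (intro quadratic_form_root_diff) (auto simp: norm_minus_commute)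
        ultimately show ?case by (simp add: matrix_vector_mult_diff_rdistrib inner_diff_right)
      qed
    qed
    show ?thesis
    proof (intro vec_tendstoI)
      fix i j
      let ?q = "\<lambda>B::real^'n^'n. (((axis i 1 + axis j 1) \<bullet> (msqrt B *v (axis i 1 + axis j 1)))
         - axis i 1 \<bullet> (msqrt B *v axis i 1) - axis j 1 \<bullet> (msqrt B *v axis j 1)) / 2"
      have eq: "msqrt B $ i $ j = ?q B" if "psd_mat B" for B :: "real^'n^'n"
        using msqrt_properties(1)[OF that] by (intro matrix_eq_of_quadratic_forms) (simp add: psd_mat_def)
      have "(?q \<longlongrightarrow> ?q A) (at A within Collect psd_mat)"
        by (intro tendsto_intros q) simp
      then show "((\<lambda>B. msqrt B $ i $ j) \<longlongrightarrow> msqrt A $ i $ j) (at A within Collect psd_mat)"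
        unfolding eq[OF A]
        by (rule Lim_transform_eventually) (use ev in \<open>eventually_elim, simp add: eq\<close>)
    qed
  qed
  then show ?thesis by (simp add: continuous_on_def)
qed

text \<open>Closedness keeps the left limits of \<open>X\<close> positive semidefinite, so that the
  square root commutes with taking left limits.\<close>

lemma closed_psd: "closed (Collect psd_mat :: (real^'n^'n) set)"
proof -
  have "Collect psd_mat = {A :: real^'n^'n. transpose A = A} \<inter> (\<Inter>v. {A. 0 \<le> v \<bullet> (A *v v)})"
    by (auto simp: psd_mat_def sym_mat_def)
  moreover have "continuous_on UNIV (transpose :: real^'n^'n \<Rightarrow> real^'n^'n)"
    unfolding transpose_def by (intro continuous_intros)
  moreover have "continuous_on UNIV (\<lambda>A::real^'n^'n. v \<bullet> (A *v v))" for v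
    unfolding matrix_vector_mult_def inner_vec_def by (auto intro!: continuous_intros)
  ultimately show ?thesis
    by (simp only:) (intro closed_Int closed_INT ballI closed_Collect_eq closed_Collect_le continuous_on_id
        continuous_on_const)
qed

lemma norm_sq_vec: "(norm x)\<^sup>2 = (\<Sum>i\<in>UNIV. (norm (x $ i))\<^sup>2)"
  by (simp add: norm_vec_def L2_set_def sum_nonneg)

lemma borel_measurable_matrix_vector [measurable (raw)]:
  fixes f :: "'a \<Rightarrow> real^'n^'m"
  assumes "f \<in> borel_measurable M" "g \<in> borel_measurable M"
  shows "(\<lambda>x. f x *v g x) \<in> borel_measurable M"
proof -
  have 1: "(\<lambda>p::(real^'n^'m) \<times> (real^'n). fst p *v snd p) \<in> borel_measurable borel"
    unfolding matrix_vector_mult_def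
    by (intro borel_measurable_continuous_onI continuous_intros)
  have 2: "(\<lambda>x. (f x, g x)) \<in> measurable M borel"
    unfolding borel_prod[symmetric] using assms by simp
  from measurable_compose[OF 2 1] show ?thesis by simp
qed

lemma borel_measurable_vec_nth [measurable (raw)]:
  fixes f :: "'a \<Rightarrow> 'b::real_normed_vector^'n"
  assumes "f \<in> borel_measurable M"
  shows "(\<lambda>x. f x $ i) \<in> borel_measurable M"
  by (rule borel_measurable_continuous_on[OF _ assms]) (intro continuous_intros)

section \<open>The standard normal law\<close>

lemma sets_std_gaussian [simp, measurable_cong]: "sets std_gaussian = sets borel"
  by (simp add: std_gaussian_def)

lemma space_std_gaussian [simp]: "space std_gaussian = UNIV"
  by (simp add: std_gaussian_def)

lemma Basis_real_vec: "Basis = range (\<lambda>i::'n::finite. axis i (1::real))"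
  by (auto simp: Basis_vec_def)

lemma prod_Basis_vec: "(\<Prod>b\<in>Basis. f b) = (\<Prod>i\<in>UNIV. f (axis i (1::real)))"
  unfolding Basis_real_vec by (subst prod.reindex) (auto simp: inj_on_def axis_eq_axis)

text \<open>Fubini for Lebesgue measure, which is a product over basis vectors; the work is the
  translation from coordinates to basis vectors.\<close>

lemma nn_integral_std_gaussian_prod:
  fixes f :: "'n::finite \<Rightarrow> real \<Rightarrow> real"
  assumes [measurable]: "\<And>i. f i \<in> borel_measurable borel" and nn: "\<And>i x. 0 \<le> f i x"
  shows "(\<integral>\<^sup>+z. ennreal (\<Prod>i\<in>UNIV. f i (z $ i)) \<partial>std_gaussian)
     = (\<Prod>i\<in>UNIV. \<integral>\<^sup>+x. ennreal (std_normal_density x * f i x) \<partial>lborel)"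
proof -
  \<comment> \<open>The definite description recovers the coordinate from the basis vector
    \<open>axis i 1\<close>.\<close>
  define h where "h b x = ennreal (std_normal_density x * f (THE i. b = axis i (1::real)) x)" for b :: "real^'n" and x
  have the: "(THE i. axis j (1::real) = axis i 1) = j" for j :: 'n
    by (simp add: axis_eq_axis)
  have [measurable]: "h b \<in> borel_measurable borel" for b unfolding h_def by measurable
  have "(\<integral>\<^sup>+z. ennreal (\<Prod>i\<in>UNIV. f i (z $ i)) \<partial>std_gaussian)
     = (\<integral>\<^sup>+z. (\<Prod>b\<in>Basis. h b (z \<bullet> b)) \<partial>lborel)"
    unfolding std_gaussian_def
    by (subst nn_integral_density)
       (auto simp: prod_Basis_vec h_def the inner_axis prod_ennreal nn prod.distrib prod_nonneg
          simp flip: ennreal_mult intro!: nn_integral_cong)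
  also have "\<dots> = (\<Prod>b\<in>Basis. \<integral>\<^sup>+x. h b x \<partial>lborel)" by (rule nn_integral_lborel_prod) auto
  finally show ?thesis by (simp add: prod_Basis_vec h_def the)
qed

text \<open>Completing the square turns the integrand into a normal density with mean
  \<open>u\<close>.\<close>

lemma nn_integral_std_normal_exp:
  "(\<integral>\<^sup>+x. ennreal (std_normal_density x * exp (u * x)) \<partial>lborel) = ennreal (exp (u\<^sup>2 / 2))"
proof -
  have "std_normal_density x * exp (u * x) = exp (u\<^sup>2 / 2) * normal_density u 1 x" for x
    by (simp add: normal_density_def exp_add[symmetric] field_simps power2_eq_square)
  then have "(\<integral>\<^sup>+x. ennreal (std_normal_density x * exp (u * x)) \<partial>lborel)
      = (\<integral>\<^sup>+x. ennreal (exp (u\<^sup>2 / 2)) * ennreal (normal_density u 1 x) \<partial>lborel)"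
    by (simp add: ennreal_mult)
  also have "\<dots> = ennreal (exp (u\<^sup>2 / 2))"
    using prob_space.emeasure_space_1[OF prob_space_normal_density[of 1 u]]
    by (simp add: nn_integral_cmult emeasure_density)
  finally show ?thesis .
qed

lemma nn_integral_std_gaussian_exp:
  fixes u :: "real^'n"
  shows "(\<integral>\<^sup>+z. ennreal (exp (u \<bullet> z)) \<partial>std_gaussian) = ennreal (exp ((norm u)\<^sup>2 / 2))"
proof -
  have "(\<integral>\<^sup>+z. ennreal (exp (u \<bullet> z)) \<partial>std_gaussian)
     = (\<integral>\<^sup>+z. ennreal (\<Prod>i\<in>UNIV. exp (u $ i * z $ i)) \<partial>std_gaussian)"
    by (simp add: inner_vec_def exp_sum)
  also have "\<dots> = (\<Prod>i\<in>UNIV. ennreal (exp ((u $ i)\<^sup>2 / 2)))"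
    by (subst nn_integral_std_gaussian_prod[where f = "\<lambda>i x. exp (u $ i * x)"])
       (auto simp: nn_integral_std_normal_exp)
  also have "\<dots> = ennreal (exp ((norm u)\<^sup>2 / 2))"
    by (simp add: prod_ennreal norm_sq_vec sum_divide_distrib exp_sum)
  finally show ?thesis .
qed

text \<open>The total mass is the moment generating function at 0.\<close>

lemma prob_space_std_gaussian: "prob_space (std_gaussian :: (real^'n) measure)"
proof
  show "emeasure (std_gaussian :: (real^'n) measure) (space std_gaussian) = 1"
    using nn_integral_std_gaussian_exp[of "0 :: real^'n"] by simp
qed

interpretation std_gaussian: prob_space "std_gaussian :: (real^'n) measure"
  by (rule prob_space_std_gaussian)

lemma measure_std_gaussian_UNIV [simp]: "measure (std_gaussian :: (real^'n) measure) UNIV = 1"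
  using std_gaussian.prob_space by simp

lemma has_bochner_integral_std_gaussian_monomial:
  fixes p :: "'n::finite \<Rightarrow> nat"
  shows "has_bochner_integral std_gaussian (\<lambda>z. \<Prod>i\<in>UNIV. (z $ i) ^ p i)
     (\<Prod>i\<in>UNIV. integral\<^sup>L lborel (\<lambda>x. std_normal_density x * x ^ p i))"
proof -
  interpret L: product_sigma_finite "\<lambda>_::real^'n. lborel :: real measure" by standard
  define h where "h b x = std_normal_density x * x ^ p (THE i. b = axis i (1::real))" for b :: "real^'n" and x
  have the: "(THE i. axis j (1::real) = axis i 1) = j" for j :: 'n
    by (simp add: axis_eq_axis)
  have int: "integrable lborel (h b)" for b
    unfolding h_def by (rule integrable_std_normal_moment)
  have [measurable]: "h b \<in> borel_measurable borel" for b unfolding h_def by measurable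
  have eq: "(\<Prod>b\<in>Basis. h b ((\<Sum>b\<in>Basis. f b *\<^sub>R b) \<bullet> b)) = (\<Prod>b\<in>Basis. h b (f b))" for f :: "real^'n \<Rightarrow> real"
    by (intro prod.cong) auto
  have "integrable (\<Pi>\<^sub>M b\<in>Basis. lborel) (\<lambda>f. \<Prod>b\<in>Basis. h b (f b))"
    "(\<integral>f. (\<Prod>b\<in>Basis. h b (f b)) \<partial>(\<Pi>\<^sub>M b\<in>Basis. lborel)) = (\<Prod>b\<in>Basis. integral\<^sup>L lborel (h b))"
    by (auto intro!: L.product_integrable_prod L.product_integral_prod int)
  then have *: "has_bochner_integral lborel (\<lambda>z. \<Prod>b\<in>Basis. h b (z \<bullet> b)) (\<Prod>b\<in>Basis. integral\<^sup>L lborel (h b))"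
    unfolding has_bochner_integral_iff
    by (subst (1 2) lborel_eq) (auto simp: integrable_distr_eq integral_distr eq)
  have "has_bochner_integral lborel (\<lambda>z. (\<Prod>i\<in>UNIV. std_normal_density (z $ i)) *\<^sub>R (\<Prod>i\<in>UNIV. (z $ i) ^ p i))
      (\<Prod>i\<in>UNIV. integral\<^sup>L lborel (\<lambda>x. std_normal_density x * x ^ p i))"
  proof -
    have "h (axis i 1) = (\<lambda>x. std_normal_density x * x ^ p i)" for i by (simp add: h_def[abs_def] the)
    with * show ?thesis by (simp add: prod_Basis_vec inner_axis prod.distrib)
  qed
  then show ?thesis
    unfolding std_gaussian_def
    by (intro has_bochner_integral_density) (auto intro!: prod_nonneg)
qed

lemma std_gaussian_second_moment:
  "has_bochner_integral std_gaussian (\<lambda>z::real^'n. z $ i * z $ j) (if i = j then 1 else 0)"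
proof -
  \<comment> \<open>The exponents add, so that \<open>i = j\<close> produces a square and
    \<open>i \<noteq> j\<close> two first powers, whose odd moments vanish.\<close>
  define p where "p k = (if k = i then 1 else 0) + (if k = j then 1 else 0 :: nat)" for k
  have "(\<Prod>k\<in>UNIV. (z $ k) ^ p k) = z $ i * z $ j" for z :: "real^'n"
    unfolding p_def power_add prod.distrib by (simp add: if_distrib[of "\<lambda>n. _ ^ n"] prod.delta cong: if_cong)
  moreover have "(\<Prod>k\<in>UNIV. integral\<^sup>L lborel (\<lambda>x. std_normal_density x * x ^ p k)) = (if i = j then 1 else 0)"
  proof (cases "i = j")
    case True
    have "integral\<^sup>L lborel (\<lambda>x. std_normal_density x * x ^ p k) = 1" for k
      using integral_std_normal_moment_even[of 0] integral_std_normal_moment_even[of 1] True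
      by (auto simp: p_def numeral_2_eq_2)
    then show ?thesis using True by simp
  next
    case False
    then have "integral\<^sup>L lborel (\<lambda>x. std_normal_density x * x ^ p i) = 0"
      using integral_std_normal_moment_odd[of 0] by (simp add: p_def)
    then have "(\<Prod>k\<in>UNIV. integral\<^sup>L lborel (\<lambda>x. std_normal_density x * x ^ p k)) = 0"
      by (intro prod_zero) auto
    then show ?thesis using False by simp
  qed
  ultimately show ?thesis using has_bochner_integral_std_gaussian_monomial[of p] by simp
qed

lemma std_gaussian_first_moment: "has_bochner_integral std_gaussian (\<lambda>z::real^'n. z $ i) 0"
proof -
  define p where "p k = (if k = i then 1 else 0 :: nat)" for k
  have 1: "(\<Prod>k\<in>UNIV. (z $ k) ^ p k) = z $ i" for z :: "real^'n"
    unfolding p_def by (simp add: if_distrib[of "\<lambda>n. _ ^ n"] prod.delta cong: if_cong)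
  have "integral\<^sup>L lborel (\<lambda>x. std_normal_density x * x ^ p i) = 0"
    using integral_std_normal_moment_odd[of 0] by (simp add: p_def)
  then have 2: "(\<Prod>k\<in>UNIV. integral\<^sup>L lborel (\<lambda>x. std_normal_density x * x ^ p k)) = 0"
    by (intro prod_zero) auto
  show ?thesis using has_bochner_integral_std_gaussian_monomial[of p] unfolding 1 2 .
qed

lemma nn_integral_std_gaussian_affine_square:
  fixes a :: "real^'n"
  shows "(\<integral>\<^sup>+z. ennreal ((c + a \<bullet> z)\<^sup>2) \<partial>std_gaussian) = ennreal (c\<^sup>2 + (norm a)\<^sup>2)"
proof -
  have eq: "(c + a \<bullet> z)\<^sup>2 = c\<^sup>2 + 2 * c * (\<Sum>i\<in>UNIV. a $ i * z $ i)
      + (\<Sum>i\<in>UNIV. \<Sum>j\<in>UNIV. (a $ i * a $ j) * (z $ i * z $ j))" for z :: "real^'n"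
    by (simp add: inner_vec_def power2_eq_square algebra_simps sum_product)
  have "has_bochner_integral std_gaussian (\<lambda>z::real^'n. (c + a \<bullet> z)\<^sup>2)
     (c\<^sup>2 + 2 * c * (\<Sum>i\<in>UNIV. a $ i * 0) + (\<Sum>i\<in>UNIV. \<Sum>j\<in>UNIV. (a $ i * a $ j) * (if i = j then 1 else 0)))"
    unfolding eq
    by (intro has_bochner_integral_add has_bochner_integral_mult_right has_bochner_integral_sum
        std_gaussian_first_moment std_gaussian_second_moment)
       (simp add: has_bochner_integral_iff std_gaussian.prob_space[simplified])
  moreover have "c\<^sup>2 + 2 * c * (\<Sum>i\<in>UNIV. a $ i * 0) + (\<Sum>i\<in>UNIV. \<Sum>j\<in>UNIV. (a $ i * a $ j) * (if i = j then 1 else 0))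
     = c\<^sup>2 + (norm a)\<^sup>2"
    unfolding norm_sq_vec
    by (simp add: power2_eq_square if_distrib[of "\<lambda>x. _ * x"] sum.delta cong: if_cong)
  ultimately have "has_bochner_integral std_gaussian (\<lambda>z::real^'n. (c + a \<bullet> z)\<^sup>2) (c\<^sup>2 + (norm a)\<^sup>2)"
    by simp
  then show ?thesis
    by (subst nn_integral_eq_integral) (auto simp: has_bochner_integral_iff)
qed

text \<open>The norm of a matrix is the Euclidean norm of its entries, so summing the scalar
  identity over the rows gives exactly \<open>norm B\<close>. This is the one-step Ito
  isometry.\<close>

lemma nn_integral_std_gaussian_affine_norm:
  fixes B :: "real^'n^'m"
  shows "(\<integral>\<^sup>+z. ennreal ((norm (v + B *v z))\<^sup>2) \<partial>std_gaussian) = ennreal ((norm v)\<^sup>2 + (norm B)\<^sup>2)"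
proof -
  have "(\<integral>\<^sup>+z. ennreal ((norm (v + B *v z))\<^sup>2) \<partial>std_gaussian)
      = (\<integral>\<^sup>+z. (\<Sum>i\<in>UNIV. ennreal ((v $ i + B $ i \<bullet> z)\<^sup>2)) \<partial>std_gaussian)"
    unfolding norm_sq_vec[of "_ + _"]
    by (intro nn_integral_cong) (simp add: matrix_vector_mul_component)
  also have "\<dots> = (\<Sum>i\<in>UNIV. ennreal ((v $ i)\<^sup>2 + (norm (B $ i))\<^sup>2))"
    by (subst nn_integral_sum) (auto simp: nn_integral_std_gaussian_affine_square)
  also have "\<dots> = ennreal ((norm v)\<^sup>2 + (norm B)\<^sup>2)"
    by (simp add: norm_sq_vec[of v] norm_sq_vec[of B] sum.distrib sum_nonneg)
  finally show ?thesis .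
qed

lemma norm_row_le: "norm (B $ i) \<le> norm B"
  by (rule Finite_Cartesian_Product.norm_nth_le)

section \<open>Exponential moments and polynomial growth\<close>

text \<open>A function that dominates all powers of the norm and whose expectation reduces to
  exponential moments of single coordinates, the quantities that pass through the induction over the
  cells of a stochastic integral.\<close>

definition exp_growth :: "real^'n \<Rightarrow> real" where
  "exp_growth x = (\<Sum>i\<in>UNIV. exp (x $ i) + exp (- x $ i))"

lemma exp_growth_measurable [measurable]: "exp_growth \<in> borel_measurable borel"
  unfolding exp_growth_def[abs_def] by measurable

lemma exp_growth_ge: "exp \<bar>x $ i\<bar> \<le> exp_growth x"
proof -
  have "exp \<bar>x $ i\<bar> \<le> exp (x $ i) + exp (- x $ i)" by (simp add: abs_if)
  also have "\<dots> \<le> exp_growth x" unfolding exp_growth_def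
    by (rule member_le_sum) (auto intro: add_nonneg_nonneg)
  finally show ?thesis .
qed

lemma exp_growth_ge_1: "1 \<le> exp_growth x"
  using exp_growth_ge[of x undefined] by (smt (verit) one_le_exp_iff)

lemma exp_growth_nonneg [simp]: "0 \<le> exp_growth x"
  using exp_growth_ge_1[of x] by linarith

text \<open>Every exponential changes by a factor of at most e \<le> 3. Hence the exponential growth
  of the true increments is controlled by that of the approximating ones, whose moments are
  known.\<close>

lemma exp_growth_add_le:
  assumes "norm e \<le> 1"
  shows "exp_growth (x + e) \<le> 3 * exp_growth x"
proof -
  have e: "\<bar>e $ i\<bar> \<le> 1" for i using component_le_norm_cart[of e i] assms by linarith
  have 1: "exp (s + t) \<le> 3 * exp s" if "\<bar>t\<bar> \<le> 1" for s t :: real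
  proof -
    have "exp t \<le> exp 1" using that by simp
    also have "\<dots> \<le> 3" by (rule exp_le)
    finally show ?thesis by (simp add: exp_add)
  qed
  have "exp (x $ i + e $ i) + exp (- (x $ i + e $ i)) \<le> 3 * (exp (x $ i) + exp (- x $ i))" for i
    using 1[of "e $ i" "x $ i"] 1[of "- e $ i" "- x $ i"] e[of i] by simp
  then show ?thesis unfolding exp_growth_def sum_distrib_left by (intro sum_mono) simp
qed

text \<open>With l = ln(\<open>exp_growth x\<close>), every coordinate is at most l in absolute
  value, so the norm is at most d l for the dimension d; and l^k / k! is one term of the series of
  exp l.\<close>

lemma norm_power_le_exp_growth:
  fixes x :: "real^'n"
  shows "norm x ^ k \<le> real CARD('n) ^ k * fact k * exp_growth x"
proof -
  have G: "exp_growth x > 0" using exp_growth_ge_1[of x] by linarith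
  define l where "l = ln (exp_growth x)"
  have l0: "l \<ge> 0" unfolding l_def using exp_growth_ge_1 by (rule ln_ge_zero)
  have "\<bar>x $ i\<bar> \<le> l" for i
    unfolding l_def using exp_growth_ge[of x i] G by (subst ln_ge_iff) auto
  then have "norm x \<le> (\<Sum>i\<in>(UNIV::'n set). l)"
    by (intro order_trans[OF norm_le_l1_cart] sum_mono)
  then have "norm x ^ k \<le> (real CARD('n) * l) ^ k" by (intro power_mono) auto
  also have "\<dots> = real CARD('n) ^ k * l ^ k" by (rule power_mult_distrib)
  also have "l ^ k \<le> fact k * exp_growth x"
  proof -
    have "l ^ k /\<^sub>R fact k \<le> exp l"
    proof -
      have "(\<lambda>n. l ^ n /\<^sub>R fact n) sums exp l" by (rule exp_converges)
      then have "(\<Sum>n\<in>{k}. l ^ n /\<^sub>R fact n) \<le> exp l"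
        using l0 sum_le_suminf[of "\<lambda>n. l ^ n /\<^sub>R fact n" "{k}"] by (auto simp: sums_iff)
      then show ?thesis by simp
    qed
    then show ?thesis using G by (simp add: l_def divide_simps mult.commute)
  qed
  finally show ?thesis by (simp add: mult.assoc mult_left_mono)
qed

text \<open>There are two exponentials for each row, and every row has norm at most
  \<open>R\<close>.\<close>

lemma nn_integral_exp_growth:
  fixes B :: "real^'n^'m"
  assumes "norm B \<le> R"
  shows "(\<integral>\<^sup>+z. ennreal (exp_growth (B *v z)) \<partial>std_gaussian) \<le> ennreal (2 * real CARD('m) * exp (R\<^sup>2 / 2))"
proof -
  have "(\<integral>\<^sup>+z. ennreal (exp_growth (B *v z)) \<partial>std_gaussian)
     = (\<integral>\<^sup>+z. (\<Sum>i\<in>UNIV. ennreal (exp (B $ i \<bullet> z)) + ennreal (exp ((- B $ i) \<bullet> z))) \<partial>std_gaussian)"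
    unfolding exp_growth_def
    by (simp add: matrix_vector_mul_component sum_ennreal[symmetric] add_nonneg_nonneg del: sum_ennreal)
  also have "\<dots> = (\<Sum>i\<in>UNIV. ennreal (exp ((norm (B $ i))\<^sup>2 / 2)) + ennreal (exp ((norm (B $ i))\<^sup>2 / 2)))"
    by (subst nn_integral_sum) (auto simp: nn_integral_add nn_integral_std_gaussian_exp simp del: inner_minus_left)
  also have "\<dots> \<le> (\<Sum>i\<in>(UNIV::'m set). ennreal (exp (R\<^sup>2 / 2)) + ennreal (exp (R\<^sup>2 / 2)))"
    using order_trans[OF norm_row_le assms]
    by (intro sum_mono add_mono ennreal_leI) (auto intro!: power_mono)
  also have "\<dots> = ennreal (2 * real CARD('m) * exp (R\<^sup>2 / 2))"
    by (simp add: ennreal_plus[symmetric] ennreal_of_nat_eq_real_of_nat ennreal_mult[symmetric] mult_ac del: ennreal_plus)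
  finally show ?thesis .
qed

text \<open>The argument is carried out for scalar functions, namely the entries of
  \<open>g\<close>; the function \<open>norm (g x)\<close> is a further instance, used for
  integrability.\<close>

locale poly_growth_fun =
  fixes f :: "real^'n \<Rightarrow> real" and C :: real and q :: nat
  assumes cont: "continuous_on UNIV f" and growth: "\<And>x. \<bar>f x\<bar> \<le> C * (1 + norm x ^ q)"
begin

lemma f_measurable [measurable]: "f \<in> borel_measurable borel"
  using cont by (rule borel_measurable_continuous_onI)

lemma C_nonneg: "C \<ge> 0"
proof -
  have "0 \<le> C * (1 + 0 ^ q)" using order_trans[OF abs_ge_zero growth[of 0]] by simp
  moreover have "(0::real) \<le> 0 ^ q" by simp
  ultimately show ?thesis by (smt (verit) mult_neg_pos)
qed

definition growth_const :: "nat \<Rightarrow> real" where "growth_const k = real CARD('n) ^ k * fact k"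

lemma growth_const_nonneg: "growth_const k \<ge> 0" by (simp add: growth_const_def)

lemma norm_power_le: "norm (x::real^'n) ^ k \<le> growth_const k * exp_growth x"
  unfolding growth_const_def by (rule norm_power_le_exp_growth)

lemma f_le: "\<bar>f x\<bar> \<le> C * (1 + growth_const q) * exp_growth x"
proof -
  have "C * (1 + norm x ^ q) \<le> C * (exp_growth x + growth_const q * exp_growth x)"
    by (intro mult_left_mono add_mono C_nonneg norm_power_le exp_growth_ge_1)
  then show ?thesis using growth[of x] by (simp add: algebra_simps)
qed

lemma f_sq_le: "(f x)\<^sup>2 \<le> 2 * C\<^sup>2 * (1 + growth_const (2 * q)) * exp_growth x"
proof -
  have "(f x)\<^sup>2 \<le> (C * (1 + norm x ^ q))\<^sup>2"
    using growth[of x] by (metis abs_ge_zero power2_abs power_mono)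
  also have "\<dots> = C\<^sup>2 * (1 + norm x ^ q)\<^sup>2" by (rule power_mult_distrib)
  also have "\<dots> \<le> C\<^sup>2 * (2 * (1 + norm x ^ (2 * q)))"
  proof (rule mult_left_mono)
    show "(1 + norm x ^ q)\<^sup>2 \<le> 2 * (1 + norm x ^ (2 * q))"
    proof -
      have "norm x ^ (2 * q) = (norm x ^ q)\<^sup>2" by (simp add: power_mult[symmetric] mult.commute)
      moreover have "(1 + s)\<^sup>2 \<le> 2 * (1 + s\<^sup>2)" for s :: real
        using zero_le_power2[of "1 - s"] by (simp add: power2_eq_square algebra_simps)
      ultimately show ?thesis by metis
    qed
  qed simp
  also have "\<dots> \<le> C\<^sup>2 * (2 * (exp_growth x + growth_const (2 * q) * exp_growth x))"
    by (intro mult_left_mono add_mono norm_power_le exp_growth_ge_1) auto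
  finally show ?thesis by (simp add: algebra_simps)
qed

text \<open>Since \<open>f\<close> is of smaller order than \<open>exp_growth\<close>, large
  arguments are absorbed by the \<epsilon>-term. On a ball, uniform continuity handles close points,
  and for separated points the bound of \<open>f\<close> is absorbed by a multiple of the squared
  distance.\<close>

lemma difference_bound:
  assumes "\<epsilon> > 0"
  obtains C' where "C' \<ge> 0" "\<And>x y. \<bar>f x - f y\<bar> \<le> \<epsilon> * (exp_growth x + exp_growth y) + C' * (norm (x - y))\<^sup>2"
proof -
  \<comment> \<open>Beyond \<open>L\<close> one spare power of the norm, bounded through
    \<open>growth_const (Suc q)\<close>, pays for the small factor
    \<open>\<epsilon>\<close>.\<close>
  define L where "L = max 1 (2 * C * growth_const (Suc q) / \<epsilon>)"
  have L: "L \<ge> 1" "2 * C * growth_const (Suc q) \<le> \<epsilon> * L"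
    using assms by (auto simp: L_def max_def field_simps)
  have far: "\<bar>f x\<bar> \<le> \<epsilon> * exp_growth x" if "norm x \<ge> L" for x
  proof -
    have "norm x \<ge> 1" using that L by linarith
    then have "\<bar>f x\<bar> \<le> C * (2 * norm x ^ q)"
      by (intro order_trans[OF growth] mult_left_mono C_nonneg) (simp add: one_le_power)
    then have "L * \<bar>f x\<bar> \<le> norm x * (C * (2 * norm x ^ q))"
      using that L C_nonneg by (intro mult_mono) auto
    also have "\<dots> = 2 * C * norm x ^ Suc q" by simp
    also have "\<dots> \<le> 2 * C * (growth_const (Suc q) * exp_growth x)"
      using C_nonneg by (intro mult_left_mono norm_power_le) auto
    also have "\<dots> \<le> (\<epsilon> * L) * exp_growth x"
      using L(2) exp_growth_ge_1[of x] by (simp add: mult.assoc[symmetric] mult_right_mono)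
    finally have "L * \<bar>f x\<bar> \<le> L * (\<epsilon> * exp_growth x)" by (simp add: mult_ac)
    then show ?thesis using L by (simp add: mult_le_cancel_left)
  qed
  have comp: "compact (cball (0::real^'n) (L + 1))" by simp
  have contL: "continuous_on (cball 0 (L + 1)) f" using cont by (rule continuous_on_subset) auto
  obtain M where M: "\<And>x. norm x \<le> L + 1 \<Longrightarrow> \<bar>f x\<bar> \<le> M" "M \<ge> 0"
  proof -
    have "bounded (f ` cball 0 (L + 1))" using compact_continuous_image[OF contL comp] by (rule compact_imp_bounded)
    then obtain M where "\<forall>x\<in>cball 0 (L + 1). norm (f x) \<le> M" by (auto simp: bounded_iff)
    then show ?thesis using that[of "max M 0"] by (auto simp: le_max_iff_disj)
  qed
  obtain \<theta> where \<theta>: "\<theta> > 0" "\<And>x y. norm x \<le> L + 1 \<Longrightarrow> norm y \<le> L + 1 \<Longrightarrow> norm (x - y) < \<theta> \<Longrightarrow> \<bar>f x - f y\<bar> < \<epsilon>"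
  proof -
    have "uniformly_continuous_on (cball 0 (L + 1)) f" by (rule compact_uniformly_continuous[OF contL comp])
    from this[unfolded uniformly_continuous_on_def, rule_format, OF assms]
    show ?thesis using that by (auto simp: dist_norm norm_minus_commute)
  qed
  \<comment> \<open>The first summand serves pairs inside the ball at distance at least
    \<open>\<theta>\<close>, the second pairs with a point outside, whose distance is at least
    1.\<close>
  define C' where "C' = 2 * M / \<theta>\<^sup>2 + M"
  have C': "C' \<ge> 0" "2 * M \<le> C' * \<theta>\<^sup>2" "M \<le> C'"
    using M \<theta> by (auto simp: C'_def field_simps)
  have G: "0 \<le> \<epsilon> * exp_growth x" "\<epsilon> \<le> \<epsilon> * exp_growth x" for x :: "real^'n"
    using assms exp_growth_ge_1[of x] by auto
  \<comment> \<open>The gap between the radii \<open>L\<close> and \<open>L + 1\<close> ensures that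
    a point outside the larger ball has distance at least 1 from \<open>x\<close>. The case in which
    \<open>y\<close> is the small point follows by symmetry.\<close>
  have main: "\<bar>f x - f y\<bar> \<le> \<epsilon> * (exp_growth x + exp_growth y) + C' * (norm (x - y))\<^sup>2" if x: "norm x < L" for x y
  proof (cases "norm y \<le> L + 1")
    case True
    show ?thesis
    proof (cases "norm (x - y) < \<theta>")
      case True
      then have "\<bar>f x - f y\<bar> < \<epsilon>" using \<theta>(2)[of x y] x \<open>norm y \<le> L + 1\<close> by simp
      moreover have "0 \<le> C' * (norm (x - y))\<^sup>2" using C' by simp
      ultimately show ?thesis using G(2)[of x] G(1)[of y] unfolding distrib_left by linarith
    next
      case False
      then have "\<theta>\<^sup>2 \<le> (norm (x - y))\<^sup>2" using \<theta> by (intro power_mono) auto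
      then have "C' * \<theta>\<^sup>2 \<le> C' * (norm (x - y))\<^sup>2" using C' by (intro mult_left_mono) auto
      moreover have "\<bar>f x\<bar> \<le> M" "\<bar>f y\<bar> \<le> M" using M x \<open>norm y \<le> L + 1\<close> by auto
      ultimately show ?thesis using C' G(1)[of x] G(1)[of y] by (simp add: distrib_left)
    qed
  next
    case False
    have "norm (x - y) \<ge> 1" using norm_triangle_ineq2[of y x] x False by (simp add: norm_minus_commute)
    then have "C' * 1 \<le> C' * (norm (x - y))\<^sup>2" using C' by (intro mult_left_mono) (auto simp: one_le_power)
    moreover have "\<bar>f x\<bar> \<le> M" using M x by auto
    moreover have "\<bar>f y\<bar> \<le> \<epsilon> * exp_growth y" using far False by simp
    ultimately show ?thesis using C' G(1)[of x] by (simp add: distrib_left)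
  qed
  show ?thesis
  proof (rule that[OF C'(1)])
    fix x y :: "real^'n"
    consider "norm x < L" | "norm y < L" | "norm x \<ge> L" "norm y \<ge> L" by linarith
    then show "\<bar>f x - f y\<bar> \<le> \<epsilon> * (exp_growth x + exp_growth y) + C' * (norm (x - y))\<^sup>2"
    proof cases
      case 1 then show ?thesis by (rule main)
    next
      case 2 from main[OF this, of x] show ?thesis by (simp add: abs_minus_commute norm_minus_commute add.commute)
    next
      case 3
      moreover have "0 \<le> C' * (norm (x - y))\<^sup>2" using C' by simp
      ultimately show ?thesis using far[of x] far[of y] by (simp add: distrib_left)
    qed
  qed
qed

text \<open>The Gaussian average as a function of the factor \<open>B\<close> instead of the
  covariance, so that later limits involve the volatility and not its square.\<close>

definition mean :: "real^'n^'n \<Rightarrow> real" where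
  "mean B = (LINT z|std_gaussian. f (B *v z))"

lemma integrable_exp_growth: "integrable std_gaussian (\<lambda>z. exp_growth ((B::real^'n^'n) *v z))"
  using nn_integral_exp_growth[of B "norm B"] exp_growth_ge_1
  by (intro integrableI_nonneg) (auto simp: le_less_trans intro: order_trans[OF zero_le_one])

lemma integrable_f: "integrable std_gaussian (\<lambda>z. f ((B::real^'n^'n) *v z))"
  by (rule Bochner_Integration.integrable_bound[OF integrable_mult_right[OF integrable_exp_growth[of B], of "C * (1 + growth_const q)"]])
     (auto intro!: always_eventually order_trans[OF f_le] simp: abs_mult C_nonneg growth_const_nonneg)

lemma integrable_f_sq: "integrable std_gaussian (\<lambda>z. (f ((B::real^'n^'n) *v z))\<^sup>2)"
  by (rule Bochner_Integration.integrable_bound[OF integrable_mult_right[OF integrable_exp_growth[of B], of "2 * C\<^sup>2 * (1 + growth_const (2 * q))"]])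
     (auto intro!: always_eventually order_trans[OF f_sq_le] simp: abs_mult growth_const_nonneg)

text \<open>The centred variable kills the cross term with \<open>v\<close>, and its variance is at
  most the second moment, bounded by \<open>f_sq_le\<close> and the exponential moments.\<close>

lemma f_variance:
  assumes "norm B \<le> R"
  shows "(\<integral>\<^sup>+z. ennreal ((v + c * (f (B *v z) - mean B))\<^sup>2) \<partial>std_gaussian)
     \<le> ennreal (v\<^sup>2 + c\<^sup>2 * (2 * C\<^sup>2 * (1 + growth_const (2 * q)) * (2 * real CARD('n) * exp (R\<^sup>2 / 2))))"
proof -
  define D where "D = 2 * C\<^sup>2 * (1 + growth_const (2 * q))"
  have D: "D \<ge> 0" using growth_const_nonneg by (simp add: D_def)
  have ex: "(v + c * (f (B *v z) - mean B))\<^sup>2 = (v - c * mean B)\<^sup>2 + 2 * (v - c * mean B) * c * f (B *v z) + c\<^sup>2 * (f (B *v z))\<^sup>2" for z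
    by (simp add: power2_eq_square algebra_simps)
  have int: "integrable std_gaussian (\<lambda>z. (v + c * (f (B *v z) - mean B))\<^sup>2)"
    unfolding ex by (intro Bochner_Integration.integrable_add integrable_mult_right integrable_f integrable_f_sq) simp
  have "(LINT z|std_gaussian. (v + c * (f (B *v z) - mean B))\<^sup>2)
      = (v - c * mean B)\<^sup>2 + 2 * (v - c * mean B) * c * mean B + c\<^sup>2 * (LINT z|std_gaussian. (f (B *v z))\<^sup>2)"
    unfolding ex using integrable_f integrable_f_sq by (simp add: mean_def)
  also have "\<dots> = v\<^sup>2 - c\<^sup>2 * (mean B)\<^sup>2 + c\<^sup>2 * (LINT z|std_gaussian. (f (B *v z))\<^sup>2)"
    by (simp add: power2_eq_square algebra_simps)
  also have "\<dots> \<le> v\<^sup>2 + c\<^sup>2 * (D * (2 * real CARD('n) * exp (R\<^sup>2 / 2)))"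
  proof -
    have "(LINT z|std_gaussian. (f (B *v z))\<^sup>2) \<le> (LINT z|std_gaussian. D * exp_growth (B *v z))"
      unfolding D_def by (intro integral_mono integrable_f_sq integrable_mult_right integrable_exp_growth f_sq_le)
    also have "\<dots> = D * (LINT z|std_gaussian. exp_growth (B *v z))" by simp
    also have "(LINT z|std_gaussian. exp_growth (B *v z)) \<le> 2 * real CARD('n) * exp (R\<^sup>2 / 2)"
    proof -
      have "ennreal (LINT z|std_gaussian. exp_growth (B *v z)) \<le> ennreal (2 * real CARD('n) * exp (R\<^sup>2 / 2))"
        using nn_integral_exp_growth[OF assms] exp_growth_ge_1
        by (subst nn_integral_eq_integral[symmetric, OF integrable_exp_growth])
           (auto intro: order_trans[OF zero_le_one])
      then show ?thesis by (subst (asm) ennreal_le_iff) auto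
    qed
    finally have "(LINT z|std_gaussian. (f (B *v z))\<^sup>2) \<le> D * (2 * real CARD('n) * exp (R\<^sup>2 / 2))"
      using D by (simp add: mult_left_mono)
    then have "c\<^sup>2 * (LINT z|std_gaussian. (f (B *v z))\<^sup>2) \<le> c\<^sup>2 * (D * (2 * real CARD('n) * exp (R\<^sup>2 / 2)))"
      by (intro mult_left_mono) auto
    moreover have "0 \<le> c\<^sup>2 * (mean B)\<^sup>2" by simp
    ultimately show ?thesis by linarith
  qed
  finally show ?thesis
    unfolding D_def by (subst nn_integral_eq_integral[OF int]) (auto intro!: ennreal_leI)
qed

text \<open>Dominated convergence: along a convergent sequence of factors with norms at most
  \<open>R\<close>, the growth bound of \<open>f\<close> with \<open>R * norm z\<close> in place of
  the argument is an integrable majorant.\<close>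

lemma continuous_mean: "continuous_on UNIV mean"
proof (rule continuous_on_sequentiallyI)
  fix u :: "nat \<Rightarrow> real^'n^'n" and B assume u: "u \<longlonglongrightarrow> B"
  then have "Bseq u" by (intro convergent_imp_Bseq convergentI)
  then obtain R where R: "R > 0" "\<And>k. norm (u k) \<le> R" by (auto simp: Bseq_def)
  have isC: "isCont f x" for x using cont by (simp add: continuous_on_eq_continuous_at)
  have dom: "norm (f (u k *v z)) \<le> C * (1 + R ^ q * norm z ^ q)" for k z
  proof -
    have "norm (u k *v z) \<le> R * norm z"
      by (intro order_trans[OF norm_matrix_vector_le] mult_right_mono R) simp
    then have "norm (u k *v z) ^ q \<le> R ^ q * norm z ^ q"
      by (metis norm_ge_zero power_mono power_mult_distrib)
    then show ?thesis by (auto intro!: order_trans[OF growth] mult_left_mono C_nonneg)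
  qed
  have G1: "integrable std_gaussian (\<lambda>z::real^'n. exp_growth z)" using integrable_exp_growth[of "mat 1"] by simp
  have int: "integrable std_gaussian (\<lambda>z::real^'n. C * (1 + R ^ q * norm z ^ q))"
  proof (intro integrable_mult_right Bochner_Integration.integrable_add)
    show "integrable std_gaussian (\<lambda>z::real^'n. norm z ^ q)"
      by (rule Bochner_Integration.integrable_bound[OF integrable_mult_right[OF G1, of "growth_const q"]])
         (auto intro!: always_eventually order_trans[OF norm_power_le] simp: abs_mult growth_const_nonneg)
  qed simp
  show "(\<lambda>k. mean (u k)) \<longlonglongrightarrow> mean B"
    unfolding mean_def
  proof (rule integral_dominated_convergence[OF _ _ int])
    show "AE z in std_gaussian. (\<lambda>k. f (u k *v z)) \<longlonglongrightarrow> f (B *v z)"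
    proof (rule AE_I2)
      fix z :: "real^'n"
      have "(\<lambda>k. u k *v z) \<longlonglongrightarrow> B *v z"
        unfolding matrix_vector_mult_def by (intro tendsto_intros u)
      then show "(\<lambda>k. f (u k *v z)) \<longlonglongrightarrow> f (B *v z)" by (rule isCont_tendsto_compose[OF isC])
    qed
  qed (use dom in auto)
qed

end

section \<open>Brownian increments\<close>

locale brownian_setup =
  fixes M :: "'a measure" and F :: "real \<Rightarrow> 'a measure" and T :: real and Z :: "real \<Rightarrow> 'a \<Rightarrow> real^'n"
  assumes T_pos: "T > 0" and basis: "filtered_prob_space M F T" and brownian: "brownian_motion M F T Z"
begin

sublocale prob_space M using basis by (simp add: filtered_prob_space_def)

lemma subalg: "t \<in> {0..T} \<Longrightarrow> subalgebra M (F t)"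
  using basis by (auto simp: filtered_prob_space_def)

lemma space_F [simp]: "t \<in> {0..T} \<Longrightarrow> space (F t) = space M"
  using subalg[of t] by (simp add: subalgebra_def)

lemma subalg_mono: "0 \<le> s \<Longrightarrow> s \<le> t \<Longrightarrow> t \<le> T \<Longrightarrow> subalgebra (F t) (F s)"
  using basis by (auto simp: filtered_prob_space_def subalgebra_def)

lemma measurable_F_M: "t \<in> {0..T} \<Longrightarrow> f \<in> borel_measurable (F t) \<Longrightarrow> f \<in> borel_measurable M"
  using measurable_from_subalg[OF subalg] by blast

lemma measurable_F_mono:
  "f \<in> borel_measurable (F s) \<Longrightarrow> 0 \<le> s \<Longrightarrow> s \<le> t \<Longrightarrow> t \<le> T \<Longrightarrow> f \<in> borel_measurable (F t)"
  using measurable_from_subalg[OF subalg_mono] by blast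

lemma Z_measurable: "t \<in> {0..T} \<Longrightarrow> Z t \<in> borel_measurable (F t)"
  using brownian by (auto simp: brownian_motion_def adapted_def)

lemma Z_measurable_M: "t \<in> {0..T} \<Longrightarrow> Z t \<in> borel_measurable M"
  using measurable_F_M Z_measurable by blast

lemma increment_law:
  assumes "0 \<le> s" "s \<le> t" "t \<le> T"
  shows "distr M borel (\<lambda>\<omega>. Z t \<omega> - Z s \<omega>) = distr std_gaussian borel (\<lambda>z. sqrt (t - s) *\<^sub>R z)"
proof -
  have "distr M borel (\<lambda>\<omega>. Z t \<omega> - Z s \<omega>) = gaussian ((t - s) *\<^sub>R mat 1)"
    using brownian assms by (auto simp: brownian_motion_def)
  then show ?thesis using assms
    by (simp add: gaussian_def msqrt_scaled_mat_1 scaleR_matrix_vector_assoc[symmetric])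
qed

text \<open>Quantities known at time \<open>s\<close> may be held fixed while the increment is
  integrated out. This takes the place of conditional expectations throughout.\<close>

lemma freezing:
  assumes st: "0 \<le> s" "s \<le> t" "t \<le> T" and W: "W \<in> borel_measurable (F s \<Otimes>\<^sub>M borel)"
  shows "(\<integral>\<^sup>+\<omega>. W (\<omega>, Z t \<omega> - Z s \<omega>) \<partial>M) = (\<integral>\<^sup>+\<omega>. (\<integral>\<^sup>+z. W (\<omega>, sqrt (t - s) *\<^sub>R z) \<partial>std_gaussian) \<partial>M)"
proof -
  define D where "D \<omega> = Z t \<omega> - Z s \<omega>" for \<omega>
  have D: "D \<in> borel_measurable M" unfolding D_def using st Z_measurable_M by simp
  have id: "(\<lambda>\<omega>. \<omega>) \<in> measurable M (F s)"
    using subalg[of s] st by (auto simp: subalgebra_def measurable_def)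
  have indep: "indep_set (sets (F s)) (sets (vimage_algebra (space M) D borel))"
    using brownian st by (auto simp: brownian_motion_def D_def[abs_def])
  interpret G: prob_space "distr M borel D" by (rule prob_space_distr[OF D])
  interpret F: prob_space "distr M (F s) (\<lambda>\<omega>. \<omega>)" by (rule prob_space_distr[OF id])
  have pair: "(\<lambda>x. (x, D x)) \<in> measurable M (F s \<Otimes>\<^sub>M borel)" using id D by simp
  \<comment> \<open>The identity map into \<open>F s\<close> has as its law the restriction of
    \<open>M\<close>. Independence identifies the joint law with the increment on rectangles, and
    rectangles determine a product measure.\<close>
  have eq: "distr M (F s) (\<lambda>\<omega>. \<omega>) \<Otimes>\<^sub>M distr M borel D = distr M (F s \<Otimes>\<^sub>M borel) (\<lambda>x. (x, D x))"
  proof (rule pair_measure_eqI)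
    fix A B assume "A \<in> sets (distr M (F s) (\<lambda>\<omega>. \<omega>))" "B \<in> sets (distr M borel D)"
    then have AB: "A \<in> sets (F s)" "B \<in> sets borel" by auto
    have A: "A \<subseteq> space M" using sets.sets_into_space[OF AB(1)] st by simp
    have "D -` B \<inter> space M \<in> sets (vimage_algebra (space M) D borel)"
      using AB(2) by (rule in_vimage_algebra)
    then have "prob (A \<inter> (D -` B \<inter> space M)) = prob A * prob (D -` B \<inter> space M)"
      using indep AB(1) by (intro indep_setD)
    moreover have "(\<lambda>x. (x, D x)) -` (A \<times> B) \<inter> space M = A \<inter> (D -` B \<inter> space M)" by auto
    ultimately show "emeasure (distr M (F s) (\<lambda>\<omega>. \<omega>)) A * emeasure (distr M borel D) B
       = emeasure (distr M (F s \<Otimes>\<^sub>M borel) (\<lambda>x. (x, D x))) (A \<times> B)"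
      using AB A by (simp add: emeasure_distr id D pair emeasure_eq_measure Int_absorb2 ennreal_mult)
  qed (auto intro: F.sigma_finite_measure_axioms G.sigma_finite_measure_axioms
       simp: sets_pair_measure_cong[OF sets_distr sets_distr])
  have Wsec: "(\<lambda>z. W (\<omega>, z)) \<in> borel_measurable borel" if "\<omega> \<in> space M" for \<omega>
    using measurable_compose[OF measurable_Pair1'[of \<omega> "F s"] W] that st by simp
  have "(\<integral>\<^sup>+\<omega>. W (\<omega>, D \<omega>) \<partial>M) = integral\<^sup>N (distr M (F s \<Otimes>\<^sub>M borel) (\<lambda>x. (x, D x))) W"
    by (subst nn_integral_distr[OF pair]) (auto simp: W)
  also have "\<dots> = (\<integral>\<^sup>+\<omega>. \<integral>\<^sup>+z. W (\<omega>, z) \<partial>distr M borel D \<partial>distr M (F s) (\<lambda>\<omega>. \<omega>))"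
    unfolding eq[symmetric] using W by (subst G.nn_integral_fst) auto
  also have "\<dots> = (\<integral>\<^sup>+\<omega>. \<integral>\<^sup>+z. W (\<omega>, z) \<partial>distr M borel D \<partial>M)"
    using W by (subst nn_integral_distr[OF id]) (auto intro!: G.borel_measurable_nn_integral_fst cong: measurable_cong_sets)
  also have "\<dots> = (\<integral>\<^sup>+\<omega>. (\<integral>\<^sup>+z. W (\<omega>, sqrt (t - s) *\<^sub>R z) \<partial>std_gaussian) \<partial>M)"
  proof (rule nn_integral_cong)
    fix \<omega> assume "\<omega> \<in> space M"
    then show "(\<integral>\<^sup>+z. W (\<omega>, z) \<partial>distr M borel D) = (\<integral>\<^sup>+z. W (\<omega>, sqrt (t - s) *\<^sub>R z) \<partial>std_gaussian)"
      unfolding D_def increment_law[OF st] using Wsec by (subst nn_integral_distr) auto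
  qed
  finally show ?thesis by (simp add: D_def)
qed

lemma freezing_norm:
  fixes V :: "'a \<Rightarrow> real^'m" and B :: "'a \<Rightarrow> real^'n^'m"
  assumes st: "0 \<le> s" "s \<le> t" "t \<le> T" and [measurable]: "V \<in> borel_measurable (F s)" "B \<in> borel_measurable (F s)"
  shows "(\<integral>\<^sup>+\<omega>. ennreal ((norm (V \<omega> + B \<omega> *v (Z t \<omega> - Z s \<omega>)))\<^sup>2) \<partial>M)
    = (\<integral>\<^sup>+\<omega>. ennreal ((norm (V \<omega>))\<^sup>2 + (t - s) * (norm (B \<omega>))\<^sup>2) \<partial>M)"
proof -
  have "(\<integral>\<^sup>+\<omega>. ennreal ((norm (V \<omega> + B \<omega> *v (Z t \<omega> - Z s \<omega>)))\<^sup>2) \<partial>M)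
     = (\<integral>\<^sup>+\<omega>. (\<integral>\<^sup>+z. ennreal ((norm (V \<omega> + B \<omega> *v (sqrt (t - s) *\<^sub>R z)))\<^sup>2) \<partial>std_gaussian) \<partial>M)"
    using freezing[OF st, of "\<lambda>p. ennreal ((norm (V (fst p) + B (fst p) *v snd p))\<^sup>2)"] by simp
  also have "\<dots> = (\<integral>\<^sup>+\<omega>. ennreal ((norm (V \<omega>))\<^sup>2 + (t - s) * (norm (B \<omega>))\<^sup>2) \<partial>M)"
    using st nn_integral_std_gaussian_affine_norm[of "V _" "sqrt (t - s) *\<^sub>R B _"]
    by (simp add: matrix_vector_mult_scaleR scaleR_matrix_vector_assoc power_mult_distrib)
  finally show ?thesis .
qed

text \<open>Given the past, the coordinate is normal with variance (t - s) |row|^2, and the row is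
  bounded by \<open>R\<close>.\<close>

lemma freezing_exp:
  fixes V :: "'a \<Rightarrow> real" and B :: "'a \<Rightarrow> real^'n^'m"
  assumes st: "0 \<le> s" "s \<le> t" "t \<le> T" and [measurable]: "V \<in> borel_measurable (F s)" "B \<in> borel_measurable (F s)"
    and B: "\<And>\<omega>. \<omega> \<in> space M \<Longrightarrow> norm (B \<omega>) \<le> R"
  shows "(\<integral>\<^sup>+\<omega>. ennreal (exp (V \<omega> + c * (B \<omega> *v (Z t \<omega> - Z s \<omega>)) $ a)) \<partial>M)
    \<le> (\<integral>\<^sup>+\<omega>. ennreal (exp (V \<omega>)) \<partial>M) * ennreal (exp (c\<^sup>2 * R\<^sup>2 * (t - s) / 2))"
proof -
  have "(\<integral>\<^sup>+\<omega>. ennreal (exp (V \<omega> + c * (B \<omega> *v (Z t \<omega> - Z s \<omega>)) $ a)) \<partial>M)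
     = (\<integral>\<^sup>+\<omega>. (\<integral>\<^sup>+z. ennreal (exp (V \<omega> + c * (B \<omega> *v (sqrt (t - s) *\<^sub>R z)) $ a)) \<partial>std_gaussian) \<partial>M)"
    using freezing[OF st, of "\<lambda>p. ennreal (exp (V (fst p) + c * (B (fst p) *v snd p) $ a))"] by simp
  also have "\<dots> = (\<integral>\<^sup>+\<omega>. ennreal (exp (V \<omega>)) * (\<integral>\<^sup>+z. ennreal (exp (((c * sqrt (t - s)) *\<^sub>R (B \<omega> $ a)) \<bullet> z)) \<partial>std_gaussian) \<partial>M)"
    by (subst nn_integral_cmult[symmetric])
       (auto simp: exp_add ennreal_mult[symmetric] matrix_vector_mul_component mult.assoc matrix_vector_mult_scaleR)
  also have "\<dots> \<le> (\<integral>\<^sup>+\<omega>. ennreal (exp (V \<omega>)) * ennreal (exp (c\<^sup>2 * R\<^sup>2 * (t - s) / 2)) \<partial>M)"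
  proof (intro nn_integral_mono mult_left_mono)
    fix \<omega> assume "\<omega> \<in> space M"
    then have "norm (B \<omega> $ a) \<le> R" using norm_row_le[of "B \<omega>" a] B[of \<omega>] by linarith
    then have "(norm (B \<omega> $ a))\<^sup>2 \<le> R\<^sup>2" by (intro power_mono) auto
    then have "c\<^sup>2 * (t - s) * (norm (B \<omega> $ a))\<^sup>2 \<le> c\<^sup>2 * (t - s) * R\<^sup>2"
      using st by (intro mult_left_mono) auto
    then show "(\<integral>\<^sup>+z. ennreal (exp (((c * sqrt (t - s)) *\<^sub>R (B \<omega> $ a)) \<bullet> z)) \<partial>std_gaussian)
        \<le> ennreal (exp (c\<^sup>2 * R\<^sup>2 * (t - s) / 2))"
      unfolding nn_integral_std_gaussian_exp using st
      by (intro ennreal_leI) (simp add: power_mult_distrib mult_ac)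
  qed simp
  also have "\<dots> = (\<integral>\<^sup>+\<omega>. ennreal (exp (V \<omega>)) \<partial>M) * ennreal (exp (c\<^sup>2 * R\<^sup>2 * (t - s) / 2))"
    using measurable_F_M[of s V] st by (intro nn_integral_multc) auto
  finally show ?thesis .
qed

section \<open>Discrete stochastic integrals\<close>

definition discrete_integral :: "(nat \<Rightarrow> real) \<Rightarrow> (nat \<Rightarrow> 'a \<Rightarrow> real^'n^'m) \<Rightarrow> nat \<Rightarrow> 'a \<Rightarrow> real^'m" where
  "discrete_integral r B k \<omega> = (\<Sum>i<k. B i \<omega> *v (Z (r (Suc i)) \<omega> - Z (r i) \<omega>))"

definition partition_integrand :: "(nat \<Rightarrow> real) \<Rightarrow> (nat \<Rightarrow> 'a \<Rightarrow> real^'n^'m) \<Rightarrow> nat \<Rightarrow> bool" where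
  "partition_integrand r B k \<longleftrightarrow> (\<forall>i\<le>k. r i \<in> {0..T}) \<and> (\<forall>i<k. r i \<le> r (Suc i)) \<and> (\<forall>i<k. B i \<in> borel_measurable (F (r i)))"

lemma partition_integrand_Suc:
  "partition_integrand r B (Suc k) \<Longrightarrow> partition_integrand r B k"
  by (auto simp: partition_integrand_def)

lemma discrete_integral_measurable:
  "partition_integrand r B k \<Longrightarrow> discrete_integral r B k \<in> borel_measurable (F (r k))"
proof (induction k)
  case 0
  then show ?case by (simp add: discrete_integral_def[abs_def])
next
  case (Suc k)
  have r: "0 \<le> r k" "r k \<le> r (Suc k)" "r (Suc k) \<le> T" "r k \<in> {0..T}" "r (Suc k) \<in> {0..T}"
    and B: "B k \<in> borel_measurable (F (r k))"
    using Suc.prems by (auto simp: partition_integrand_def)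
  have "discrete_integral r B k \<in> borel_measurable (F (r (Suc k)))" "B k \<in> borel_measurable (F (r (Suc k)))"
    "Z (r k) \<in> borel_measurable (F (r (Suc k)))" "Z (r (Suc k)) \<in> borel_measurable (F (r (Suc k)))"
    using Suc.IH[OF partition_integrand_Suc[OF Suc.prems]] r B measurable_F_mono[OF _ r(1,2,3)] Z_measurable by blast+
  then have "(\<lambda>\<omega>. discrete_integral r B k \<omega> + B k \<omega> *v (Z (r (Suc k)) \<omega> - Z (r k) \<omega>)) \<in> borel_measurable (F (r (Suc k)))"
    by measurable
  then show ?case by (simp add: discrete_integral_def[abs_def])
qed

text \<open>Freezing everything but the last increment adds one square without a cross term. Working
  in \<open>ennreal\<close> allows unbounded integrands.\<close>

lemma discrete_integral_isometry:
  assumes "partition_integrand r B k"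
  shows "(\<integral>\<^sup>+\<omega>. ennreal ((norm (discrete_integral r B k \<omega>))\<^sup>2) \<partial>M)
    = (\<integral>\<^sup>+\<omega>. ennreal (\<Sum>i<k. (r (Suc i) - r i) * (norm (B i \<omega>))\<^sup>2) \<partial>M)"
  using assms
proof (induction k)
  case 0
  then show ?case by (simp add: discrete_integral_def)
next
  case (Suc k)
  have P: "partition_integrand r B k" by (rule partition_integrand_Suc[OF Suc.prems])
  have r: "0 \<le> r k" "r k \<le> r (Suc k)" "r (Suc k) \<le> T" "r k \<in> {0..T}" 
    and B: "\<And>i. i \<le> k \<Longrightarrow> B i \<in> borel_measurable (F (r i))" and ri: "\<And>i. i \<le> k \<Longrightarrow> r i \<in> {0..T} \<and> r i \<le> r (Suc i)"
    using Suc.prems by (auto simp: partition_integrand_def)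
  have BM: "B i \<in> borel_measurable M" if "i \<le> k" for i
    using measurable_F_M[OF _ B[OF that]] ri[OF that] by blast
  have V: "discrete_integral r B k \<in> borel_measurable M"
    using measurable_F_M[OF r(4) discrete_integral_measurable[OF P]] .
  have "(\<integral>\<^sup>+\<omega>. ennreal ((norm (discrete_integral r B (Suc k) \<omega>))\<^sup>2) \<partial>M)
     = (\<integral>\<^sup>+\<omega>. ennreal ((norm (discrete_integral r B k \<omega> + B k \<omega> *v (Z (r (Suc k)) \<omega> - Z (r k) \<omega>)))\<^sup>2) \<partial>M)"
    by (simp add: discrete_integral_def)
  also have "\<dots> = (\<integral>\<^sup>+\<omega>. ennreal ((norm (discrete_integral r B k \<omega>))\<^sup>2 + (r (Suc k) - r k) * (norm (B k \<omega>))\<^sup>2) \<partial>M)"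
    using B[of k] by (intro freezing_norm[OF r(1,2,3) discrete_integral_measurable[OF P]]) simp
  also have "\<dots> = (\<integral>\<^sup>+\<omega>. ennreal ((norm (discrete_integral r B k \<omega>))\<^sup>2) + ennreal ((r (Suc k) - r k) * (norm (B k \<omega>))\<^sup>2) \<partial>M)"
    using r by simp
  also have "\<dots> = (\<integral>\<^sup>+\<omega>. ennreal ((norm (discrete_integral r B k \<omega>))\<^sup>2) \<partial>M) + (\<integral>\<^sup>+\<omega>. ennreal ((r (Suc k) - r k) * (norm (B k \<omega>))\<^sup>2) \<partial>M)"
    using V BM[of k] by (intro nn_integral_add) auto
  also have "\<dots> = (\<integral>\<^sup>+\<omega>. ennreal (\<Sum>i<k. (r (Suc i) - r i) * (norm (B i \<omega>))\<^sup>2) + ennreal ((r (Suc k) - r k) * (norm (B k \<omega>))\<^sup>2) \<partial>M)"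
    unfolding Suc.IH[OF P] using BM by (intro nn_integral_add[symmetric]) auto
  also have "\<dots> = (\<integral>\<^sup>+\<omega>. ennreal (\<Sum>i<Suc k. (r (Suc i) - r i) * (norm (B i \<omega>))\<^sup>2) \<partial>M)"
  proof (rule nn_integral_cong)
    fix \<omega>
    have "0 \<le> (\<Sum>i<k. (r (Suc i) - r i) * (norm (B i \<omega>))\<^sup>2)"
      using ri by (intro sum_nonneg) auto
    then show "ennreal (\<Sum>i<k. (r (Suc i) - r i) * (norm (B i \<omega>))\<^sup>2) + ennreal ((r (Suc k) - r k) * (norm (B k \<omega>))\<^sup>2)
       = ennreal (\<Sum>i<Suc k. (r (Suc i) - r i) * (norm (B i \<omega>))\<^sup>2)"
      using r by simp
  qed
  finally show ?case .
qed

text \<open>Each step multiplies the exponential moment by a deterministic factor, which is why the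
  integrand needs a deterministic bound. The exponents telescope to the length of the
  interval.\<close>

lemma discrete_integral_exp:
  assumes "partition_integrand r B k" and B: "\<And>i \<omega>. i < k \<Longrightarrow> \<omega> \<in> space M \<Longrightarrow> norm (B i \<omega>) \<le> R"
  shows "(\<integral>\<^sup>+\<omega>. ennreal (exp (c * discrete_integral r B k \<omega> $ a)) \<partial>M) \<le> ennreal (exp (c\<^sup>2 * R\<^sup>2 * (r k - r 0) / 2))"
  using assms
proof (induction k)
  case 0
  then show ?case by (simp add: discrete_integral_def emeasure_space_1)
next
  case (Suc k)
  have P: "partition_integrand r B k" by (rule partition_integrand_Suc[OF Suc.prems(1)])
  have r: "0 \<le> r k" "r k \<le> r (Suc k)" "r (Suc k) \<le> T" and Bk: "B k \<in> borel_measurable (F (r k))"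
    using Suc.prems by (auto simp: partition_integrand_def)
  have "(\<integral>\<^sup>+\<omega>. ennreal (exp (c * discrete_integral r B (Suc k) \<omega> $ a)) \<partial>M)
     = (\<integral>\<^sup>+\<omega>. ennreal (exp (c * discrete_integral r B k \<omega> $ a + c * (B k \<omega> *v (Z (r (Suc k)) \<omega> - Z (r k) \<omega>)) $ a)) \<partial>M)"
    by (simp add: discrete_integral_def distrib_left)
  also have "\<dots> \<le> (\<integral>\<^sup>+\<omega>. ennreal (exp (c * discrete_integral r B k \<omega> $ a)) \<partial>M) * ennreal (exp (c\<^sup>2 * R\<^sup>2 * (r (Suc k) - r k) / 2))"
    using Bk Suc.prems(2)[of k] discrete_integral_measurable[OF P] by (intro freezing_exp[OF r]) auto
  also have "\<dots> \<le> ennreal (exp (c\<^sup>2 * R\<^sup>2 * (r k - r 0) / 2)) * ennreal (exp (c\<^sup>2 * R\<^sup>2 * (r (Suc k) - r k) / 2))"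
    using Suc.IH[OF P] Suc.prems(2) by (intro mult_right_mono) auto
  also have "\<dots> = ennreal (exp (c\<^sup>2 * R\<^sup>2 * (r (Suc k) - r 0) / 2))"
    by (simp add: ennreal_mult[symmetric] exp_add[symmetric] field_simps)
  finally show ?case .
qed

section \<open>Integrals of simple integrands\<close>

definition clip :: "real \<Rightarrow> real \<Rightarrow> real \<Rightarrow> real" where "clip a b x = max a (min b x)"

text \<open>When a cell collapses under clipping, its left end may be moved back in time, where
  \<open>A i\<close> need not be measurable. The value 0 restores adaptedness, and does no harm as
  the increment over the collapsed cell vanishes.\<close>

definition clipped_integrand where
  "clipped_integrand a b ts A i \<omega> = (if clip a b (ts i) < clip a b (ts (Suc i)) then A i \<omega> else 0)"

lemma clip_mono: "x \<le> y \<Longrightarrow> clip a b x \<le> clip a b y" by (auto simp: clip_def)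

lemma clip_range: "a \<le> b \<Longrightarrow> clip a b x \<in> {a..b}" by (auto simp: clip_def)

lemma clip_less_iff: "a < s \<Longrightarrow> s \<le> b \<Longrightarrow> clip a b x < s \<longleftrightarrow> x < s" by (auto simp: clip_def)

text \<open>On cells that do not collapse, clipping only moves the left end forward, so
  measurability is preserved.\<close>

lemma clip_strict: "clip a b x < clip a b y \<Longrightarrow> x \<le> clip a b x" by (auto simp: clip_def)

lemma simple_integral_increment:
  assumes "0 \<le> a" "a \<le> b" and mono: "\<And>i. i < k \<Longrightarrow> ts i \<le> ts (Suc i)"
  shows "simple_integral Z k ts A b \<omega> - simple_integral Z k ts A a \<omega>
    = discrete_integral (\<lambda>i. clip a b (ts i)) (clipped_integrand a b ts A) k \<omega>"
proof -
  \<comment> \<open>Clipping to the interval from \<open>a\<close> to \<open>b\<close> corresponds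
    to the difference of stopping at \<open>b\<close> and at \<open>a\<close>.\<close>
  have Zc: "Z (clip a b x) \<omega> = Z a \<omega> + Z (min b x) \<omega> - Z (min a x) \<omega>" for x
    using assms(1,2) by (auto simp: clip_def min_def max_def)
  have *: "A i \<omega> *v (Z (min b (ts (Suc i))) \<omega> - Z (min b (ts i)) \<omega>) - A i \<omega> *v (Z (min a (ts (Suc i))) \<omega> - Z (min a (ts i)) \<omega>)
     = clipped_integrand a b ts A i \<omega> *v (Z (clip a b (ts (Suc i))) \<omega> - Z (clip a b (ts i)) \<omega>)"
    if "i < k" for i
  proof -
    have "A i \<omega> *v (Z (clip a b (ts (Suc i))) \<omega> - Z (clip a b (ts i)) \<omega>) =
      A i \<omega> *v (Z (min b (ts (Suc i))) \<omega> - Z (min b (ts i)) \<omega>) - A i \<omega> *v (Z (min a (ts (Suc i))) \<omega> - Z (min a (ts i)) \<omega>)"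
      unfolding Zc by (simp add: matrix_vector_mult_diff_distrib matrix_vector_right_distrib)
    moreover have "clip a b (ts i) = clip a b (ts (Suc i))" if "\<not> clip a b (ts i) < clip a b (ts (Suc i))"
      using clip_mono[OF mono[OF \<open>i < k\<close>], of a b] that by simp
    ultimately show ?thesis by (auto simp: clipped_integrand_def)
  qed
  show ?thesis unfolding simple_integral_def discrete_integral_def sum_subtractf[symmetric]
    by (intro sum.cong refl *) simp
qed

lemma clipped_partition:
  assumes "0 \<le> a" "a \<le> b" "b \<le> T" and A: "\<And>i. i < k \<Longrightarrow> ts i \<in> {0..T} \<and> A i \<in> borel_measurable (F (ts i))"
    and mono: "\<And>i. i < k \<Longrightarrow> ts i \<le> ts (Suc i)"
  shows "partition_integrand (\<lambda>i. clip a b (ts i)) (clipped_integrand a b ts A) k"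
  unfolding partition_integrand_def
proof (intro conjI allI impI)
  fix i
  have c: "clip a b (ts i) \<in> {a..b}" for i using clip_range assms by blast
  then show "clip a b (ts i) \<in> {0..T}" using c[of i] assms(1,3) unfolding atLeastAtMost_iff by linarith
  assume i: "i < k"
  then show "clip a b (ts i) \<le> clip a b (ts (Suc i))" using clip_mono mono by blast
  show "clipped_integrand a b ts A i \<in> borel_measurable (F (clip a b (ts i)))"
  proof (cases "clip a b (ts i) < clip a b (ts (Suc i))")
    case True
    have "0 \<le> ts i" using A[OF i] by simp
    moreover have "clip a b (ts i) \<le> T" using c[of i] assms(3) by simp
    ultimately have "A i \<in> borel_measurable (F (clip a b (ts i)))"
      using clip_strict[OF True] by (intro measurable_F_mono[OF conjunct2[OF A[OF i]]])
    then show ?thesis using True by (simp add: clipped_integrand_def[abs_def])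
  qed (simp add: clipped_integrand_def[abs_def])
qed

lemma partition_cell:
  fixes ts :: "nat \<Rightarrow> real"
  assumes "ts 0 < s" "s \<le> ts k" "\<And>i. i < k \<Longrightarrow> ts i \<le> ts (Suc i)"
  obtains i where "i < k" "s \<in> {ts i<..ts (Suc i)}" "\<And>j. j < k \<Longrightarrow> s \<in> {ts j<..ts (Suc j)} \<Longrightarrow> j = i"
proof -
  have mono: "ts i \<le> ts j" if "i \<le> j" "j \<le> k" for i j
    using that by (induction rule: dec_induct) (use assms(3) in \<open>auto intro: order_trans\<close>)
  define l where "l = (LEAST l. s \<le> ts l)"
  have l: "s \<le> ts l" "\<And>j. s \<le> ts j \<Longrightarrow> l \<le> j"
    unfolding l_def using assms(2) by (auto intro: LeastI Least_le)
  have "l \<noteq> 0" using l(1) assms(1) by (cases l) auto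
  then obtain i where i: "l = Suc i" by (cases l) auto
  have ik: "i < k" using l(2)[OF assms(2)] i by simp
  have "ts i < s" using l(2)[of i] i by force
  moreover have "j = i" if "j < k" "s \<in> {ts j<..ts (Suc j)}" for j
  proof -
    have "Suc j \<le> i \<Longrightarrow> False" using mono[of "Suc j" i] that ik \<open>ts i < s\<close> by auto
    moreover have "Suc i \<le> j \<Longrightarrow> False" using mono[of "Suc i" j] that l(1) i by auto
    ultimately show ?thesis by (metis less_Suc_eq_le linorder_neqE_nat Suc_leI)
  qed
  ultimately show ?thesis using that[OF ik] l(1) i by auto
qed

lemma simple_value_cell:
  assumes "i < k" "s \<in> {ts i<..ts (Suc i)}" "\<And>j. j < k \<Longrightarrow> s \<in> {ts j<..ts (Suc j)} \<Longrightarrow> j = i"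
  shows "simple_value k ts A s \<omega> = A i \<omega>"
proof -
  have "indicat_real {ts j<..ts (Suc j)} s *\<^sub>R A j \<omega> = (if j = i then A i \<omega> else 0)" if "j < k" for j
  proof (cases "j = i")
    case False
    then have "s \<notin> {ts j<..ts (Suc j)}" using assms(3)[OF that] by blast
    then show ?thesis using False by (simp del: greaterThanAtMost_iff)
  qed (use assms(2) in simp)
  then have "simple_value k ts A s \<omega> = (\<Sum>j<k. if j = i then A i \<omega> else 0)"
    unfolding simple_value_def by (intro sum.cong refl) simp
  then show ?thesis using assms(1) by simp
qed

text \<open>The half-open cells cover the interval exactly once, so a step function is integrated by
  its clipped cell lengths. The function \<open>\<phi>\<close> is later a squared norm or the
  squared distance to a frozen matrix.\<close>

lemma nn_integral_simple_value:
  fixes \<phi> :: "real^'n^'n \<Rightarrow> real"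
  assumes ab: "ts 0 \<le> a" "a \<le> b" "b \<le> ts k" and mono: "\<And>i. i < k \<Longrightarrow> ts i \<le> ts (Suc i)" and \<phi>: "\<And>x. 0 \<le> \<phi> x"
  shows "(\<integral>\<^sup>+s. ennreal (\<phi> (simple_value k ts A s \<omega>)) * indicator {a<..b} s \<partial>lborel)
    = ennreal (\<Sum>i<k. (clip a b (ts (Suc i)) - clip a b (ts i)) * \<phi> (A i \<omega>))"
proof -
  let ?r = "\<lambda>i. clip a b (ts i)"
  have r: "?r i \<le> ?r (Suc i)" if "i < k" for i using clip_mono[OF mono[OF that]] .
  have pt: "ennreal (\<phi> (simple_value k ts A s \<omega>)) * indicator {a<..b} s
     = (\<Sum>i<k. ennreal (\<phi> (A i \<omega>)) * indicator {?r i<..?r (Suc i)} s)" for s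
  proof (cases "s \<in> {a<..b}")
    case True
    then have s: "a < s" "s \<le> b" "ts 0 < s" "s \<le> ts k" using ab by auto
    obtain i where i: "i < k" "s \<in> {ts i<..ts (Suc i)}" "\<And>j. j < k \<Longrightarrow> s \<in> {ts j<..ts (Suc j)} \<Longrightarrow> j = i"
      using partition_cell[OF s(3,4) mono] by metis
    have iff: "s \<in> {?r j<..?r (Suc j)} \<longleftrightarrow> s \<in> {ts j<..ts (Suc j)}" for j
      using clip_less_iff[OF s(1,2), of "ts j"] clip_less_iff[OF s(1,2), of "ts (Suc j)"] by auto
    have "ennreal (\<phi> (A j \<omega>)) * indicator {?r j<..?r (Suc j)} s = (if j = i then ennreal (\<phi> (A i \<omega>)) else 0)"
      if "j < k" for j
    proof (cases "j = i")
      case False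
      then have "s \<notin> {?r j<..?r (Suc j)}" using i(3)[OF that] iff[of j] by blast
      then show ?thesis using False by (simp del: greaterThanAtMost_iff)
    next
      case True
      then have "s \<in> {?r j<..?r (Suc j)}" using i(2) iff[of j] by blast
      then show ?thesis using True by (simp del: greaterThanAtMost_iff)
    qed
    then have "(\<Sum>j<k. ennreal (\<phi> (A j \<omega>)) * indicator {?r j<..?r (Suc j)} s) = (\<Sum>j<k. if j = i then ennreal (\<phi> (A i \<omega>)) else 0)"
      by (intro sum.cong refl) simp
    then show ?thesis using True i(1) simple_value_cell[where A = A and \<omega> = \<omega>, OF i] by simp
  next
    case False
    then have "s \<notin> {?r j<..?r (Suc j)}" for j
      using clip_range[OF ab(2), of "ts j"] clip_range[OF ab(2), of "ts (Suc j)"] by auto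
    then show ?thesis using False by simp
  qed
  have "(\<integral>\<^sup>+s. ennreal (\<phi> (simple_value k ts A s \<omega>)) * indicator {a<..b} s \<partial>lborel)
    = (\<Sum>i<k. ennreal (\<phi> (A i \<omega>)) * ennreal (?r (Suc i) - ?r i))"
    unfolding pt using r by (subst nn_integral_sum) (auto simp: nn_integral_cmult)
  also have "\<dots> = ennreal (\<Sum>i<k. (?r (Suc i) - ?r i) * \<phi> (A i \<omega>))"
    using r \<phi> by (subst sum_ennreal[symmetric]) (auto simp: ennreal_mult[symmetric] mult.commute intro!: sum.cong)
  finally show ?thesis .
qed

text \<open>Extending a simple integrand by zero lets its partition start at \<open>0\<close> and end at \<open>T\<close>, so that
  its increments can be compared with those of \<open>Z\<close>.\<close>

lemma simple_integrand_extend: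
  assumes "simple_integrand M F T k ts A"
  obtains k' ts' A' where "simple_integrand M F T k' ts' A'" "ts' 0 = 0" "ts' k' = T"
    "\<And>s \<omega>. simple_value k' ts' A' s \<omega> = simple_value k ts A s \<omega>"
    "\<And>t \<omega>. simple_integral Z k' ts' A' t \<omega> = simple_integral Z k ts A t \<omega>"
proof -
  define ts' where "ts' i = (if i = 0 then 0 else if i \<le> Suc k then ts (i - 1) else T)" for i
  define A' where "A' i = (if i = 0 \<or> i = Suc k then (\<lambda>_. 0) else A (i - 1))" for i
  have sum': "(\<Sum>i<Suc (Suc k). f i) = f 0 + (\<Sum>i<k. f (Suc i)) + f (Suc k)" for f :: "nat \<Rightarrow> 'b::comm_monoid_add"
    by (subst sum.lessThan_Suc_shift) (simp add: add_ac)
  have ts'S: "ts' (Suc i) = ts i" if "i \<le> k" for i using that by (simp add: ts'_def)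
  have A'S: "A' (Suc i) = A i" if "i < k" for i using that by (simp add: A'_def)
  have A'0: "A' 0 = (\<lambda>_. 0)" "A' (Suc k) = (\<lambda>_. 0)" by (auto simp: A'_def)
  show ?thesis
  proof
    show "simple_integrand M F T (Suc (Suc k)) ts' A'"
      unfolding simple_integrand_def
    proof (intro conjI allI impI)
      fix i
      show "ts' i \<in> {0..T}"
        using assms T_pos by (auto simp: ts'_def simple_integrand_def)
      assume i: "i < Suc (Suc k)"
      show "ts' i \<le> ts' (Suc i)"
        using assms T_pos i unfolding ts'_def simple_integrand_def
        by (cases i) (auto simp: less_Suc_eq_le dest: spec[of _ 0])
      show "A' i \<in> borel_measurable (F (ts' i))"
        using assms i by (cases i) (auto simp: A'_def ts'_def simple_integrand_def)
      show "\<exists>C. \<forall>\<omega>\<in>space M. norm (A' i \<omega>) \<le> C"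
      proof (cases "i = 0 \<or> i = Suc k")
        case False
        then have "i - 1 < k" using i by auto
        then show ?thesis using assms False by (auto simp: A'_def simple_integrand_def)
      qed (auto simp: A'_def)
    qed
    show "ts' 0 = 0" "ts' (Suc (Suc k)) = T" by (auto simp: ts'_def)
    show "simple_value (Suc (Suc k)) ts' A' s \<omega> = simple_value k ts A s \<omega>" for s \<omega>
      unfolding simple_value_def sum' by (simp add: A'0 A'S ts'S)
    show "simple_integral Z (Suc (Suc k)) ts' A' t \<omega> = simple_integral Z k ts A t \<omega>" for t \<omega>
      unfolding simple_integral_def sum' by (simp add: A'0 A'S ts'S)
  qed
qed

text \<open>The test includes the current term, so the sum is cut before it can overshoot
  \<open>\<delta>\<close>. For the integrands below this test is still measurable at the left end of
  the cell.\<close>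

lemma stopped_sum_le:
  fixes a :: "nat \<Rightarrow> real"
  assumes "\<And>i. 0 \<le> a i" "0 \<le> \<delta>"
  shows "(\<Sum>i<k. if (\<Sum>l\<le>i. a l) \<le> \<delta> then a i else 0) \<le> \<delta>"
proof (induction k)
  case (Suc k)
  show ?case
  proof (cases "(\<Sum>l\<le>k. a l) \<le> \<delta>")
    case True
    have "(\<Sum>i<Suc k. if (\<Sum>l\<le>i. a l) \<le> \<delta> then a i else 0) \<le> (\<Sum>i<Suc k. a i)"
      using assms by (intro sum_mono) auto
    then show ?thesis using True by (simp add: lessThan_Suc_atMost)
  qed (use Suc in simp)
qed (use assms in simp)

text \<open>Lenglart's inequality for simple integrands, by stopping the integrand before its quadratic
  variation exceeds \<open>\<delta>\<close>.\<close>

lemma simple_integral_lenglart: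
  assumes A: "simple_integrand M F T k ts A" and ts0: "ts 0 = 0" and S: "finite S" "S \<subseteq> {0..T}" and "\<delta> \<ge> 0" "c > 0"
  shows "prob {\<omega>\<in>space M. (\<Sum>i<k. (ts (Suc i) - ts i) * (norm (A i \<omega>))\<^sup>2) \<le> \<delta> \<and> (\<exists>t\<in>S. norm (simple_integral Z k ts A t \<omega>) > c)}
    \<le> real (card S) * (\<delta> / c\<^sup>2)"
proof -
  have mono: "ts i \<le> ts (Suc i)" "ts i \<in> {0..T}" "A i \<in> borel_measurable (F (ts i))" if "i < k" for i
    using A that by (auto simp: simple_integrand_def)
  have tmono: "ts i \<le> ts j" if "i \<le> j" "j < k" for i j
    using that by (induction rule: dec_induct) (use mono(1) in \<open>auto intro: order_trans\<close>)
  define a where "a i \<omega> = (if i < k then (ts (Suc i) - ts i) * (norm (A i \<omega>))\<^sup>2 else 0)" for i \<omega>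
  have a0: "a i \<omega> \<ge> 0" for i \<omega> using mono by (auto simp: a_def)
  \<comment> \<open>The decision uses the quadratic variation up to and including the current cell,
    which is known at time \<open>ts i\<close>. Thus \<open>B\<close> is adapted and its quadratic
    variation never exceeds \<open>\<delta>\<close>.\<close>
  define B where "B i \<omega> = (if (\<Sum>l\<le>i. a l \<omega>) \<le> \<delta> then A i \<omega> else 0)" for i \<omega>
  have Bm: "B i \<in> borel_measurable (F (ts i))" if i: "i < k" for i
  proof -
    have "A l \<in> borel_measurable (F (ts i))" if "l \<le> i" for l
      using measurable_F_mono[OF mono(3)[of l]] tmono[OF that i] mono(2)[of l] mono(2)[of i] that i by auto
    then have [measurable]: "(\<lambda>\<omega>. \<Sum>l\<le>i. a l \<omega>) \<in> borel_measurable (F (ts i))"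
      unfolding a_def using i by (intro borel_measurable_sum) auto
    have [measurable]: "A i \<in> borel_measurable (F (ts i))" using mono i by blast
    show ?thesis unfolding B_def[abs_def] by measurable
  qed
  have Jm: "simple_integral Z k ts A' t \<in> borel_measurable M"
    if "t \<in> {0..T}" and A': "\<And>i. i < k \<Longrightarrow> A' i \<in> borel_measurable (F (ts i))" for A' :: "nat \<Rightarrow> 'a \<Rightarrow> real^'n^'n" and t
  proof -
    have "A' i \<in> borel_measurable M" if "i < k" for i
      using measurable_F_M[OF mono(2)[OF that] A'[OF that]] .
    moreover have "Z (min t (ts i)) \<in> borel_measurable M" if "i \<le> k" for i
      using A that \<open>t \<in> {0..T}\<close> by (intro Z_measurable_M) (auto simp: simple_integrand_def min_def)
    ultimately show ?thesis unfolding simple_integral_def[abs_def]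
      by (intro borel_measurable_sum borel_measurable_matrix_vector borel_measurable_diff) auto
  qed
  \<comment> \<open>Isometry and Chebyshev at one fixed time.\<close>
  have bnd: "prob {\<omega>\<in>space M. norm (simple_integral Z k ts B t \<omega>) > c} \<le> \<delta> / c\<^sup>2" if t: "t \<in> {0..T}" for t
  proof -
    let ?r = "\<lambda>i. clip 0 t (ts i)"
    have J0: "simple_integral Z k ts B 0 \<omega> = 0" for \<omega>
    proof -
      have "min 0 (ts i) = 0" if "i \<le> k" for i using A that by (auto simp: simple_integrand_def)
      then show ?thesis by (simp add: simple_integral_def)
    qed
    have J: "simple_integral Z k ts B t \<omega> = discrete_integral ?r (clipped_integrand 0 t ts B) k \<omega>" for \<omega>
      using simple_integral_increment[of 0 t k ts B \<omega>] t mono(1) J0 by auto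
    have P: "partition_integrand ?r (clipped_integrand 0 t ts B) k"
      using t mono Bm by (intro clipped_partition) auto
    have le: "(\<Sum>i<k. (?r (Suc i) - ?r i) * (norm (clipped_integrand 0 t ts B i \<omega>))\<^sup>2) \<le> \<delta>" for \<omega>
    proof -
      have "(\<Sum>i<k. (?r (Suc i) - ?r i) * (norm (clipped_integrand 0 t ts B i \<omega>))\<^sup>2) \<le> (\<Sum>i<k. if (\<Sum>l\<le>i. a l \<omega>) \<le> \<delta> then a i \<omega> else 0)"
      proof (intro sum_mono)
        fix i assume "i \<in> {..<k}"
        then have i: "i < k" by simp
        have "?r (Suc i) - ?r i \<le> ts (Suc i) - ts i" using mono[OF i] by (auto simp: clip_def)
        then show "(?r (Suc i) - ?r i) * (norm (clipped_integrand 0 t ts B i \<omega>))\<^sup>2 \<le> (if (\<Sum>l\<le>i. a l \<omega>) \<le> \<delta> then a i \<omega> else 0)"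
          using i mono[OF i] by (auto simp: clipped_integrand_def B_def a_def intro!: mult_right_mono)
      qed
      also have "\<dots> \<le> \<delta>" using a0 \<open>\<delta> \<ge> 0\<close> by (rule stopped_sum_le)
      finally show ?thesis .
    qed
    have m: "simple_integral Z k ts B t \<in> borel_measurable M" using t Bm by (rule Jm)
    have "(\<integral>\<^sup>+\<omega>. ennreal ((norm (simple_integral Z k ts B t \<omega>))\<^sup>2) \<partial>M) \<le> (\<integral>\<^sup>+\<omega>. ennreal \<delta> \<partial>M)"
      unfolding J discrete_integral_isometry[OF P] by (intro nn_integral_mono ennreal_leI le)
    then have E: "(\<integral>\<^sup>+\<omega>. ennreal ((norm (simple_integral Z k ts B t \<omega>))\<^sup>2) \<partial>M) \<le> ennreal \<delta>"
      by (simp add: emeasure_space_1)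
    have "emeasure M {\<omega>\<in>space M. norm (simple_integral Z k ts B t \<omega>) > c}
      \<le> emeasure M {\<omega>\<in>space M. 1 \<le> ennreal (1 / c\<^sup>2) * ennreal ((norm (simple_integral Z k ts B t \<omega>))\<^sup>2)}"
    proof (rule emeasure_mono)
      show "{\<omega>\<in>space M. norm (simple_integral Z k ts B t \<omega>) > c}
        \<subseteq> {\<omega>\<in>space M. 1 \<le> ennreal (1 / c\<^sup>2) * ennreal ((norm (simple_integral Z k ts B t \<omega>))\<^sup>2)}"
      proof safe
        fix \<omega> assume "c < norm (simple_integral Z k ts B t \<omega>)"
        then have "c\<^sup>2 \<le> (norm (simple_integral Z k ts B t \<omega>))\<^sup>2" using \<open>c > 0\<close> by (intro power_mono) auto
        then have "1 \<le> 1 / c\<^sup>2 * (norm (simple_integral Z k ts B t \<omega>))\<^sup>2" using \<open>c > 0\<close> by (simp add: field_simps)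
        then show "1 \<le> ennreal (1 / c\<^sup>2) * ennreal ((norm (simple_integral Z k ts B t \<omega>))\<^sup>2)"
          by (simp add: ennreal_mult[symmetric] ennreal_ge_1 del: times_divide_eq_left)
      qed
    qed (use m in measurable)
    also have "\<dots> \<le> ennreal (1 / c\<^sup>2) * (\<integral>\<^sup>+\<omega>. ennreal ((norm (simple_integral Z k ts B t \<omega>))\<^sup>2) * indicator (space M) \<omega> \<partial>M)"
      using nn_integral_Markov_inequality[where u = "\<lambda>\<omega>. ennreal ((norm (simple_integral Z k ts B t \<omega>))\<^sup>2)"
          and M = M and A = "space M" and c = "ennreal (1 / c\<^sup>2)"] m
      by simp
    also have "\<dots> \<le> ennreal (1 / c\<^sup>2) * ennreal \<delta>"
      using E by (intro mult_left_mono) (auto simp: nn_integral_cong[of M "\<lambda>\<omega>. f \<omega> * indicator (space M) \<omega>" for f])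
    also have "\<dots> = ennreal (\<delta> / c\<^sup>2)" using \<open>\<delta> \<ge> 0\<close> by (simp add: ennreal_mult[symmetric])
    finally show ?thesis using \<open>\<delta> \<ge> 0\<close> by (simp add: emeasure_eq_measure)
  qed
  \<comment> \<open>If the full quadratic variation is at most \<open>\<delta>\<close>, no cell is
    switched off and both integrals coincide pathwise.\<close>
  have eq: "simple_integral Z k ts A t \<omega> = simple_integral Z k ts B t \<omega>"
    if small: "(\<Sum>i<k. (ts (Suc i) - ts i) * (norm (A i \<omega>))\<^sup>2) \<le> \<delta>" for t \<omega>
  proof -
    have "(\<Sum>l\<le>i. a l \<omega>) \<le> \<delta>" if "i < k" for i
    proof -
      have "(\<Sum>l\<le>i. a l \<omega>) \<le> (\<Sum>l<k. a l \<omega>)" using that a0 by (intro sum_mono2) auto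
      also have "\<dots> = (\<Sum>i<k. (ts (Suc i) - ts i) * (norm (A i \<omega>))\<^sup>2)" by (simp add: a_def)
      finally show ?thesis using small by linarith
    qed
    then show ?thesis by (simp add: simple_integral_def B_def)
  qed
  \<comment> \<open>A union bound over the finite set \<open>S\<close> stands in for a maximal
    inequality, at the price of the factor \<open>card S\<close>.\<close>
  have "prob {\<omega>\<in>space M. (\<Sum>i<k. (ts (Suc i) - ts i) * (norm (A i \<omega>))\<^sup>2) \<le> \<delta> \<and> (\<exists>t\<in>S. norm (simple_integral Z k ts A t \<omega>) > c)}
     \<le> prob (\<Union>t\<in>S. {\<omega>\<in>space M. norm (simple_integral Z k ts B t \<omega>) > c})"
  proof (rule finite_measure_mono)
    show "(\<Union>t\<in>S. {\<omega>\<in>space M. norm (simple_integral Z k ts B t \<omega>) > c}) \<in> events"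
    proof (intro sets.finite_UN S(1))
      fix t assume "t \<in> S"
      then have [measurable]: "simple_integral Z k ts B t \<in> borel_measurable M" using S Bm by (intro Jm) auto
      show "{\<omega>\<in>space M. norm (simple_integral Z k ts B t \<omega>) > c} \<in> events" by measurable
    qed
  qed (use eq in auto)
  also have "\<dots> \<le> (\<Sum>t\<in>S. prob {\<omega>\<in>space M. norm (simple_integral Z k ts B t \<omega>) > c})"
  proof (intro finite_measure_subadditive_finite S(1) image_subsetI)
    fix t assume "t \<in> S"
    then have [measurable]: "simple_integral Z k ts B t \<in> borel_measurable M" using S Bm by (intro Jm) auto
    show "{\<omega>\<in>space M. norm (simple_integral Z k ts B t \<omega>) > c} \<in> events" by measurable
  qed
  also have "\<dots> \<le> (\<Sum>t\<in>S. \<delta> / c\<^sup>2)" using bnd S by (intro sum_mono) auto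
  finally show ?thesis by simp
qed

end

locale brownian_poly = brownian_setup M F T Z + poly_growth_fun f C q
  for M :: "'a measure" and F T and Z :: "real \<Rightarrow> 'a \<Rightarrow> real^'n" and f :: "real^'n \<Rightarrow> real" and C q
begin

definition variance_bound :: "real \<Rightarrow> real" where
  "variance_bound R = 2 * C\<^sup>2 * (1 + growth_const (2 * q)) * (2 * real CARD('n) * exp (R\<^sup>2 / 2))"

lemma variance_bound_nonneg: "0 \<le> variance_bound R"
  by (simp add: variance_bound_def growth_const_nonneg)

text \<open>The summands are martingale differences: given the past up to the left end of its cell
  each one is centred, so only the variances add up.\<close>

lemma weak_law:
  fixes B :: "nat \<Rightarrow> 'a \<Rightarrow> real^'n^'n"
  assumes n: "n > 0" and K: "real K / real n \<le> T"
    and B: "\<And>i. i < K \<Longrightarrow> B i \<in> borel_measurable (F (real i / real n))"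
    and R: "\<And>i \<omega>. i < K \<Longrightarrow> \<omega> \<in> space M \<Longrightarrow> norm (B i \<omega>) \<le> R"
  shows "(\<integral>\<^sup>+\<omega>. ennreal ((\<Sum>i<K. w i * (f (B i \<omega> *v (sqrt (real n) *\<^sub>R (Z (real (Suc i) / real n) \<omega> - Z (real i / real n) \<omega>))) - mean (B i \<omega>)))\<^sup>2) \<partial>M)
    \<le> ennreal (variance_bound R * (\<Sum>i<K. (w i)\<^sup>2))"
  using K B R
proof (induction K)
  case 0
  then show ?case by simp
next
  case (Suc k)
  define V where "V \<omega> = (\<Sum>i<k. w i * (f (B i \<omega> *v (sqrt (real n) *\<^sub>R (Z (real (Suc i) / real n) \<omega> - Z (real i / real n) \<omega>))) - mean (B i \<omega>)))" for \<omega>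
  define s t where "s = real k / real n" and "t = real (Suc k) / real n"
  have "0 \<le> s" "s \<le> t" "t \<le> T" using Suc.prems(1) n by (auto simp: s_def t_def divide_right_mono)
  then have st: "0 \<le> s" "s \<le> t" "t \<le> T" "s \<in> {0..T}" by auto
  \<comment> \<open>The scaled increment over a cell of length 1/n is standard normal.\<close>
  have root: "sqrt (real n) * sqrt (t - s) = 1"
    using n by (simp add: s_def t_def diff_divide_distrib[symmetric] real_sqrt_divide)
  have mean_m: "mean \<in> borel_measurable borel" by (rule borel_measurable_continuous_onI[OF continuous_mean])
  have Vm: "V \<in> borel_measurable (F s)"
    unfolding V_def[abs_def]
  proof (intro borel_measurable_sum borel_measurable_times borel_measurable_diff)
    fix i assume "i \<in> {..<k}"
    then have i: "i < k" by simp
    have le: "0 \<le> real i / real n" "real i / real n \<le> s" "0 \<le> real (Suc i) / real n" "real (Suc i) / real n \<le> s"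
      using i n by (auto simp: s_def divide_right_mono)
    have [measurable]: "B i \<in> borel_measurable (F s)" using measurable_F_mono[OF Suc.prems(2)[of i] le(1,2)] i st by auto
    have [measurable]: "Z (real (Suc i) / real n) \<in> borel_measurable (F s)" "Z (real i / real n) \<in> borel_measurable (F s)"
      using measurable_F_mono[OF Z_measurable le(3,4)] measurable_F_mono[OF Z_measurable le(1,2)] le st by auto
    show "(\<lambda>\<omega>. f (B i \<omega> *v (sqrt (real n) *\<^sub>R (Z (real (Suc i) / real n) \<omega> - Z (real i / real n) \<omega>)))) \<in> borel_measurable (F s)"
      by measurable
    show "(\<lambda>\<omega>. mean (B i \<omega>)) \<in> borel_measurable (F s)" using measurable_compose[OF _ mean_m] by measurable
  qed simp
  have Bm [measurable]: "B k \<in> borel_measurable (F s)" using Suc.prems(2)[of k] by (simp add: s_def)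
  note [measurable] = Vm mean_m
  have "(\<integral>\<^sup>+\<omega>. ennreal ((\<Sum>i<Suc k. w i * (f (B i \<omega> *v (sqrt (real n) *\<^sub>R (Z (real (Suc i) / real n) \<omega> - Z (real i / real n) \<omega>))) - mean (B i \<omega>)))\<^sup>2) \<partial>M)
     = (\<integral>\<^sup>+\<omega>. ennreal ((V \<omega> + w k * (f (B k \<omega> *v (sqrt (real n) *\<^sub>R (Z t \<omega> - Z s \<omega>))) - mean (B k \<omega>)))\<^sup>2) \<partial>M)"
    by (simp add: V_def s_def t_def)
  also have "\<dots> = (\<integral>\<^sup>+\<omega>. (\<integral>\<^sup>+z. ennreal ((V \<omega> + w k * (f (B k \<omega> *v (sqrt (real n) *\<^sub>R (sqrt (t - s) *\<^sub>R z))) - mean (B k \<omega>)))\<^sup>2) \<partial>std_gaussian) \<partial>M)"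
    using freezing[OF st(1,2,3), of "\<lambda>p. ennreal ((V (fst p) + w k * (f (B k (fst p) *v (sqrt (real n) *\<^sub>R snd p)) - mean (B k (fst p))))\<^sup>2)"]
    by simp
  also have "\<dots> \<le> (\<integral>\<^sup>+\<omega>. ennreal ((V \<omega>)\<^sup>2 + (w k)\<^sup>2 * variance_bound R) \<partial>M)"
  proof (rule nn_integral_mono)
    fix \<omega> assume "\<omega> \<in> space M"
    then have "norm (B k \<omega>) \<le> R" using Suc.prems(3) by simp
    from f_variance[OF this, of "V \<omega>" "w k"]
    show "(\<integral>\<^sup>+z. ennreal ((V \<omega> + w k * (f (B k \<omega> *v (sqrt (real n) *\<^sub>R (sqrt (t - s) *\<^sub>R z))) - mean (B k \<omega>)))\<^sup>2) \<partial>std_gaussian)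
      \<le> ennreal ((V \<omega>)\<^sup>2 + (w k)\<^sup>2 * variance_bound R)"
      by (simp add: root variance_bound_def)
  qed
  also have "\<dots> = (\<integral>\<^sup>+\<omega>. ennreal ((V \<omega>)\<^sup>2) \<partial>M) + ennreal ((w k)\<^sup>2 * variance_bound R)"
    using measurable_F_M[OF st(4) Vm] variance_bound_nonneg
    by (simp add: nn_integral_add emeasure_space_1)
  also have "\<dots> \<le> ennreal (variance_bound R * (\<Sum>i<k. (w i)\<^sup>2)) + ennreal ((w k)\<^sup>2 * variance_bound R)"
    unfolding V_def using Suc.prems n by (intro add_right_mono Suc.IH) (auto simp: field_simps)
  also have "\<dots> = ennreal (variance_bound R * (\<Sum>i<Suc k. (w i)\<^sup>2))"
    using variance_bound_nonneg by (subst ennreal_plus[symmetric]) (auto simp: sum_nonneg algebra_simps)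
  finally show ?case .
qed

end

section \<open>Paths with one-sided limits\<close>

lemma bounded_of_locally_bounded:
  fixes f :: "real \<Rightarrow> 'b::real_normed_vector"
  assumes "\<And>t. t \<in> {0..T} \<Longrightarrow> \<exists>d>0. \<exists>B. \<forall>s\<in>{0..T}. \<bar>s - t\<bar> < d \<longrightarrow> norm (f s) \<le> B"
  shows "\<exists>B. \<forall>s\<in>{0..T}. norm (f s) \<le> B"
proof -
  from assms obtain d B where d: "\<And>t. t \<in> {0..T} \<Longrightarrow> d t > 0"
    "\<And>t s. t \<in> {0..T} \<Longrightarrow> s \<in> {0..T} \<Longrightarrow> \<bar>s - t\<bar> < d t \<Longrightarrow> norm (f s) \<le> B t" by metis
  have "compact {0..T}" by simp
  then obtain S where S: "S \<subseteq> {0..T}" "finite S" "{0..T} \<subseteq> (\<Union>t\<in>S. ball t (d t))"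
    by (rule compactE_image[of _ "{0..T}" "\<lambda>t. ball t (d t)"]) (use d(1) in force)+
  have "norm (f s) \<le> Max (insert 0 (B ` S))" if s: "s \<in> {0..T}" for s
  proof -
    obtain t where t: "t \<in> S" "s \<in> ball t (d t)" using S(3) s by blast
    then have "norm (f s) \<le> B t"
      using S(1) d(2)[of t s] s by (auto simp: dist_real_def abs_minus_commute)
    also have "\<dots> \<le> Max (insert 0 (B ` S))" using t S(2) by (intro Max_ge) auto
    finally show ?thesis .
  qed
  then show ?thesis by blast
qed

lemma bounded_of_onesided_limits:
  fixes f :: "real \<Rightarrow> 'b::real_normed_vector"
  assumes right: "\<And>t. t \<in> {0..<T} \<Longrightarrow> \<exists>l. (f \<longlongrightarrow> l) (at_right t)"
    and left: "\<And>t. t \<in> {0<..T} \<Longrightarrow> \<exists>l. (f \<longlongrightarrow> l) (at_left t)"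
  shows "\<exists>B. \<forall>s\<in>{0..T}. norm (f s) \<le> B"
proof (rule bounded_of_locally_bounded)
  fix t assume t: "t \<in> {0..T}"
  have R: "\<exists>b>t. \<exists>B. \<forall>s. t < s \<and> s < b \<and> s \<le> T \<longrightarrow> norm (f s) \<le> B"
  proof (cases "t < T")
    case True
    then obtain l where "(f \<longlongrightarrow> l) (at_right t)" using right[of t] t by auto
    then have "\<forall>\<^sub>F s in at_right t. dist (f s) l < 1" by (rule tendstoD) simp
    then obtain b where b: "b > t" "\<And>s. t < s \<Longrightarrow> s < b \<Longrightarrow> dist (f s) l < 1"
      by (auto simp: eventually_at_right_field)
    have "norm (f s) \<le> norm l + 1" if "t < s" "s < b" for s
      using b(2)[OF that] norm_triangle_ineq2[of "f s" l] by (simp add: dist_norm)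
    then show ?thesis using b(1) by blast
  qed (use t in \<open>auto intro!: exI[of _ "t + 1"]\<close>)
  have L: "\<exists>a<t. \<exists>B. \<forall>s. a < s \<and> s < t \<and> 0 \<le> s \<longrightarrow> norm (f s) \<le> B"
  proof (cases "0 < t")
    case True
    then obtain l where "(f \<longlongrightarrow> l) (at_left t)" using left[of t] t by auto
    then have "\<forall>\<^sub>F s in at_left t. dist (f s) l < 1" by (rule tendstoD) simp
    then obtain a where a: "a < t" "\<And>s. a < s \<Longrightarrow> s < t \<Longrightarrow> dist (f s) l < 1"
      by (auto simp: eventually_at_left_field)
    have "norm (f s) \<le> norm l + 1" if "a < s" "s < t" for s
      using a(2)[OF that] norm_triangle_ineq2[of "f s" l] by (simp add: dist_norm)
    then show ?thesis using a(1) by blast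
  qed (use t in \<open>auto intro!: exI[of _ "t - 1"]\<close>)
  obtain b B where b: "b > t" "\<And>s. t < s \<Longrightarrow> s < b \<Longrightarrow> s \<le> T \<Longrightarrow> norm (f s) \<le> B" using R by blast
  obtain a B' where a: "a < t" "\<And>s. a < s \<Longrightarrow> s < t \<Longrightarrow> 0 \<le> s \<Longrightarrow> norm (f s) \<le> B'" using L by blast
  show "\<exists>d>0. \<exists>B. \<forall>s\<in>{0..T}. \<bar>s - t\<bar> < d \<longrightarrow> norm (f s) \<le> B"
  proof (intro exI conjI ballI impI)
    show "min (b - t) (t - a) > 0" using a b by simp
    fix s assume s: "s \<in> {0..T}" "\<bar>s - t\<bar> < min (b - t) (t - a)"
    consider "s = t" | "t < s" | "s < t" by linarith
    then show "norm (f s) \<le> max (norm (f t)) (max B B')"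
      by cases (use s a(2)[of s] b(2)[of s] in \<open>auto simp: le_max_iff_disj\<close>)
  qed
qed

lemma cadlag_bounded:
  fixes f :: "real \<Rightarrow> 'b::real_normed_vector"
  assumes "cadlag T f"
  obtains B where "\<And>s. s \<in> {0..T} \<Longrightarrow> norm (f s) \<le> B"
  using bounded_of_onesided_limits[of T f] assms unfolding cadlag_def by blast

lemma caglad_bounded:
  fixes f :: "real \<Rightarrow> 'b::real_normed_vector"
  assumes "caglad T f"
  obtains B where "\<And>s. s \<in> {0..T} \<Longrightarrow> norm (f s) \<le> B"
  using bounded_of_onesided_limits[of T f] assms unfolding caglad_def by blast

lemma leftlim_tendsto:
  assumes "cadlag T f" "t \<in> {0<..T}"
  shows "(f \<longlongrightarrow> leftlim f t) (at_left t)"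
proof -
  obtain l where l: "(f \<longlongrightarrow> l) (at_left t)" using assms unfolding cadlag_def by blast
  then have "Lim (at_left t) f = l" by (intro tendsto_Lim) auto
  then show ?thesis using l assms by (simp add: leftlim_def)
qed

lemma leftlim_eqI: "(f \<longlongrightarrow> l) (at_left t) \<Longrightarrow> t > 0 \<Longrightarrow> leftlim f t = l"
  unfolding leftlim_def by (auto intro: tendsto_Lim)

lemma eventually_at_left_interval:
  fixes t :: real
  shows "a < t \<Longrightarrow> (\<And>s. a < s \<Longrightarrow> s < t \<Longrightarrow> P s) \<Longrightarrow> \<forall>\<^sub>F s in at_left t. P s"
  by (auto simp: eventually_at_left_field)

lemma eventually_at_right_interval:
  fixes t :: real
  shows "t < a \<Longrightarrow> (\<And>s. t < s \<Longrightarrow> s < a \<Longrightarrow> P s) \<Longrightarrow> \<forall>\<^sub>F s in at_right t. P s"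
  by (auto simp: eventually_at_right_field)

text \<open>Applied to the square root on the closed cone of positive semidefinite matrices, and to
  projections and averages on the whole space.\<close>

lemma
  fixes f :: "real \<Rightarrow> 'b::t2_space" and g :: "'b \<Rightarrow> 'c::t2_space"
  assumes f: "cadlag T f" and S: "closed S" "\<And>s. s \<in> {0..T} \<Longrightarrow> f s \<in> S" and g: "continuous_on S g"
  shows leftlim_in_closed: "t \<in> {0..T} \<Longrightarrow> leftlim f t \<in> S"
    and cadlag_compose: "cadlag T (\<lambda>s. g (f s))"
    and leftlim_compose: "t \<in> {0..T} \<Longrightarrow> leftlim (\<lambda>s. g (f s)) t = g (leftlim f t)"
proof -
  have evl: "\<forall>\<^sub>F s in at_left t. f s \<in> S" if "t \<in> {0<..T}" for t
    using that S(2) by (intro eventually_at_left_interval[of 0]) auto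
  have evr: "\<forall>\<^sub>F s in at_right t. f s \<in> S" if "t \<in> {0..<T}" for t
    using that S(2) by (intro eventually_at_right_interval[of _ T]) auto
  have inS: "leftlim f t \<in> S" if "t \<in> {0<..T}" for t
    using Lim_in_closed_set[OF S(1) evl[OF that] _ leftlim_tendsto[OF f that]] by simp
  show "leftlim f t \<in> S" if "t \<in> {0..T}"
    using inS[of t] S(2)[of 0] that by (cases "t = 0") (auto simp: leftlim_def)
  have tl: "((\<lambda>s. g (f s)) \<longlongrightarrow> g (leftlim f t)) (at_left t)" if "t \<in> {0<..T}" for t
    by (rule continuous_on_tendsto_compose[OF g leftlim_tendsto[OF f that] inS[OF that] evl[OF that]])
  show "cadlag T (\<lambda>s. g (f s))"
    unfolding cadlag_def
  proof (intro conjI ballI)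
    fix t assume t: "t \<in> {0..<T}"
    then show "((\<lambda>s. g (f s)) \<longlongrightarrow> g (f t)) (at_right t)"
      using f S(2) by (intro continuous_on_tendsto_compose[OF g _ _ evr[OF t]]) (auto simp: cadlag_def)
  qed (use tl in blast)
  show "leftlim (\<lambda>s. g (f s)) t = g (leftlim f t)" if "t \<in> {0..T}"
    using that leftlim_eqI[OF tl[of t]] by (cases "t = 0") (auto simp: leftlim_def)
qed

lemma cadlag_right_modulus:
  fixes f :: "real \<Rightarrow> 'b::real_normed_vector"
  assumes f: "cadlag T f" and t: "0 \<le> t" "t < T" and "\<epsilon> > 0"
  obtains d where "d > 0" "t + d \<le> T" "\<And>s. t \<le> s \<Longrightarrow> s < t + d \<Longrightarrow> norm (f s - f t) \<le> \<epsilon>"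
    "\<And>s. t < s \<Longrightarrow> s < t + d \<Longrightarrow> norm (leftlim f s - f t) \<le> \<epsilon>"
proof -
  have "(f \<longlongrightarrow> f t) (at_right t)" using f t by (auto simp: cadlag_def)
  then have "\<forall>\<^sub>F s in at_right t. dist (f s) (f t) < \<epsilon>" by (rule tendstoD) fact
  then obtain b where b: "b > t" "\<And>s. t < s \<Longrightarrow> s < b \<Longrightarrow> norm (f s - f t) < \<epsilon>"
    by (auto simp: eventually_at_right_field dist_norm)
  define d where "d = min (b - t) (T - t)"
  have near: "norm (f s - f t) \<le> \<epsilon>" if "t \<le> s" "s < t + d" for s
  proof (cases "s = t")
    case False
    have "d \<le> b - t" by (simp add: d_def)
    then have "s < b" using that by linarith
    then show ?thesis using b(2)[of s] that False by simp
  qed (use \<open>\<epsilon> > 0\<close> in simp)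
  show ?thesis
  proof
    show "d > 0" "t + d \<le> T" using b t by (auto simp: d_def)
    show "norm (leftlim f s - f t) \<le> \<epsilon>" if s: "t < s" "s < t + d" for s
    proof -
      have "s \<in> {0<..T}" using s t by (auto simp: d_def)
      then have "((\<lambda>u. norm (f u - f t)) \<longlongrightarrow> norm (leftlim f s - f t)) (at_left s)"
        by (intro tendsto_intros leftlim_tendsto[OF f])
      moreover have "\<forall>\<^sub>F u in at_left s. norm (f u - f t) \<le> \<epsilon>"
        using s near by (intro eventually_at_left_interval[of t]) auto
      ultimately show ?thesis by (rule tendsto_upperbound) simp
    qed
  qed (use near in auto)
qed

lemma cadlag_left_modulus:
  fixes f :: "real \<Rightarrow> 'b::real_normed_vector"
  assumes f: "cadlag T f" and t: "0 < t" "t \<le> T" and "\<epsilon> > 0"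
  obtains d where "d > 0" "d \<le> t" "\<And>s. t - d < s \<Longrightarrow> s < t \<Longrightarrow> norm (f s - leftlim f t) \<le> \<epsilon>"
    "\<And>s. t - d < s \<Longrightarrow> s \<le> t \<Longrightarrow> norm (leftlim f s - leftlim f t) \<le> \<epsilon>"
proof -
  have "(f \<longlongrightarrow> leftlim f t) (at_left t)" using leftlim_tendsto[OF f] t by auto
  then have "\<forall>\<^sub>F s in at_left t. dist (f s) (leftlim f t) < \<epsilon>" by (rule tendstoD) fact
  then obtain b where b: "b < t" "\<And>s. b < s \<Longrightarrow> s < t \<Longrightarrow> norm (f s - leftlim f t) < \<epsilon>"
    by (auto simp: eventually_at_left_field dist_norm)
  define d where "d = min (t - b) t"
  have near: "norm (f s - leftlim f t) \<le> \<epsilon>" if "t - d < s" "s < t" for s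
  proof -
    have "d \<le> t - b" by (simp add: d_def)
    then have "b < s" using that by linarith
    then show ?thesis using b(2)[of s] that by simp
  qed
  show ?thesis
  proof
    show "d > 0" "d \<le> t" using b t by (auto simp: d_def)
    show "norm (leftlim f s - leftlim f t) \<le> \<epsilon>" if s: "t - d < s" "s \<le> t" for s
    proof -
      have "s \<in> {0<..T}" using s t by (auto simp: d_def)
      then have "((\<lambda>u. norm (f u - leftlim f t)) \<longlongrightarrow> norm (leftlim f s - leftlim f t)) (at_left s)"
        by (intro tendsto_intros leftlim_tendsto[OF f])
      moreover have "\<forall>\<^sub>F u in at_left s. norm (f u - leftlim f t) \<le> \<epsilon>"
        using s near by (intro eventually_at_left_interval[of "t - d"]) auto
      ultimately show ?thesis by (rule tendsto_upperbound) simp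
    qed
  qed (use near in auto)
qed

lemma leftlim_measurable:
  fixes X :: "real \<Rightarrow> 'a \<Rightarrow> 'b::{metric_space}"
  assumes X: "\<And>s. s \<in> {0..T} \<Longrightarrow> X s \<in> borel_measurable M"
    and cadlag: "\<And>\<omega>. \<omega> \<in> space M \<Longrightarrow> cadlag T (\<lambda>s. X s \<omega>)" and t: "t \<in> {0..T}"
  shows "(\<lambda>\<omega>. leftlim (\<lambda>s. X s \<omega>) t) \<in> borel_measurable M"
proof (cases "t = 0")
  case True
  then show ?thesis using X[of 0] t by (simp add: leftlim_def)
next
  case False
  then have t: "t \<in> {0<..T}" "0 < t" using t by auto
  \<comment> \<open>The offset 2 keeps \<open>u 0\<close> strictly positive.\<close>
  define u where "u k = t - t / real (k + 2)" for k
  have u: "u k \<in> {0<..<t}" for k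
  proof -
    have "t * 1 < t * real (k + 2)" using t by (intro mult_strict_left_mono) auto
    then show ?thesis using t by (simp add: u_def divide_less_eq)
  qed
  have "u \<longlonglongrightarrow> t - 0" unfolding u_def
    by (intro tendsto_diff tendsto_const LIMSEQ_ignore_initial_segment[where k = 2, OF lim_const_over_n])
  then have "filterlim u (at_left t) sequentially"
    using u by (auto simp: filterlim_at intro!: always_eventually)
  then have "(\<lambda>k. X (u k) \<omega>) \<longlonglongrightarrow> leftlim (\<lambda>s. X s \<omega>) t" if "\<omega> \<in> space M" for \<omega>
    by (rule filterlim_compose[OF leftlim_tendsto[OF cadlag[OF that] t(1)]])
  then show ?thesis
  proof (rule borel_measurable_LIMSEQ_metric[rotated])
    show "X (u k) \<in> borel_measurable M" for k using u[of k] t by (intro X) auto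
  qed
qed

section \<open>Convergence in probability\<close>

text \<open>Dominated convergence of indicators. It turns pathwise statements with random constants
  into statements on probabilities.\<close>

lemma (in prob_space) prob_eventually_not_in:
  assumes E: "\<And>j. E j \<in> events" and AE: "AE \<omega> in M. \<forall>\<^sub>F j in sequentially. \<omega> \<notin> E j"
  shows "(\<lambda>j. prob (E j)) \<longlonglongrightarrow> 0"
proof -
  have "(\<lambda>j. \<integral>\<omega>. indicat_real (E j) \<omega> \<partial>M) \<longlonglongrightarrow> (\<integral>\<omega>. 0 \<partial>M)"
  proof (rule integral_dominated_convergence[where w = "\<lambda>_. 1"])
    show "AE \<omega> in M. (\<lambda>j. indicat_real (E j) \<omega>) \<longlonglongrightarrow> 0"
      using AE by eventually_elim (auto intro!: tendsto_eventually elim: eventually_mono)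
  qed (use E in \<open>auto simp: indicator_def\<close>)
  then show ?thesis using E by simp
qed

lemma (in prob_space) prob_gt_le_expectation:
  assumes U: "U \<in> borel_measurable M" and le: "(\<integral>\<^sup>+\<omega>. ennreal (U \<omega>) \<partial>M) \<le> ennreal c" and "a > 0" "c \<ge> 0"
  shows "prob {\<omega>\<in>space M. U \<omega> > a} \<le> c / a"
proof -
  have "emeasure M {\<omega>\<in>space M. U \<omega> > a} \<le> emeasure M {\<omega>\<in>space M. 1 \<le> ennreal (1 / a) * ennreal (U \<omega>)}"
  proof (rule emeasure_mono)
    show "{\<omega>\<in>space M. U \<omega> > a} \<subseteq> {\<omega>\<in>space M. 1 \<le> ennreal (1 / a) * ennreal (U \<omega>)}"
    proof safe
      fix \<omega> assume "a < U \<omega>"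
      then have "1 \<le> 1 / a * U \<omega>" using \<open>a > 0\<close> by (simp add: field_simps)
      then show "1 \<le> ennreal (1 / a) * ennreal (U \<omega>)"
        using \<open>a > 0\<close> by (simp add: ennreal_mult'[symmetric] ennreal_ge_1 del: times_divide_eq_left)
    qed
  qed (use U in measurable)
  also have "\<dots> \<le> ennreal (1 / a) * (\<integral>\<^sup>+\<omega>. ennreal (U \<omega>) * indicator (space M) \<omega> \<partial>M)"
    using nn_integral_Markov_inequality[where u = "\<lambda>\<omega>. ennreal (U \<omega>)" and M = M and A = "space M" and c = "ennreal (1 / a)"] U
    by simp
  also have "\<dots> = ennreal (1 / a) * (\<integral>\<^sup>+\<omega>. ennreal (U \<omega>) \<partial>M)"
    by (intro arg_cong2[where f = "(*)"] nn_integral_cong) auto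
  also have "\<dots> \<le> ennreal (1 / a) * ennreal c" using le by (intro mult_left_mono) auto
  also have "\<dots> = ennreal (c / a)" using assms by (simp add: ennreal_mult[symmetric])
  finally show ?thesis using assms by (simp add: emeasure_eq_measure)
qed

lemma (in prob_space) prob_gt_tendsto_0:
  assumes U: "\<And>j. U j \<in> borel_measurable M" and lim: "(\<lambda>j. \<integral>\<^sup>+\<omega>. ennreal (U j \<omega>) \<partial>M) \<longlonglongrightarrow> 0" and "a > 0"
  shows "(\<lambda>j. prob {\<omega>\<in>space M. U j \<omega> > a}) \<longlonglongrightarrow> 0"
proof (rule tendstoI)
  fix e :: real assume "e > 0"
  then have "\<forall>\<^sub>F j in sequentially. (\<integral>\<^sup>+\<omega>. ennreal (U j \<omega>) \<partial>M) < ennreal (a * e / 2)"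
    using lim \<open>a > 0\<close> by (intro order_tendstoD) auto
  then show "\<forall>\<^sub>F j in sequentially. dist (prob {\<omega>\<in>space M. U j \<omega> > a}) 0 < e"
  proof eventually_elim
    case (elim j)
    have "prob {\<omega>\<in>space M. U j \<omega> > a} \<le> (a * e / 2) / a"
      using elim \<open>a > 0\<close> \<open>e > 0\<close> by (intro prob_gt_le_expectation U) auto
    then show ?case using \<open>a > 0\<close> \<open>e > 0\<close> by simp
  qed
qed

text \<open>Truncation by the nearest point of a ball: bounded by \<open>R\<close>, 1-Lipschitz, and
  the identity on the ball. These are the only properties that enter the estimates.\<close>

definition proj :: "real \<Rightarrow> real^'n^'n \<Rightarrow> real^'n^'n" where
  "proj R = closest_point (cball 0 R)"

lemma norm_proj_le: "0 \<le> R \<Longrightarrow> norm (proj R x) \<le> R"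
  using closest_point_in_set[of "cball 0 R" x] by (simp add: proj_def)

lemma proj_lipschitz: "0 \<le> R \<Longrightarrow> norm (proj R x - proj R y) \<le> norm (x - y)"
  using closest_point_lipschitz[of "cball 0 R" x y] by (simp add: proj_def dist_norm)

lemma proj_self: "norm x \<le> R \<Longrightarrow> proj R x = x"
  by (simp add: proj_def closest_point_self)

lemma continuous_proj: "0 \<le> R \<Longrightarrow> continuous_on S (proj R)"
  unfolding proj_def by (intro continuous_on_closest_point) auto

lemma norm_diff_proj_le:
  assumes "0 \<le> R" shows "norm (proj R x - proj R y) \<le> 2 * R"
  using norm_triangle_ineq4[of "proj R x" "proj R y"] norm_proj_le[OF assms, of x] norm_proj_le[OF assms, of y] by linarith

lemma measurable_proj: "0 \<le> R \<Longrightarrow> proj R \<in> borel_measurable borel"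
  by (intro borel_measurable_continuous_onI continuous_proj)

lemma norm_sq_triangle: "(norm (x - z))\<^sup>2 \<le> 2 * (norm (x - y))\<^sup>2 + 2 * (norm (y - z))\<^sup>2"
  for x y z :: "'b::real_normed_vector"
proof -
  have "norm (x - z) \<le> norm (x - y) + norm (y - z)"
    using norm_triangle_ineq[of "x - y" "y - z"] by simp
  then have "(norm (x - z))\<^sup>2 \<le> (norm (x - y) + norm (y - z))\<^sup>2" by (intro power_mono) auto
  also have "\<dots> \<le> 2 * (norm (x - y))\<^sup>2 + 2 * (norm (y - z))\<^sup>2"
    using zero_le_power2[of "norm (x - y) - norm (y - z)"] by (simp add: power2_eq_square algebra_simps)
  finally show ?thesis .
qed

lemma nn_integral_weighted_sum:
  assumes "\<And>i. i \<in> S \<Longrightarrow> 0 \<le> c i" "\<And>i. i \<in> S \<Longrightarrow> a i \<in> borel_measurable M"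
    and "\<And>i \<omega>. i \<in> S \<Longrightarrow> \<omega> \<in> space M \<Longrightarrow> 0 \<le> a i \<omega>"
  shows "(\<integral>\<^sup>+\<omega>. ennreal (\<Sum>i\<in>S. c i * a i \<omega>) \<partial>M) = (\<Sum>i\<in>S. ennreal (c i) * (\<integral>\<^sup>+\<omega>. ennreal (a i \<omega>) \<partial>M))"
proof -
  have "(\<integral>\<^sup>+\<omega>. ennreal (\<Sum>i\<in>S. c i * a i \<omega>) \<partial>M) = (\<integral>\<^sup>+\<omega>. (\<Sum>i\<in>S. ennreal (c i) * ennreal (a i \<omega>)) \<partial>M)"
    using assms by (intro nn_integral_cong) (auto simp: ennreal_mult[symmetric] intro!: sum_ennreal[symmetric])
  also have "\<dots> = (\<Sum>i\<in>S. ennreal (c i) * (\<integral>\<^sup>+\<omega>. ennreal (a i \<omega>) \<partial>M))"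
    using assms by (subst nn_integral_sum) (auto intro!: sum.cong nn_integral_cmult)
  finally show ?thesis .
qed

section \<open>Estimates for simple integrals over one cell, and joint measurability\<close>

context brownian_setup
begin

lemma discrete_integral_measurable_M:
  assumes "partition_integrand r B k"
  shows "discrete_integral r B k \<in> borel_measurable M"
proof -
  have "r k \<in> {0..T}" using assms by (auto simp: partition_integrand_def)
  then show ?thesis by (rule measurable_F_M) (rule discrete_integral_measurable[OF assms])
qed

text \<open>The square of the scaling factor sqrt m cancels the length 1/m of the interval, so the
  bound does not depend on \<open>m\<close>.\<close>

lemma discrete_integral_exp_growth:
  fixes B :: "nat \<Rightarrow> 'a \<Rightarrow> real^'n^'m"
  assumes P: "partition_integrand r B k" and B: "\<And>i \<omega>. i < k \<Longrightarrow> \<omega> \<in> space M \<Longrightarrow> norm (B i \<omega>) \<le> R"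
    and m: "m > 0" "r k - r 0 \<le> 1 / real m"
  shows "(\<integral>\<^sup>+\<omega>. ennreal (exp_growth (sqrt (real m) *\<^sub>R discrete_integral r B k \<omega>)) \<partial>M)
     \<le> ennreal (2 * real CARD('m) * exp (R\<^sup>2 / 2))"
proof -
  have [measurable]: "discrete_integral r B k \<in> borel_measurable M" by (rule discrete_integral_measurable_M[OF P])
  have b: "(\<integral>\<^sup>+\<omega>. ennreal (exp (c * discrete_integral r B k \<omega> $ a)) \<partial>M) \<le> ennreal (exp (R\<^sup>2 / 2))"
    if "c\<^sup>2 = real m" for c a
  proof -
    have "c\<^sup>2 * R\<^sup>2 * (r k - r 0) \<le> real m * R\<^sup>2 * (1 / real m)"
      unfolding that using m(2) by (intro mult_left_mono) auto
    also have "\<dots> = R\<^sup>2" using m by simp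
    finally show ?thesis
      by (intro order_trans[OF discrete_integral_exp[OF P B]] ennreal_leI) auto
  qed
  have "(\<integral>\<^sup>+\<omega>. ennreal (exp_growth (sqrt (real m) *\<^sub>R discrete_integral r B k \<omega>)) \<partial>M)
     = (\<integral>\<^sup>+\<omega>. (\<Sum>a\<in>UNIV. ennreal (exp (sqrt (real m) * discrete_integral r B k \<omega> $ a)) + ennreal (exp ((- sqrt (real m)) * discrete_integral r B k \<omega> $ a))) \<partial>M)"
    unfolding exp_growth_def
    by (simp add: sum_ennreal[symmetric] add_nonneg_nonneg del: sum_ennreal)
  also have "\<dots> = (\<Sum>a\<in>UNIV. (\<integral>\<^sup>+\<omega>. ennreal (exp (sqrt (real m) * discrete_integral r B k \<omega> $ a)) \<partial>M)
      + (\<integral>\<^sup>+\<omega>. ennreal (exp ((- sqrt (real m)) * discrete_integral r B k \<omega> $ a)) \<partial>M))"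
    by (subst nn_integral_sum) (auto intro!: sum.cong nn_integral_add)
  also have "\<dots> \<le> (\<Sum>a\<in>(UNIV::'m set). ennreal (exp (R\<^sup>2 / 2)) + ennreal (exp (R\<^sup>2 / 2)))"
    by (intro sum_mono add_mono b) auto
  also have "\<dots> = ennreal (2 * real CARD('m) * exp (R\<^sup>2 / 2))"
    by (simp add: ennreal_plus[symmetric] ennreal_of_nat_eq_real_of_nat ennreal_mult[symmetric] mult_ac del: ennreal_plus)
  finally show ?thesis .
qed

text \<open>As \<open>S\<close> is known at time \<open>a\<close>, the difference is again a
  discrete integral, with integrand \<open>A - S\<close> on the cells clipped to the interval, and
  the isometry applies.\<close>

lemma simple_integral_compare:
  assumes A: "simple_integrand M F T k ts A" and ts: "ts 0 = 0" "ts k = T"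
    and ab: "0 \<le> a" "a \<le> b" "b \<le> T" and S: "S \<in> borel_measurable (F a)"
  shows "(\<integral>\<^sup>+\<omega>. ennreal ((norm (simple_integral Z k ts A b \<omega> - simple_integral Z k ts A a \<omega> - S \<omega> *v (Z b \<omega> - Z a \<omega>)))\<^sup>2) \<partial>M)
    = (\<integral>\<^sup>+\<omega>. (\<integral>\<^sup>+s. ennreal ((norm (simple_value k ts A s \<omega> - S \<omega>))\<^sup>2) * indicator {a<..b} s \<partial>lborel) \<partial>M)"
proof -
  define r where "r i = clip a b (ts i)" for i
  define B where "B i \<omega> = (if r i < r (Suc i) then A i \<omega> - S \<omega> else 0)" for i \<omega>
  have mono: "\<And>i. i < k \<Longrightarrow> ts i \<le> ts (Suc i)" and Am: "\<And>i. i < k \<Longrightarrow> ts i \<in> {0..T} \<and> A i \<in> borel_measurable (F (ts i))"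
    using A by (auto simp: simple_integrand_def)
  have rmono: "r i \<le> r (Suc i)" if "i < k" for i using clip_mono[OF mono[OF that]] by (simp add: r_def)
  have r0: "r 0 = a" "r k = b" using ab ts by (auto simp: r_def clip_def)
  have P0: "partition_integrand r (clipped_integrand a b ts A) k"
    unfolding r_def using Am mono by (intro clipped_partition ab)
  have rab: "a \<le> r i" "r i \<le> b" for i using clip_range[OF ab(2), of "ts i"] by (auto simp: r_def)
  have P: "partition_integrand r B k"
    unfolding partition_integrand_def
  proof (intro conjI allI impI)
    fix i assume i: "i < k"
    have [measurable]: "S \<in> borel_measurable (F (r i))" using measurable_F_mono[OF S ab(1) rab(1)] rab(2)[of i] ab by simp
    have [measurable]: "clipped_integrand a b ts A i \<in> borel_measurable (F (r i))" using P0 i by (simp add: partition_integrand_def)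
    have "B i = (\<lambda>\<omega>. if r i < r (Suc i) then clipped_integrand a b ts A i \<omega> - S \<omega> else 0)"
      by (auto simp: B_def clipped_integrand_def r_def fun_eq_iff)
    then show "B i \<in> borel_measurable (F (r i))" by simp
  qed (use P0 in \<open>auto simp: partition_integrand_def\<close>)
  have tel: "(\<Sum>i<j. Z (r (Suc i)) \<omega> - Z (r i) \<omega>) = Z (r j) \<omega> - Z (r 0) \<omega>" for j \<omega>
    by (induction j) auto
  have lin: "(\<Sum>i<j. S \<omega> *v (Z (r (Suc i)) \<omega> - Z (r i) \<omega>)) = S \<omega> *v (\<Sum>i<j. Z (r (Suc i)) \<omega> - Z (r i) \<omega>)" for j \<omega>
    by (induction j) (auto simp: matrix_vector_right_distrib)
  have "simple_integral Z k ts A b \<omega> - simple_integral Z k ts A a \<omega> - S \<omega> *v (Z b \<omega> - Z a \<omega>) = discrete_integral r B k \<omega>" for \<omega>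
  proof -
    have "S \<omega> *v (Z b \<omega> - Z a \<omega>) = (\<Sum>i<k. S \<omega> *v (Z (r (Suc i)) \<omega> - Z (r i) \<omega>))"
      using lin[of \<omega> k] tel[of \<omega> k] r0 by simp
    moreover have "simple_integral Z k ts A b \<omega> - simple_integral Z k ts A a \<omega> = discrete_integral r (clipped_integrand a b ts A) k \<omega>"
      unfolding r_def using mono by (intro simple_integral_increment ab)
    moreover have "clipped_integrand a b ts A i \<omega> *v (Z (r (Suc i)) \<omega> - Z (r i) \<omega>) - S \<omega> *v (Z (r (Suc i)) \<omega> - Z (r i) \<omega>)
       = B i \<omega> *v (Z (r (Suc i)) \<omega> - Z (r i) \<omega>)" if "i < k" for i
    proof (cases "r i < r (Suc i)")
      case True
      then show ?thesis by (simp add: B_def clipped_integrand_def r_def[symmetric] matrix_vector_mult_diff_rdistrib)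
    next
      case False
      then have "r i = r (Suc i)" using rmono[OF that] by simp
      then show ?thesis by (simp add: B_def)
    qed
    ultimately show ?thesis by (simp add: discrete_integral_def sum_subtractf[symmetric])
  qed
  then have "(\<integral>\<^sup>+\<omega>. ennreal ((norm (simple_integral Z k ts A b \<omega> - simple_integral Z k ts A a \<omega> - S \<omega> *v (Z b \<omega> - Z a \<omega>)))\<^sup>2) \<partial>M)
     = (\<integral>\<^sup>+\<omega>. ennreal (\<Sum>i<k. (r (Suc i) - r i) * (norm (B i \<omega>))\<^sup>2) \<partial>M)"
    using discrete_integral_isometry[OF P] by simp
  moreover have "(\<Sum>i<k. (r (Suc i) - r i) * (norm (B i \<omega>))\<^sup>2) = (\<Sum>i<k. (r (Suc i) - r i) * (norm (A i \<omega> - S \<omega>))\<^sup>2)" for \<omega>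
    using rmono by (intro sum.cong refl) (force simp: B_def)
  moreover have "ennreal (\<Sum>i<k. (r (Suc i) - r i) * (norm (A i \<omega> - S \<omega>))\<^sup>2)
     = (\<integral>\<^sup>+s. ennreal ((norm (simple_value k ts A s \<omega> - S \<omega>))\<^sup>2) * indicator {a<..b} s \<partial>lborel)" for \<omega>
    unfolding r_def using ab ts mono
    by (intro nn_integral_simple_value[where \<phi> = "\<lambda>x. (norm (x - S \<omega>))\<^sup>2", symmetric]) auto
  ultimately show ?thesis by simp
qed

lemma simple_value_joint_measurable:
  assumes "simple_integrand M F T k ts A"
  shows "(\<lambda>p. simple_value k ts A (snd p) (fst p)) \<in> borel_measurable (M \<Otimes>\<^sub>M borel)"
proof -
  have "A i \<in> borel_measurable M" if "i < k" for i
  proof -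
    have "ts i \<in> {0..T}" "A i \<in> borel_measurable (F (ts i))" using assms that by (auto simp: simple_integrand_def)
    then show ?thesis by (rule measurable_F_M)
  qed
  then show ?thesis unfolding simple_value_def by (intro borel_measurable_sum) auto
qed

lemma progressive_joint_measurable:
  fixes H :: "real \<Rightarrow> 'a \<Rightarrow> 'b::real_normed_vector"
  assumes "progressive F T H"
  shows "(\<lambda>p. if snd p \<in> {0..T} then H (snd p) (fst p) else 0) \<in> borel_measurable (M \<Otimes>\<^sub>M borel)"
proof -
  have H: "(\<lambda>(s, \<omega>). H s \<omega>) \<in> borel_measurable (restrict_space borel {0..T} \<Otimes>\<^sub>M F T)"
    using assms T_pos by (auto simp: progressive_def)
  have FT: "(\<lambda>p. fst p) \<in> measurable (restrict_space (M \<Otimes>\<^sub>M borel) {p. snd p \<in> {0..T}}) (F T)"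
  proof -
    have "(\<lambda>p. fst p) \<in> measurable (M \<Otimes>\<^sub>M (borel :: real measure)) (F T)"
      using T_pos by (intro measurable_compose[OF measurable_fst measurable_from_subalg[OF subalg[of T]]]) auto
    then show ?thesis by (rule measurable_restrict_space1)
  qed
  have "(\<lambda>p. snd p) \<in> measurable (restrict_space (M \<Otimes>\<^sub>M borel) {p. snd p \<in> {0..T}}) (restrict_space borel {0..T})"
    by (intro measurable_restrict_space2 measurable_restrict_space1 measurable_snd) (auto simp: space_restrict_space)
  then have "(\<lambda>p. (snd p, fst p)) \<in> measurable (restrict_space (M \<Otimes>\<^sub>M borel) {p. snd p \<in> {0..T}}) (restrict_space borel {0..T} \<Otimes>\<^sub>M F T)"
    using FT by (intro measurable_Pair)
  from measurable_compose[OF this H]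
  have 1: "(\<lambda>p. H (snd p) (fst p)) \<in> borel_measurable (restrict_space (M \<Otimes>\<^sub>M borel) {p. snd p \<in> {0..T}})" by simp
  have "{p. snd p \<in> {0..T}} \<inter> space (M \<Otimes>\<^sub>M borel) \<in> sets (M \<Otimes>\<^sub>M (borel :: real measure))"
  proof -
    have "{p. snd p \<in> {0..T}} \<inter> space (M \<Otimes>\<^sub>M borel) = space M \<times> {0..T}" by (auto simp: space_pair_measure)
    then show ?thesis by simp
  qed
  then show ?thesis
    using 1 by (subst measurable_If_restrict_space_iff) auto
qed

end

section \<open>The diffusion part\<close>

text \<open>\<open>Sg\<close> is the volatility as a cadlag process and \<open>H\<close> its
  left-continuous version, the integrand of \<open>I\<close>. The process \<open>D\<close> differs
  from \<open>I\<close> by a path that is Lipschitz with a random constant, which is all the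
  information kept on the drift.\<close>

locale fejer_diffusion = fejer_point T n N t0 t1 t + brownian_poly M F T Z f C q
  for T :: real and n N :: "nat \<Rightarrow> nat" and t0 t1 t :: real
    and M :: "'a measure" and F :: "real \<Rightarrow> 'a measure" and Z :: "real \<Rightarrow> 'a \<Rightarrow> real^'n"
    and f :: "real^'n \<Rightarrow> real" and C :: real and q :: nat +
  fixes Sg :: "real \<Rightarrow> 'a \<Rightarrow> real^'n^'n" and H :: "real \<Rightarrow> 'a \<Rightarrow> real^'n^'n" and I D :: "real \<Rightarrow> 'a \<Rightarrow> real^'n"
  assumes Sg_adapted: "adapted F T Sg"
    and Sg_cadlag: "\<And>\<omega>. \<omega> \<in> space M \<Longrightarrow> cadlag T (\<lambda>u. Sg u \<omega>)"
    and H_eq: "\<And>\<omega> s. \<omega> \<in> space M \<Longrightarrow> s \<in> {0<..T} \<Longrightarrow> H s \<omega> = leftlim (\<lambda>u. Sg u \<omega>) s"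
    and ito: "is_ito_integral M F T Z H I"
    and D_measurable: "\<And>s. s \<in> {0..T} \<Longrightarrow> D s \<in> borel_measurable M"
    and drift: "AE \<omega> in M. \<exists>c. \<forall>s r. 0 \<le> s \<and> s \<le> r \<and> r \<le> T \<longrightarrow>
       norm ((D r \<omega> - D s \<omega>) - (I r \<omega> - I s \<omega>)) \<le> c * (r - s)"
begin

lemma t0_range: "0 < t0" "t0 \<le> T" and t1_range: "0 \<le> t1" "t1 < T"
  using t01 fejer_asymptotics_axioms by (auto simp: fejer_asymptotics_def)

lemma grid_le_T:
  assumes "i < K j" "n j > 0"
  shows "real (Suc i) / real (n j) \<le> T" "real i / real (n j) \<in> {0..T}" "real (Suc i) / real (n j) \<in> {0..T}"
    "real i / real (n j) \<le> real (Suc i) / real (n j)" "real i / real (n j) < T"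
proof -
  have "real (Suc i) \<le> real (n j) * T"
    using assms(1) by (simp add: zless_nat_eq_int_zless) linarith
  then show 1: "real (Suc i) / real (n j) \<le> T" using assms(2) by (simp add: divide_le_eq mult.commute)
  show 2: "real i / real (n j) \<le> real (Suc i) / real (n j)" by (simp add: divide_right_mono)
  show "real i / real (n j) < T"
    using 1 divide_strict_right_mono[of "real i" "real (Suc i)" "real (n j)"] assms(2) by simp
  then show "real i / real (n j) \<in> {0..T}" by simp
  show "real (Suc i) / real (n j) \<in> {0..T}" using 1 by simp
qed

lemma w_nonneg: "0 \<le> w t j i"
  using t01 fejer_asymptotics_axioms by (intro fejer_weight_nonneg) (auto simp: fejer_asymptotics_def)

lemma Sg_measurable: "s \<in> {0..T} \<Longrightarrow> Sg s \<in> borel_measurable (F s)"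
  using Sg_adapted by (auto simp: adapted_def)

lemma Sg_measurable_M: "s \<in> {0..T} \<Longrightarrow> Sg s \<in> borel_measurable M"
  using measurable_F_M Sg_measurable by blast

definition left_value :: "'a \<Rightarrow> real^'n^'n" where "left_value \<omega> = leftlim (\<lambda>u. Sg u \<omega>) t0"

lemma left_value_measurable: "left_value \<in> borel_measurable M"
  unfolding left_value_def[abs_def] using t0_range
  by (intro leftlim_measurable[of T] Sg_measurable_M Sg_cadlag) auto

lemma mean_measurable: "mean \<in> borel_measurable borel"
  by (rule borel_measurable_continuous_onI[OF continuous_mean])

definition limit :: "'a \<Rightarrow> real" where "limit \<omega> = (mean (left_value \<omega>) + mean (Sg t1 \<omega>)) / 2"

definition limit_proj :: "real \<Rightarrow> 'a \<Rightarrow> real" where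
  "limit_proj R \<omega> = (mean (proj R (left_value \<omega>)) + mean (proj R (Sg t1 \<omega>))) / 2"

lemma limit_proj_measurable: "0 \<le> R \<Longrightarrow> limit_proj R \<in> borel_measurable M"
  unfolding limit_proj_def[abs_def] using t1_range left_value_measurable Sg_measurable_M[of t1]
  by (intro borel_measurable_divide borel_measurable_add measurable_compose[OF measurable_compose[OF _ measurable_proj] mean_measurable]) auto

lemma limit_measurable: "limit \<in> borel_measurable M"
  unfolding limit_def[abs_def] using t1_range left_value_measurable Sg_measurable_M[of t1]
  by (intro borel_measurable_divide borel_measurable_add measurable_compose[OF _ mean_measurable]) auto

lemma cadlag_proj: "0 \<le> R \<Longrightarrow> \<omega> \<in> space M \<Longrightarrow> cadlag T (\<lambda>u. proj R (Sg u \<omega>))"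
  using cadlag_compose[OF Sg_cadlag closed_UNIV _ continuous_proj] by simp

lemma leftlim_proj: "0 \<le> R \<Longrightarrow> \<omega> \<in> space M \<Longrightarrow> s \<in> {0..T} \<Longrightarrow>
    leftlim (\<lambda>u. proj R (Sg u \<omega>)) s = proj R (leftlim (\<lambda>u. Sg u \<omega>) s)"
  using leftlim_compose[OF Sg_cadlag closed_UNIV _ continuous_proj] by simp

section \<open>Weighted sums along the volatility path\<close>

text \<open>Projected volatilities stay in a compact ball, where \<open>mean\<close> is bounded;
  composed with the path it gives a bounded cadlag function to which
  \<open>weighted_sum_limit\<close> applies.\<close>

lemma mean_sum_limit:
  assumes R: "0 \<le> R" and \<omega>: "\<omega> \<in> space M"
  shows "(\<lambda>j. \<Sum>i<K j. w t j i * mean (proj R (Sg (real i / real (n j)) \<omega>))) \<longlonglongrightarrow> limit_proj R \<omega>"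
proof -
  define g where "g s = mean (proj R (Sg s \<omega>))" for s
  have cg: "continuous_on UNIV (\<lambda>x. mean (proj R x))"
    using continuous_on_compose2[OF continuous_mean continuous_proj[OF R]] by auto
  have g: "cadlag T g"
    unfolding g_def[abs_def] using cadlag_compose[OF Sg_cadlag[OF \<omega>] closed_UNIV _ cg] by simp
  have gl: "leftlim g t0 = mean (proj R (left_value \<omega>))"
    unfolding g_def[abs_def] left_value_def
    using leftlim_compose[OF Sg_cadlag[OF \<omega>] closed_UNIV _ cg, of t0] t0_range by simp
  have "bounded (mean ` cball 0 R)"
    by (intro compact_imp_bounded compact_continuous_image continuous_on_subset[OF continuous_mean]) auto
  then obtain B where "\<forall>x\<in>cball 0 R. \<bar>mean x\<bar> \<le> B" by (auto simp: bounded_iff)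
  then have B: "\<And>x. norm x \<le> R \<Longrightarrow> \<bar>mean x\<bar> \<le> B" by auto
  have "(\<lambda>j. \<Sum>i<K j. w t j i * g (real i / real (n j))) \<longlonglongrightarrow> (leftlim g t0 + g t1) / 2"
  proof (rule weighted_sum_limit)
    show "\<bar>g (real i / real (n j))\<bar> \<le> B" for j i
      unfolding g_def by (intro B norm_proj_le R)
    fix \<epsilon> :: real assume "\<epsilon> > 0"
    obtain d where d: "d > 0" "\<And>s. t1 \<le> s \<Longrightarrow> s < t1 + d \<Longrightarrow> norm (g s - g t1) \<le> \<epsilon>"
      using cadlag_right_modulus[OF g t1_range \<open>\<epsilon> > 0\<close>] by metis
    show "\<exists>d>0. \<forall>\<^sub>F j in sequentially. \<forall>i<K j. t1 \<le> real i / real (n j) \<longrightarrow> real i / real (n j) < t1 + d \<longrightarrow>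
        \<bar>g (real i / real (n j)) - g t1\<bar> \<le> \<epsilon>"
      using d by (intro exI[of _ d]) auto
    obtain d where d: "d > 0" "\<And>s. t0 - d < s \<Longrightarrow> s < t0 \<Longrightarrow> norm (g s - leftlim g t0) \<le> \<epsilon>"
      using cadlag_left_modulus[OF g t0_range \<open>\<epsilon> > 0\<close>] by metis
    \<comment> \<open>Halving \<open>d\<close> turns the non-strict bound of the window into the
      strict one of the modulus.\<close>
    have "\<forall>\<^sub>F j in sequentially. \<forall>i<K j. t0 - d / 2 \<le> real i / real (n j) \<longrightarrow> (real i + 1) / real (n j) \<le> t0 \<longrightarrow>
        \<bar>g (real i / real (n j)) - leftlim g t0\<bar> \<le> \<epsilon>"
      using n_pos
    proof eventually_elim
      case (elim j)
      have "real i / real (n j) < (real i + 1) / real (n j)" for i using elim by (simp add: divide_strict_right_mono)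
      then show ?case using d by (smt (verit) field_sum_of_halves real_norm_def)
    qed
    then show "\<exists>d>0. \<forall>\<^sub>F j in sequentially. \<forall>i<K j. t0 - d \<le> real i / real (n j) \<longrightarrow> (real i + 1) / real (n j) \<le> t0 \<longrightarrow>
        \<bar>g (real i / real (n j)) - leftlim g t0\<bar> \<le> \<epsilon>"
      using d(1) by (intro exI[of _ "d / 2"]) auto
  qed
  then show ?thesis by (simp add: gl g_def limit_proj_def)
qed

text \<open>Progressive measurability gives joint measurability on \<open>{0..T}\<close>; extension
  by 0 carries it to the whole line, where Fubini is applied.\<close>

definition H_ext :: "real \<Rightarrow> 'a \<Rightarrow> real^'n^'n" where "H_ext s \<omega> = (if s \<in> {0..T} then H s \<omega> else 0)"

lemma H_ext_measurable: "(\<lambda>p. H_ext (snd p) (fst p)) \<in> borel_measurable (M \<Otimes>\<^sub>M borel)"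
  unfolding H_ext_def using ito by (intro progressive_joint_measurable) (auto simp: is_ito_integral_def)

definition cell_osc :: "real \<Rightarrow> nat \<Rightarrow> nat \<Rightarrow> 'a \<Rightarrow> ennreal" where
  "cell_osc R j i \<omega> = (\<integral>\<^sup>+s. ennreal ((norm (proj R (H_ext s \<omega>) - proj R (Sg (real i / real (n j)) \<omega>)))\<^sup>2)
     * indicator {real i / real (n j)<..real (Suc i) / real (n j)} s \<partial>lborel)"

lemma cell_osc_measurable:
  assumes R: "0 \<le> R" and i: "i < K j" "n j > 0"
  shows "cell_osc R j i \<in> borel_measurable M"
proof -
  have [measurable]: "(\<lambda>p. H_ext (snd p) (fst p)) \<in> borel_measurable (M \<Otimes>\<^sub>M lborel)"
    using H_ext_measurable by (simp cong: measurable_cong_sets)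
  have [measurable]: "Sg (real i / real (n j)) \<in> borel_measurable M" using grid_le_T[OF i] by (intro Sg_measurable_M)
  note [measurable] = measurable_proj[OF R]
  have "(\<lambda>p. ennreal ((norm (proj R (H_ext (snd p) (fst p)) - proj R (Sg (real i / real (n j)) (fst p))))\<^sup>2)
     * indicator {real i / real (n j)<..real (Suc i) / real (n j)} (snd p)) \<in> borel_measurable (M \<Otimes>\<^sub>M lborel)"
    by measurable
  then show ?thesis unfolding cell_osc_def[abs_def]
    by (intro lborel.borel_measurable_nn_integral) (simp add: split_beta')
qed

lemma cell_osc_le:
  assumes i: "i < K j" "n j > 0" and b: "b \<ge> 0"
    and le: "\<And>s. real i / real (n j) < s \<Longrightarrow> s \<le> real (Suc i) / real (n j) \<Longrightarrow>
       norm (proj R (H s \<omega>) - proj R (Sg (real i / real (n j)) \<omega>)) \<le> b"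
  shows "cell_osc R j i \<omega> \<le> ennreal (b\<^sup>2 / real (n j))"
proof -
  have "cell_osc R j i \<omega> \<le> (\<integral>\<^sup>+s. ennreal (b\<^sup>2) * indicator {real i / real (n j)<..real (Suc i) / real (n j)} s \<partial>lborel)"
    unfolding cell_osc_def
  proof (intro nn_integral_mono)
    fix s
    show "ennreal ((norm (proj R (H_ext s \<omega>) - proj R (Sg (real i / real (n j)) \<omega>)))\<^sup>2)
     * indicator {real i / real (n j)<..real (Suc i) / real (n j)} s
      \<le> ennreal (b\<^sup>2) * indicator {real i / real (n j)<..real (Suc i) / real (n j)} s"
    proof (cases "s \<in> {real i / real (n j)<..real (Suc i) / real (n j)}")
      case True
      moreover have "0 \<le> real i / real (n j)" by simp
      then have "s \<in> {0..T}" using True grid_le_T(1)[OF i] unfolding greaterThanAtMost_iff atLeastAtMost_iff by linarith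
      ultimately show ?thesis using le[of s]
        by (auto simp: H_ext_def intro!: ennreal_leI power_mono)
    qed simp
  qed
  also have "\<dots> = ennreal (b\<^sup>2 / real (n j))"
    using grid_le_T[OF i] i by (simp add: nn_integral_cmult ennreal_mult[symmetric] diff_divide_distrib[symmetric])
  finally show ?thesis .
qed

text \<open>For each path, the mean squared oscillation over a cell is bounded and tends to 0 near
  the point from either side, so \<open>weighted_sum_limit\<close> applies with both limits 0. The
  truncation supplies the majorant for passing to expectations.\<close>

lemma osc_expectation_limit:
  assumes R: "0 \<le> R"
  shows "(\<lambda>j. \<integral>\<^sup>+\<omega>. (\<Sum>i<K j. ennreal (w t j i * real (n j)) * cell_osc R j i \<omega>) \<partial>M) \<longlonglongrightarrow> 0"
proof -
  \<comment> \<open>Dominated convergence requires its bounds for every index, hence the shift by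
    \<open>j0\<close>.\<close>
  obtain j0 where j0: "\<And>j. j \<ge> j0 \<Longrightarrow> n j > 0 \<and> (\<Sum>i<K j. w t j i) \<le> 2"
    using eventually_conj[OF n_pos weight_total_le] unfolding eventually_sequentially by blast
  define b where "b = 2 * R"
  have bnd: "cell_osc R j i \<omega> \<le> ennreal (b\<^sup>2 / real (n j))" if "i < K j" "n j > 0" for j i \<omega>
    using that R norm_diff_proj_le[OF R] by (intro cell_osc_le) (auto simp: b_def)
  define e where "e \<omega> j i = (if n j > 0 then real (n j) * enn2real (cell_osc R j i \<omega>) else 0)" for \<omega> j i
  have osc_e: "ennreal (real (n j)) * cell_osc R j i \<omega> = ennreal (e \<omega> j i)" if "i < K j" "n j > 0" for j i \<omega>
  proof -
    have "cell_osc R j i \<omega> < \<top>" using bnd[OF that, of \<omega>] by (rule le_less_trans) simp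
    then show ?thesis using that by (simp add: e_def ennreal_mult)
  qed
  have e_le: "e \<omega> j i \<le> c\<^sup>2" if "i < K j" "cell_osc R j i \<omega> \<le> ennreal (c\<^sup>2 / real (n j))" for \<omega> j i c
  proof (cases "n j > 0")
    case True
    then have "enn2real (cell_osc R j i \<omega>) \<le> c\<^sup>2 / real (n j)" using that by (intro enn2real_leI) auto
    then show ?thesis using True by (simp add: e_def field_simps)
  qed (simp add: e_def)
  have e0: "0 \<le> e \<omega> j i" for \<omega> j i by (simp add: e_def)
  have sum_e: "(\<Sum>i<K j. ennreal (w t j i * real (n j)) * cell_osc R j i \<omega>) = ennreal (\<Sum>i<K j. w t j i * e \<omega> j i)"
    if "n j > 0" for \<omega> j
  proof -
    have "(\<Sum>i<K j. ennreal (w t j i * real (n j)) * cell_osc R j i \<omega>) = (\<Sum>i<K j. ennreal (w t j i * e \<omega> j i))"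
      using that osc_e e0 w_nonneg by (intro sum.cong refl) (simp add: ennreal_mult mult.assoc)
    then show ?thesis using e0 w_nonneg by (simp add: sum_ennreal)
  qed
  have pathwise: "(\<lambda>j. \<Sum>i<K j. w t j i * e \<omega> j i) \<longlonglongrightarrow> (0 + 0) / 2" if \<omega>: "\<omega> \<in> space M" for \<omega>
  proof (rule weighted_sum_limit)
    show "\<bar>e \<omega> j i\<bar> \<le> b\<^sup>2" if "i < K j" for j i
    proof (cases "n j > 0")
      case True
      then show ?thesis using e_le[OF that bnd[OF that]] e0[of \<omega> j i] by simp
    qed (simp add: e_def)
    fix \<epsilon> :: real assume "\<epsilon> > 0"
    \<comment> \<open>Comparing through a common limit doubles \<open>c\<close>, and the oscillation
      is squared: (2 c)^2 = \<open>\<epsilon>\<close>.\<close>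
    define c where "c = sqrt \<epsilon> / 2"
    have c: "c > 0" "(2 * c)\<^sup>2 = \<epsilon>" using \<open>\<epsilon> > 0\<close> by (auto simp: c_def power2_eq_square)
    let ?g = "\<lambda>u. proj R (Sg u \<omega>)"
    have cell: "\<bar>e \<omega> j i - 0\<bar> \<le> \<epsilon>" if "i < K j" "n j > 0" and a: "norm (?g (real i / real (n j)) - a) \<le> c"
       "\<And>s. real i / real (n j) < s \<Longrightarrow> s \<le> real (Suc i) / real (n j) \<Longrightarrow> norm (leftlim ?g s - a) \<le> c" for j i a
    proof -
      have "norm (proj R (H s \<omega>) - ?g (real i / real (n j))) \<le> 2 * c"
        if s: "real i / real (n j) < s" "s \<le> real (Suc i) / real (n j)" for s
      proof -
        have "0 \<le> real i / real (n j)" by simp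
        then have "s \<in> {0<..T}" using s grid_le_T(1)[OF \<open>i < K j\<close> \<open>n j > 0\<close>] unfolding greaterThanAtMost_iff by linarith
        then have "proj R (H s \<omega>) = leftlim ?g s" using H_eq[OF \<omega>] leftlim_proj[OF R \<omega>, of s] by auto
        then show ?thesis using a(1) a(2)[OF s] norm_triangle_ineq4[of "leftlim ?g s - a" "?g (real i / real (n j)) - a"]
          by simp
      qed
      then have "cell_osc R j i \<omega> \<le> ennreal ((2 * c)\<^sup>2 / real (n j))"
        using that(1,2) c by (intro cell_osc_le) auto
      from e_le[OF that(1) this] show ?thesis unfolding c(2) using e0[of \<omega> j i] by simp
    qed
    obtain d where d: "d > 0" "\<And>s. t1 \<le> s \<Longrightarrow> s < t1 + d \<Longrightarrow> norm (?g s - ?g t1) \<le> c"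
        "\<And>s. t1 < s \<Longrightarrow> s < t1 + d \<Longrightarrow> norm (leftlim ?g s - ?g t1) \<le> c"
      using cadlag_right_modulus[OF cadlag_proj[OF R \<omega>] t1_range c(1)] by metis
    \<comment> \<open>On the right the condition is on the left end of a cell, so the cell length
      must be small for the whole cell to lie in the window.\<close>
    have "\<forall>\<^sub>F j in sequentially. 1 / real (n j) < d / 2" using order_tendstoD(2)[OF inverse_n, of "d/2"] d by simp
    then have "\<forall>\<^sub>F j in sequentially. \<forall>i<K j. t1 \<le> real i / real (n j) \<longrightarrow> real i / real (n j) < t1 + d / 2 \<longrightarrow> \<bar>e \<omega> j i - 0\<bar> \<le> \<epsilon>"
      using n_pos
    proof eventually_elim
      case (elim j)
      show ?case
      proof (intro allI impI)
        fix i assume i: "i < K j" "t1 \<le> real i / real (n j)" "real i / real (n j) < t1 + d / 2"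
        have "real (Suc i) / real (n j) = real i / real (n j) + 1 / real (n j)" by (simp add: add_divide_distrib)
        then have "real (Suc i) / real (n j) < t1 + d" using i elim by simp
        then show "\<bar>e \<omega> j i - 0\<bar> \<le> \<epsilon>" using i d elim by (intro cell[of i j "?g t1"]) auto
      qed
    qed
    then show "\<exists>d>0. \<forall>\<^sub>F j in sequentially. \<forall>i<K j. t1 \<le> real i / real (n j) \<longrightarrow> real i / real (n j) < t1 + d \<longrightarrow> \<bar>e \<omega> j i - 0\<bar> \<le> \<epsilon>"
      using d(1) by (intro exI[of _ "d / 2"]) auto
    obtain d where d: "d > 0" "\<And>s. t0 - d < s \<Longrightarrow> s < t0 \<Longrightarrow> norm (?g s - leftlim ?g t0) \<le> c"
        "\<And>s. t0 - d < s \<Longrightarrow> s \<le> t0 \<Longrightarrow> norm (leftlim ?g s - leftlim ?g t0) \<le> c"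
      using cadlag_left_modulus[OF cadlag_proj[OF R \<omega>] t0_range c(1)] by metis
    have "\<forall>\<^sub>F j in sequentially. \<forall>i<K j. t0 - d / 2 \<le> real i / real (n j) \<longrightarrow> (real i + 1) / real (n j) \<le> t0 \<longrightarrow> \<bar>e \<omega> j i - 0\<bar> \<le> \<epsilon>"
      using n_pos
    proof eventually_elim
      case (elim j)
      show ?case
      proof (intro allI impI)
        fix i assume i: "i < K j" "t0 - d / 2 \<le> real i / real (n j)" "(real i + 1) / real (n j) \<le> t0"
        have "real i / real (n j) < (real i + 1) / real (n j)" using elim by (simp add: divide_strict_right_mono)
        moreover have "real (Suc i) / real (n j) \<le> t0" using i by (simp add: add.commute)
        ultimately show "\<bar>e \<omega> j i - 0\<bar> \<le> \<epsilon>" using i d elim by (intro cell[of i j "leftlim ?g t0"]) auto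
      qed
    qed
    then show "\<exists>d>0. \<forall>\<^sub>F j in sequentially. \<forall>i<K j. t0 - d \<le> real i / real (n j) \<longrightarrow> (real i + 1) / real (n j) \<le> t0 \<longrightarrow> \<bar>e \<omega> j i - 0\<bar> \<le> \<epsilon>"
      using d(1) by (intro exI[of _ "d / 2"]) auto
  qed
  have "(\<lambda>j. \<integral>\<^sup>+\<omega>. (\<Sum>i<K (j + j0). ennreal (w t (j + j0) i * real (n (j + j0))) * cell_osc R (j + j0) i \<omega>) \<partial>M) \<longlonglongrightarrow> (\<integral>\<^sup>+\<omega>. 0 \<partial>M)"
  proof (rule nn_integral_dominated_convergence[where w = "\<lambda>_. ennreal (2 * b\<^sup>2)"])
    fix j
    have nj: "n (j + j0) > 0" "(\<Sum>i<K (j + j0). w t (j + j0) i) \<le> 2" using j0[of "j + j0"] by auto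
    show "(\<lambda>\<omega>. \<Sum>i<K (j + j0). ennreal (w t (j + j0) i * real (n (j + j0))) * cell_osc R (j + j0) i \<omega>) \<in> borel_measurable M"
      using nj by (intro borel_measurable_sum borel_measurable_times_ennreal cell_osc_measurable[OF R]) auto
    show "AE \<omega> in M. (\<Sum>i<K (j + j0). ennreal (w t (j + j0) i * real (n (j + j0))) * cell_osc R (j + j0) i \<omega>) \<le> ennreal (2 * b\<^sup>2)"
    proof (intro AE_I2)
      fix \<omega>
      have "(\<Sum>i<K (j + j0). w t (j + j0) i * e \<omega> (j + j0) i) \<le> (\<Sum>i<K (j + j0). w t (j + j0) i * b\<^sup>2)"
        using w_nonneg nj by (intro sum_mono mult_left_mono e_le bnd) auto
      also have "\<dots> \<le> 2 * b\<^sup>2" unfolding sum_distrib_right[symmetric] using nj by (intro mult_right_mono) auto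
      finally show "(\<Sum>i<K (j + j0). ennreal (w t (j + j0) i * real (n (j + j0))) * cell_osc R (j + j0) i \<omega>) \<le> ennreal (2 * b\<^sup>2)"
        unfolding sum_e[OF nj(1)] by (rule ennreal_leI)
    qed
  next
    show "AE \<omega> in M. (\<lambda>j. \<Sum>i<K (j + j0). ennreal (w t (j + j0) i * real (n (j + j0))) * cell_osc R (j + j0) i \<omega>) \<longlonglongrightarrow> 0"
    proof (intro AE_I2)
      fix \<omega> assume "\<omega> \<in> space M"
      from LIMSEQ_ignore_initial_segment[OF pathwise[OF this], of j0]
      have "(\<lambda>j. ennreal (\<Sum>i<K (j + j0). w t (j + j0) i * e \<omega> (j + j0) i)) \<longlonglongrightarrow> ennreal 0"
        by (intro tendsto_ennrealI) simp
      moreover have "n (j + j0) > 0" for j using j0[of "j + j0"] by simp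
      ultimately show "(\<lambda>j. \<Sum>i<K (j + j0). ennreal (w t (j + j0) i * real (n (j + j0))) * cell_osc R (j + j0) i \<omega>) \<longlonglongrightarrow> 0"
        by (simp add: sum_e)
    qed
  qed (auto simp: emeasure_space_1)
  then show ?thesis by (simp add: LIMSEQ_offset)
qed

section \<open>Truncation of the volatility\<close>

text \<open>Restricting to rational times makes the event measurable; the bound extends to all times, and
  to the left limits, because the paths are cadlag.\<close>

definition bounded_event :: "real \<Rightarrow> 'a set" where
  "bounded_event R = (\<Inter>s\<in>\<rat> \<inter> {0..<T}. {\<omega>\<in>space M. norm (Sg s \<omega>) \<le> R})"

lemma zero_in_grid: "0 \<in> \<rat> \<inter> {0..<T}" using t0_range by auto

lemma bounded_event_measurable: "bounded_event R \<in> events"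
  unfolding bounded_event_def
proof (rule sets.countable_INT')
  show "countable (\<rat> \<inter> {0..<T})" using countable_rat by (rule countable_subset[rotated]) auto
  show "(\<lambda>s. {\<omega> \<in> space M. norm (Sg s \<omega>) \<le> R}) ` (\<rat> \<inter> {0..<T}) \<subseteq> events"
  proof safe
    fix s assume "s \<in> {0..<T}"
    then have [measurable]: "Sg s \<in> borel_measurable M" by (intro Sg_measurable_M) auto
    show "{\<omega> \<in> space M. norm (Sg s \<omega>) \<le> R} \<in> events" by measurable
  qed
qed (use zero_in_grid in blast)

lemma bounded_event_space: "bounded_event R \<subseteq> space M"
  using zero_in_grid by (auto simp: bounded_event_def)

lemma bounded_event_Sg:
  assumes \<omega>: "\<omega> \<in> bounded_event R" and s: "s \<in> {0..<T}"
  shows "norm (Sg s \<omega>) \<le> R"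
proof (rule ccontr)
  assume "\<not> norm (Sg s \<omega>) \<le> R"
  moreover have "\<omega> \<in> space M" using bounded_event_space \<omega> by blast
  then have "((\<lambda>u. Sg u \<omega>) \<longlongrightarrow> Sg s \<omega>) (at_right s)" using Sg_cadlag s by (auto simp: cadlag_def)
  then have "((\<lambda>u. norm (Sg u \<omega>)) \<longlongrightarrow> norm (Sg s \<omega>)) (at_right s)" by (rule tendsto_norm)
  ultimately have "\<forall>\<^sub>F u in at_right s. R < norm (Sg u \<omega>)" by (intro order_tendstoD) auto
  then obtain b where b: "b > s" "\<And>u. s < u \<Longrightarrow> u < b \<Longrightarrow> R < norm (Sg u \<omega>)"
    by (auto simp: eventually_at_right_field)
  have "s < min b T" using b s by auto
  then obtain u where u: "u \<in> \<rat>" "s < u" "u < min b T" using Rats_dense_in_real by blast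
  then have "norm (Sg u \<omega>) \<le> R" using \<omega> s by (auto simp: bounded_event_def)
  then show False using b(2)[of u] u by auto
qed

lemma bounded_event_leftlim:
  assumes \<omega>: "\<omega> \<in> bounded_event R" and s: "s \<in> {0<..T}"
  shows "norm (leftlim (\<lambda>u. Sg u \<omega>) s) \<le> R"
proof -
  have \<omega>': "\<omega> \<in> space M" using bounded_event_space \<omega> by blast
  have "((\<lambda>u. norm (Sg u \<omega>)) \<longlongrightarrow> norm (leftlim (\<lambda>u. Sg u \<omega>) s)) (at_left s)"
    by (intro tendsto_norm leftlim_tendsto[OF Sg_cadlag[OF \<omega>'] s])
  moreover have "\<forall>\<^sub>F u in at_left s. norm (Sg u \<omega>) \<le> R"
    using s by (intro eventually_at_left_interval[of 0] bounded_event_Sg[OF \<omega>]) auto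
  ultimately show ?thesis by (rule tendsto_upperbound) simp
qed

text \<open>Every cadlag path is bounded on \<open>{0..T}\<close>, so each path eventually belongs
  to the events with integer radius.\<close>

lemma bounded_event_large:
  assumes "\<eta> > 0"
  obtains R where "R > 0" "prob (space M - bounded_event R) < \<eta>"
proof -
  have "(\<lambda>k. prob (space M - bounded_event (real (Suc k)))) \<longlonglongrightarrow> 0"
  proof (rule prob_eventually_not_in)
    show "AE \<omega> in M. \<forall>\<^sub>F k in sequentially. \<omega> \<notin> space M - bounded_event (real (Suc k))"
    proof (rule AE_I2)
      fix \<omega> assume \<omega>: "\<omega> \<in> space M"
      obtain B where B: "\<And>s. s \<in> {0..T} \<Longrightarrow> norm (Sg s \<omega>) \<le> B" using cadlag_bounded[OF Sg_cadlag[OF \<omega>]] by blast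
      obtain k0 :: nat where "B \<le> real k0" using real_arch_simple by blast
      then have "\<omega> \<in> bounded_event (real (Suc k))" if "k \<ge> k0" for k
        using that \<omega> unfolding bounded_event_def by (auto intro!: order_trans[OF B])
      then show "\<forall>\<^sub>F k in sequentially. \<omega> \<notin> space M - bounded_event (real (Suc k))"
        unfolding eventually_sequentially by blast
    qed
  qed (use bounded_event_measurable in auto)
  then have "\<forall>\<^sub>F k in sequentially. prob (space M - bounded_event (real (Suc k))) < \<eta>"
    using assms by (rule order_tendstoD)
  then obtain k where "prob (space M - bounded_event (real (Suc k))) < \<eta>"
    by (auto simp: eventually_sequentially)
  then show ?thesis using that[of "real (Suc k)"] by simp
qed

lemma limit_proj_eq: "\<omega> \<in> bounded_event R \<Longrightarrow> limit_proj R \<omega> = limit \<omega>"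
  using bounded_event_Sg[of \<omega> R t1] bounded_event_leftlim[of \<omega> R t0] t0_range t1_range
  by (simp add: limit_proj_def limit_def left_value_def proj_self)

end

text \<open>The integrands with index m are used at grid size n = m. The uniform error 1/(n+1)
  survives multiplication by sqrt n. The fourth power leaves O(1/n) after Chebyshev at level 1/(n+1)
  and a union over about n T grid points.\<close>

locale fejer_approx = fejer_diffusion T n N t0 t1 t M F Z f C q Sg H I D
  for T :: real and n N :: "nat \<Rightarrow> nat" and t0 t1 t :: real
    and M :: "'a measure" and F :: "real \<Rightarrow> 'a measure" and Z :: "real \<Rightarrow> 'a \<Rightarrow> real^'n"
    and f :: "real^'n \<Rightarrow> real" and C :: real and q :: nat
    and Sg :: "real \<Rightarrow> 'a \<Rightarrow> real^'n^'n" and H :: "real \<Rightarrow> 'a \<Rightarrow> real^'n^'n" and I D :: "real \<Rightarrow> 'a \<Rightarrow> real^'n" +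
  fixes k :: "nat \<Rightarrow> nat" and ts :: "nat \<Rightarrow> nat \<Rightarrow> real" and S :: "nat \<Rightarrow> nat \<Rightarrow> 'a \<Rightarrow> real^'n^'n"
  assumes simple: "\<And>m. simple_integrand M F T (k m) (ts m) (S m)"
    and ts0: "\<And>m. ts m 0 = 0" and tsT: "\<And>m. ts m (k m) = T"
    and err_measurable: "\<And>m. (\<lambda>\<omega>. LINT s:{0..T}|lborel. (norm (simple_value (k m) (ts m) (S m) s \<omega> - H s \<omega>))\<^sup>2) \<in> borel_measurable M"
    and err_small: "\<And>m. prob {\<omega>\<in>space M. (LINT s:{0..T}|lborel. (norm (simple_value (k m) (ts m) (S m) s \<omega> - H s \<omega>))\<^sup>2) > 1 / real (Suc m) ^ 4}
       \<le> 1 / real (Suc m) ^ 4"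
    and sup_measurable: "\<And>m. (\<lambda>\<omega>. SUP s\<in>{0..T}. norm (simple_integral Z (k m) (ts m) (S m) s \<omega> - I s \<omega>)) \<in> borel_measurable M"
    and sup_small: "\<And>m. prob {\<omega>\<in>space M. (SUP s\<in>{0..T}. norm (simple_integral Z (k m) (ts m) (S m) s \<omega> - I s \<omega>)) > 1 / real (Suc m)}
       \<le> 1 / real (Suc m)"
begin

definition err :: "nat \<Rightarrow> 'a \<Rightarrow> real" where
  "err m \<omega> = (LINT s:{0..T}|lborel. (norm (simple_value (k m) (ts m) (S m) s \<omega> - H s \<omega>))\<^sup>2)"

definition sup_err :: "nat \<Rightarrow> 'a \<Rightarrow> real" where
  "sup_err m \<omega> = (SUP s\<in>{0..T}. norm (simple_integral Z (k m) (ts m) (S m) s \<omega> - I s \<omega>))"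

definition proj_S :: "real \<Rightarrow> nat \<Rightarrow> nat \<Rightarrow> 'a \<Rightarrow> real^'n^'n" where "proj_S R m i \<omega> = proj R (S m i \<omega>)"

lemma ts_mono: "i < k m \<Longrightarrow> ts m i \<le> ts m (Suc i)"
  and ts_range: "i \<le> k m \<Longrightarrow> ts m i \<in> {0..T}"
  using simple[of m] by (auto simp: simple_integrand_def)

lemma proj_S_simple: "0 \<le> R \<Longrightarrow> simple_integrand M F T (k m) (ts m) (proj_S R m)"
  using simple[of m] norm_proj_le[of R] unfolding simple_integrand_def proj_S_def[abs_def]
  by (auto intro!: measurable_compose[OF _ measurable_proj])

lemma diff_simple: "0 \<le> R \<Longrightarrow> simple_integrand M F T (k m) (ts m) (\<lambda>i \<omega>. S m i \<omega> - proj_S R m i \<omega>)"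
proof -
  assume R: "0 \<le> R"
  have "\<exists>c. \<forall>\<omega>\<in>space M. norm (S m i \<omega> - proj_S R m i \<omega>) \<le> c" if i: "i < k m" for i
  proof -
    obtain c where c: "\<forall>\<omega>\<in>space M. norm (S m i \<omega>) \<le> c" using simple[of m] i by (auto simp: simple_integrand_def)
    have "norm (S m i \<omega> - proj_S R m i \<omega>) \<le> c + R" if "\<omega> \<in> space M" for \<omega>
      using c that norm_triangle_ineq4[of "S m i \<omega>" "proj_S R m i \<omega>"] norm_proj_le[OF R, of "S m i \<omega>"]
      unfolding proj_S_def by fastforce
    then show ?thesis by blast
  qed
  then show ?thesis using simple[of m] proj_S_simple[OF R, of m] 
    unfolding simple_integrand_def by (auto intro!: borel_measurable_diff)
qed

text \<open>One cell serves all integrands on the same partition. Hence pointwise operations on the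
  coefficients, even nonlinear ones such as \<open>proj\<close>, carry over to the step
  functions.\<close>

lemma cell_of:
  assumes "s \<in> {0<..T}"
  obtains i where "i < k m" "\<forall>(A :: nat \<Rightarrow> 'a \<Rightarrow> real^'n^'n) \<omega>. simple_value (k m) (ts m) A s \<omega> = A i \<omega>"
proof -
  have "ts m 0 < s" "s \<le> ts m (k m)" using assms ts0 tsT by auto
  from partition_cell[OF this ts_mono] obtain i where i: "i < k m" "s \<in> {ts m i<..ts m (Suc i)}"
    "\<And>j. j < k m \<Longrightarrow> s \<in> {ts m j<..ts m (Suc j)} \<Longrightarrow> j = i" by metis
  show ?thesis by (rule that[OF i(1)]) (intro allI simple_value_cell i)
qed

lemma simple_value_SP:
  assumes "s \<in> {0<..T}"
  shows "simple_value (k m) (ts m) (proj_S R m) s \<omega> = proj R (simple_value (k m) (ts m) (S m) s \<omega>)"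
proof -
  obtain i where i: "i < k m" "\<forall>(A :: nat \<Rightarrow> 'a \<Rightarrow> real^'n^'n) \<omega>. simple_value (k m) (ts m) A s \<omega> = A i \<omega>" by (rule cell_of[OF assms, of m])
  show ?thesis by (simp only: i(2)[rule_format] proj_S_def)
qed

lemma simple_value_diff:
  assumes "s \<in> {0<..T}"
  shows "simple_value (k m) (ts m) (\<lambda>i \<omega>. S m i \<omega> - proj_S R m i \<omega>) s \<omega>
   = simple_value (k m) (ts m) (S m) s \<omega> - proj R (simple_value (k m) (ts m) (S m) s \<omega>)"
proof -
  obtain i where i: "i < k m" "\<forall>(A :: nat \<Rightarrow> 'a \<Rightarrow> real^'n^'n) \<omega>. simple_value (k m) (ts m) A s \<omega> = A i \<omega>" by (rule cell_of[OF assms, of m])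
  show ?thesis by (simp only: i(2)[rule_format] proj_S_def)
qed

text \<open>\<open>err\<close> is a Bochner integral and would be 0 for a non-integrable error. The
  almost sure square integrability of \<open>H\<close> rules this out, as the simple integrand is
  bounded along each path.\<close>

lemma squared_error_le_err:
  "AE \<omega> in M. (\<integral>\<^sup>+s. ennreal ((norm (simple_value (k m) (ts m) (S m) s \<omega> - H_ext s \<omega>))\<^sup>2) * indicator {0<..T} s \<partial>lborel) \<le> ennreal (err m \<omega>)"
proof -
  have "AE \<omega> in M. set_integrable lborel {0..T} (\<lambda>s. (norm (H s \<omega>))\<^sup>2)"
    using ito by (auto simp: is_ito_integral_def)
  then show ?thesis
  proof (rule AE_mp, intro AE_I2 impI)
    fix \<omega> assume \<omega>: "\<omega> \<in> space M" and int: "set_integrable lborel {0..T} (\<lambda>s. (norm (H s \<omega>))\<^sup>2)"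
    let ?v = "\<lambda>s. simple_value (k m) (ts m) (S m) s \<omega>"
    have Hm [measurable]: "(\<lambda>s. H_ext s \<omega>) \<in> borel_measurable borel"
      using measurable_compose[OF measurable_Pair1'[OF \<omega>, of borel] H_ext_measurable] by simp
    have vm [measurable]: "?v \<in> borel_measurable borel"
      using measurable_compose[OF measurable_Pair1'[OF \<omega>, of borel] simple_value_joint_measurable[OF simple]] by simp
    define c where "c = (\<Sum>i<k m. norm (S m i \<omega>))"
    have v: "norm (?v s) \<le> c" for s
      unfolding simple_value_def c_def by (intro sum_norm_le) (auto simp: indicator_def)
    have "integrable lborel (\<lambda>s. indicat_real {0..T} s * (norm (?v s - H_ext s \<omega>))\<^sup>2)"
    proof (rule Bochner_Integration.integrable_bound)
      show "integrable lborel (\<lambda>s. 2 * c\<^sup>2 * indicat_real {0..T} s + 2 * (indicat_real {0..T} s * (norm (H s \<omega>))\<^sup>2))"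
        using int by (intro Bochner_Integration.integrable_add integrable_mult_right)
          (auto simp: set_integrable_def emeasure_lborel_Icc_eq intro!: integrable_real_indicator)
      show "AE s in lborel. norm (indicat_real {0..T} s * (norm (?v s - H_ext s \<omega>))\<^sup>2)
        \<le> norm (2 * c\<^sup>2 * indicat_real {0..T} s + 2 * (indicat_real {0..T} s * (norm (H s \<omega>))\<^sup>2))"
      proof (intro AE_I2)
        fix s
        have "(norm (?v s - H_ext s \<omega>))\<^sup>2 \<le> 2 * (norm (?v s))\<^sup>2 + 2 * (norm (H_ext s \<omega>))\<^sup>2"
          using norm_sq_triangle[of "?v s" "H_ext s \<omega>" 0] by simp
        also have "(norm (?v s))\<^sup>2 \<le> c\<^sup>2" using v by (intro power_mono) auto
        finally show "norm (indicat_real {0..T} s * (norm (?v s - H_ext s \<omega>))\<^sup>2)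
          \<le> norm (2 * c\<^sup>2 * indicat_real {0..T} s + 2 * (indicat_real {0..T} s * (norm (H s \<omega>))\<^sup>2))"
          by (auto simp: indicator_def H_ext_def)
      qed
    qed measurable
    then have "(\<integral>\<^sup>+s. ennreal (indicat_real {0..T} s * (norm (?v s - H_ext s \<omega>))\<^sup>2) \<partial>lborel)
        = ennreal (LINT s|lborel. indicat_real {0..T} s * (norm (?v s - H_ext s \<omega>))\<^sup>2)"
      by (intro nn_integral_eq_integral) auto
    also have "(LINT s|lborel. indicat_real {0..T} s * (norm (?v s - H_ext s \<omega>))\<^sup>2) = err m \<omega>"
      unfolding err_def set_lebesgue_integral_def
      by (intro Bochner_Integration.integral_cong) (auto simp: H_ext_def indicator_def)
    finally have eq: "(\<integral>\<^sup>+s. ennreal (indicat_real {0..T} s * (norm (?v s - H_ext s \<omega>))\<^sup>2) \<partial>lborel) = ennreal (err m \<omega>)" .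
    show "(\<integral>\<^sup>+s. ennreal ((norm (?v s - H_ext s \<omega>))\<^sup>2) * indicator {0<..T} s \<partial>lborel) \<le> ennreal (err m \<omega>)"
      unfolding eq[symmetric] by (intro nn_integral_mono) (auto simp: indicator_def)
  qed
qed

definition proj_err :: "real \<Rightarrow> nat \<Rightarrow> 'a \<Rightarrow> ennreal" where
  "proj_err R m \<omega> = (\<integral>\<^sup>+s. ennreal ((norm (proj R (simple_value (k m) (ts m) (S m) s \<omega>) - proj R (H_ext s \<omega>)))\<^sup>2) * indicator {0<..T} s \<partial>lborel)"

lemma simple_value_measurable_lborel: "(\<lambda>p. simple_value (k m) (ts m) (S m) (snd p) (fst p)) \<in> borel_measurable (M \<Otimes>\<^sub>M lborel)"
  using simple_value_joint_measurable[OF simple] by (simp cong: measurable_cong_sets)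

lemma H_ext_measurable_lborel: "(\<lambda>p. H_ext (snd p) (fst p)) \<in> borel_measurable (M \<Otimes>\<^sub>M lborel)"
  using H_ext_measurable by (simp cong: measurable_cong_sets)

text \<open>With \<delta> = 1/(m+1)^4: off an event of probability at most \<delta>, the projection
  contracts an error of at most \<delta>; on that event the crude bound (2 R)^2 T is used.\<close>

lemma proj_err_expectation:
  assumes R: "0 \<le> R"
  shows "(\<integral>\<^sup>+\<omega>. proj_err R m \<omega> \<partial>M) \<le> ennreal ((1 + 4 * R\<^sup>2 * T) / real (Suc m) ^ 4)"
proof -
  define \<delta> where "\<delta> = 1 / real (Suc m) ^ 4"
  have T0: "T > 0" using t0_range by simp
  have \<delta>: "\<delta> \<ge> 0" by (simp add: \<delta>_def)
  define G where "G = {\<omega>\<in>space M. err m \<omega> > \<delta>}"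
  have G: "G \<in> events" "prob G \<le> \<delta>"
    using err_measurable[of m] err_small[of m] by (auto simp: G_def \<delta>_def err_def[abs_def])
  have "AE \<omega> in M. proj_err R m \<omega> \<le> ennreal \<delta> + ennreal (4 * R\<^sup>2 * T) * indicator G \<omega>"
    using squared_error_le_err[of m]
  proof (rule AE_mp, intro AE_I2 impI)
    fix \<omega> assume \<omega>: "\<omega> \<in> space M"
      and e: "(\<integral>\<^sup>+s. ennreal ((norm (simple_value (k m) (ts m) (S m) s \<omega> - H_ext s \<omega>))\<^sup>2) * indicator {0<..T} s \<partial>lborel) \<le> ennreal (err m \<omega>)"
    show "proj_err R m \<omega> \<le> ennreal \<delta> + ennreal (4 * R\<^sup>2 * T) * indicator G \<omega>"
    proof (cases "\<omega> \<in> G")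
      case True
      have "proj_err R m \<omega> \<le> (\<integral>\<^sup>+s. ennreal (4 * R\<^sup>2) * indicator {0<..T} s \<partial>lborel)"
        unfolding proj_err_def
      proof (intro nn_integral_mono mult_right_mono ennreal_leI)
        fix s
        have "(norm (proj R (simple_value (k m) (ts m) (S m) s \<omega>) - proj R (H_ext s \<omega>)))\<^sup>2 \<le> (2 * R)\<^sup>2"
          by (intro power_mono norm_diff_proj_le R) simp
        then show "(norm (proj R (simple_value (k m) (ts m) (S m) s \<omega>) - proj R (H_ext s \<omega>)))\<^sup>2 \<le> 4 * R\<^sup>2"
          by (simp add: power_mult_distrib)
      qed simp
      also have "\<dots> = ennreal (4 * R\<^sup>2 * T)" using T0 by (simp add: nn_integral_cmult ennreal_mult)
      finally show ?thesis using True by (simp add: add_increasing)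
    next
      case False
      have "proj_err R m \<omega> \<le> (\<integral>\<^sup>+s. ennreal ((norm (simple_value (k m) (ts m) (S m) s \<omega> - H_ext s \<omega>))\<^sup>2) * indicator {0<..T} s \<partial>lborel)"
        unfolding proj_err_def
        by (intro nn_integral_mono mult_right_mono ennreal_leI power_mono proj_lipschitz R) auto
      also have "\<dots> \<le> ennreal (err m \<omega>)" by (rule e)
      also have "\<dots> \<le> ennreal \<delta>" using False \<omega> by (intro ennreal_leI) (auto simp: G_def)
      finally show ?thesis using False by simp
    qed
  qed
  then have "(\<integral>\<^sup>+\<omega>. proj_err R m \<omega> \<partial>M) \<le> (\<integral>\<^sup>+\<omega>. ennreal \<delta> + ennreal (4 * R\<^sup>2 * T) * indicator G \<omega> \<partial>M)"
    by (rule nn_integral_mono_AE)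
  also have "\<dots> = ennreal \<delta> + ennreal (4 * R\<^sup>2 * T) * ennreal (prob G)"
    using G by (simp add: nn_integral_add nn_integral_cmult emeasure_space_1 emeasure_eq_measure prob_space)
  also have "\<dots> \<le> ennreal \<delta> + ennreal (4 * R\<^sup>2 * T) * ennreal \<delta>"
    using G by (intro add_left_mono mult_left_mono ennreal_leI) auto
  also have "\<dots> = ennreal ((1 + 4 * R\<^sup>2 * T) / real (Suc m) ^ 4)"
    using \<delta> T0 by (simp add: ennreal_mult[symmetric] ennreal_plus[symmetric] \<delta>_def add_divide_distrib del: ennreal_plus)
  finally show ?thesis .
qed

section \<open>Comparison of the truncated increments\<close>

text \<open>Scaled increments over the \<open>i\<close>-th cell: of the simple integral with truncated integrand, and of
  \<open>Z\<close> with the truncated volatility frozen at the left end of the cell.\<close>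

definition approx_incr :: "real \<Rightarrow> nat \<Rightarrow> nat \<Rightarrow> 'a \<Rightarrow> real^'n" where
  "approx_incr R j i \<omega> = sqrt (real (n j)) *\<^sub>R
     (simple_integral Z (k (n j)) (ts (n j)) (proj_S R (n j)) (real (Suc i) / real (n j)) \<omega>
      - simple_integral Z (k (n j)) (ts (n j)) (proj_S R (n j)) (real i / real (n j)) \<omega>)"

definition frozen_incr :: "real \<Rightarrow> nat \<Rightarrow> nat \<Rightarrow> 'a \<Rightarrow> real^'n" where
  "frozen_incr R j i \<omega> = proj R (Sg (real i / real (n j)) \<omega>) *v
     (sqrt (real (n j)) *\<^sub>R (Z (real (Suc i) / real (n j)) \<omega> - Z (real i / real (n j)) \<omega>))"

lemma simple_integral_measurable:
  assumes A: "simple_integrand M F T k' ts' A" and s: "s \<in> {0..T}"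
  shows "simple_integral Z k' ts' A s \<in> borel_measurable M"
proof -
  have "A i \<in> borel_measurable M" if "i < k'" for i
  proof -
    have "ts' i \<in> {0..T}" "A i \<in> borel_measurable (F (ts' i))" using A that by (auto simp: simple_integrand_def)
    then show ?thesis by (rule measurable_F_M)
  qed
  moreover have "Z (min s (ts' i)) \<in> borel_measurable M" if "i \<le> k'" for i
    using A that s by (intro Z_measurable_M) (auto simp: simple_integrand_def min_def)
  ultimately show ?thesis unfolding simple_integral_def[abs_def]
    by (intro borel_measurable_sum borel_measurable_matrix_vector borel_measurable_diff) auto
qed

lemma proj_Sg_measurable:
  assumes R: "0 \<le> R" and i: "i < K j" "n j > 0"
  shows "(\<lambda>\<omega>. proj R (Sg (real i / real (n j)) \<omega>)) \<in> borel_measurable (F (real i / real (n j)))"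
  using grid_le_T[OF i] by (intro measurable_compose[OF Sg_measurable measurable_proj[OF R]])

lemma approx_incr_measurable: "0 \<le> R \<Longrightarrow> i < K j \<Longrightarrow> n j > 0 \<Longrightarrow> approx_incr R j i \<in> borel_measurable M"
  unfolding approx_incr_def[abs_def] using grid_le_T[of i j]
  by (intro borel_measurable_scaleR borel_measurable_diff borel_measurable_const simple_integral_measurable proj_S_simple) auto

lemma frozen_incr_measurable: "0 \<le> R \<Longrightarrow> i < K j \<Longrightarrow> n j > 0 \<Longrightarrow> frozen_incr R j i \<in> borel_measurable M"
  unfolding frozen_incr_def[abs_def] using grid_le_T[of i j]
  by (intro borel_measurable_matrix_vector borel_measurable_scaleR borel_measurable_diff borel_measurable_const
      Z_measurable_M measurable_F_M[OF _ proj_Sg_measurable]) auto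

definition growth_bound :: "real \<Rightarrow> real" where "growth_bound R = 2 * real CARD('n) * exp (R\<^sup>2 / 2)"

lemma growth_bound_nonneg: "0 \<le> growth_bound R" by (simp add: growth_bound_def)

lemma approx_incr_exp_growth:
  assumes R: "0 \<le> R" and i: "i < K j" "n j > 0"
  shows "(\<integral>\<^sup>+\<omega>. ennreal (exp_growth (approx_incr R j i \<omega>)) \<partial>M) \<le> ennreal (growth_bound R)"
proof -
  let ?a = "real i / real (n j)" and ?b = "real (Suc i) / real (n j)"
  note g = grid_le_T[OF i]
  have ab: "0 \<le> ?a" "?a \<le> ?b" "?b \<le> T" using g by auto
  let ?r = "\<lambda>l. clip ?a ?b (ts (n j) l)" and ?B = "clipped_integrand ?a ?b (ts (n j)) (proj_S R (n j))"
  have P: "partition_integrand ?r ?B (k (n j))"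
    using proj_S_simple[OF R, of "n j"] by (intro clipped_partition ab) (auto simp: simple_integrand_def)
  have "?r (k (n j)) - ?r 0 \<le> 1 / real (n j)"
    using ab by (simp add: clip_def ts0 tsT add_divide_distrib)
  moreover have "norm (?B l \<omega>) \<le> R" for l \<omega>
    using R by (simp add: clipped_integrand_def proj_S_def norm_proj_le)
  ultimately have "(\<integral>\<^sup>+\<omega>. ennreal (exp_growth (sqrt (real (n j)) *\<^sub>R discrete_integral ?r ?B (k (n j)) \<omega>)) \<partial>M)
     \<le> ennreal (2 * real CARD('n) * exp (R\<^sup>2 / 2))"
    using i by (intro discrete_integral_exp_growth[OF P]) auto
  moreover have "approx_incr R j i \<omega> = sqrt (real (n j)) *\<^sub>R discrete_integral ?r ?B (k (n j)) \<omega>" for \<omega>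
    unfolding approx_incr_def using ts_mono[of _ "n j"]
    by (subst simple_integral_increment[OF ab(1,2)]) auto
  ultimately show ?thesis by (simp add: growth_bound_def)
qed

lemma frozen_incr_exp_growth:
  assumes R: "0 \<le> R" and i: "i < K j" "n j > 0"
  shows "(\<integral>\<^sup>+\<omega>. ennreal (exp_growth (frozen_incr R j i \<omega>)) \<partial>M) \<le> ennreal (growth_bound R)"
proof -
  let ?a = "real i / real (n j)" and ?b = "real (Suc i) / real (n j)"
  note g = grid_le_T[OF i]
  \<comment> \<open>A partition consisting of a single cell, with a constant integrand.\<close>
  let ?r = "\<lambda>l. if l = 0 then ?a else ?b" and ?B = "\<lambda>(l::nat) \<omega>. proj R (Sg ?a \<omega>)"
  have P: "partition_integrand ?r ?B 1"
    using g proj_Sg_measurable[OF R i] by (auto simp: partition_integrand_def)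
  have "(\<integral>\<^sup>+\<omega>. ennreal (exp_growth (sqrt (real (n j)) *\<^sub>R discrete_integral ?r ?B 1 \<omega>)) \<partial>M)
     \<le> ennreal (2 * real CARD('n) * exp (R\<^sup>2 / 2))"
    using i norm_proj_le[OF R] by (intro discrete_integral_exp_growth[OF P]) (auto simp: add_divide_distrib)
  moreover have "frozen_incr R j i \<omega> = sqrt (real (n j)) *\<^sub>R discrete_integral ?r ?B 1 \<omega>" for \<omega>
    by (simp add: frozen_incr_def discrete_integral_def matrix_vector_mult_scaleR)
  ultimately show ?thesis by (simp add: growth_bound_def)
qed

definition cell_err :: "real \<Rightarrow> nat \<Rightarrow> nat \<Rightarrow> 'a \<Rightarrow> ennreal" where
  "cell_err R j i \<omega> = (\<integral>\<^sup>+s. ennreal ((norm (proj R (simple_value (k (n j)) (ts (n j)) (S (n j)) s \<omega>) - proj R (H_ext s \<omega>)))\<^sup>2)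
     * indicator {real i / real (n j)<..real (Suc i) / real (n j)} s \<partial>lborel)"

lemma cell_err_measurable:
  assumes "0 \<le> R"
  shows "cell_err R j i \<in> borel_measurable M"
proof -
  note [measurable] = measurable_proj[OF assms] simple_value_measurable_lborel H_ext_measurable_lborel
  have "(\<lambda>p. ennreal ((norm (proj R (simple_value (k (n j)) (ts (n j)) (S (n j)) (snd p) (fst p)) - proj R (H_ext (snd p) (fst p))))\<^sup>2)
     * indicator {real i / real (n j)<..real (Suc i) / real (n j)} (snd p)) \<in> borel_measurable (M \<Otimes>\<^sub>M lborel)" by measurable
  then show ?thesis unfolding cell_err_def[abs_def]
    by (intro lborel.borel_measurable_nn_integral) (simp add: split_beta')
qed

lemma section_measurable:
  assumes \<omega>: "\<omega> \<in> space M"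
  shows "(\<lambda>s. H_ext s \<omega>) \<in> borel_measurable borel" "(\<lambda>s. simple_value (k m) (ts m) (S m) s \<omega>) \<in> borel_measurable borel"
  using measurable_compose[OF measurable_Pair1'[OF \<omega>, of borel] H_ext_measurable]
    measurable_compose[OF measurable_Pair1'[OF \<omega>, of borel] simple_value_joint_measurable[OF simple]] by auto

lemma sum_cell_err_le:
  assumes R: "0 \<le> R" and \<omega>: "\<omega> \<in> space M" and n: "n j > 0"
  shows "(\<Sum>i<K j. cell_err R j i \<omega>) \<le> proj_err R (n j) \<omega>"
proof -
  note [measurable] = measurable_proj[OF R] section_measurable[OF \<omega>]
  let ?h = "\<lambda>s. ennreal ((norm (proj R (simple_value (k (n j)) (ts (n j)) (S (n j)) s \<omega>) - proj R (H_ext s \<omega>)))\<^sup>2)"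
  let ?c = "\<lambda>i. {real i / real (n j)<..real (Suc i) / real (n j)}"
  have "(\<Sum>i<K j. cell_err R j i \<omega>) = (\<integral>\<^sup>+s. (\<Sum>i<K j. ?h s * indicator (?c i) s) \<partial>lborel)"
    unfolding cell_err_def by (subst nn_integral_sum) auto
  also have "\<dots> \<le> (\<integral>\<^sup>+s. ?h s * indicator {0<..T} s \<partial>lborel)"
  proof (intro nn_integral_mono)
    fix s
    have uniq: "i = l" if "s \<in> ?c i" "s \<in> ?c l" for i l
    proof -
      have "real i < real (n j) * s" "real (n j) * s \<le> real (Suc i)" "real l < real (n j) * s" "real (n j) * s \<le> real (Suc l)"
        using that n by (auto simp: field_simps)
      then have "real i < real (Suc l)" "real l < real (Suc i)" by linarith+
      then show ?thesis by simp
    qed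
    show "(\<Sum>i<K j. ?h s * indicator (?c i) s) \<le> ?h s * indicator {0<..T} s"
    proof (cases "\<exists>l<K j. s \<in> ?c l")
      case True
      then obtain l where l: "l < K j" "s \<in> ?c l" by blast
      have "?h s * indicator (?c i) s = (if i = l then ?h s else 0)" for i
        using uniq[OF _ l(2), of i] l(2) by (cases "i = l") (auto simp: indicator_def)
      then have "(\<Sum>i<K j. ?h s * indicator (?c i) s) = ?h s" using l(1) by simp
      moreover have "s \<in> {0<..T}"
      proof -
        have "0 \<le> real l / real (n j)" by simp
        then show ?thesis using l(2) grid_le_T(1)[OF l(1) n] unfolding greaterThanAtMost_iff by linarith
      qed
      ultimately show ?thesis by simp
    next
      case False
      then have "(\<Sum>i<K j. ?h s * indicator (?c i) s) = 0" by (intro sum.neutral) auto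
      then show ?thesis by (simp only: zero_le)
    qed
  qed
  finally show ?thesis by (simp add: proj_err_def)
qed

text \<open>The isometry expresses the distance through the integrands, and the projected true
  volatility is inserted between them: one part is the approximation error, the other the
  oscillation within the cell.\<close>

lemma approx_incr_ZE_distance:
  assumes R: "0 \<le> R" and i: "i < K j" "n j > 0"
  shows "(\<integral>\<^sup>+\<omega>. ennreal ((norm (approx_incr R j i \<omega> - frozen_incr R j i \<omega>))\<^sup>2) \<partial>M)
     \<le> ennreal (real (n j)) * (2 * (\<integral>\<^sup>+\<omega>. cell_err R j i \<omega> \<partial>M) + 2 * (\<integral>\<^sup>+\<omega>. cell_osc R j i \<omega> \<partial>M))"
proof -
  let ?a = "real i / real (n j)" and ?b = "real (Suc i) / real (n j)"
  note g = grid_le_T[OF i]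
  have ab: "0 \<le> ?a" "?a \<le> ?b" "?b \<le> T" using g by auto
  let ?v = "\<lambda>s \<omega>. simple_value (k (n j)) (ts (n j)) (S (n j)) s \<omega>" and ?P = "\<lambda>\<omega>. proj R (Sg ?a \<omega>)"
  have "(norm (approx_incr R j i \<omega> - frozen_incr R j i \<omega>))\<^sup>2 = real (n j) * (norm (simple_integral Z (k (n j)) (ts (n j)) (proj_S R (n j)) ?b \<omega>
      - simple_integral Z (k (n j)) (ts (n j)) (proj_S R (n j)) ?a \<omega> - ?P \<omega> *v (Z ?b \<omega> - Z ?a \<omega>)))\<^sup>2" for \<omega>
    by (simp add: approx_incr_def frozen_incr_def matrix_vector_mult_scaleR scaleR_diff_right[symmetric] power_mult_distrib)
  then have "(\<integral>\<^sup>+\<omega>. ennreal ((norm (approx_incr R j i \<omega> - frozen_incr R j i \<omega>))\<^sup>2) \<partial>M)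
    = ennreal (real (n j)) * (\<integral>\<^sup>+\<omega>. ennreal ((norm (simple_integral Z (k (n j)) (ts (n j)) (proj_S R (n j)) ?b \<omega>
      - simple_integral Z (k (n j)) (ts (n j)) (proj_S R (n j)) ?a \<omega> - ?P \<omega> *v (Z ?b \<omega> - Z ?a \<omega>)))\<^sup>2) \<partial>M)"
    (is "_ = _ * ?L")
    using g simple_integral_measurable[OF proj_S_simple[OF R]] Z_measurable_M measurable_F_M[OF g(2) proj_Sg_measurable[OF R i]]
    by (simp add: ennreal_mult) (intro nn_integral_cmult measurable_compose[OF _ measurable_ennreal] borel_measurable_power
        borel_measurable_norm borel_measurable_diff borel_measurable_matrix_vector; simp)
  moreover have "?L \<le> 2 * (\<integral>\<^sup>+\<omega>. cell_err R j i \<omega> \<partial>M) + 2 * (\<integral>\<^sup>+\<omega>. cell_osc R j i \<omega> \<partial>M)"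
  proof -
  have "(\<integral>\<^sup>+\<omega>. ennreal ((norm (simple_integral Z (k (n j)) (ts (n j)) (proj_S R (n j)) ?b \<omega>
      - simple_integral Z (k (n j)) (ts (n j)) (proj_S R (n j)) ?a \<omega> - ?P \<omega> *v (Z ?b \<omega> - Z ?a \<omega>)))\<^sup>2) \<partial>M)
    = (\<integral>\<^sup>+\<omega>. (\<integral>\<^sup>+s. ennreal ((norm (simple_value (k (n j)) (ts (n j)) (proj_S R (n j)) s \<omega> - ?P \<omega>))\<^sup>2) * indicator {?a<..?b} s \<partial>lborel) \<partial>M)"
    by (rule simple_integral_compare[OF proj_S_simple[OF R] ts0 tsT ab proj_Sg_measurable[OF R i]])
  also have "\<dots> \<le> (\<integral>\<^sup>+\<omega>. 2 * cell_err R j i \<omega> + 2 * cell_osc R j i \<omega> \<partial>M)"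
  proof (rule nn_integral_mono)
    fix \<omega> assume \<omega>: "\<omega> \<in> space M"
    note [measurable] = measurable_proj[OF R] section_measurable[OF \<omega>]
    have "(\<integral>\<^sup>+s. ennreal ((norm (simple_value (k (n j)) (ts (n j)) (proj_S R (n j)) s \<omega> - ?P \<omega>))\<^sup>2) * indicator {?a<..?b} s \<partial>lborel)
      \<le> (\<integral>\<^sup>+s. 2 * (ennreal ((norm (proj R (?v s \<omega>) - proj R (H_ext s \<omega>)))\<^sup>2) * indicator {?a<..?b} s)
          + 2 * (ennreal ((norm (proj R (H_ext s \<omega>) - ?P \<omega>))\<^sup>2) * indicator {?a<..?b} s) \<partial>lborel)"
    proof (rule nn_integral_mono)
      fix s
      show "ennreal ((norm (simple_value (k (n j)) (ts (n j)) (proj_S R (n j)) s \<omega> - ?P \<omega>))\<^sup>2) * indicator {?a<..?b} s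
       \<le> 2 * (ennreal ((norm (proj R (?v s \<omega>) - proj R (H_ext s \<omega>)))\<^sup>2) * indicator {?a<..?b} s)
          + 2 * (ennreal ((norm (proj R (H_ext s \<omega>) - ?P \<omega>))\<^sup>2) * indicator {?a<..?b} s)"
      proof (cases "s \<in> {?a<..?b}")
        case True
        then have s: "s \<in> {0<..T}" using ab unfolding greaterThanAtMost_iff by linarith
        have "ennreal ((norm (proj R (?v s \<omega>) - ?P \<omega>))\<^sup>2)
          \<le> ennreal (2 * (norm (proj R (?v s \<omega>) - proj R (H_ext s \<omega>)))\<^sup>2 + 2 * (norm (proj R (H_ext s \<omega>) - ?P \<omega>))\<^sup>2)"
          by (intro ennreal_leI norm_sq_triangle)
        then show ?thesis using True s by (simp add: simple_value_SP ennreal_mult)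
      qed simp
    qed
    also have "\<dots> = 2 * cell_err R j i \<omega> + 2 * cell_osc R j i \<omega>"
      unfolding cell_err_def cell_osc_def
      by (subst nn_integral_add) (auto simp: nn_integral_cmult)
    finally show "(\<integral>\<^sup>+s. ennreal ((norm (simple_value (k (n j)) (ts (n j)) (proj_S R (n j)) s \<omega> - ?P \<omega>))\<^sup>2) * indicator {?a<..?b} s \<partial>lborel)
      \<le> 2 * cell_err R j i \<omega> + 2 * cell_osc R j i \<omega>" .
  qed
  also have "\<dots> = 2 * (\<integral>\<^sup>+\<omega>. cell_err R j i \<omega> \<partial>M) + 2 * (\<integral>\<^sup>+\<omega>. cell_osc R j i \<omega> \<partial>M)"
    using cell_err_measurable[OF R] cell_osc_measurable[OF R i]
    by (subst nn_integral_add) (auto simp: nn_integral_cmult)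
  finally show ?thesis .
  qed
  ultimately show ?thesis by (simp add: mult_left_mono)
qed

definition dist_sum :: "real \<Rightarrow> nat \<Rightarrow> 'a \<Rightarrow> real" where
  "dist_sum R j \<omega> = (\<Sum>i<K j. w t j i * (norm (approx_incr R j i \<omega> - frozen_incr R j i \<omega>))\<^sup>2)"

text \<open>The oscillation part vanishes by concentration of the weights. For the approximation
  part each weight times n is at most n/T, and the total error of order 1/n^4 outweighs this
  factor.\<close>

lemma dist_sum_limit:
  assumes R: "0 \<le> R"
  shows "(\<lambda>j. \<integral>\<^sup>+\<omega>. ennreal (dist_sum R j \<omega>) \<partial>M) \<longlonglongrightarrow> 0"
proof -
  have T0: "T > 0" using t0_range by simp
  define c where "c = 2 * (1 + 4 * R\<^sup>2 * T) / T"
  define O' where "O' j = (\<integral>\<^sup>+\<omega>. (\<Sum>i<K j. ennreal (w t j i * real (n j)) * cell_osc R j i \<omega>) \<partial>M)" for j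
  have "(\<lambda>j. ennreal (c * (1 / real (n j))) + 2 * O' j) \<longlonglongrightarrow> ennreal (c * 0) + 2 * 0"
    unfolding O'_def
    by (intro tendsto_add ennreal_tendsto_cmult osc_expectation_limit R tendsto_ennrealI tendsto_mult tendsto_const inverse_n) simp_all
  then have lim: "(\<lambda>j. ennreal (c * (1 / real (n j))) + 2 * O' j) \<longlonglongrightarrow> 0" by simp
  have "\<forall>\<^sub>F j in sequentially. real (N j) / real (n j) < 1" using order_tendstoD(2)[OF ratio, of 1] by simp
  then have "\<forall>\<^sub>F j in sequentially. (\<integral>\<^sup>+\<omega>. ennreal (dist_sum R j \<omega>) \<partial>M) \<le> ennreal (c * (1 / real (n j))) + 2 * O' j"
    using n_pos
  proof eventually_elim
    case (elim j)
    then have nj: "n j > 0" and Nn: "real (N j) \<le> real (n j)" by (auto simp: divide_less_eq)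
    \<comment> \<open>Uses N \<le> n, which holds eventually.\<close>
    have w_le: "w t j i * real (n j) \<le> real (n j) / T" for i
    proof -
      have "w t j i * real (n j) \<le> real (N j) / (real (n j) * T) * real (n j)"
        by (intro mult_right_mono fejer_weight_le T0) simp
      also have "\<dots> = real (N j) / T" using nj by simp
      also have "\<dots> \<le> real (n j) / T" using Nn T0 by (intro divide_right_mono) auto
      finally show ?thesis .
    qed
    have half: "2 * ennreal (c / 2 * (1 / real (n j))) = ennreal (c * (1 / real (n j)))"
    proof -
      have "2 * ennreal x = ennreal (2 * x)" if "x \<ge> 0" for x using that by (simp add: ennreal_mult)
      moreover have "0 \<le> c" using T0 by (simp add: c_def)
      ultimately show ?thesis by simp
    qed
    define E' where "E' = (\<Sum>i<K j. ennreal (w t j i * real (n j)) * (\<integral>\<^sup>+\<omega>. cell_err R j i \<omega> \<partial>M))"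
    have Osum: "(\<Sum>i<K j. ennreal (w t j i * real (n j)) * (\<integral>\<^sup>+\<omega>. cell_osc R j i \<omega> \<partial>M)) = O' j"
      unfolding O'_def using cell_osc_measurable[OF R _ nj]
      by (subst nn_integral_sum) (auto simp: nn_integral_cmult)
    have "E' \<le> (\<Sum>i<K j. ennreal (real (n j) / T) * (\<integral>\<^sup>+\<omega>. cell_err R j i \<omega> \<partial>M))"
      unfolding E'_def using w_le by (intro sum_mono mult_right_mono ennreal_leI) auto
    also have "\<dots> = ennreal (real (n j) / T) * (\<integral>\<^sup>+\<omega>. (\<Sum>i<K j. cell_err R j i \<omega>) \<partial>M)"
      using cell_err_measurable[OF R] by (subst nn_integral_sum) (auto simp: sum_distrib_left)
    also have "\<dots> \<le> ennreal (real (n j) / T) * (\<integral>\<^sup>+\<omega>. proj_err R (n j) \<omega> \<partial>M)"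
      using sum_cell_err_le[OF R _ nj] by (intro mult_left_mono nn_integral_mono) auto
    also have "\<dots> \<le> ennreal (real (n j) / T) * ennreal ((1 + 4 * R\<^sup>2 * T) / real (Suc (n j)) ^ 4)"
      by (intro mult_left_mono proj_err_expectation R) simp
    also have "\<dots> = ennreal (real (n j) / T * ((1 + 4 * R\<^sup>2 * T) / real (Suc (n j)) ^ 4))"
      using T0 by (intro ennreal_mult[symmetric]) auto
    also have "\<dots> \<le> ennreal (c / 2 * (1 / real (n j)))"
    proof (rule ennreal_leI)
      have "real (n j) * real (n j) \<le> real (Suc (n j)) ^ 2" by (simp add: power2_eq_square mult_mono)
      also have "\<dots> \<le> real (Suc (n j)) ^ 4" by (rule power_increasing) auto
      finally have "real (n j) * real (n j) \<le> real (Suc (n j)) ^ 4" .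
      then have "real (n j) / real (Suc (n j)) ^ 4 \<le> 1 / real (n j)"
        using nj by (simp add: divide_le_eq le_divide_eq)
      then have "(1 + 4 * R\<^sup>2 * T) / T * (real (n j) / real (Suc (n j)) ^ 4) \<le> (1 + 4 * R\<^sup>2 * T) / T * (1 / real (n j))"
        using T0 by (intro mult_left_mono) auto
      moreover have "c / 2 = (1 + 4 * R\<^sup>2 * T) / T" using T0 by (simp add: c_def field_simps)
      moreover have "x / T * (y / z) = y / T * (x / z)" for x y z :: real by simp
      ultimately show "real (n j) / T * ((1 + 4 * R\<^sup>2 * T) / real (Suc (n j)) ^ 4) \<le> c / 2 * (1 / real (n j))"
        by metis
    qed
    finally have E'_le: "E' \<le> ennreal (c / 2 * (1 / real (n j)))" .
    have "(\<integral>\<^sup>+\<omega>. ennreal (dist_sum R j \<omega>) \<partial>M) = (\<Sum>i<K j. ennreal (w t j i) * (\<integral>\<^sup>+\<omega>. ennreal ((norm (approx_incr R j i \<omega> - frozen_incr R j i \<omega>))\<^sup>2) \<partial>M))"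
      unfolding dist_sum_def using w_nonneg approx_incr_measurable[OF R _ nj] frozen_incr_measurable[OF R _ nj]
      by (intro nn_integral_weighted_sum) auto
    also have "\<dots> \<le> (\<Sum>i<K j. ennreal (w t j i) * (ennreal (real (n j)) * (2 * (\<integral>\<^sup>+\<omega>. cell_err R j i \<omega> \<partial>M) + 2 * (\<integral>\<^sup>+\<omega>. cell_osc R j i \<omega> \<partial>M))))"
      using nj by (intro sum_mono mult_left_mono approx_incr_ZE_distance R) auto
    also have "\<dots> = 2 * E' + 2 * (\<Sum>i<K j. ennreal (w t j i * real (n j)) * (\<integral>\<^sup>+\<omega>. cell_osc R j i \<omega> \<partial>M))"
      unfolding E'_def sum_distrib_left sum.distrib[symmetric] using w_nonneg
      by (intro sum.cong refl) (simp add: ennreal_mult distrib_left mult_ac)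
    also have "\<dots> = 2 * E' + 2 * O' j" by (simp only: Osum)
    also have "\<dots> \<le> 2 * ennreal (c / 2 * (1 / real (n j))) + 2 * O' j"
      by (intro add_right_mono mult_left_mono E'_le) simp
    finally show ?case unfolding half .
  qed
  then show ?thesis
    by (intro tendsto_sandwich[OF _ _ tendsto_const lim]) auto
qed

end

section \<open>Exceptional events: failure of the approximation, of the truncation, and large
  drift\<close>

context fejer_approx
begin

lemma sqrt_n_at_top: "filterlim (\<lambda>j. sqrt (real (n j))) at_top sequentially"
  by (intro filterlim_compose[OF sqrt_at_top] filterlim_compose[OF filterlim_real_sequentially n_lim])

lemma sqrt_n_over_n: "(\<lambda>j. sqrt (real (n j)) / real (Suc (n j))) \<longlonglongrightarrow> 0"
proof (rule Lim_null_comparison)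
  show "(\<lambda>j. 1 / sqrt (real (n j))) \<longlonglongrightarrow> 0"
    by (intro real_tendsto_divide_at_top[OF tendsto_const] sqrt_n_at_top)
  show "\<forall>\<^sub>F j in sequentially. norm (sqrt (real (n j)) / real (Suc (n j))) \<le> 1 / sqrt (real (n j))"
    using n_pos by eventually_elim (simp add: divide_le_eq le_divide_eq)
qed

lemma I_measurable: "s \<in> {0..T} \<Longrightarrow> I s \<in> borel_measurable M"
  and I_continuous: "\<omega> \<in> space M \<Longrightarrow> continuous_on {0..T} (\<lambda>s. I s \<omega>)"
  using ito by (auto simp: is_ito_integral_def)

text \<open>The supremum bounds its members only when they are bounded above; this follows from
  continuity in time of both integrals.\<close>

lemma simple_integral_sup_err:
  assumes \<omega>: "\<omega> \<in> space M" and s: "s \<in> {0..T}"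
  shows "norm (simple_integral Z (k m) (ts m) (S m) s \<omega> - I s \<omega>) \<le> sup_err m \<omega>"
proof -
  have Zc: "continuous_on {0..T} (\<lambda>s. Z s \<omega>)" using brownian \<omega> by (auto simp: brownian_motion_def)
  have c: "continuous_on {0..T} (\<lambda>s. Z (min s (ts m i)) \<omega>)" if "i \<le> k m" for i
    using ts_range[OF that] by (intro continuous_on_compose2[OF Zc] continuous_intros) (auto simp: min_def)
  have "continuous_on {0..T} (\<lambda>s. norm (simple_integral Z (k m) (ts m) (S m) s \<omega> - I s \<omega>))"
    unfolding simple_integral_def
  proof (intro continuous_on_norm continuous_on_diff continuous_on_sum I_continuous \<omega>)
    fix i assume "i \<in> {..<k m}"
    then have "continuous_on {0..T} (\<lambda>s. Z (min s (ts m (Suc i))) \<omega> - Z (min s (ts m i)) \<omega>)"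
      by (intro continuous_on_diff c) auto
    then show "continuous_on {0..T} (\<lambda>s. S m i \<omega> *v (Z (min s (ts m (Suc i))) \<omega> - Z (min s (ts m i)) \<omega>))"
      by (rule continuous_on_compose2[OF matrix_vector_mult_linear_continuous_on]) auto
  qed
  then have "bdd_above ((\<lambda>s. norm (simple_integral Z (k m) (ts m) (S m) s \<omega> - I s \<omega>)) ` {0..T})"
    by (intro bounded_imp_bdd_above compact_imp_bounded compact_continuous_image) auto
  then show ?thesis unfolding sup_err_def using s by (intro cSUP_upper)
qed

text \<open>The event of Lenglart's inequality for the part of the simple integrand cut off by the
  projection. The factor 4 matches the bound \<open>4 * err\<close> in
  \<open>truncation_quadratic_error\<close>.\<close>

definition tail_event :: "real \<Rightarrow> nat \<Rightarrow> 'a set" where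
  "tail_event R j = {\<omega>\<in>space M. (\<Sum>i<k (n j). (ts (n j) (Suc i) - ts (n j) i) * (norm (S (n j) i \<omega> - proj_S R (n j) i \<omega>))\<^sup>2) \<le> 4 / real (Suc (n j)) ^ 4
     \<and> (\<exists>s\<in>(\<lambda>i. real i / real (n j)) ` {..K j}. norm (simple_integral Z (k (n j)) (ts (n j)) (\<lambda>i \<omega>. S (n j) i \<omega> - proj_S R (n j) i \<omega>) s \<omega>) > 1 / real (Suc (n j)))}"

lemma grid_range: "i \<le> K j \<Longrightarrow> n j > 0 \<Longrightarrow> real i / real (n j) \<in> {0..T}"
proof -
  assume i: "i \<le> K j" "n j > 0"
  have "0 \<le> real (n j) * T" using t0_range by simp
  then have "int i \<le> \<lfloor>real (n j) * T\<rfloor>" using i(1) by (subst (asm) le_nat_iff) auto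
  then have "real i \<le> real (n j) * T" by (simp add: le_floor_iff)
  then show ?thesis using i(2) by (simp add: divide_le_eq mult.commute)
qed

lemma tail_event_measurable:
  assumes R: "0 \<le> R" and n: "n j > 0"
  shows "tail_event R j \<in> events"
proof -
  have Dm: "simple_integral Z (k (n j)) (ts (n j)) (\<lambda>i \<omega>. S (n j) i \<omega> - proj_S R (n j) i \<omega>) (real i / real (n j)) \<in> borel_measurable M"
    if "i \<le> K j" for i
    by (intro simple_integral_measurable diff_simple R grid_range that n)
  have "(\<lambda>\<omega>. S (n j) i \<omega> - proj_S R (n j) i \<omega>) \<in> borel_measurable M" if "i < k (n j)" for i
  proof (rule measurable_F_M)
    show "ts (n j) i \<in> {0..T}" using ts_range[of i "n j"] that by simp
    show "(\<lambda>\<omega>. S (n j) i \<omega> - proj_S R (n j) i \<omega>) \<in> borel_measurable (F (ts (n j) i))"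
      using diff_simple[OF R, of "n j"] that by (auto simp: simple_integrand_def)
  qed
  then have m1: "(\<lambda>\<omega>. \<Sum>i<k (n j). (ts (n j) (Suc i) - ts (n j) i) * (norm (S (n j) i \<omega> - proj_S R (n j) i \<omega>))\<^sup>2) \<in> borel_measurable M"
    by (intro borel_measurable_sum borel_measurable_times borel_measurable_const borel_measurable_power borel_measurable_norm) auto
  have "{\<omega>\<in>space M. \<exists>s\<in>(\<lambda>i. real i / real (n j)) ` {..K j}. norm (simple_integral Z (k (n j)) (ts (n j)) (\<lambda>i \<omega>. S (n j) i \<omega> - proj_S R (n j) i \<omega>) s \<omega>) > 1 / real (Suc (n j))}
    = (\<Union>i\<in>{..K j}. {\<omega>\<in>space M. norm (simple_integral Z (k (n j)) (ts (n j)) (\<lambda>i \<omega>. S (n j) i \<omega> - proj_S R (n j) i \<omega>) (real i / real (n j)) \<omega>) > 1 / real (Suc (n j))})"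
    by auto
  also have "\<dots> \<in> events"
  proof (intro sets.finite_UN)
    fix i assume "i \<in> {..K j}"
    then have [measurable]: "simple_integral Z (k (n j)) (ts (n j)) (\<lambda>i \<omega>. S (n j) i \<omega> - proj_S R (n j) i \<omega>) (real i / real (n j)) \<in> borel_measurable M"
      using Dm by simp
    show "{\<omega>\<in>space M. norm (simple_integral Z (k (n j)) (ts (n j)) (\<lambda>i \<omega>. S (n j) i \<omega> - proj_S R (n j) i \<omega>) (real i / real (n j)) \<omega>) > 1 / real (Suc (n j))} \<in> events"
      by measurable
  qed simp
  finally have 2: "{\<omega>\<in>space M. \<exists>s\<in>(\<lambda>i. real i / real (n j)) ` {..K j}. norm (simple_integral Z (k (n j)) (ts (n j)) (\<lambda>i \<omega>. S (n j) i \<omega> - proj_S R (n j) i \<omega>) s \<omega>) > 1 / real (Suc (n j))} \<in> events" .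
  have "{\<omega>\<in>space M. (\<Sum>i<k (n j). (ts (n j) (Suc i) - ts (n j) i) * (norm (S (n j) i \<omega> - proj_S R (n j) i \<omega>))\<^sup>2) \<le> 4 / real (Suc (n j)) ^ 4} \<in> events"
    using m1 by measurable
  from sets.Int[OF this 2] show ?thesis unfolding tail_event_def by (simp add: Int_def conj_ac cong: conj_cong) 
qed

text \<open>With m = n + 1, Lenglart gives at most (n T + 1) times 4 m^(-4) m^2, which is
  O(1/m).\<close>

lemma tail_event_limit:
  assumes R: "0 \<le> R"
  shows "(\<lambda>j. prob (tail_event R j)) \<longlonglongrightarrow> 0"
proof (rule Lim_null_comparison)
  have T0: "T > 0" using t0_range by simp
  show "(\<lambda>j. 4 * (T + 1) * (1 / real (n j))) \<longlonglongrightarrow> 0"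
    using tendsto_mult_left[OF inverse_n, of "4 * (T + 1)"] by simp
  show "\<forall>\<^sub>F j in sequentially. norm (prob (tail_event R j)) \<le> 4 * (T + 1) * (1 / real (n j))"
    using n_pos
  proof eventually_elim
    case (elim j)
    define m where "m = real (Suc (n j))"
    have m: "m > 0" "real (n j) \<le> m" "1 \<le> m" by (auto simp: m_def)
    let ?S = "(\<lambda>i. real i / real (n j)) ` {..K j}"
    have S: "finite ?S" "?S \<subseteq> {0..T}" using grid_range elim by auto
    have "prob (tail_event R j) \<le> real (card ?S) * (4 / m ^ 4 / (1 / m)\<^sup>2)"
      unfolding tail_event_def m_def[symmetric]
      using m by (intro simple_integral_lenglart diff_simple R ts0 S) auto
    also have "\<dots> \<le> (real (n j) * T + 1) * (4 / m ^ 4 / (1 / m)\<^sup>2)"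
    proof (rule mult_right_mono)
      have "card ?S \<le> card {..K j}" by (rule card_image_le) simp
      then have "real (card ?S) \<le> real (K j) + 1" by simp
      also have "real (K j) \<le> real (n j) * T" using T0 by simp
      finally show "real (card ?S) \<le> real (n j) * T + 1" by simp
    qed (use m in simp)
    also have "4 / m ^ 4 / (1 / m)\<^sup>2 = 4 / m\<^sup>2"
      using m by (simp add: power2_eq_square power4_eq_xxxx)
    also have "(real (n j) * T + 1) * (4 / m\<^sup>2) \<le> (m * (T + 1)) * (4 / m\<^sup>2)"
    proof (rule mult_right_mono)
      have "real (n j) * T \<le> m * T" using m T0 by (intro mult_right_mono) auto
      then show "real (n j) * T + 1 \<le> m * (T + 1)" using m by (simp add: distrib_left)
    qed simp
    also have "\<dots> = 4 * (T + 1) * (1 / m)" using m by (simp add: power2_eq_square)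
    also have "\<dots> \<le> 4 * (T + 1) * (1 / real (n j))"
      using T0 m elim by (intro mult_left_mono divide_left_mono) auto
    finally show ?case by simp
  qed
qed

text \<open>On the event the true integrand lies in the ball, so it is its own projection. By the
  Lipschitz property a value v is then moved by at most 2 |v - H|, and squaring gives the factor
  4.\<close>

lemma truncation_quadratic_error:
  assumes R: "0 \<le> R"
  shows "AE \<omega> in M. \<omega> \<in> bounded_event R \<longrightarrow>
     (\<Sum>i<k m. (ts m (Suc i) - ts m i) * (norm (S m i \<omega> - proj_S R m i \<omega>))\<^sup>2) \<le> 4 * err m \<omega>"
  using squared_error_le_err[of m]
proof (rule AE_mp, intro AE_I2 impI)
  fix \<omega> assume \<omega>: "\<omega> \<in> space M" and b: "\<omega> \<in> bounded_event R"
    and e: "(\<integral>\<^sup>+s. ennreal ((norm (simple_value (k m) (ts m) (S m) s \<omega> - H_ext s \<omega>))\<^sup>2) * indicator {0<..T} s \<partial>lborel) \<le> ennreal (err m \<omega>)"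
  note [measurable] = section_measurable[OF \<omega>]
  have T0: "0 \<le> T" using t0_range by simp
  have err0: "0 \<le> err m \<omega>"
    unfolding err_def set_lebesgue_integral_def by (intro Bochner_Integration.integral_nonneg) (auto simp: indicator_def)
  let ?v = "\<lambda>s. simple_value (k m) (ts m) (S m) s \<omega>"
  let ?d = "\<lambda>s. simple_value (k m) (ts m) (\<lambda>i \<omega>. S m i \<omega> - proj_S R m i \<omega>) s \<omega>"
  have "ennreal (\<Sum>i<k m. (ts m (Suc i) - ts m i) * (norm (S m i \<omega> - proj_S R m i \<omega>))\<^sup>2)
     = ennreal (\<Sum>i<k m. (clip 0 T (ts m (Suc i)) - clip 0 T (ts m i)) * (norm (S m i \<omega> - proj_S R m i \<omega>))\<^sup>2)"
  proof -
    have "clip 0 T (ts m i) = ts m i" if "i \<le> k m" for i using ts_range[OF that] by (auto simp: clip_def)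
    then show ?thesis by (intro arg_cong[where f = ennreal] sum.cong refl) auto
  qed
  also have "\<dots> = (\<integral>\<^sup>+s. ennreal ((norm (?d s))\<^sup>2) * indicator {0<..T} s \<partial>lborel)"
    using T0 ts_mono[of _ m] by (intro nn_integral_simple_value[where \<phi> = "\<lambda>x. (norm x)\<^sup>2", symmetric]) (auto simp: ts0 tsT)
  also have "\<dots> \<le> (\<integral>\<^sup>+s. 4 * (ennreal ((norm (?v s - H_ext s \<omega>))\<^sup>2) * indicator {0<..T} s) \<partial>lborel)"
  proof (rule nn_integral_mono)
    fix s
    show "ennreal ((norm (?d s))\<^sup>2) * indicator {0<..T} s \<le> 4 * (ennreal ((norm (?v s - H_ext s \<omega>))\<^sup>2) * indicator {0<..T} s)"
    proof (cases "s \<in> {0<..T}")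
      case True
      have "H_ext s \<omega> = leftlim (\<lambda>u. Sg u \<omega>) s" using True H_eq[OF \<omega> True] by (simp add: H_ext_def)
      then have "norm (H_ext s \<omega>) \<le> R" using bounded_event_leftlim[OF b True] by simp
      then have pH: "proj R (H_ext s \<omega>) = H_ext s \<omega>" by (rule proj_self)
      have "norm (?v s - proj R (?v s)) \<le> norm (?v s - H_ext s \<omega>) + norm (proj R (H_ext s \<omega>) - proj R (?v s))"
        using norm_triangle_ineq[of "?v s - H_ext s \<omega>" "H_ext s \<omega> - proj R (?v s)"] unfolding pH by simp
      also have "\<dots> \<le> 2 * norm (?v s - H_ext s \<omega>)"
        using proj_lipschitz[OF R, of "H_ext s \<omega>" "?v s"] by (simp add: norm_minus_commute)
      finally have "(norm (?d s))\<^sup>2 \<le> (2 * norm (?v s - H_ext s \<omega>))\<^sup>2"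
        unfolding simple_value_diff[OF True] by (intro power_mono) auto
      then have "ennreal ((norm (?d s))\<^sup>2) \<le> ennreal (4 * (norm (?v s - H_ext s \<omega>))\<^sup>2)"
        by (intro ennreal_leI) (simp add: power_mult_distrib)
      then show ?thesis using True by (simp add: ennreal_mult)
    qed simp
  qed
  also have "\<dots> \<le> 4 * ennreal (err m \<omega>)"
    using e by (subst nn_integral_cmult) (auto intro!: mult_left_mono)
  also have "\<dots> = ennreal (4 * err m \<omega>)" using err0 by (simp add: ennreal_mult)
  finally show "(\<Sum>i<k m. (ts m (Suc i) - ts m i) * (norm (S m i \<omega> - proj_S R m i \<omega>))\<^sup>2) \<le> 4 * err m \<omega>"
    using err0 by (subst (asm) ennreal_le_iff) auto
qed

definition drift_event :: "real \<Rightarrow> nat \<Rightarrow> 'a set" where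
  "drift_event d j = (\<Union>i<K j. {\<omega>\<in>space M. sqrt (real (n j)) * norm ((D (real (Suc i) / real (n j)) \<omega> - D (real i / real (n j)) \<omega>)
       - (I (real (Suc i) / real (n j)) \<omega> - I (real i / real (n j)) \<omega>)) > d})"

lemma drift_event_measurable:
  assumes "n j > 0"
  shows "drift_event d j \<in> events"
  unfolding drift_event_def
proof (rule sets.finite_UN)
  fix i assume "i \<in> {..<K j}"
  then have g: "real i / real (n j) \<in> {0..T}" "real (Suc i) / real (n j) \<in> {0..T}" using grid_le_T[of i j] assms by auto
  note [measurable] = D_measurable[OF g(1)] D_measurable[OF g(2)] I_measurable[OF g(1)] I_measurable[OF g(2)]
  show "{\<omega>\<in>space M. sqrt (real (n j)) * norm ((D (real (Suc i) / real (n j)) \<omega> - D (real i / real (n j)) \<omega>)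
       - (I (real (Suc i) / real (n j)) \<omega> - I (real i / real (n j)) \<omega>)) > d} \<in> events"
    by measurable
qed simp

text \<open>Scaled drift increments are at most c / sqrt n with a random c, so the argument is
  pathwise and ends with \<open>prob_eventually_not_in\<close>.\<close>

lemma drift_event_limit:
  assumes "d > 0"
  shows "(\<lambda>j. prob (drift_event d j)) \<longlonglongrightarrow> 0"
proof -
  have "(\<lambda>j. prob (if n j > 0 then drift_event d j else {})) \<longlonglongrightarrow> 0"
  proof (rule prob_eventually_not_in)
    show "(if n j > 0 then drift_event d j else {}) \<in> events" for j using drift_event_measurable by auto
    show "AE \<omega> in M. \<forall>\<^sub>F j in sequentially. \<omega> \<notin> (if n j > 0 then drift_event d j else {})"
      using drift
    proof eventually_elim
      case (elim \<omega>)
      then obtain c where c: "\<And>s r. 0 \<le> s \<Longrightarrow> s \<le> r \<Longrightarrow> r \<le> T \<Longrightarrow> norm ((D r \<omega> - D s \<omega>) - (I r \<omega> - I s \<omega>)) \<le> c * (r - s)"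
        by blast
      have "(\<lambda>j. c * (1 / sqrt (real (n j)))) \<longlonglongrightarrow> c * 0"
        by (intro tendsto_mult tendsto_const real_tendsto_divide_at_top[OF tendsto_const] sqrt_n_at_top)
      then have "\<forall>\<^sub>F j in sequentially. c * (1 / sqrt (real (n j))) < d" using assms by (intro order_tendstoD) auto
      then show ?case using n_pos
      proof eventually_elim
        case (elim j)
        have "sqrt (real (n j)) * norm ((D (real (Suc i) / real (n j)) \<omega> - D (real i / real (n j)) \<omega>)
           - (I (real (Suc i) / real (n j)) \<omega> - I (real i / real (n j)) \<omega>)) \<le> d" if i: "i < K j" for i
        proof -
          have "norm ((D (real (Suc i) / real (n j)) \<omega> - D (real i / real (n j)) \<omega>)
           - (I (real (Suc i) / real (n j)) \<omega> - I (real i / real (n j)) \<omega>)) \<le> c * (real (Suc i) / real (n j) - real i / real (n j))"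
            using grid_le_T[OF i \<open>n j > 0\<close>] by (intro c) auto
          also have "\<dots> = c / real (n j)" by (simp add: diff_divide_distrib[symmetric])
          finally have "sqrt (real (n j)) * norm ((D (real (Suc i) / real (n j)) \<omega> - D (real i / real (n j)) \<omega>)
           - (I (real (Suc i) / real (n j)) \<omega> - I (real i / real (n j)) \<omega>)) \<le> sqrt (real (n j)) * (c / real (n j))"
            by (intro mult_left_mono) auto
          also have "\<dots> = c * (1 / sqrt (real (n j)))"
            using \<open>n j > 0\<close> by (simp add: real_div_sqrt field_simps)
          finally show ?thesis using elim by linarith
        qed
        then have "\<omega> \<notin> drift_event d j" unfolding drift_event_def by (auto simp: not_less)
        then show ?case by simp
      qed
    qed
  qed
  then show ?thesis
    by (rule Lim_transform_eventually) (use n_pos in \<open>eventually_elim, simp\<close>)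
qed

end

section \<open>Replacement of the increments by frozen ones, and the limit for the diffusion
  part\<close>

context fejer_approx
begin

definition weighted_increments :: "nat \<Rightarrow> 'a \<Rightarrow> real" where
  "weighted_increments j \<omega> = (\<Sum>i<K j. w t j i * f (sqrt (real (n j)) *\<^sub>R (D (real (Suc i) / real (n j)) \<omega> - D (real i / real (n j)) \<omega>)))"

text \<open>The factor 3 comes from \<open>exp_growth_add_le\<close>, which passes from the true
  increments to the approximating ones.\<close>

definition growth_sum :: "real \<Rightarrow> nat \<Rightarrow> 'a \<Rightarrow> real" where
  "growth_sum R j \<omega> = (\<Sum>i<K j. w t j i * (3 * exp_growth (approx_incr R j i \<omega>) + exp_growth (frozen_incr R j i \<omega>)))"

definition fluctuation :: "real \<Rightarrow> nat \<Rightarrow> 'a \<Rightarrow> real" where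
  "fluctuation R j \<omega> = (\<Sum>i<K j. w t j i * (f (frozen_incr R j i \<omega>) - mean (proj R (Sg (real i / real (n j)) \<omega>))))"

definition mean_sum :: "real \<Rightarrow> nat \<Rightarrow> 'a \<Rightarrow> real" where
  "mean_sum R j \<omega> = (\<Sum>i<K j. w t j i * mean (proj R (Sg (real i / real (n j)) \<omega>)))"

lemma
  assumes R: "0 \<le> R" and n: "n j > 0"
  shows growth_sum_measurable: "growth_sum R j \<in> borel_measurable M"
    and dist_sum_measurable: "dist_sum R j \<in> borel_measurable M"
    and fluctuation_measurable: "fluctuation R j \<in> borel_measurable M"
    and mean_sum_measurable: "mean_sum R j \<in> borel_measurable M"
proof -
  note m = approx_incr_measurable[OF R _ n] frozen_incr_measurable[OF R _ n]
  have mm: "(\<lambda>\<omega>. mean (proj R (Sg (real i / real (n j)) \<omega>))) \<in> borel_measurable M" if "i < K j" for i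
    using grid_le_T[OF that n] by (intro measurable_compose[OF measurable_compose[OF Sg_measurable_M measurable_proj[OF R]] mean_measurable])
  show "growth_sum R j \<in> borel_measurable M" unfolding growth_sum_def[abs_def]
    using m by (intro borel_measurable_sum borel_measurable_times borel_measurable_add borel_measurable_const
        measurable_compose[OF _ exp_growth_measurable]) auto
  show "dist_sum R j \<in> borel_measurable M" unfolding dist_sum_def[abs_def]
    using m by (intro borel_measurable_sum borel_measurable_times borel_measurable_const borel_measurable_power
        borel_measurable_norm borel_measurable_diff) auto
  show "fluctuation R j \<in> borel_measurable M" unfolding fluctuation_def[abs_def]
    using m mm by (intro borel_measurable_sum borel_measurable_times borel_measurable_const borel_measurable_diff
        measurable_compose[OF _ f_measurable]) auto
  show "mean_sum R j \<in> borel_measurable M" unfolding mean_sum_def[abs_def]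
    using mm by (intro borel_measurable_sum borel_measurable_times borel_measurable_const) auto
qed

text \<open>The constant is (3 + 1) times the bound for one cell, times the bound 2 on the total
  weight.\<close>

lemma growth_sum_expectation:
  assumes R: "0 \<le> R" and n: "n j > 0" and wt: "(\<Sum>i<K j. w t j i) \<le> 2"
  shows "(\<integral>\<^sup>+\<omega>. ennreal (growth_sum R j \<omega>) \<partial>M) \<le> ennreal (8 * growth_bound R)"
proof -
  note m = measurable_compose[OF approx_incr_measurable[OF R _ n] exp_growth_measurable] measurable_compose[OF frozen_incr_measurable[OF R _ n] exp_growth_measurable]
  have G: "0 \<le> growth_bound R" by (rule growth_bound_nonneg)
  have cell: "(\<integral>\<^sup>+\<omega>. ennreal (3 * exp_growth (approx_incr R j i \<omega>) + exp_growth (frozen_incr R j i \<omega>)) \<partial>M) \<le> ennreal (4 * growth_bound R)" if i: "i < K j" for i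
  proof -
    have "(\<integral>\<^sup>+\<omega>. ennreal (3 * exp_growth (approx_incr R j i \<omega>) + exp_growth (frozen_incr R j i \<omega>)) \<partial>M)
      = (\<integral>\<^sup>+\<omega>. ennreal 3 * ennreal (exp_growth (approx_incr R j i \<omega>)) + ennreal (exp_growth (frozen_incr R j i \<omega>)) \<partial>M)"
      by (intro nn_integral_cong) (simp add: ennreal_mult)
    also have "\<dots> = ennreal 3 * (\<integral>\<^sup>+\<omega>. ennreal (exp_growth (approx_incr R j i \<omega>)) \<partial>M) + (\<integral>\<^sup>+\<omega>. ennreal (exp_growth (frozen_incr R j i \<omega>)) \<partial>M)"
      using m[OF i] by (subst nn_integral_add) (auto simp del: ennreal_numeral intro!: nn_integral_cmult)
    also have "\<dots> \<le> ennreal 3 * ennreal (growth_bound R) + ennreal (growth_bound R)"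
      by (intro add_mono mult_left_mono approx_incr_exp_growth frozen_incr_exp_growth R i n) simp
    also have "\<dots> = ennreal (4 * growth_bound R)"
      using G by (simp add: ennreal_mult[symmetric] ennreal_plus[symmetric] del: ennreal_plus ennreal_numeral)
    finally show ?thesis .
  qed
  have "(\<integral>\<^sup>+\<omega>. ennreal (growth_sum R j \<omega>) \<partial>M) = (\<Sum>i<K j. ennreal (w t j i) * (\<integral>\<^sup>+\<omega>. ennreal (3 * exp_growth (approx_incr R j i \<omega>) + exp_growth (frozen_incr R j i \<omega>)) \<partial>M))"
    unfolding growth_sum_def using w_nonneg m
    by (intro nn_integral_weighted_sum) auto
  also have "\<dots> \<le> (\<Sum>i<K j. ennreal (w t j i) * ennreal (4 * growth_bound R))"
    by (intro sum_mono mult_left_mono cell) auto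
  also have "\<dots> = ennreal (\<Sum>i<K j. w t j i * (4 * growth_bound R))"
    using G w_nonneg by (subst sum_ennreal[symmetric]) (auto simp: ennreal_mult intro!: sum.cong)
  also have "\<dots> \<le> ennreal (2 * (4 * growth_bound R))"
    unfolding sum_distrib_right[symmetric] using G wt by (intro ennreal_leI mult_right_mono) auto
  finally show ?thesis by simp
qed

text \<open>The sum of squared weights is at most the largest weight N/(n T) times the total weight,
  hence O(N/n).\<close>

lemma fluctuation_limit:
  assumes R: "0 \<le> R"
  shows "(\<lambda>j. \<integral>\<^sup>+\<omega>. ennreal ((fluctuation R j \<omega>)\<^sup>2) \<partial>M) \<longlonglongrightarrow> 0"
proof -
  have T0: "T > 0" using t0_range by simp
  have "(\<lambda>j. ennreal (variance_bound R * (2 / T) * (real (N j) / real (n j)))) \<longlonglongrightarrow> ennreal (variance_bound R * (2 / T) * 0)"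
    by (intro tendsto_ennrealI tendsto_mult tendsto_const ratio)
  then have lim: "(\<lambda>j. ennreal (variance_bound R * (2 / T) * (real (N j) / real (n j)))) \<longlonglongrightarrow> 0" by simp
  have "\<forall>\<^sub>F j in sequentially. (\<integral>\<^sup>+\<omega>. ennreal ((fluctuation R j \<omega>)\<^sup>2) \<partial>M) \<le> ennreal (variance_bound R * (2 / T) * (real (N j) / real (n j)))"
    using n_pos weight_total_le
  proof eventually_elim
    case (elim j)
    then have n: "n j > 0" by simp
    have KT: "real (K j) / real (n j) \<le> T"
      using grid_range[of "K j" j] n by simp
    have "(\<integral>\<^sup>+\<omega>. ennreal ((fluctuation R j \<omega>)\<^sup>2) \<partial>M) \<le> ennreal (variance_bound R * (\<Sum>i<K j. (w t j i)\<^sup>2))"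
      unfolding fluctuation_def frozen_incr_def
      using norm_proj_le[OF R] by (intro weak_law n KT proj_Sg_measurable R) auto
    also have "\<dots> \<le> ennreal (variance_bound R * ((2 / T) * (real (N j) / real (n j))))"
    proof (intro ennreal_leI mult_left_mono variance_bound_nonneg)
      have "(\<Sum>i<K j. (w t j i)\<^sup>2) \<le> (\<Sum>i<K j. w t j i * (real (N j) / (real (n j) * T)))"
        unfolding power2_eq_square using w_nonneg by (intro sum_mono mult_left_mono fejer_weight_le T0) auto
      also have "\<dots> \<le> 2 * (real (N j) / (real (n j) * T))"
        unfolding sum_distrib_right[symmetric] using elim T0 by (intro mult_right_mono) auto
      finally show "(\<Sum>i<K j. (w t j i)\<^sup>2) \<le> (2 / T) * (real (N j) / real (n j))" by (simp add: mult.commute)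
    qed
    finally show ?case by (simp add: mult.assoc)
  qed
  then show ?thesis by (intro tendsto_sandwich[OF _ _ tendsto_const lim]) auto
qed

text \<open>The error splits into the drift, the uniform error of the simple integral, and the
  integral of the part removed by the projection. The first costs d/3; the other two occur at both
  ends of the cell, giving 4 sqrt n / (n + 1) \<le> 2 d / 3.\<close>

lemma increment_close:
  assumes R: "0 \<le> R" and \<omega>: "\<omega> \<in> space M" and i: "i < K j" "n j > 0" and d: "d > 0"
    and 1: "\<omega> \<notin> drift_event (d / 3) j"
    and 2: "sup_err (n j) \<omega> \<le> 1 / real (Suc (n j))"
    and 3: "(\<Sum>i<k (n j). (ts (n j) (Suc i) - ts (n j) i) * (norm (S (n j) i \<omega> - proj_S R (n j) i \<omega>))\<^sup>2) \<le> 4 / real (Suc (n j)) ^ 4"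
    and 4: "\<omega> \<notin> tail_event R j"
    and small: "sqrt (real (n j)) / real (Suc (n j)) \<le> d / 6"
  shows "norm (sqrt (real (n j)) *\<^sub>R (D (real (Suc i) / real (n j)) \<omega> - D (real i / real (n j)) \<omega>) - approx_incr R j i \<omega>) \<le> d"
proof -
  let ?a = "real i / real (n j)" and ?b = "real (Suc i) / real (n j)" and ?r = "sqrt (real (n j))" and ?h = "1 / real (Suc (n j))"
  let ?J = "\<lambda>A s. simple_integral Z (k (n j)) (ts (n j)) A s \<omega>"
  define dI dJ where "dI s = ?J (S (n j)) s - I s \<omega>" and "dJ s = ?J (\<lambda>i \<omega>. S (n j) i \<omega> - proj_S R (n j) i \<omega>) s" for s
  have ab: "?a \<in> {0..T}" "?b \<in> {0..T}" using grid_le_T[OF i] by auto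
  have lin: "dJ s = ?J (S (n j)) s - ?J (proj_S R (n j)) s" for s
    unfolding dJ_def simple_integral_def sum_subtractf[symmetric] by (simp add: matrix_vector_mult_diff_rdistrib)
  have nI: "norm (dI s) \<le> ?h" if "s \<in> {0..T}" for s
    using simple_integral_sup_err[OF \<omega> that, of "n j"] 2 by (simp add: dI_def)
  have nJ: "norm (dJ (real l / real (n j))) \<le> ?h" if "l \<le> K j" for l
    using 3 4 \<omega> that by (force simp: tail_event_def dJ_def not_less)
  define e0 where "e0 = (D ?b \<omega> - D ?a \<omega>) - (I ?b \<omega> - I ?a \<omega>)"
  have n0: "?r * norm e0 \<le> d / 3"
    using 1 i(1) \<omega> by (force simp: drift_event_def e0_def not_less)
  have rep: "?r *\<^sub>R (D ?b \<omega> - D ?a \<omega>) - approx_incr R j i \<omega> = ?r *\<^sub>R e0 + ?r *\<^sub>R ((dJ ?b - dI ?b) - (dJ ?a - dI ?a))"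
    unfolding approx_incr_def e0_def lin dI_def by (simp add: algebra_simps)
  have "norm ((dJ ?b - dI ?b) - (dJ ?a - dI ?a)) \<le> norm (dJ ?b) + norm (dI ?b) + (norm (dJ ?a) + norm (dI ?a))"
    by (intro norm_triangle_le_diff add_mono norm_triangle_ineq4)
  also have "\<dots> \<le> ?h + ?h + (?h + ?h)"
    using i(1) by (intro add_mono nI nJ ab) auto
  finally have "?r * norm ((dJ ?b - dI ?b) - (dJ ?a - dI ?a)) \<le> ?r * (4 * ?h)" by (intro mult_left_mono) auto
  also have "\<dots> = 4 * (?r / real (Suc (n j)))" by simp
  also have "\<dots> \<le> 4 * (d / 6)" using small by (intro mult_left_mono) auto
  finally have "?r * norm ((dJ ?b - dI ?b) - (dJ ?a - dI ?a)) \<le> 2 * d / 3" by simp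
  then show ?thesis
    unfolding rep using n0 norm_triangle_ineq[of "?r *\<^sub>R e0" "?r *\<^sub>R ((dJ ?b - dI ?b) - (dJ ?a - dI ?a))"] by simp
qed

text \<open>The bound on differences of \<open>f\<close> is summed over the cells, with
  \<open>approx_incr\<close> as intermediate point for the squared distance. The bound d \<le> 1
  permits the transfer of exponential growth, and the last constant contains the total weight
  2.\<close>

lemma replacement_error:
  assumes d: "0 \<le> d" "d \<le> 1" and \<epsilon>: "0 \<le> \<epsilon>" and C': "0 \<le> C'"
    and f: "\<And>x y. \<bar>f x - f y\<bar> \<le> \<epsilon> * (exp_growth x + exp_growth y) + C' * (norm (x - y))\<^sup>2"
    and close: "\<And>i. i < K j \<Longrightarrow> norm (sqrt (real (n j)) *\<^sub>R (D (real (Suc i) / real (n j)) \<omega> - D (real i / real (n j)) \<omega>) - approx_incr R j i \<omega>) \<le> d"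
    and wt: "(\<Sum>i<K j. w t j i) \<le> 2"
  shows "\<bar>weighted_increments j \<omega> - (\<Sum>i<K j. w t j i * f (frozen_incr R j i \<omega>))\<bar> \<le> \<epsilon> * growth_sum R j \<omega> + 2 * C' * dist_sum R j \<omega> + 4 * C' * d\<^sup>2"
proof -
  define X where "X i = sqrt (real (n j)) *\<^sub>R (D (real (Suc i) / real (n j)) \<omega> - D (real i / real (n j)) \<omega>)" for i
  have cell: "\<bar>f (X i) - f (frozen_incr R j i \<omega>)\<bar> \<le> \<epsilon> * (3 * exp_growth (approx_incr R j i \<omega>) + exp_growth (frozen_incr R j i \<omega>))
      + 2 * C' * (norm (approx_incr R j i \<omega> - frozen_incr R j i \<omega>))\<^sup>2 + 2 * C' * d\<^sup>2" if i: "i < K j" for i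
  proof -
    have e: "norm (X i - approx_incr R j i \<omega>) \<le> d" using close[OF i] by (simp add: X_def)
    have "exp_growth (approx_incr R j i \<omega> + (X i - approx_incr R j i \<omega>)) \<le> 3 * exp_growth (approx_incr R j i \<omega>)"
      using e d by (intro exp_growth_add_le) linarith
    then have g: "\<epsilon> * (exp_growth (X i) + exp_growth (frozen_incr R j i \<omega>)) \<le> \<epsilon> * (3 * exp_growth (approx_incr R j i \<omega>) + exp_growth (frozen_incr R j i \<omega>))"
      using \<epsilon> by (intro mult_left_mono) auto
    have "(norm (X i - approx_incr R j i \<omega>))\<^sup>2 \<le> d\<^sup>2" using e by (intro power_mono) auto
    then have "(norm (X i - frozen_incr R j i \<omega>))\<^sup>2 \<le> 2 * d\<^sup>2 + 2 * (norm (approx_incr R j i \<omega> - frozen_incr R j i \<omega>))\<^sup>2"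
      using norm_sq_triangle[of "X i" "frozen_incr R j i \<omega>" "approx_incr R j i \<omega>"] by linarith
    then have "C' * (norm (X i - frozen_incr R j i \<omega>))\<^sup>2 \<le> C' * (2 * d\<^sup>2 + 2 * (norm (approx_incr R j i \<omega> - frozen_incr R j i \<omega>))\<^sup>2)"
      using C' by (rule mult_left_mono)
    then show ?thesis using f[of "X i" "frozen_incr R j i \<omega>"] g by (simp add: algebra_simps)
  qed
  have "\<bar>weighted_increments j \<omega> - (\<Sum>i<K j. w t j i * f (frozen_incr R j i \<omega>))\<bar> = \<bar>\<Sum>i<K j. w t j i * (f (X i) - f (frozen_incr R j i \<omega>))\<bar>"
    by (simp add: weighted_increments_def X_def sum_subtractf right_diff_distrib)
  also have "\<dots> \<le> (\<Sum>i<K j. w t j i * \<bar>f (X i) - f (frozen_incr R j i \<omega>)\<bar>)"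
    using w_nonneg by (intro order_trans[OF sum_abs] sum_mono) (simp add: abs_mult)
  also have "\<dots> \<le> (\<Sum>i<K j. w t j i * (\<epsilon> * (3 * exp_growth (approx_incr R j i \<omega>) + exp_growth (frozen_incr R j i \<omega>))
      + 2 * C' * (norm (approx_incr R j i \<omega> - frozen_incr R j i \<omega>))\<^sup>2 + 2 * C' * d\<^sup>2))"
    using w_nonneg by (intro sum_mono mult_left_mono cell) auto
  also have "\<dots> = \<epsilon> * growth_sum R j \<omega> + 2 * C' * dist_sum R j \<omega> + (2 * C' * d\<^sup>2) * (\<Sum>i<K j. w t j i)"
    unfolding growth_sum_def dist_sum_def sum_distrib_left sum.distrib[symmetric]
    by (intro sum.cong refl) (simp only: distrib_left mult_ac)
  also have "(2 * C' * d\<^sup>2) * (\<Sum>i<K j. w t j i) \<le> (2 * C' * d\<^sup>2) * 2"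
    using C' wt by (intro mult_left_mono) auto
  finally show ?thesis by simp
qed

text \<open>The constants are chosen in the order \<open>R\<close>, \<open>\<epsilon>'\<close>,
  \<open>C'\<close>, \<open>d\<close>. The growth term is not small by itself: its expectation is
  merely bounded in terms of \<open>R\<close>, so \<open>\<epsilon>'\<close> has to be chosen after
  \<open>R\<close>, and \<open>C'\<close>, which may be huge, multiplies quantities that tend to 0
  or are tuned by \<open>d\<close>.\<close>

theorem weighted_increments_limit:
  assumes \<epsilon>: "\<epsilon> > 0"
  shows "(\<lambda>j. prob {\<omega>\<in>space M. \<bar>weighted_increments j \<omega> - limit \<omega>\<bar> > \<epsilon>}) \<longlonglongrightarrow> 0"
proof (rule tendstoI)
  fix \<eta> :: real assume \<eta>: "\<eta> > 0"
  obtain R where R: "R > 0" "prob (space M - bounded_event R) < \<eta> / 3" using bounded_event_large[of "\<eta> / 3"] \<eta> by auto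
  then have R0: "0 \<le> R" by simp
  \<comment> \<open>Five errors are added: growth, squared distance, the term in d^2, fluctuation,
    and the sum of the averages.\<close>
  define \<epsilon>1 where "\<epsilon>1 = \<epsilon> / 5"
  have \<epsilon>1: "\<epsilon>1 > 0" using \<epsilon> by (simp add: \<epsilon>1_def)
  define G where "G = 8 * growth_bound R + 1"
  have G: "G > 0" "8 * growth_bound R \<le> G" using growth_bound_nonneg[of R] by (auto simp: G_def)
  \<comment> \<open>Chosen so that Markov's inequality bounds the probability of
    \<open>\<epsilon>' * growth_sum > \<epsilon>1\<close> by \<open>\<eta> / 3\<close>.\<close>
  define \<epsilon>' where "\<epsilon>' = \<epsilon>1 * \<eta> / (3 * G)"
  have \<epsilon>': "\<epsilon>' > 0" using \<epsilon>1 \<eta> G by (simp add: \<epsilon>'_def)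
  obtain C' where C': "C' \<ge> 0" "\<And>x y. \<bar>f x - f y\<bar> \<le> \<epsilon>' * (exp_growth x + exp_growth y) + C' * (norm (x - y))\<^sup>2"
    using difference_bound[OF \<epsilon>'] by blast
  \<comment> \<open>As d \<le> 1, the square of d is at most d. The summand 1 in the denominator
    avoids division by zero when \<open>C' = 0\<close>.\<close>
  define d where "d = min 1 (\<epsilon>1 / (4 * C' + 1))"
  have d: "d > 0" "d \<le> 1" "4 * C' * d\<^sup>2 \<le> \<epsilon>1"
  proof -
    show "d > 0" "d \<le> 1" using \<epsilon>1 C' by (auto simp: d_def)
    then have "d * d \<le> d * 1" by (intro mult_left_mono) auto
    then have "4 * C' * d\<^sup>2 \<le> (4 * C' + 1) * d"
      using C' \<open>d > 0\<close> by (simp add: power2_eq_square mult_mono)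
    also have "\<dots> \<le> (4 * C' + 1) * (\<epsilon>1 / (4 * C' + 1))" using C' by (intro mult_left_mono) (auto simp: d_def)
    also have "\<dots> = \<epsilon>1" using C' by simp
    finally show "4 * C' * d\<^sup>2 \<le> \<epsilon>1" .
  qed
  \<comment> \<open>Up to null sets the error exceeds \<open>\<epsilon>\<close> only on one of these
    events or on \<open>E0\<close>. The probabilities of \<open>E0\<close> and \<open>E5\<close> are
    merely below or equal to \<open>\<eta> / 3\<close> by the choice of \<open>R\<close> and
    \<open>\<epsilon>'\<close>; all others tend to 0.\<close>
  define E1 E2 E3 E4 where "E1 j = drift_event (d / 3) j" and "E2 j = {\<omega>\<in>space M. sup_err (n j) \<omega> > 1 / real (Suc (n j))}"
    and "E3 j = tail_event R j" and "E4 j = {\<omega>\<in>space M. err (n j) \<omega> > 1 / real (Suc (n j)) ^ 4}" for j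
  define E5 E6 E7 E8 where "E5 j = {\<omega>\<in>space M. growth_sum R j \<omega> > \<epsilon>1 / \<epsilon>'}" and "E6 j = {\<omega>\<in>space M. dist_sum R j \<omega> > \<epsilon>1 / (2 * C' + 1)}"
    and "E7 j = {\<omega>\<in>space M. (fluctuation R j \<omega>)\<^sup>2 > \<epsilon>1\<^sup>2}" and "E8 j = {\<omega>\<in>space M. \<bar>mean_sum R j \<omega> - limit_proj R \<omega>\<bar> > \<epsilon>1}" for j
  define E0 where "E0 = space M - bounded_event R"
  have E0: "E0 \<in> events" using bounded_event_measurable by (auto simp: E0_def)
  have meas: "E1 j \<in> events" "E2 j \<in> events" "E3 j \<in> events" "E4 j \<in> events" "E5 j \<in> events" "E6 j \<in> events" "E7 j \<in> events" "E8 j \<in> events"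
    if n: "n j > 0" for j
  proof -
    have errm: "err (n j) \<in> borel_measurable M" "sup_err (n j) \<in> borel_measurable M"
      unfolding err_def[abs_def] sup_err_def[abs_def] by (rule err_measurable sup_measurable)+
    note facts = errm growth_sum_measurable[OF R0 n] dist_sum_measurable[OF R0 n] fluctuation_measurable[OF R0 n]
      mean_sum_measurable[OF R0 n] limit_proj_measurable[OF R0]
    show "E1 j \<in> events" unfolding E1_def by (rule drift_event_measurable[OF n])
    show "E3 j \<in> events" unfolding E3_def by (rule tail_event_measurable[OF R0 n])
    show "E2 j \<in> events" "E4 j \<in> events" "E5 j \<in> events" "E6 j \<in> events" "E7 j \<in> events" "E8 j \<in> events"
      unfolding E2_def E4_def E5_def E6_def E7_def E8_def
      by (intro borel_measurable_less borel_measurable_const borel_measurable_power borel_measurable_abs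
          borel_measurable_diff facts)+
  qed
  have small_ev: "\<forall>\<^sub>F j in sequentially. sqrt (real (n j)) / real (Suc (n j)) < d / 6"
    using order_tendstoD(2)[OF sqrt_n_over_n, of "d / 6"] d(1) by simp
  have incl: "\<forall>\<^sub>F j in sequentially. AE \<omega> in M. \<omega> \<in> {\<omega>\<in>space M. \<bar>weighted_increments j \<omega> - limit \<omega>\<bar> > \<epsilon>} \<longrightarrow>
     \<omega> \<in> E0 \<union> (E1 j \<union> (E2 j \<union> (E3 j \<union> (E4 j \<union> (E5 j \<union> (E6 j \<union> (E7 j \<union> E8 j)))))))"
    using n_pos weight_total_le small_ev
  proof eventually_elim
    case (elim j)
    then have n: "n j > 0" and small: "sqrt (real (n j)) / real (Suc (n j)) \<le> d / 6" by auto
    show ?case using truncation_quadratic_error[OF R0, of "n j"]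
    proof (rule AE_mp, intro AE_I2 impI)
      fix \<omega> assume q: "\<omega> \<in> bounded_event R \<longrightarrow> (\<Sum>i<k (n j). (ts (n j) (Suc i) - ts (n j) i) * (norm (S (n j) i \<omega> - proj_S R (n j) i \<omega>))\<^sup>2) \<le> 4 * err (n j) \<omega>"
        and big: "\<omega> \<in> {\<omega>\<in>space M. \<bar>weighted_increments j \<omega> - limit \<omega>\<bar> > \<epsilon>}"
      show "\<omega> \<in> E0 \<union> (E1 j \<union> (E2 j \<union> (E3 j \<union> (E4 j \<union> (E5 j \<union> (E6 j \<union> (E7 j \<union> E8 j)))))))"
      proof (rule ccontr)
        assume no: "\<not> ?thesis"
        have \<omega>: "\<omega> \<in> space M" using big by simp
        have b: "\<omega> \<in> bounded_event R" using no \<omega> by (simp add: E0_def)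
        have 4: "err (n j) \<omega> \<le> 1 / real (Suc (n j)) ^ 4" using no \<omega> by (simp add: E4_def not_less)
        have close: "norm (sqrt (real (n j)) *\<^sub>R (D (real (Suc i) / real (n j)) \<omega> - D (real i / real (n j)) \<omega>) - approx_incr R j i \<omega>) \<le> d"
          if i: "i < K j" for i
        proof (rule increment_close[OF R0 \<omega> i n d(1) _ _ _ _ small])
          show "\<omega> \<notin> drift_event (d / 3) j" using no by (simp add: E1_def)
          show "sup_err (n j) \<omega> \<le> 1 / real (Suc (n j))" using no \<omega> by (simp add: E2_def not_less)
          show "\<omega> \<notin> tail_event R j" using no by (simp add: E3_def)
          show "(\<Sum>i<k (n j). (ts (n j) (Suc i) - ts (n j) i) * (norm (S (n j) i \<omega> - proj_S R (n j) i \<omega>))\<^sup>2) \<le> 4 / real (Suc (n j)) ^ 4"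
            using q b 4 by simp
        qed
        have r: "\<bar>weighted_increments j \<omega> - (\<Sum>i<K j. w t j i * f (frozen_incr R j i \<omega>))\<bar> \<le> \<epsilon>' * growth_sum R j \<omega> + 2 * C' * dist_sum R j \<omega> + 4 * C' * d\<^sup>2"
          using d \<epsilon>' C' elim by (intro replacement_error close) auto
        have 5: "\<epsilon>' * growth_sum R j \<omega> \<le> \<epsilon>1"
        proof -
          have "growth_sum R j \<omega> \<le> \<epsilon>1 / \<epsilon>'" using no \<omega> by (simp add: E5_def not_less)
          then show ?thesis using \<epsilon>' by (simp add: pos_le_divide_eq mult.commute)
        qed
        have 6: "2 * C' * dist_sum R j \<omega> \<le> \<epsilon>1"
        proof -
          have "dist_sum R j \<omega> \<le> \<epsilon>1 / (2 * C' + 1)" using no \<omega> by (simp add: E6_def not_less)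
          then have "(2 * C' + 1) * dist_sum R j \<omega> \<le> \<epsilon>1" using C' by (simp add: pos_le_divide_eq mult.commute)
          moreover have "0 \<le> dist_sum R j \<omega>" unfolding dist_sum_def by (intro sum_nonneg mult_nonneg_nonneg w_nonneg) simp
          ultimately show ?thesis by (simp add: distrib_right)
        qed
        have 7: "\<bar>fluctuation R j \<omega>\<bar> \<le> \<epsilon>1"
        proof -
          have "(fluctuation R j \<omega>)\<^sup>2 \<le> \<epsilon>1\<^sup>2" using no \<omega> by (simp add: E7_def not_less)
          then show ?thesis using \<epsilon>1 by (simp add: abs_le_square_iff[symmetric])
        qed
        have 8: "\<bar>mean_sum R j \<omega> - limit_proj R \<omega>\<bar> \<le> \<epsilon>1" using no \<omega> by (simp add: E8_def not_less)
        have "(\<Sum>i<K j. w t j i * f (frozen_incr R j i \<omega>)) = fluctuation R j \<omega> + mean_sum R j \<omega>"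
          by (simp add: fluctuation_def mean_sum_def sum_subtractf right_diff_distrib)
        then have "\<bar>weighted_increments j \<omega> - limit \<omega>\<bar> \<le> 5 * \<epsilon>1"
          using r 5 6 7 8 d(3) limit_proj_eq[OF b] by linarith
        then show False using big by (simp add: \<epsilon>1_def)
      qed
    qed
  qed
  have p5: "\<forall>\<^sub>F j in sequentially. prob (E5 j) \<le> \<eta> / 3"
    using n_pos weight_total_le
  proof eventually_elim
    case (elim j)
    have "prob (E5 j) \<le> G / (\<epsilon>1 / \<epsilon>')"
      unfolding E5_def
    proof (rule prob_gt_le_expectation)
      show "(\<integral>\<^sup>+\<omega>. ennreal (growth_sum R j \<omega>) \<partial>M) \<le> ennreal G"
        using growth_sum_expectation[OF R0 elim] ennreal_leI[OF G(2)] by (rule order_trans)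
    qed (use \<epsilon>1 \<epsilon>' G growth_sum_measurable[OF R0] elim in auto)
    also have "\<dots> = \<eta> / 3" using \<epsilon>1 G by (simp add: \<epsilon>'_def)
    finally show ?case .
  qed
  have le_n: "(\<lambda>j. prob (E2 j)) \<longlonglongrightarrow> 0" "(\<lambda>j. prob (E4 j)) \<longlonglongrightarrow> 0"
  proof -
    have "norm (prob (E2 j)) \<le> 1 / real (n j)" "norm (prob (E4 j)) \<le> 1 / real (n j)" if "n j > 0" for j
    proof -
      have a: "1 / real (Suc (n j)) \<le> 1 / real (n j)" using that by (intro divide_left_mono) auto
      have "real (Suc (n j)) ^ 1 \<le> real (Suc (n j)) ^ 4" by (rule power_increasing) auto
      then have b: "1 / real (Suc (n j)) ^ 4 \<le> 1 / real (Suc (n j))" by (intro divide_left_mono) auto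
      show "norm (prob (E2 j)) \<le> 1 / real (n j)" using sup_small[of "n j"] a by (simp add: E2_def sup_err_def)
      show "norm (prob (E4 j)) \<le> 1 / real (n j)" using err_small[of "n j"] a b by (simp add: E4_def err_def)
    qed
    then have ev: "\<forall>\<^sub>F j in sequentially. norm (prob (E2 j)) \<le> 1 / real (n j)" "\<forall>\<^sub>F j in sequentially. norm (prob (E4 j)) \<le> 1 / real (n j)"
      using n_pos by (auto elim: eventually_mono)
    show "(\<lambda>j. prob (E2 j)) \<longlonglongrightarrow> 0" by (rule Lim_null_comparison[OF ev(1) inverse_n])
    show "(\<lambda>j. prob (E4 j)) \<longlonglongrightarrow> 0" by (rule Lim_null_comparison[OF ev(2) inverse_n])
  qed
  \<comment> \<open>Measurability of the events is available for positive \<open>n j\<close>, so the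
    limits are taken along shifted sequences.\<close>
  obtain j0 where j0: "\<And>j. j \<ge> j0 \<Longrightarrow> n j > 0" using n_pos unfolding eventually_sequentially by blast
  have l6: "(\<lambda>j. prob (E6 j)) \<longlonglongrightarrow> 0"
  proof (rule LIMSEQ_offset[of _ j0])
    show "(\<lambda>j. prob (E6 (j + j0))) \<longlonglongrightarrow> 0"
      unfolding E6_def using \<epsilon>1 C' j0
      by (intro prob_gt_tendsto_0 LIMSEQ_ignore_initial_segment[OF dist_sum_limit[OF R0]] dist_sum_measurable R0) auto
  qed
  have l7: "(\<lambda>j. prob (E7 j)) \<longlonglongrightarrow> 0"
  proof (rule LIMSEQ_offset[of _ j0])
    show "(\<lambda>j. prob (E7 (j + j0))) \<longlonglongrightarrow> 0"
      unfolding E7_def using \<epsilon>1 j0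
      by (intro prob_gt_tendsto_0 LIMSEQ_ignore_initial_segment[OF fluctuation_limit[OF R0]] borel_measurable_power fluctuation_measurable R0) auto
  qed
  have l8: "(\<lambda>j. prob (E8 j)) \<longlonglongrightarrow> 0"
  proof (rule LIMSEQ_offset[of _ j0], rule prob_eventually_not_in)
    show "E8 (j + j0) \<in> events" for j using j0 meas by simp
    show "AE \<omega> in M. \<forall>\<^sub>F j in sequentially. \<omega> \<notin> E8 (j + j0)"
    proof (rule AE_I2)
      fix \<omega> assume \<omega>: "\<omega> \<in> space M"
      have "(\<lambda>j. mean_sum R (j + j0) \<omega>) \<longlonglongrightarrow> limit_proj R \<omega>"
        unfolding mean_sum_def by (rule LIMSEQ_ignore_initial_segment[OF mean_sum_limit[OF R0 \<omega>]])
      from tendstoD[OF this \<epsilon>1] show "\<forall>\<^sub>F j in sequentially. \<omega> \<notin> E8 (j + j0)"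
        by eventually_elim (auto simp: E8_def dist_real_def)
    qed
  qed
  have "(\<lambda>j. prob (E1 j) + prob (E2 j) + prob (E3 j) + prob (E4 j) + prob (E6 j) + prob (E7 j) + prob (E8 j)) \<longlonglongrightarrow> 0 + 0 + 0 + 0 + 0 + 0 + 0"
    using d unfolding E1_def E3_def
    by (intro tendsto_add le_n l6 l7 l8 drift_event_limit tail_event_limit R0) auto
  then have rest: "\<forall>\<^sub>F j in sequentially. prob (E1 j) + prob (E2 j) + prob (E3 j) + prob (E4 j) + prob (E6 j) + prob (E7 j) + prob (E8 j) < \<eta> / 3"
    using \<eta> by (intro order_tendstoD) auto
  show "\<forall>\<^sub>F j in sequentially. dist (prob {\<omega>\<in>space M. \<bar>weighted_increments j \<omega> - limit \<omega>\<bar> > \<epsilon>}) 0 < \<eta>"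
    using incl rest p5 n_pos
  proof eventually_elim
    case (elim j)
    note m = meas[OF elim(4)]
    have "prob {\<omega>\<in>space M. \<bar>weighted_increments j \<omega> - limit \<omega>\<bar> > \<epsilon>}
       \<le> prob (E0 \<union> (E1 j \<union> (E2 j \<union> (E3 j \<union> (E4 j \<union> (E5 j \<union> (E6 j \<union> (E7 j \<union> E8 j))))))))"
      using E0 m by (intro finite_measure_mono_AE elim(1)) auto
    also have "\<dots> \<le> prob E0 + (prob (E1 j) + (prob (E2 j) + (prob (E3 j) + (prob (E4 j) + (prob (E5 j) + (prob (E6 j) + (prob (E7 j) + prob (E8 j))))))))"
      using E0 m by (intro order_trans[OF measure_Un_le] add_left_mono order_refl sets.Un) auto
    also have "\<dots> < \<eta>" using R(2) elim(2,3) unfolding E0_def[symmetric] by linarith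
    finally show ?case by simp
  qed
qed

end

section \<open>Choice of the simple integrands\<close>

context fejer_diffusion
begin

theorem increments_limit:
  assumes "\<epsilon> > 0"
  shows "(\<lambda>j. prob {\<omega>\<in>space M. \<bar>(\<Sum>i<K j. w t j i * f (sqrt (real (n j)) *\<^sub>R (D (real (Suc i) / real (n j)) \<omega> - D (real i / real (n j)) \<omega>))) - limit \<omega>\<bar> > \<epsilon>}) \<longlonglongrightarrow> 0"
proof -
  obtain k ts A where simple: "\<And>l::nat. simple_integrand M F T (k l) (ts l) (A l)"
    and c1: "conv_in_prob M (\<lambda>l \<omega>. LINT s:{0..T}|lborel. (norm (simple_value (k l) (ts l) (A l) s \<omega> - H s \<omega>))\<^sup>2) (\<lambda>_. 0)"
    and c2: "conv_in_prob M (\<lambda>l \<omega>. SUP s\<in>{0..T}. norm (simple_integral Z (k l) (ts l) (A l) s \<omega> - I s \<omega>)) (\<lambda>_. 0)"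
    using ito unfolding is_ito_integral_def by blast
  define V where "V l \<omega> = (LINT s:{0..T}|lborel. (norm (simple_value (k l) (ts l) (A l) s \<omega> - H s \<omega>))\<^sup>2)" for l \<omega>
  define U where "U l \<omega> = (SUP s\<in>{0..T}. norm (simple_integral Z (k l) (ts l) (A l) s \<omega> - I s \<omega>))" for l \<omega>
  have Vm: "V l \<in> borel_measurable M" and Um: "U l \<in> borel_measurable M" for l
    using c1 c2 by (auto simp: conv_in_prob_def V_def[abs_def] U_def[abs_def])
  have Vl: "(\<lambda>l. prob {\<omega>\<in>space M. dist (V l \<omega>) 0 > a}) \<longlonglongrightarrow> 0" and Ul: "(\<lambda>l. prob {\<omega>\<in>space M. dist (U l \<omega>) 0 > a}) \<longlonglongrightarrow> 0" if "a > 0" for a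
    using c1 c2 that by (auto simp: conv_in_prob_def V_def[abs_def] U_def[abs_def])
  \<comment> \<open>The assumptions of the locale \<open>fejer_approx\<close> for one index
    \<open>m\<close>. Convergence in probability supplies, for each \<open>m\<close>, an index from
    which on the accuracy is reached, and extension by zero makes the partition span
    \<open>{0..T}\<close>.\<close>
  define P where "P m k' ts' A' \<longleftrightarrow> simple_integrand M F T k' ts' A' \<and> ts' 0 = 0 \<and> ts' k' = T
     \<and> (\<lambda>\<omega>. LINT s:{0..T}|lborel. (norm (simple_value k' ts' A' s \<omega> - H s \<omega>))\<^sup>2) \<in> borel_measurable M
     \<and> prob {\<omega>\<in>space M. (LINT s:{0..T}|lborel. (norm (simple_value k' ts' A' s \<omega> - H s \<omega>))\<^sup>2) > 1 / real (Suc m) ^ 4} \<le> 1 / real (Suc m) ^ 4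
     \<and> (\<lambda>\<omega>. SUP s\<in>{0..T}. norm (simple_integral Z k' ts' A' s \<omega> - I s \<omega>)) \<in> borel_measurable M
     \<and> prob {\<omega>\<in>space M. (SUP s\<in>{0..T}. norm (simple_integral Z k' ts' A' s \<omega> - I s \<omega>)) > 1 / real (Suc m)} \<le> 1 / real (Suc m)" for m k' ts' and A' :: "nat \<Rightarrow> 'a \<Rightarrow> real^'n^'n"
  have "\<exists>k' ts' A'. P m k' ts' A'" for m
  proof -
    define a b where "a = 1 / real (Suc m) ^ 4" and "b = 1 / real (Suc m)"
    have ab: "a > 0" "b > 0" by (auto simp: a_def b_def)
    have "\<forall>\<^sub>F l in sequentially. prob {\<omega>\<in>space M. dist (V l \<omega>) 0 > a} < a" "\<forall>\<^sub>F l in sequentially. prob {\<omega>\<in>space M. dist (U l \<omega>) 0 > b} < b"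
      using order_tendstoD(2)[OF Vl[OF ab(1)] ab(1)] order_tendstoD(2)[OF Ul[OF ab(2)] ab(2)] by auto
    then have "\<forall>\<^sub>F l in sequentially. prob {\<omega>\<in>space M. dist (V l \<omega>) 0 > a} < a \<and> prob {\<omega>\<in>space M. dist (U l \<omega>) 0 > b} < b"
      by (rule eventually_conj)
    then obtain l where l: "prob {\<omega>\<in>space M. dist (V l \<omega>) 0 > a} < a" "prob {\<omega>\<in>space M. dist (U l \<omega>) 0 > b} < b"
      by (auto simp: eventually_sequentially)
    have "prob {\<omega>\<in>space M. V l \<omega> > a} \<le> prob {\<omega>\<in>space M. dist (V l \<omega>) 0 > a}"
      using Vm[of l] by (intro finite_measure_mono) auto
    then have Va: "prob {\<omega>\<in>space M. V l \<omega> > a} \<le> a" using l by simp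
    have "prob {\<omega>\<in>space M. U l \<omega> > b} \<le> prob {\<omega>\<in>space M. dist (U l \<omega>) 0 > b}"
      using Um[of l] by (intro finite_measure_mono) auto
    then have Ub: "prob {\<omega>\<in>space M. U l \<omega> > b} \<le> b" using l by simp
    obtain k' ts' A' where e: "simple_integrand M F T k' ts' A'" "ts' 0 = 0" "ts' k' = T"
      "\<And>s \<omega>. simple_value k' ts' A' s \<omega> = simple_value (k l) (ts l) (A l) s \<omega>"
      "\<And>s \<omega>. simple_integral Z k' ts' A' s \<omega> = simple_integral Z (k l) (ts l) (A l) s \<omega>"
      using simple_integrand_extend[OF simple[of l]] by blast
    show ?thesis
      using e(1,2,3) Va Ub Vm[of l] Um[of l] unfolding V_def U_def a_def b_def P_def
      by (intro exI[of _ k'] exI[of _ ts'] exI[of _ A']) (simp add: e(4,5))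
  qed
  then obtain k' ts' A' where app: "\<And>m. P m (k' m) (ts' m) (A' m)" by metis
  interpret fejer_approx T n N t0 t1 t M F Z f C q Sg H I D k' ts' A'
    using app unfolding P_def by unfold_locales auto
  show ?thesis using weighted_increments_limit[OF assms] by (simp add: weighted_increments_def)
qed

end

section \<open>Matrix-valued random variables\<close>

lemma borel_measurable_vec_lambda:
  fixes V :: "'a \<Rightarrow> 'b::euclidean_space^'n"
  assumes "\<And>i. (\<lambda>\<omega>. V \<omega> $ i) \<in> borel_measurable M"
  shows "V \<in> borel_measurable M"
proof -
  have V: "V \<omega> = (\<Sum>i\<in>UNIV. axis i (V \<omega> $ i))" for \<omega>
    by (simp add: vec_eq_iff axis_def if_distrib sum.delta cong: if_cong)
  have "continuous_on UNIV (axis i :: 'b \<Rightarrow> 'b^'n)" for i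
    unfolding axis_def
  proof (rule continuous_on_vec_lambda)
    fix l :: 'n
    show "continuous_on UNIV (\<lambda>x::'b. if l = i then x else 0)" by (cases "l = i") (auto intro: continuous_intros)
  qed
  then have "(\<lambda>\<omega>. axis i (V \<omega> $ i)) \<in> borel_measurable M" for i
    by (rule borel_measurable_continuous_on) (rule assms)
  then have "(\<lambda>\<omega>. \<Sum>i\<in>UNIV. axis i (V \<omega> $ i)) \<in> borel_measurable M" by (intro borel_measurable_sum)
  then show ?thesis by (simp only: V[symmetric])
qed

lemma conv_in_prob_matrixI:
  fixes U :: "nat \<Rightarrow> 'a \<Rightarrow> complex^'n^'n" and V :: "'a \<Rightarrow> complex^'n^'n"
  assumes M: "prob_space M"
    and U: "\<And>j a b. (\<lambda>\<omega>. U j \<omega> $ a $ b) \<in> borel_measurable M"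
    and V: "\<And>a b. (\<lambda>\<omega>. V \<omega> $ a $ b) \<in> borel_measurable M"
    and lim: "\<And>a b \<epsilon>. \<epsilon> > 0 \<Longrightarrow> (\<lambda>j. measure M {\<omega>\<in>space M. norm (U j \<omega> $ a $ b - V \<omega> $ a $ b) > \<epsilon>}) \<longlonglongrightarrow> 0"
  shows "conv_in_prob M U V"
  unfolding conv_in_prob_def
proof (intro conjI allI impI)
  interpret prob_space M by fact
  show "U j \<in> borel_measurable M" for j by (intro borel_measurable_vec_lambda U)
  show "V \<in> borel_measurable M" by (intro borel_measurable_vec_lambda V)
  fix \<epsilon> :: real assume \<epsilon>: "\<epsilon> > 0"
  \<comment> \<open>If all entries deviate by at most \<open>c\<close>, the sum over the entries,
    and hence the norm, is at most \<open>\<epsilon>\<close>.\<close>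
  define c where "c = \<epsilon> / (real CARD('n) * real CARD('n))"
  have c: "c > 0" using \<epsilon> by (simp add: c_def)
  define E where "E j a b = {\<omega>\<in>space M. norm (U j \<omega> $ a $ b - V \<omega> $ a $ b) > c}" for j a b
  have Em: "E j a b \<in> events" for j a b
  proof -
    note [measurable] = U V
    show ?thesis unfolding E_def by measurable
  qed
  have incl: "{\<omega>\<in>space M. dist (U j \<omega>) (V \<omega>) > \<epsilon>} \<subseteq> (\<Union>a\<in>UNIV. \<Union>b\<in>UNIV. E j a b)" for j
  proof (rule ccontr)
    assume "\<not> ?thesis"
    then obtain \<omega> where \<omega>12: "\<omega> \<in> space M" "dist (U j \<omega>) (V \<omega>) > \<epsilon>" and "\<omega> \<notin> (\<Union>a\<in>UNIV. \<Union>b\<in>UNIV. E j a b)"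
      by blast
    then have "norm (U j \<omega> $ a $ b - V \<omega> $ a $ b) \<le> c" for a b by (auto simp: E_def not_less)
    note \<omega> = \<omega>12 this
    have "norm (U j \<omega> - V \<omega>) \<le> (\<Sum>a\<in>UNIV. norm ((U j \<omega> - V \<omega>) $ a))"
      by (simp add: norm_vec_def L2_set_le_sum)
    also have "\<dots> \<le> (\<Sum>a\<in>UNIV. \<Sum>b\<in>UNIV. norm ((U j \<omega> - V \<omega>) $ a $ b))"
      by (intro sum_mono) (simp add: norm_vec_def L2_set_le_sum)
    also have "\<dots> \<le> (\<Sum>a\<in>(UNIV::'n set). \<Sum>b\<in>(UNIV::'n set). c)"
      using \<omega>(3) by (intro sum_mono) simp
    also have "\<dots> = \<epsilon>" by (simp add: c_def)
    finally show False using \<omega>(2) by (simp add: dist_norm)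
  qed
  have le: "prob {\<omega>\<in>space M. dist (U j \<omega>) (V \<omega>) > \<epsilon>} \<le> (\<Sum>a\<in>UNIV. \<Sum>b\<in>UNIV. prob (E j a b))" for j
  proof -
    have "prob {\<omega>\<in>space M. dist (U j \<omega>) (V \<omega>) > \<epsilon>} \<le> prob (\<Union>a\<in>UNIV. \<Union>b\<in>UNIV. E j a b)"
      using Em by (intro finite_measure_mono incl sets.finite_UN) auto
    also have "\<dots> \<le> (\<Sum>a\<in>UNIV. prob (\<Union>b\<in>UNIV. E j a b))"
      using Em by (intro finite_measure_subadditive_finite) (auto intro!: sets.finite_UN)
    also have "\<dots> \<le> (\<Sum>a\<in>UNIV. \<Sum>b\<in>UNIV. prob (E j a b))"
      using Em by (intro sum_mono finite_measure_subadditive_finite) auto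
    finally show ?thesis .
  qed
  have "(\<lambda>j. \<Sum>a\<in>UNIV. \<Sum>b\<in>UNIV. prob (E j a b)) \<longlonglongrightarrow> (\<Sum>a\<in>(UNIV::'n set). \<Sum>b\<in>(UNIV::'n set). 0)"
    unfolding E_def by (intro tendsto_sum lim c)
  then have "(\<lambda>j. \<Sum>a\<in>UNIV. \<Sum>b\<in>UNIV. prob (E j a b)) \<longlonglongrightarrow> 0" by simp
  then show "(\<lambda>j. prob {\<omega>\<in>space M. dist (U j \<omega>) (V \<omega>) > \<epsilon>}) \<longlonglongrightarrow> 0"
    by (rule tendsto_sandwich[OF always_eventually always_eventually tendsto_const, rotated -1]) (auto intro: le)
qed

lemma conv_in_prob_AE_cong:
  assumes M: "prob_space M" and U: "conv_in_prob M U V" and V': "V' \<in> borel_measurable M" and eq: "AE \<omega> in M. V \<omega> = V' \<omega>"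
  shows "conv_in_prob M U V'"
  unfolding conv_in_prob_def
proof (intro conjI allI impI V')
  interpret prob_space M by fact
  have Um: "U j \<in> borel_measurable M" and Vm: "V \<in> borel_measurable M" for j using U by (auto simp: conv_in_prob_def)
  show "U j \<in> borel_measurable M" for j by (rule Um)
  fix \<epsilon> :: real assume "\<epsilon> > 0"
  then have "(\<lambda>j. prob {\<omega>\<in>space M. dist (U j \<omega>) (V \<omega>) > \<epsilon>}) \<longlonglongrightarrow> 0" using U by (auto simp: conv_in_prob_def)
  moreover have "prob {\<omega>\<in>space M. dist (U j \<omega>) (V \<omega>) > \<epsilon>} = prob {\<omega>\<in>space M. dist (U j \<omega>) (V' \<omega>) > \<epsilon>}" for j
  proof (rule finite_measure_eq_AE)
    note [measurable] = Um Vm V'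
    show "{\<omega>\<in>space M. dist (U j \<omega>) (V \<omega>) > \<epsilon>} \<in> events" "{\<omega>\<in>space M. dist (U j \<omega>) (V' \<omega>) > \<epsilon>} \<in> events"
      by measurable
    show "AE \<omega> in M. \<omega> \<in> {\<omega>\<in>space M. dist (U j \<omega>) (V \<omega>) > \<epsilon>} \<longleftrightarrow> \<omega> \<in> {\<omega>\<in>space M. dist (U j \<omega>) (V' \<omega>) > \<epsilon>}"
      using eq by eventually_elim auto
  qed
  ultimately show "(\<lambda>j. prob {\<omega>\<in>space M. dist (U j \<omega>) (V' \<omega>) > \<epsilon>}) \<longlonglongrightarrow> 0" by simp
qed

section \<open>The estimator as a weighted sum of increments\<close>

lemma sum_from_1: "(\<Sum>m = 1..K. h m) = (\<Sum>i<K. h (Suc i))"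
  by (simp add: sum.atLeast1_atMost_eq)

lemma grid_incr_Suc: "grid_incr n (Suc i) u = u (real (Suc i) / real n) - u (real i / real n)"
  by (simp add: grid_incr_def)

lemma fourier_V_entry:
  "fourier_V T g k n u $ a $ b = (1 / real n) *\<^sub>R (\<Sum>i<nat \<lfloor>real n * T\<rfloor>.
     exp (- (\<i> * of_real (2 * pi / T * of_int k * (real i / real n))))
       * of_real (g (sqrt (real n) *\<^sub>R (u (real (Suc i) / real n) - u (real i / real n))) $ a $ b))"
  unfolding fourier_V_def sum_from_1 grid_incr_Suc by (simp add: cscale_def cmat_def)

lemma rho_hat_entry_fourier:
  "rho_hat T g n N t u $ a $ b = (1 / T) *\<^sub>R (\<Sum>k\<in>{- int N..int N}. (1 - real_of_int \<bar>k\<bar> / real N) *\<^sub>R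
      (exp (\<i> * of_real (2 * pi / T * of_int k * t)) * fourier_V T g k n u $ a $ b))"
  unfolding rho_hat_def by (simp add: cscale_def)

text \<open>Exchanging the sums over frequencies and cells collects the Fejer kernel at the angle of
  t - i/n; its evenness reverses the sign to match the weights.\<close>

lemma rho_hat_entry:
  assumes "N > 0"
  shows "rho_hat T g n N t u $ a $ b
    = of_real (\<Sum>i<nat \<lfloor>real n * T\<rfloor>. fejer_weight T n N t i * g (sqrt (real n) *\<^sub>R (u (real (Suc i) / real n) - u (real i / real n))) $ a $ b)"
proof -
  define K where "K = nat \<lfloor>real n * T\<rfloor>"
  define G where "G i = complex_of_real (g (sqrt (real n) *\<^sub>R (u (real (Suc i) / real n) - u (real i / real n))) $ a $ b)" for i
  define \<theta> where "\<theta> i = 2 * pi / T * (t - real i / real n)" for i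
  have V: "fourier_V T g k n u $ a $ b
     = (1 / real n) *\<^sub>R (\<Sum>i<K. exp (- (\<i> * of_real (2 * pi / T * of_int k * (real i / real n)))) * G i)" for k
    unfolding fourier_V_entry K_def[symmetric] G_def ..
  have e: "exp (\<i> * of_real (2 * pi / T * of_int k * t)) * exp (- (\<i> * of_real (2 * pi / T * of_int k * (real i / real n))))
     = exp (\<i> * of_real (of_int k * \<theta> i))" for k i
  proof -
    have "2 * pi / T * of_int k * t - 2 * pi / T * of_int k * (real i / real n) = of_int k * \<theta> i"
    proof -
      have "c * k * t - c * k * s = k * (c * (t - s))" for c k s :: real by (simp add: algebra_simps)
      then show ?thesis unfolding \<theta>_def .
    qed
    then have "\<i> * complex_of_real (2 * pi / T * of_int k * t) + - (\<i> * of_real (2 * pi / T * of_int k * (real i / real n))) = \<i> * of_real (of_int k * \<theta> i)"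
      by (metis (no_types, lifting) add_uminus_conv_diff of_real_diff right_diff_distrib)
    then show ?thesis by (simp add: exp_add[symmetric] del: of_real_mult of_real_divide)
  qed
  have "rho_hat T g n N t u $ a $ b = (1 / T) *\<^sub>R (\<Sum>k\<in>{- int N..int N}. (1 - real_of_int \<bar>k\<bar> / real N) *\<^sub>R
      (exp (\<i> * of_real (2 * pi / T * of_int k * t)) * (1 / real n) *\<^sub>R (\<Sum>i<K. exp (- (\<i> * of_real (2 * pi / T * of_int k * (real i / real n)))) * G i)))"
    unfolding rho_hat_entry_fourier V ..
  also have "\<dots> = (1 / T) *\<^sub>R (\<Sum>k\<in>{- int N..int N}. (\<Sum>i<K. (1 / real n) *\<^sub>R (((1 - real_of_int \<bar>k\<bar> / real N) *\<^sub>R exp (\<i> * of_real (of_int k * \<theta> i))) * G i)))"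
    unfolding e[symmetric] by (simp add: scaleR_sum_right sum_distrib_left mult_ac)
  also have "\<dots> = (1 / T) *\<^sub>R (\<Sum>i<K. (1 / real n) *\<^sub>R ((\<Sum>k\<in>{- int N..int N}. (1 - real_of_int \<bar>k\<bar> / real N) *\<^sub>R exp (\<i> * of_real (of_int k * \<theta> i))) * G i))"
    by (subst sum.swap) (simp only: scaleR_sum_right sum_distrib_right)
  also have "\<dots> = (1 / T) *\<^sub>R (\<Sum>i<K. (1 / real n) *\<^sub>R (of_real (fejer N (\<theta> i)) * G i))"
    unfolding fejer_complex[OF assms] ..
  also have "\<dots> = of_real (\<Sum>i<K. fejer N (\<theta> i) / (real n * T) * g (sqrt (real n) *\<^sub>R (u (real (Suc i) / real n) - u (real i / real n))) $ a $ b)"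
    by (simp add: G_def scaleR_sum_right scaleR_conv_of_real mult_ac sum_divide_distrib)
  finally have "rho_hat T g n N t u $ a $ b
    = of_real (\<Sum>i<K. fejer N (\<theta> i) / (real n * T) * g (sqrt (real n) *\<^sub>R (u (real (Suc i) / real n) - u (real i / real n))) $ a $ b)" .
  moreover have "fejer N (\<theta> i) / (real n * T) = fejer_weight T n N t i" for i
  proof -
    have "\<theta> i = - (2 * pi / T * (real i / real n - t))"
      unfolding \<theta>_def by (simp only: mult_minus_right[symmetric] minus_diff_eq)
    then show ?thesis by (simp only: fejer_weight_def fejer_minus)
  qed
  ultimately show ?thesis by (simp only: K_def)
qed

lemma rho_hat_measurable:
  fixes Y :: "real \<Rightarrow> 'a \<Rightarrow> real^'n"
  assumes g: "continuous_on UNIV g" and Y: "\<And>s. s \<in> {0..T} \<Longrightarrow> Y s \<in> borel_measurable M" and T: "T > 0"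
  shows "(\<lambda>\<omega>. rho_hat T g n N t (\<lambda>s. Y s \<omega>) $ a $ b) \<in> borel_measurable M"
proof (cases "n = 0")
  \<comment> \<open>For \<open>n = 0\<close> the factor 1/n is 0, so the estimator vanishes. The
    case arises because convergence in probability asks for measurability at every index.\<close>
  case True
  then have "fourier_V T g k n u = 0" for k and u :: "real \<Rightarrow> real^'n" by (simp add: fourier_V_def)
  then show ?thesis by (simp add: rho_hat_def cscale_def)
next
  case False
  have gm: "g \<in> borel_measurable borel" using g by (rule borel_measurable_continuous_onI)
  have "(\<lambda>\<omega>. g (sqrt (real n) *\<^sub>R (Y (real (Suc i) / real n) \<omega> - Y (real i / real n) \<omega>)) $ a $ b) \<in> borel_measurable M"
    if i: "i < nat \<lfloor>real n * T\<rfloor>" for i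
  proof -
    have "real (Suc i) \<le> real n * T" using i by (simp add: zless_nat_eq_int_zless) linarith
    then have b: "real (Suc i) / real n \<le> T" using False by (simp add: divide_le_eq mult.commute)
    moreover have "real i / real n \<le> real (Suc i) / real n" by (simp add: divide_right_mono)
    ultimately have "Y (real (Suc i) / real n) \<in> borel_measurable M" "Y (real i / real n) \<in> borel_measurable M"
      by (auto intro!: Y)
    then show ?thesis
      by (intro borel_measurable_vec_nth measurable_compose[OF _ gm] borel_measurable_scaleR borel_measurable_diff borel_measurable_const)
  qed
  then have e: "(\<lambda>\<omega>. complex_of_real (g (sqrt (real n) *\<^sub>R (Y (real (Suc i) / real n) \<omega> - Y (real i / real n) \<omega>)) $ a $ b)) \<in> borel_measurable M"
    if "i < nat \<lfloor>real n * T\<rfloor>" for i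
    using that by (intro measurable_compose[OF _ borel_measurable_of_real]) auto
  have "(\<lambda>\<omega>. fourier_V T g k n (\<lambda>s. Y s \<omega>) $ a $ b) \<in> borel_measurable M" for k
    unfolding fourier_V_entry
    by (intro borel_measurable_scaleR borel_measurable_sum borel_measurable_times borel_measurable_const e) simp
  then show ?thesis unfolding rho_hat_entry_fourier
    by (intro borel_measurable_scaleR borel_measurable_sum borel_measurable_times borel_measurable_const)
qed

section \<open>The Gaussian functional\<close>

lemma poly_growth_entry:
  fixes g :: "real^'n \<Rightarrow> real^'n^'n"
  assumes "continuous_on UNIV g" "\<And>x. norm (g x) \<le> C * (1 + norm x ^ q)"
  shows "poly_growth_fun (\<lambda>x. g x $ a $ b) C q"
proof
  show "continuous_on UNIV (\<lambda>x. g x $ a $ b)" using assms(1) by (intro continuous_intros)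
  show "\<bar>g x $ a $ b\<bar> \<le> C * (1 + norm x ^ q)" for x
  proof -
    have "norm (g x $ a $ b) \<le> norm (g x)"
      by (rule order_trans[OF Finite_Cartesian_Product.norm_nth_le Finite_Cartesian_Product.norm_nth_le])
    then show ?thesis using assms(2)[of x] by simp
  qed
qed

text \<open>Taking an entry is bounded linear and commutes with the matrix-valued integral once
  \<open>g\<close> itself is integrable.\<close>

lemma rho_entry:
  fixes g :: "real^'n \<Rightarrow> real^'n^'n"
  assumes g: "continuous_on UNIV g" "\<And>x. norm (g x) \<le> C * (1 + norm x ^ q)"
  shows "rho g A $ a $ b = poly_growth_fun.mean (\<lambda>x. g x $ a $ b) (msqrt A)"
proof -
  interpret e: poly_growth_fun "\<lambda>x. g x $ a $ b" C q by (rule poly_growth_entry[OF g])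
  \<comment> \<open>The scalar theory applied to the norm of \<open>g\<close> yields the
    integrability of the matrix-valued function.\<close>
  interpret n: poly_growth_fun "\<lambda>x. norm (g x)" C q
    using g by unfold_locales (auto intro: continuous_intros)
  have gm [measurable]: "g \<in> borel_measurable borel" using g(1) by (rule borel_measurable_continuous_onI)
  have "integrable std_gaussian (\<lambda>z. norm (g (msqrt A *v z)))" by (rule n.integrable_f)
  then have int: "integrable std_gaussian (\<lambda>z. g (msqrt A *v z))" by (subst (asm) integrable_norm_iff) measurable
  have bl: "bounded_linear (\<lambda>x::real^'n^'n. x $ a $ b)"
    using bounded_linear_compose[OF bounded_linear_vec_nth bounded_linear_vec_nth] by blast
  have "rho g A = (LINT z|std_gaussian. g (msqrt A *v z))"
    unfolding rho_def gaussian_def by (intro integral_distr) measurable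
  then show ?thesis unfolding e.mean_def using integral_bounded_linear[OF bl int] by simp
qed

section \<open>Removal of the jumps\<close>

lemma (in prob_space) localizing_seq_prob:
  assumes sub: "subalgebra M (F T)" and T: "T \<ge> 0" and \<tau>: "localizing_seq M F T \<tau>"
  shows "(\<lambda>p. prob {\<omega>\<in>space M. \<tau> p \<omega> \<le> ereal T}) \<longlonglongrightarrow> 0"
proof (rule prob_eventually_not_in)
  show "{\<omega>\<in>space M. \<tau> p \<omega> \<le> ereal T} \<in> events" for p
  proof -
    have "{\<omega>\<in>space M. \<tau> p \<omega> \<le> ereal T} \<in> sets (F T)" using \<tau> T by (auto simp: localizing_seq_def ext_stopping_time_def)
    then show ?thesis using sub by (auto simp: subalgebra_def)
  qed
  have "AE \<omega> in M. (\<lambda>p. \<tau> p \<omega>) \<longlonglongrightarrow> \<infinity>" using \<tau> by (simp add: localizing_seq_def)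
  then show "AE \<omega> in M. \<forall>\<^sub>F p in sequentially. \<omega> \<notin> {\<omega>\<in>space M. \<tau> p \<omega> \<le> ereal T}"
  proof eventually_elim
    case (elim \<omega>)
    then have "\<forall>\<^sub>F p in sequentially. ereal T < \<tau> p \<omega>" by (intro order_tendstoD) auto
    then show ?case by eventually_elim auto
  qed
qed

text \<open>A caglad path is bounded on the compact interval, so its integral is Lipschitz; the
  constant depends on the path.\<close>

lemma drift_increment_bound:
  fixes \<beta> :: "real \<Rightarrow> real^'n"
  assumes int: "set_integrable lborel {0..T} \<beta>" and c: "caglad T \<beta>"
  shows "\<exists>B. \<forall>s r. 0 \<le> s \<and> s \<le> r \<and> r \<le> T \<longrightarrow> norm ((LINT u:{0..r}|lborel. \<beta> u) - (LINT u:{0..s}|lborel. \<beta> u)) \<le> B * (r - s)"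
proof -
  obtain B where B: "\<And>s. s \<in> {0..T} \<Longrightarrow> norm (\<beta> s) \<le> B" using caglad_bounded[OF c] by blast
  have "norm ((LINT u:{0..r}|lborel. \<beta> u) - (LINT u:{0..s}|lborel. \<beta> u)) \<le> B * (r - s)" if sr: "0 \<le> s" "s \<le> r" "r \<le> T" for s r
  proof -
    have i: "set_integrable lborel {0..s} \<beta>" "set_integrable lborel {s<..r} \<beta>"
      using sr by (auto intro!: set_integrable_subset[OF int])
    have "{0..r} = {0..s} \<union> {s<..r}" "{0..s} \<inter> {s<..r} = {}" using sr by auto
    then have "(LINT u:{0..r}|lborel. \<beta> u) = (LINT u:{0..s}|lborel. \<beta> u) + (LINT u:{s<..r}|lborel. \<beta> u)"
      using set_integral_Un[OF _ i] by auto
    then have "norm ((LINT u:{0..r}|lborel. \<beta> u) - (LINT u:{0..s}|lborel. \<beta> u)) = norm (LINT u|lborel. indicat_real {s<..r} u *\<^sub>R \<beta> u)"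
      by (simp add: set_lebesgue_integral_def)
    also have "\<dots> \<le> (LINT u|lborel. norm (indicat_real {s<..r} u *\<^sub>R \<beta> u))"
      by (rule integral_norm_bound)
    also have "\<dots> \<le> (LINT u|lborel. B * indicat_real {s<..r} u)"
    proof (rule integral_mono)
      show "integrable lborel (\<lambda>u. norm (indicat_real {s<..r} u *\<^sub>R \<beta> u))"
        using i(2) unfolding set_integrable_def by (rule integrable_norm)
      show "norm (indicat_real {s<..r} u *\<^sub>R \<beta> u) \<le> B * indicat_real {s<..r} u" for u
        using B[of u] sr by (auto simp: indicator_def)
    qed (use sr in \<open>auto intro!: integrable_mult_right integrable_real_indicator\<close>)
    also have "\<dots> = B * (r - s)" using sr by simp
    finally show ?thesis .
  qed
  then show ?thesis by blast
qed

context fejer_point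
begin

text \<open>Off the event that \<tau>_p is at most \<open>T\<close>, \<open>Y\<close> and
  \<open>D\<close> coincide on the whole grid with the approximating processes. For a fixed p these
  differ little in expectation, uniformly over the cells, hence also in the weighted sum.\<close>

lemma jump_removal:
  fixes g :: "real^'n \<Rightarrow> real^'n^'n" and Y D :: "real \<Rightarrow> 'a \<Rightarrow> real^'n" and a b :: 'n
  assumes basis: "filtered_prob_space M F T" and g: "continuous_on UNIV g"
    and Y: "\<And>s. s \<in> {0..T} \<Longrightarrow> Y s \<in> borel_measurable M" and D: "\<And>s. s \<in> {0..T} \<Longrightarrow> D s \<in> borel_measurable M"
    and Y': "\<And>p s. s \<in> {0..T} \<Longrightarrow> Y' p s \<in> borel_measurable M" and D': "\<And>p s. s \<in> {0..T} \<Longrightarrow> D' p s \<in> borel_measurable M"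
    and \<tau>: "localizing_seq M F T \<tau>"
    and eq: "\<And>p. AE \<omega> in M. \<forall>s\<in>{0..T}. ereal s < \<tau> p \<omega> \<longrightarrow> Y' p s \<omega> = Y s \<omega> \<and> D s \<omega> = D' p s \<omega>"
    and lim: "\<And>p. (\<lambda>n. SUP m\<in>{1..nat \<lfloor>real n * T\<rfloor>}. ennreal (real n powr 0) *
       (\<integral>\<^sup>+\<omega>. ennreal (norm (g (sqrt (real n) *\<^sub>R grid_incr n m (\<lambda>t. Y' p t \<omega>)) - g (sqrt (real n) *\<^sub>R grid_incr n m (\<lambda>t. D' p t \<omega>)))) \<partial>M)) \<longlonglongrightarrow> 0"
    and \<epsilon>: "\<epsilon> > 0"
  defines "S \<equiv> \<lambda>j U. \<Sum>i<K j. w t j i * g (sqrt (real (n j)) *\<^sub>R (U (real (Suc i) / real (n j)) - U (real i / real (n j)))) $ a $ b"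
  shows "(\<lambda>j. measure M {\<omega>\<in>space M. \<bar>S j (\<lambda>s. Y s \<omega>) - S j (\<lambda>s. D s \<omega>)\<bar> > \<epsilon>}) \<longlonglongrightarrow> 0"
proof (rule tendstoI)
  interpret prob_space M using basis by (simp add: filtered_prob_space_def)
  have T0: "0 \<le> T" "T > 0" using T_pos by auto
  have gm: "g \<in> borel_measurable borel" using g by (rule borel_measurable_continuous_onI)
  have grid: "real (Suc i) / real (n j) \<in> {0..T}" "real i / real (n j) \<in> {0..T}" if i: "i < K j" "n j > 0" for i j
  proof -
    have "real (Suc i) \<le> real (n j) * T" using i by (simp add: zless_nat_eq_int_zless) linarith
    then have b: "real (Suc i) / real (n j) \<le> T" using i by (simp add: divide_le_eq mult.commute)
    moreover have "real i / real (n j) \<le> real (Suc i) / real (n j)" by (simp add: divide_right_mono)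
    ultimately show "real (Suc i) / real (n j) \<in> {0..T}" "real i / real (n j) \<in> {0..T}" by auto
  qed
  have w0: "0 \<le> w t j i" for j i by (rule fejer_weight_nonneg[OF T0(2)])
  have gU: "(\<lambda>\<omega>. g (sqrt (real (n j)) *\<^sub>R (U (real (Suc i) / real (n j)) \<omega> - U (real i / real (n j)) \<omega>))) \<in> borel_measurable M"
    if "\<And>s. s \<in> {0..T} \<Longrightarrow> U s \<in> borel_measurable M" "i < K j" "n j > 0" for U j i
    using grid[OF that(2,3)]
    by (intro measurable_compose[OF _ gm] borel_measurable_scaleR borel_measurable_const borel_measurable_diff that(1))
  have Sm: "(\<lambda>\<omega>. S j (\<lambda>s. U s \<omega>)) \<in> borel_measurable M"
    if "\<And>s. s \<in> {0..T} \<Longrightarrow> U s \<in> borel_measurable M" "n j > 0" for U j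
    unfolding S_def using that gU
    by (intro borel_measurable_sum borel_measurable_times borel_measurable_const borel_measurable_vec_nth) auto
  fix \<eta> :: real assume \<eta>: "\<eta> > 0"
  have sub: "subalgebra M (F T)" using basis T0 by (auto simp: filtered_prob_space_def)
  obtain p where p: "prob {\<omega>\<in>space M. \<tau> p \<omega> \<le> ereal T} < \<eta> / 2"
    using order_tendstoD(2)[OF localizing_seq_prob[OF sub T0(1) \<tau>], of "\<eta> / 2"] \<eta> by (auto simp: eventually_sequentially)
  have \<tau>m: "{\<omega>\<in>space M. \<tau> p \<omega> \<le> ereal T} \<in> events"
  proof -
    have "{\<omega>\<in>space M. \<tau> p \<omega> \<le> ereal T} \<in> sets (F T)" using \<tau> T0 by (auto simp: localizing_seq_def ext_stopping_time_def)
    then show ?thesis using sub by (auto simp: subalgebra_def)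
  qed
  define d where "d i j \<omega> = norm (g (sqrt (real (n j)) *\<^sub>R (Y' p (real (Suc i) / real (n j)) \<omega> - Y' p (real i / real (n j)) \<omega>))
      - g (sqrt (real (n j)) *\<^sub>R (D' p (real (Suc i) / real (n j)) \<omega> - D' p (real i / real (n j)) \<omega>)))" for i j \<omega>
  have dm: "d i j \<in> borel_measurable M" if "i < K j" "n j > 0" for i j
  proof -
    have [measurable]: "(\<lambda>\<omega>. g (sqrt (real (n j)) *\<^sub>R (Y' p (real (Suc i) / real (n j)) \<omega> - Y' p (real i / real (n j)) \<omega>))) \<in> borel_measurable M"
      "(\<lambda>\<omega>. g (sqrt (real (n j)) *\<^sub>R (D' p (real (Suc i) / real (n j)) \<omega> - D' p (real i / real (n j)) \<omega>))) \<in> borel_measurable M"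
      by (rule gU[OF _ that], erule Y' D')+
    show ?thesis unfolding d_def[abs_def] by measurable
  qed
  \<comment> \<open>The weighted sum has expectation at most \<open>2 * \<delta>\<close>, so
    Markov's inequality at level \<open>\<epsilon>\<close> gives \<open>\<eta> / 4\<close>.\<close>
  define \<delta> where "\<delta> = \<epsilon> * \<eta> / 8"
  have \<delta>: "\<delta> > 0" using \<epsilon> \<eta> by (simp add: \<delta>_def)
  have "\<forall>\<^sub>F m in sequentially. (SUP i\<in>{1..nat \<lfloor>real m * T\<rfloor>}. ennreal (real m powr 0) *
       (\<integral>\<^sup>+\<omega>. ennreal (norm (g (sqrt (real m) *\<^sub>R grid_incr m i (\<lambda>t. Y' p t \<omega>)) - g (sqrt (real m) *\<^sub>R grid_incr m i (\<lambda>t. D' p t \<omega>)))) \<partial>M)) < ennreal \<delta>"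
    using lim[of p] \<delta> by (intro order_tendstoD) auto
  from eventually_compose_filterlim[OF this n_lim]
  have sup: "\<forall>\<^sub>F j in sequentially. (SUP i\<in>{1..K j}. ennreal (real (n j) powr 0) *
       (\<integral>\<^sup>+\<omega>. ennreal (norm (g (sqrt (real (n j)) *\<^sub>R grid_incr (n j) i (\<lambda>t. Y' p t \<omega>)) - g (sqrt (real (n j)) *\<^sub>R grid_incr (n j) i (\<lambda>t. D' p t \<omega>)))) \<partial>M)) < ennreal \<delta>" .
  show "\<forall>\<^sub>F j in sequentially. dist (prob {\<omega>\<in>space M. \<bar>S j (\<lambda>s. Y s \<omega>) - S j (\<lambda>s. D s \<omega>)\<bar> > \<epsilon>}) 0 < \<eta>"
    using sup n_pos weight_total_le
  proof eventually_elim
    case (elim j)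
    note n = elim(2)
    have cell: "(\<integral>\<^sup>+\<omega>. ennreal (d i j \<omega>) \<partial>M) \<le> ennreal \<delta>" if i: "i < K j" for i
    proof -
      have "Suc i \<in> {1..K j}" using i by auto
      then have "ennreal (real (n j) powr 0) *
       (\<integral>\<^sup>+\<omega>. ennreal (norm (g (sqrt (real (n j)) *\<^sub>R grid_incr (n j) (Suc i) (\<lambda>t. Y' p t \<omega>)) - g (sqrt (real (n j)) *\<^sub>R grid_incr (n j) (Suc i) (\<lambda>t. D' p t \<omega>)))) \<partial>M)
        \<le> (SUP i\<in>{1..K j}. ennreal (real (n j) powr 0) *
       (\<integral>\<^sup>+\<omega>. ennreal (norm (g (sqrt (real (n j)) *\<^sub>R grid_incr (n j) i (\<lambda>t. Y' p t \<omega>)) - g (sqrt (real (n j)) *\<^sub>R grid_incr (n j) i (\<lambda>t. D' p t \<omega>)))) \<partial>M))"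
        by (rule SUP_upper)
      also have "\<dots> \<le> ennreal \<delta>" using elim(1) by simp
      \<comment> \<open>For positive n the factor \<open>real n powr 0\<close> equals 1.\<close>
      finally show ?thesis using n unfolding grid_incr_Suc d_def by simp
    qed
    define W where "W \<omega> = (\<Sum>i<K j. w t j i * d i j \<omega>)" for \<omega>
    have d0: "0 \<le> d i j \<omega>" for i \<omega> by (simp add: d_def)
    have Wm: "W \<in> borel_measurable M"
      unfolding W_def[abs_def] using dm n by (intro borel_measurable_sum borel_measurable_times borel_measurable_const) auto
    have "(\<integral>\<^sup>+\<omega>. ennreal (W \<omega>) \<partial>M) = (\<Sum>i<K j. ennreal (w t j i) * (\<integral>\<^sup>+\<omega>. ennreal (d i j \<omega>) \<partial>M))"
      unfolding W_def using w0 dm n d0 by (intro nn_integral_weighted_sum) auto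
    also have "\<dots> \<le> (\<Sum>i<K j. ennreal (w t j i) * ennreal \<delta>)"
      by (intro sum_mono mult_left_mono cell) auto
    also have "\<dots> = ennreal (\<Sum>i<K j. w t j i * \<delta>)"
      using \<delta> w0 by (subst sum_ennreal[symmetric]) (auto simp: ennreal_mult intro!: sum.cong)
    also have "\<dots> \<le> ennreal (2 * \<delta>)"
      unfolding sum_distrib_right[symmetric] using elim(3) \<delta> by (intro ennreal_leI mult_right_mono) auto
    finally have "prob {\<omega>\<in>space M. W \<omega> > \<epsilon>} \<le> 2 * \<delta> / \<epsilon>" using Wm \<epsilon> \<delta> by (intro prob_gt_le_expectation) auto
    then have pW: "prob {\<omega>\<in>space M. W \<omega> > \<epsilon>} \<le> \<eta> / 4" using \<epsilon> by (simp add: \<delta>_def)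
    have SW: "\<bar>S j (\<lambda>s. Y' p s \<omega>) - S j (\<lambda>s. D' p s \<omega>)\<bar> \<le> W \<omega>" for \<omega>
    proof -
      have c: "\<bar>x $ a $ b - y $ a $ b\<bar> \<le> norm (x - y)" for x y :: "real^'n^'n"
        using order_trans[OF Finite_Cartesian_Product.norm_nth_le[of "(x - y) $ a" b] Finite_Cartesian_Product.norm_nth_le[of "x - y" a]] by simp
      have "\<bar>S j (\<lambda>s. Y' p s \<omega>) - S j (\<lambda>s. D' p s \<omega>)\<bar> \<le> (\<Sum>i<K j. \<bar>w t j i * g (sqrt (real (n j)) *\<^sub>R (Y' p (real (Suc i) / real (n j)) \<omega> - Y' p (real i / real (n j)) \<omega>)) $ a $ b
         - w t j i * g (sqrt (real (n j)) *\<^sub>R (D' p (real (Suc i) / real (n j)) \<omega> - D' p (real i / real (n j)) \<omega>)) $ a $ b\<bar>)"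
        unfolding S_def sum_subtractf[symmetric] by (rule sum_abs)
      also have "\<dots> \<le> W \<omega>" unfolding W_def d_def right_diff_distrib[symmetric] abs_mult
        using w0 c by (intro sum_mono) (simp add: mult_left_mono)
      finally show ?thesis .
    qed
    have "prob {\<omega>\<in>space M. \<bar>S j (\<lambda>s. Y s \<omega>) - S j (\<lambda>s. D s \<omega>)\<bar> > \<epsilon>} \<le> prob ({\<omega>\<in>space M. \<tau> p \<omega> \<le> ereal T} \<union> {\<omega>\<in>space M. W \<omega> > \<epsilon>})"
    proof (rule finite_measure_mono_AE)
      show "AE \<omega> in M. \<omega> \<in> {\<omega>\<in>space M. \<bar>S j (\<lambda>s. Y s \<omega>) - S j (\<lambda>s. D s \<omega>)\<bar> > \<epsilon>} \<longrightarrow> \<omega> \<in> {\<omega>\<in>space M. \<tau> p \<omega> \<le> ereal T} \<union> {\<omega>\<in>space M. W \<omega> > \<epsilon>}"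
        using eq[of p]
      proof eventually_elim
        case (elim \<omega>)
        show ?case
        proof (cases "\<tau> p \<omega> \<le> ereal T")
          case False
          have "Y' p s \<omega> = Y s \<omega> \<and> D s \<omega> = D' p s \<omega>" if "s \<in> {0..T}" for s
          proof -
            have "ereal s \<le> ereal T" using that by simp
            also have "ereal T < \<tau> p \<omega>" using False by simp
            finally have "ereal s < \<tau> p \<omega>" .
            then show ?thesis using elim that by blast
          qed
          then have "S j (\<lambda>s. Y s \<omega>) = S j (\<lambda>s. Y' p s \<omega>)" "S j (\<lambda>s. D s \<omega>) = S j (\<lambda>s. D' p s \<omega>)"
            unfolding S_def using grid[OF _ n] by (auto intro!: sum.cong)
          then show ?thesis using SW[of \<omega>] by auto
        qed auto
      qed
      show "{\<omega>\<in>space M. \<tau> p \<omega> \<le> ereal T} \<union> {\<omega>\<in>space M. W \<omega> > \<epsilon>} \<in> events"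
        using \<tau>m Wm by (intro sets.Un borel_measurable_less borel_measurable_const)
    qed
    also have "\<dots> \<le> prob {\<omega>\<in>space M. \<tau> p \<omega> \<le> ereal T} + prob {\<omega>\<in>space M. W \<omega> > \<epsilon>}"
      using \<tau>m Wm by (intro measure_Un_le borel_measurable_less borel_measurable_const)
    also have "\<dots> < \<eta>" using p pW \<eta> by linarith
    finally show ?case by simp
  qed
qed

end

section \<open>The theorem\<close>

text \<open>N/n is the quotient of N^(1 - \<gamma>), which tends to 0 as \<gamma> > 1, and
  n/N^\<gamma>, which has a positive limit.\<close>

lemma sampling_ratio_limit:
  assumes "\<gamma> > (1::real)" "\<kappa> > 0" "filterlim N at_top sequentially"
    and lim: "(\<lambda>j. real (n j) / real (N j) powr \<gamma>) \<longlonglongrightarrow> \<kappa>"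
  shows "(\<lambda>j. real (N j) / real (n j)) \<longlonglongrightarrow> 0"
proof -
  have "filterlim (\<lambda>j. real (N j)) at_top sequentially"
    by (intro filterlim_compose[OF filterlim_real_sequentially assms(3)])
  then have "(\<lambda>j. real (N j) powr (1 - \<gamma>)) \<longlonglongrightarrow> 0"
    using assms(1) by (intro tendsto_neg_powr) auto
  from tendsto_divide[OF this lim] have "(\<lambda>j. real (N j) powr (1 - \<gamma>) / (real (n j) / real (N j) powr \<gamma>)) \<longlonglongrightarrow> 0"
    using assms(2) by simp
  moreover have "\<forall>\<^sub>F j in sequentially. N j > 0"
    using assms(3) unfolding filterlim_at_top by (auto dest!: spec[of _ 1] elim: eventually_mono)
  then have "\<forall>\<^sub>F j in sequentially. real (N j) powr (1 - \<gamma>) / (real (n j) / real (N j) powr \<gamma>) = real (N j) / real (n j)"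
  proof eventually_elim
    case (elim j)
    have "real (N j) powr (1 - \<gamma>) * real (N j) powr \<gamma> = real (N j)"
      using elim by (simp add: powr_add[symmetric])
    then show ?case by simp
  qed
  ultimately show ?thesis by (rule Lim_transform_eventually)
qed

text \<open>The Fejer mean lives on the circle obtained by gluing \<open>T\<close> to 0, so at both
  endpoints the one-sided limits are those at \<open>T\<close> from the left and at 0. This is why
  the second part asks for \<open>X 0 = X T\<close> almost surely there. Both parts follow from one
  statement on the representatives \<open>t0\<close>, \<open>t1\<close> of a point of the
  circle.\<close>

theorem theorem3p8:
  fixes M :: "'a measure" and F :: "real \<Rightarrow> 'a measure" and T :: real
    and h :: "real^'n \<Rightarrow> real^'n"
    and Y :: "real \<Rightarrow> 'a \<Rightarrow> real^'n" and y :: "real^'n" and b :: "real \<Rightarrow> 'a \<Rightarrow> real^'n"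
    and X :: "real \<Rightarrow> 'a \<Rightarrow> real^'n^'n" and Z :: "real \<Rightarrow> 'a \<Rightarrow> real^'n"
    and K :: "real \<Rightarrow> 'a \<Rightarrow> (real^'n) measure"
    and g :: "real^'n \<Rightarrow> real^'n^'n"
    and \<gamma> \<kappa> :: real and n N :: "nat \<Rightarrow> nat"
  assumes "T > 0" and "filtered_prob_space M F T" and "truncation h"
    and "basic_setting M F T h Y y b X Z K"
    and "\<And>x. sym_mat (g x)" and "continuous_on UNIV g" and "poly_growth g"
    and "jump_approximation M F T h Y y b X Z K g 0"
    and "\<gamma> > 1" and "\<kappa> > 0"
    and "filterlim n at_top sequentially" and "filterlim N at_top sequentially"
    and "(\<lambda>j. real (n j) / real (N j) powr \<gamma>) \<longlonglongrightarrow> \<kappa>"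
  shows "(\<forall>t\<in>{0..T}.
           conv_in_prob M (\<lambda>j \<omega>. rho_hat T g (n j) (N j) t (\<lambda>u. Y u \<omega>))
             (\<lambda>\<omega>. cmat ((1 / 2) *\<^sub>R
                (rho g (Lim (at_left t) (periodic_ext T (\<lambda>u. X u \<omega>)))
                 + rho g (periodic_ext T (\<lambda>u. X u \<omega>) t)))))
       \<and> (no_fixed_discontinuity M T X \<longrightarrow>
           (\<forall>t\<in>{0..T}. (t = 0 \<or> t = T \<longrightarrow> (AE \<omega> in M. X 0 \<omega> = X T \<omega>)) \<longrightarrow>
             conv_in_prob M (\<lambda>j \<omega>. rho_hat T g (n j) (N j) t (\<lambda>u. Y u \<omega>))
               (\<lambda>\<omega>. cmat (rho g (X t \<omega>)))))"
proof -
  note basic = assms(4)[unfolded basic_setting_def]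
  have basis: "filtered_prob_space M F T" by fact
  interpret prob_space M using basis by (simp add: filtered_prob_space_def)
  have bm: "brownian_motion M F T Z" using basic by simp
  interpret bs: brownian_setup M F T Z by unfold_locales fact+
  interpret fa: fejer_asymptotics T n N
    using assms sampling_ratio_limit[of \<gamma> \<kappa> N n] by unfold_locales auto
  have Xad: "adapted F T X" and Xc: "\<And>\<omega>. \<omega> \<in> space M \<Longrightarrow> cadlag T (\<lambda>s. X s \<omega>)"
    and Xp: "\<And>\<omega> s. \<omega> \<in> space M \<Longrightarrow> s \<in> {0..T} \<Longrightarrow> X s \<omega> \<in> Collect psd_mat"
    using basic by auto
  define Sg where "Sg s \<omega> = msqrt (X s \<omega>)" for s \<omega>
  have Sg_cadlag: "cadlag T (\<lambda>s. Sg s \<omega>)" if "\<omega> \<in> space M" for \<omega>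
    unfolding Sg_def by (rule cadlag_compose[OF Xc[OF that] closed_psd Xp[OF that] continuous_on_msqrt])
  have Sg_left: "leftlim (\<lambda>s. Sg s \<omega>) t = msqrt (leftlim (\<lambda>s. X s \<omega>) t)" if "\<omega> \<in> space M" "t \<in> {0..T}" for \<omega> t
    unfolding Sg_def by (rule leftlim_compose[OF Xc[OF that(1)] closed_psd Xp[OF that(1)] continuous_on_msqrt that(2)])
  have Sg_adapted: "adapted F T Sg"
    unfolding adapted_def
  proof
    fix s assume s: "s \<in> {0..T}"
    have Xs: "X s \<in> borel_measurable (F s)" using Xad s by (simp add: adapted_def)
    \<comment> \<open>Outside the positive semidefinite matrices \<open>msqrt\<close> is an
      unspecified value, so measurability is obtained for its product with the indicator of the
      cone, on which \<open>X\<close> takes its values.\<close>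
    have "(\<lambda>x. indicat_real (Collect psd_mat) x *\<^sub>R msqrt x) \<in> borel_measurable (borel :: (real^'n^'n) measure)"
      by (intro borel_measurable_continuous_on_indicator continuous_on_msqrt borel_closed closed_psd)
    from measurable_compose[OF Xs this]
    have "(\<lambda>\<omega>. indicat_real (Collect psd_mat) (X s \<omega>) *\<^sub>R msqrt (X s \<omega>)) \<in> borel_measurable (F s)" .
    then show "Sg s \<in> borel_measurable (F s)"
      using Xp s by (subst measurable_cong) (auto simp: Sg_def bs.space_F)
  qed
  obtain C q where growth: "\<And>x. norm (g x) \<le> C * (1 + norm x ^ q)" using assms(7) by (auto simp: poly_growth_def)
  note g = assms(6)
  obtain h' D \<tau> Y' y' b' X' Z' K' D' where
    cag: "AE \<omega> in M. caglad T (\<lambda>s. drift_for h b K h' s \<omega>)"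
    and Dp: "is_diffusion_part M F T h y b X Z K h' D"
    and \<tau>: "localizing_seq M F T \<tau>"
    and ap: "\<And>p::nat. basic_setting M F T h (Y' p) (y' p) (b' p) (X' p) (Z' p) (K' p)
       \<and> is_diffusion_part M F T h (y' p) (b' p) (X' p) (Z' p) (K' p) h' (D' p)
       \<and> (AE \<omega> in M. \<forall>t\<in>{0..T}. ereal t < \<tau> p \<omega> \<longrightarrow> Y' p t \<omega> = Y t \<omega> \<and> D t \<omega> = D' p t \<omega>)
       \<and> (\<lambda>n. SUP m\<in>{1..nat \<lfloor>real n * T\<rfloor>}. ennreal (real n powr 0) *
            (\<integral>\<^sup>+\<omega>. ennreal (norm (g (sqrt (real n) *\<^sub>R grid_incr n m (\<lambda>t. Y' p t \<omega>))
                - g (sqrt (real n) *\<^sub>R grid_incr n m (\<lambda>t. D' p t \<omega>)))) \<partial>M)) \<longlonglongrightarrow> 0"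
  proof -
    from assms(8)[unfolded jump_approximation_def] show ?thesis
    proof (elim exE conjE)
      fix h' D \<tau> Y' y' b' X' Z' K' D'
      assume cag: "AE \<omega> in M. (\<forall>s\<in>{0<..T}. integrable (K s \<omega>) (\<lambda>\<xi>. h' \<xi> - h \<xi>)) \<and> caglad T (\<lambda>s. drift_for h b K h' s \<omega>)"
        and ap: "is_diffusion_part M F T h y b X Z K h' D" "localizing_seq M F T \<tau>"
        "\<forall>p::nat. basic_setting M F T h (Y' p) (y' p) (b' p) (X' p) (Z' p) (K' p)
       \<and> is_diffusion_part M F T h (y' p) (b' p) (X' p) (Z' p) (K' p) h' (D' p)
       \<and> (AE \<omega> in M. \<forall>t\<in>{0..T}. ereal t < \<tau> p \<omega> \<longrightarrow> Y' p t \<omega> = Y t \<omega> \<and> D t \<omega> = D' p t \<omega>)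
       \<and> (\<lambda>n. SUP m\<in>{1..nat \<lfloor>real n * T\<rfloor>}. ennreal (real n powr 0) *
            (\<integral>\<^sup>+\<omega>. ennreal (norm (g (sqrt (real n) *\<^sub>R grid_incr n m (\<lambda>t. Y' p t \<omega>))
                - g (sqrt (real n) *\<^sub>R grid_incr n m (\<lambda>t. D' p t \<omega>)))) \<partial>M)) \<longlonglongrightarrow> 0"
      have "AE \<omega> in M. caglad T (\<lambda>s. drift_for h b K h' s \<omega>)" using cag by eventually_elim simp
      then show ?thesis by (rule that[OF _ ap(1,2) spec[OF ap(3)]])
    qed
  qed
  from Dp[unfolded is_diffusion_part_def] obtain I where
    Dm: "\<And>s. s \<in> {0..T} \<Longrightarrow> D s \<in> borel_measurable M"
    and Dint: "AE \<omega> in M. set_integrable lborel {0..T} (\<lambda>s. drift_for h b K h' s \<omega>)"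
    and I: "is_ito_integral M F T Z (vol X) I"
    and Deq: "AE \<omega> in M. \<forall>t\<in>{0..T}. D t \<omega> = y + (LINT s:{0..t}|lborel. drift_for h b K h' s \<omega>) + I t \<omega>"
    by auto
  have drift: "AE \<omega> in M. \<exists>c. \<forall>s r. 0 \<le> s \<and> s \<le> r \<and> r \<le> T \<longrightarrow> norm ((D r \<omega> - D s \<omega>) - (I r \<omega> - I s \<omega>)) \<le> c * (r - s)"
    using cag Dint Deq
  proof eventually_elim
    case (elim \<omega>)
    obtain c where c: "\<And>s r. 0 \<le> s \<Longrightarrow> s \<le> r \<Longrightarrow> r \<le> T \<Longrightarrow>
       norm ((LINT u:{0..r}|lborel. drift_for h b K h' u \<omega>) - (LINT u:{0..s}|lborel. drift_for h b K h' u \<omega>)) \<le> c * (r - s)"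
      using drift_increment_bound[OF elim(2,1)] by blast
    have "norm ((D r \<omega> - D s \<omega>) - (I r \<omega> - I s \<omega>)) \<le> c * (r - s)" if "0 \<le> s" "s \<le> r" "r \<le> T" for s r
      using c[OF that] elim(3) that by (simp add: algebra_simps)
    then show ?case by blast
  qed
  have Ym: "Y s \<in> borel_measurable M" if "s \<in> {0..T}" for s
    using basic that by (intro bs.measurable_F_M[OF that]) (auto simp: semimartingale_def adapted_def)
  have Y'm: "Y' p s \<in> borel_measurable M" if "s \<in> {0..T}" for p s
    using ap[of p] that by (intro bs.measurable_F_M[OF that]) (auto simp: basic_setting_def semimartingale_def adapted_def)
  have D'm: "D' p s \<in> borel_measurable M" if "s \<in> {0..T}" for p s
    using ap[of p] that by (auto simp: is_diffusion_part_def)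
  have Xm: "X s \<in> borel_measurable M" if "s \<in> {0..T}" for s
    using Xad that by (intro bs.measurable_F_M[OF that]) (auto simp: adapted_def)
  have rho_m: "(\<lambda>\<omega>. rho g (A \<omega>) $ c $ d) \<in> borel_measurable M"
    if A: "(\<lambda>\<omega>. msqrt (A \<omega>)) \<in> borel_measurable M" for A and c d
  proof -
    interpret e: poly_growth_fun "\<lambda>x. g x $ c $ d" C q by (rule poly_growth_entry[OF g growth])
    show ?thesis unfolding rho_entry[OF g growth]
      by (rule measurable_compose[OF A borel_measurable_continuous_onI[OF e.continuous_mean]])
  qed
  \<comment> \<open>The limits are written with the representatives \<open>t0\<close> and
    \<open>t1\<close>, so that interior points and endpoints are treated together.\<close>
  have main: "conv_in_prob M (\<lambda>j \<omega>. rho_hat T g (n j) (N j) t (\<lambda>u. Y u \<omega>))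
      (\<lambda>\<omega>. cmat ((1 / 2) *\<^sub>R (rho g (leftlim (\<lambda>u. X u \<omega>) t0) + rho g (X t1 \<omega>))))"
    if t: "t \<in> {t0, t1}" "(t0 = t1 \<and> 0 < t0 \<and> t0 < T) \<or> (t0 = T \<and> t1 = 0)" for t t0 t1
  proof (rule conv_in_prob_matrixI)
    interpret fp: fejer_point T n N t0 t1 t by unfold_locales (use t in auto)
    have tr: "t0 \<in> {0..T}" "t1 \<in> {0..T}" using t assms(1) by auto
    show "prob_space M" by unfold_locales
    show "(\<lambda>\<omega>. rho_hat T g (n j) (N j) t (\<lambda>u. Y u \<omega>) $ c $ d) \<in> borel_measurable M" for j c d
      by (rule rho_hat_measurable[OF g Ym assms(1)])
    have ml: "(\<lambda>\<omega>. msqrt (leftlim (\<lambda>u. X u \<omega>) t0)) \<in> borel_measurable M"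
    proof -
      have "(\<lambda>\<omega>. leftlim (\<lambda>u. Sg u \<omega>) t0) \<in> borel_measurable M"
      proof (rule leftlim_measurable[of T, OF _ Sg_cadlag tr(1)])
        show "Sg s \<in> borel_measurable M" if "s \<in> {0..T}" for s
          using Sg_adapted that by (intro bs.measurable_F_M[OF that]) (auto simp: adapted_def)
      qed
      then show ?thesis using Sg_left tr by (subst (asm) measurable_cong) auto
    qed
    have mr: "(\<lambda>\<omega>. msqrt (X t1 \<omega>)) \<in> borel_measurable M"
      using bs.measurable_F_M[OF tr(2), of "Sg t1"] Sg_adapted tr by (simp add: adapted_def Sg_def[abs_def])
    show "(\<lambda>\<omega>. cmat ((1 / 2) *\<^sub>R (rho g (leftlim (\<lambda>u. X u \<omega>) t0) + rho g (X t1 \<omega>))) $ c $ d) \<in> borel_measurable M" for c d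
      using rho_m[OF ml, of c d] rho_m[OF mr, of c d] unfolding cmat_def
      by (simp del: of_real_add of_real_divide of_real_mult)
    fix c d :: 'n and \<epsilon> :: real assume \<epsilon>: "\<epsilon> > 0"
    interpret fd: fejer_diffusion T n N t0 t1 t M F Z "\<lambda>x. g x $ c $ d" C q Sg "vol X" I D
    proof -
      interpret e: poly_growth_fun "\<lambda>x. g x $ c $ d" C q by (rule poly_growth_entry[OF g growth])
      show "fejer_diffusion T n N t0 t1 t M F Z (\<lambda>x. g x $ c $ d) C q Sg (vol X) I D"
        by unfold_locales (use Sg_adapted Sg_cadlag I Dm drift Sg_left in \<open>auto simp: vol_def\<close>)
    qed
    let ?S = "\<lambda>j U. \<Sum>i<nat \<lfloor>real (n j) * T\<rfloor>. fejer_weight T (n j) (N j) t i * g (sqrt (real (n j)) *\<^sub>R (U (real (Suc i) / real (n j)) - U (real i / real (n j)))) $ c $ d"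
    have e2: "\<epsilon> / 2 > 0" using \<epsilon> by simp
    have s1: "(\<lambda>j. prob {\<omega>\<in>space M. \<bar>?S j (\<lambda>s. Y s \<omega>) - ?S j (\<lambda>s. D s \<omega>)\<bar> > \<epsilon> / 2}) \<longlonglongrightarrow> 0"
      by (rule fp.jump_removal[where Y' = Y' and D' = D' and \<tau> = \<tau>, OF basis g Ym Dm Y'm D'm \<tau> _ _ e2]) (use ap in auto)
    have s2: "(\<lambda>j. prob {\<omega>\<in>space M. \<bar>?S j (\<lambda>s. D s \<omega>) - fd.limit \<omega>\<bar> > \<epsilon> / 2}) \<longlonglongrightarrow> 0"
      by (rule fd.increments_limit[OF e2])
    have lim_eq: "cmat ((1 / 2) *\<^sub>R (rho g (leftlim (\<lambda>u. X u \<omega>) t0) + rho g (X t1 \<omega>))) $ c $ d = of_real (fd.limit \<omega>)" if "\<omega> \<in> space M" for \<omega>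
      \<comment> \<open>The root of the left limit of \<open>X\<close> is the left limit of the
        root, which converts \<open>rho\<close> into \<open>mean\<close> of the volatility.\<close>
      using Sg_left[OF that tr(1)] by (simp add: cmat_def fd.limit_def fd.left_value_def rho_entry[OF g growth] Sg_def)
    have le: "\<forall>\<^sub>F j in sequentially. prob {\<omega>\<in>space M. norm (rho_hat T g (n j) (N j) t (\<lambda>u. Y u \<omega>) $ c $ d
         - cmat ((1 / 2) *\<^sub>R (rho g (leftlim (\<lambda>u. X u \<omega>) t0) + rho g (X t1 \<omega>))) $ c $ d) > \<epsilon>}
       \<le> prob {\<omega>\<in>space M. \<bar>?S j (\<lambda>s. Y s \<omega>) - ?S j (\<lambda>s. D s \<omega>)\<bar> > \<epsilon> / 2} + prob {\<omega>\<in>space M. \<bar>?S j (\<lambda>s. D s \<omega>) - fd.limit \<omega>\<bar> > \<epsilon> / 2}"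
      using fa.N_pos fa.n_pos
    proof eventually_elim
      case (elim j)
      have Sm: "(\<lambda>\<omega>. ?S j (\<lambda>s. U s \<omega>)) \<in> borel_measurable M" if "\<And>s. s \<in> {0..T} \<Longrightarrow> U s \<in> borel_measurable M" for U
        using fd.grid_le_T[of _ j] elim
        by (intro borel_measurable_sum borel_measurable_times borel_measurable_const measurable_compose[OF _ fd.f_measurable]
            borel_measurable_scaleR borel_measurable_diff that) auto
      let ?A = "{\<omega>\<in>space M. \<bar>?S j (\<lambda>s. Y s \<omega>) - ?S j (\<lambda>s. D s \<omega>)\<bar> > \<epsilon> / 2}" and ?B = "{\<omega>\<in>space M. \<bar>?S j (\<lambda>s. D s \<omega>) - fd.limit \<omega>\<bar> > \<epsilon> / 2}"
      have SY: "(\<lambda>\<omega>. ?S j (\<lambda>s. Y s \<omega>)) \<in> borel_measurable M" by (rule Sm[OF Ym])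
      have SD: "(\<lambda>\<omega>. ?S j (\<lambda>s. D s \<omega>)) \<in> borel_measurable M" by (rule Sm[OF Dm])
      have AB: "?A \<in> events" "?B \<in> events"
        by (rule borel_measurable_less[OF borel_measurable_const borel_measurable_abs[OF borel_measurable_diff[OF SY SD]]])
           (rule borel_measurable_less[OF borel_measurable_const borel_measurable_abs[OF borel_measurable_diff[OF SD fd.limit_measurable]]])
      have AB_un: "?A \<union> ?B \<in> events" by (rule sets.Un[OF AB])
      have "{\<omega>\<in>space M. norm (rho_hat T g (n j) (N j) t (\<lambda>u. Y u \<omega>) $ c $ d
         - cmat ((1 / 2) *\<^sub>R (rho g (leftlim (\<lambda>u. X u \<omega>) t0) + rho g (X t1 \<omega>))) $ c $ d) > \<epsilon>} \<subseteq> ?A \<union> ?B"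
      proof
        fix \<omega> assume "\<omega> \<in> {\<omega>\<in>space M. norm (rho_hat T g (n j) (N j) t (\<lambda>u. Y u \<omega>) $ c $ d
         - cmat ((1 / 2) *\<^sub>R (rho g (leftlim (\<lambda>u. X u \<omega>) t0) + rho g (X t1 \<omega>))) $ c $ d) > \<epsilon>}"
        then have \<omega>: "\<omega> \<in> space M" and big: "norm (rho_hat T g (n j) (N j) t (\<lambda>u. Y u \<omega>) $ c $ d
         - cmat ((1 / 2) *\<^sub>R (rho g (leftlim (\<lambda>u. X u \<omega>) t0) + rho g (X t1 \<omega>))) $ c $ d) > \<epsilon>" by auto
        have "\<bar>?S j (\<lambda>s. Y s \<omega>) - fd.limit \<omega>\<bar> > \<epsilon>"
          using big unfolding rho_hat_entry[OF elim(1)] lim_eq[OF \<omega>] of_real_diff[symmetric] norm_of_real .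
        then have "\<bar>?S j (\<lambda>s. Y s \<omega>) - ?S j (\<lambda>s. D s \<omega>)\<bar> > \<epsilon> / 2 \<or> \<bar>?S j (\<lambda>s. D s \<omega>) - fd.limit \<omega>\<bar> > \<epsilon> / 2" by linarith
        then show "\<omega> \<in> ?A \<union> ?B" using \<omega> by blast
      qed
      then have "prob {\<omega>\<in>space M. norm (rho_hat T g (n j) (N j) t (\<lambda>u. Y u \<omega>) $ c $ d
         - cmat ((1 / 2) *\<^sub>R (rho g (leftlim (\<lambda>u. X u \<omega>) t0) + rho g (X t1 \<omega>))) $ c $ d) > \<epsilon>} \<le> prob (?A \<union> ?B)"
        by (rule finite_measure_mono[OF _ AB_un])
      also have "\<dots> \<le> prob ?A + prob ?B" by (rule measure_Un_le[OF AB])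
      finally show ?case .
    qed
    show "(\<lambda>j. prob {\<omega>\<in>space M. norm (rho_hat T g (n j) (N j) t (\<lambda>u. Y u \<omega>) $ c $ d
         - cmat ((1 / 2) *\<^sub>R (rho g (leftlim (\<lambda>u. X u \<omega>) t0) + rho g (X t1 \<omega>))) $ c $ d) > \<epsilon>}) \<longlonglongrightarrow> 0"
      by (rule tendsto_sandwich[OF _ le tendsto_const]) (use tendsto_add[OF s1 s2] in auto)
  qed
  \<comment> \<open>An interior point represents itself on both sides; the endpoints are both
    represented by \<open>T\<close> from the left and 0 from the right.\<close>
  have reps: "\<exists>t0 t1. t \<in> {t0, t1} \<and> ((t0 = t1 \<and> 0 < t0 \<and> t0 < T) \<or> (t0 = T \<and> t1 = 0))
      \<and> (\<forall>\<omega>. Lim (at_left t) (periodic_ext T (\<lambda>u. X u \<omega>)) = leftlim (\<lambda>u. X u \<omega>) t0 \<and> periodic_ext T (\<lambda>u. X u \<omega>) t = X t1 \<omega>)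
      \<and> (0 < t \<and> t < T \<longrightarrow> t0 = t \<and> t1 = t)"
    if t: "t \<in> {0..T}" for t
  proof (cases "t = 0 \<or> t = T")
    case True
    then show ?thesis
      using assms(1) Lim_periodic_ext_0[OF assms(1)] Lim_periodic_ext[OF assms(1), of T] periodic_ext_T[OF assms(1)]
        periodic_ext_eq[OF assms(1), of 0]
      by (intro exI[of _ T] exI[of _ 0]) auto
  next
    case False
    then show ?thesis
      using t Lim_periodic_ext[OF assms(1), of t] periodic_ext_eq[OF assms(1), of t]
      by (intro exI[of _ t]) auto
  qed
  show ?thesis
  proof (intro conjI impI ballI)
    fix t assume "t \<in> {0..T}"
    from reps[OF this] obtain t0 t1 where r: "t \<in> {t0, t1}" "(t0 = t1 \<and> 0 < t0 \<and> t0 < T) \<or> (t0 = T \<and> t1 = 0)"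
      "\<And>\<omega>. Lim (at_left t) (periodic_ext T (\<lambda>u. X u \<omega>)) = leftlim (\<lambda>u. X u \<omega>) t0"
      "\<And>\<omega>. periodic_ext T (\<lambda>u. X u \<omega>) t = X t1 \<omega>" by blast
    show "conv_in_prob M (\<lambda>j \<omega>. rho_hat T g (n j) (N j) t (\<lambda>u. Y u \<omega>))
             (\<lambda>\<omega>. cmat ((1 / 2) *\<^sub>R
                (rho g (Lim (at_left t) (periodic_ext T (\<lambda>u. X u \<omega>)))
                 + rho g (periodic_ext T (\<lambda>u. X u \<omega>) t))))"
      unfolding r(3,4) by (rule main[OF r(1,2)])
  next
    fix t assume nf: "no_fixed_discontinuity M T X" and t: "t \<in> {0..T}"
      and per: "t = 0 \<or> t = T \<longrightarrow> (AE \<omega> in M. X 0 \<omega> = X T \<omega>)"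
    from reps[OF t] obtain t0 t1 where r: "t \<in> {t0, t1}" "(t0 = t1 \<and> 0 < t0 \<and> t0 < T) \<or> (t0 = T \<and> t1 = 0)"
      "0 < t \<and> t < T \<longrightarrow> t0 = t \<and> t1 = t" by blast
    have "AE \<omega> in M. leftlim (\<lambda>u. X u \<omega>) t0 = X t0 \<omega>"
      using nf r(2) assms(1) by (auto simp: no_fixed_discontinuity_def)
    \<comment> \<open>At an endpoint one of \<open>t0\<close>, \<open>t1\<close> equals
      \<open>t\<close> and the other is the opposite endpoint, where periodicity gives the same
      value almost surely.\<close>
    moreover have "AE \<omega> in M. X t0 \<omega> = X t \<omega> \<and> X t1 \<omega> = X t \<omega>"
    proof (cases "0 < t \<and> t < T")
      case False
      then have "t = 0 \<or> t = T" using t by auto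
      then show ?thesis using per r(1,2) assms(1) by (auto elim!: AE_mp)
    qed (use r(3) in simp)
    ultimately have "AE \<omega> in M. cmat ((1 / 2) *\<^sub>R (rho g (leftlim (\<lambda>u. X u \<omega>) t0) + rho g (X t1 \<omega>))) = cmat (rho g (X t \<omega>))"
      by eventually_elim (simp add: scaleR_2[symmetric])
    moreover have "(\<lambda>\<omega>. cmat (rho g (X t \<omega>))) \<in> borel_measurable M"
    proof (intro borel_measurable_vec_lambda)
      have "(\<lambda>\<omega>. msqrt (X t \<omega>)) \<in> borel_measurable M"
        using bs.measurable_F_M[OF t, of "Sg t"] Sg_adapted t by (simp add: adapted_def Sg_def[abs_def])
      then show "(\<lambda>\<omega>. cmat (rho g (X t \<omega>)) $ c $ d) \<in> borel_measurable M" for c d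
        using rho_m[of "X t" c d] by (simp add: cmat_def)
    qed
    ultimately show "conv_in_prob M (\<lambda>j \<omega>. rho_hat T g (n j) (N j) t (\<lambda>u. Y u \<omega>)) (\<lambda>\<omega>. cmat (rho g (X t \<omega>)))"
      by (intro conv_in_prob_AE_cong[OF prob_space_axioms main[OF r(1,2)]])
  qed
qed

end
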